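(* Let $\mathcal{N}\subset\mathbb{R}^m$ be a closed $C^2$ submanifold and let $u\in\dot H^{1/2}(\mathbb{R},\mathcal{N})$ be a weak $1/2$-harmonic map. Then $(-\Delta)^{1/2}u\in L^1(\mathbb{R})$.
   Context: $\dot H^{1/2}(\mathbb{R},\mathcal{N})=\{u\in\dot H^{1/2}(\mathbb{R},\mathbb{R}^m):u(x)\in\mathcal{N}\text{ for a.e. }x\in\mathbb{R}\}$. A weak $1/2$-harmonic map is a critical point, among $\mathcal{N}$-valued maps, of $E^{1/2}(u)=\int_{\mathbb{R}}|(-\Delta)^{1/4}u|^2dx$; equivalently $P_T(u)(-\Delta)^{1/2}u=0$ in $\mathcal{D}'(\mathbb{R})$, where for $z\in\mathcal{N}$, $P_T(z)$ is the orthogonal projection of $\mathbb{R}^m$ onto $T_z\mathcal{N}$. $(-\Delta)^s$ is the Fourier multiplier with symbol $|\xi|^{2s}$. *)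

theory Defs
  imports "HOL-Analysis.Analysis"
begin

subsection \<open>Embedded submanifolds of class C2\<close>

definition C2_on :: "'a::euclidean_space set \<Rightarrow> ('a \<Rightarrow> 'b::euclidean_space) \<Rightarrow> bool" where
  "C2_on U f \<longleftrightarrow>
     (\<exists>(f' :: 'a \<Rightarrow> 'a \<Rightarrow>\<^sub>L 'b) (f'' :: 'a \<Rightarrow> 'a \<Rightarrow>\<^sub>L ('a \<Rightarrow>\<^sub>L 'b)).
        (\<forall>x\<in>U. (f has_derivative blinfun_apply (f' x)) (at x)) \<and>
        (\<forall>x\<in>U. (f' has_derivative blinfun_apply (f'' x)) (at x)) \<and>
        continuous_on U f'')"

text \<open>Submanifolds without boundary, of constant dimension \<open>k\<close>: near each of its points \<open>N\<close> is
  mapped onto an open piece of a \<open>k\<close>-dimensional linear subspace by a C2 diffeomorphism between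
  open subsets of the ambient space.\<close>

definition C2_submanifold :: "nat \<Rightarrow> 'a::euclidean_space set \<Rightarrow> bool" where
  "C2_submanifold k N \<longleftrightarrow>
     (\<forall>p\<in>N. \<exists>(U :: 'a set) (V :: 'a set) (L :: 'a set) \<Psi> \<Phi>.
        open U \<and> open V \<and> p \<in> U \<and> subspace L \<and> dim L = k \<and>
        homeomorphism U V \<Psi> \<Phi> \<and> C2_on U \<Psi> \<and> C2_on V \<Phi> \<and>
        \<Psi> ` (N \<inter> U) = L \<inter> V)"

text \<open>``Closed'' is the closed-manifold notion: compact and without boundary.\<close>

definition closed_C2_submanifold :: "'a::euclidean_space set \<Rightarrow> bool" where
  "closed_C2_submanifold N \<longleftrightarrow> compact N \<and> (\<exists>k::nat. C2_submanifold k N)"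

subsection \<open>The fractional Laplacian on the real line\<close>

definition test_function :: "(real \<Rightarrow> real) \<Rightarrow> bool" where
  "test_function \<phi> \<longleftrightarrow>
     (\<forall>n x. (deriv ^^ n) \<phi> differentiable (at x)) \<and> compact (closure {x. \<phi> x \<noteq> 0})"

text \<open>With this normalisation \<open>- d\<^sup>2/dx\<^sup>2\<close> has symbol \<open>\<xi>\<^sup>2\<close>.\<close>

definition fourier :: "(real \<Rightarrow> real) \<Rightarrow> real \<Rightarrow> complex" where
  "fourier \<phi> \<xi> = (\<integral>x. of_real (\<phi> x) * cis (- (x * \<xi>)) \<partial>lborel)"

text \<open>The Fourier multiplier with symbol \<open>\<bar>\<xi>\<bar> powr (2 * s)\<close>. As \<open>\<phi>\<close> is real and the symbol is real
  and even, the inverse transform is real, so \<open>Re\<close> is only a coercion.\<close>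

definition frac_lap_test :: "real \<Rightarrow> (real \<Rightarrow> real) \<Rightarrow> real \<Rightarrow> real" where
  "frac_lap_test s \<phi> x =
     Re ((\<integral>\<xi>. of_real (\<bar>\<xi>\<bar> powr (2 * s)) * fourier \<phi> \<xi> * cis (x * \<xi>) \<partial>lborel) / of_real (2 * pi))"

text \<open>The distribution \<open>(-\<Delta>)\<^sup>s u\<close> is the function \<open>f\<close>, the multiplier being transposed onto test
  functions. For \<open>0 < s < 1\<close>, \<open>frac_lap_test s \<phi>\<close> is bounded and \<open>O(\<bar>x\<bar> powr - (1 + 2 * s))\<close>, so
  the weighted integrability of \<open>u\<close> makes the left-hand pairing absolutely convergent.
  Functions are Borel representatives of their almost-everywhere classes.\<close>

definition has_frac_laplacian ::
  "real \<Rightarrow> (real \<Rightarrow> 'a::euclidean_space) \<Rightarrow> (real \<Rightarrow> 'a) \<Rightarrow> bool" where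
  "has_frac_laplacian s u f \<longleftrightarrow>
     u \<in> borel_measurable lborel \<and>
     integrable lborel (\<lambda>x. ((1 + \<bar>x\<bar>) powr - (1 + 2 * s)) *\<^sub>R u x) \<and>
     (\<forall>r. set_integrable lborel {-r..r} f) \<and>
     (\<forall>\<phi>. test_function \<phi> \<longrightarrow>
        (\<integral>x. frac_lap_test s \<phi> x *\<^sub>R u x \<partial>lborel) = (\<integral>x. \<phi> x *\<^sub>R f x \<partial>lborel))"

text \<open>Determined up to null sets whenever \<open>(-\<Delta>)\<^sup>s u\<close> is a locally integrable function.\<close>

definition frac_laplacian :: "real \<Rightarrow> (real \<Rightarrow> 'a::euclidean_space) \<Rightarrow> real \<Rightarrow> 'a" where
  "frac_laplacian s u = (SOME f. has_frac_laplacian s u f)"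

subsection \<open>The homogeneous Sobolev space and half-harmonic maps\<close>

definition square_integrable :: "(real \<Rightarrow> 'a::euclidean_space) \<Rightarrow> bool" where
  "square_integrable f \<longleftrightarrow>
     f \<in> borel_measurable lborel \<and> integrable lborel (\<lambda>x. (norm (f x))\<^sup>2)"

definition Hdot_half :: "(real \<Rightarrow> 'a::euclidean_space) set" where
  "Hdot_half = {u. \<exists>f. has_frac_laplacian (1/4) u f \<and> square_integrable f}"

definition Hdot_half_into :: "'a::euclidean_space set \<Rightarrow> (real \<Rightarrow> 'a) set" where
  "Hdot_half_into N = {u \<in> Hdot_half. AE x in lborel. u x \<in> N}"

definition half_energy :: "(real \<Rightarrow> 'a::euclidean_space) \<Rightarrow> real" where
  "half_energy u = (\<integral>x. (norm (frac_laplacian (1/4) u x))\<^sup>2 \<partial>lborel)"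

text \<open>\<open>v\<close> is differentiable at \<open>t = 0\<close>, with velocity \<open>w\<close>, as a curve in
  \<open>Hdot_half \<inter> L\<^sup>\<infinity>\<close>; the square of the \<open>Hdot_half\<close> seminorm is \<open>half_energy\<close>. Convergence in
  \<open>L\<^sup>\<infinity>\<close> is needed too because the seminorm does not see constants.\<close>

definition has_velocity ::
  "(real \<Rightarrow> real \<Rightarrow> 'a::euclidean_space) \<Rightarrow> (real \<Rightarrow> 'a) \<Rightarrow> bool" where
  "has_velocity v w \<longleftrightarrow>
     w \<in> Hdot_half \<and> (\<exists>B. AE x in lborel. norm (w x) \<le> B) \<and>
     ((\<lambda>t. half_energy (\<lambda>x. (v t x - v 0 x) /\<^sub>R t - w x)) \<longlongrightarrow> 0) (at 0) \<and>
     (\<forall>\<epsilon>>0. \<forall>\<^sub>F t in at 0. AE x in lborel. norm ((v t x - v 0 x) /\<^sub>R t - w x) \<le> \<epsilon>)"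

text \<open>Critical points of \<open>half_energy\<close> among \<open>N\<close>-valued maps: the energy is stationary at \<open>u\<close>
  along every differentiable curve of \<open>N\<close>-valued maps through \<open>u\<close>.\<close>

definition weak_half_harmonic :: "'a::euclidean_space set \<Rightarrow> (real \<Rightarrow> 'a) \<Rightarrow> bool" where
  "weak_half_harmonic N u \<longleftrightarrow>
     u \<in> Hdot_half_into N \<and>
     (\<forall>v w. (\<forall>t. v t \<in> Hdot_half_into N) \<and> v 0 = u \<and> has_velocity v w \<longrightarrow>
        ((\<lambda>t. half_energy (v t)) has_real_derivative 0) (at 0))"

end

theory Submission
  imports Defs "HOL-Probability.Probability" "HOL-Computational_Algebra.Polynomial"
begin

text \<open>For bounded maps, membership in \<open>Hdot_half\<close>, which is defined by a Fourier multiplier, means that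
  the Gagliardo energy, the integral over the plane of \<open>(norm (u (x + h) - u x) / h)\<^sup>2\<close>, is finite, and
  \<open>half_energy\<close> is a constant multiple of it (\<open>bounded_Hdot_half\<close>). In the same way the distribution
  \<open>(-\<Delta>)\<^sup>1\<^sup>/\<^sup>2 u\<close>, tested with \<open>\<phi>\<close> in the direction \<open>e\<close>, is a multiple of the inner product of the
  difference quotients of \<open>u\<close> and of \<open>\<phi> e\<close> (\<open>half_laplacian_vector_pair\<close>).

  Near each of its points a C2 submanifold has orthogonal tangent projections \<open>P z\<close>, Lipschitz in
  \<open>z\<close>, and \<open>N\<close>-valued displacements \<open>G z b = z + P z b + O((norm b)\<^sup>2)\<close> (\<open>submanifold_tangent_flow\<close>).
  Composed with \<open>u\<close>, the displacements are admissible curves with velocity \<open>P u a\<close>, for every bounded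
  field \<open>a\<close> of finite energy, cut off inside the chart; so the difference quotient of \<open>u\<close> is
  orthogonal to that of the velocity (\<open>tent_variation_orthogonal\<close>). A finite partition of unity
  on the compact set \<open>N\<close> glues the charts: in the pairing, the constant direction \<open>e\<close> may be replaced
  by its normal part \<open>s\<close> along \<open>u\<close> (\<open>half_harmonic_normal_field\<close>).

  The gain is that a chord of \<open>N\<close> is tangent to second order. Hence
  \<open>\<bar>s x \<bullet> (u x - u y)\<bar> \<le> C (norm (u x - u y))\<^sup>2\<close>. Expanding the product of the increments of \<open>u\<close> and
  of \<open>\<phi> s\<close> gives two terms, each of which is a value of \<open>\<phi>\<close> times a kernel dominated by the energy
  density of \<open>u\<close>, which is integrable on the plane. Integrating out the increment \<open>h\<close> turns the pairing
  into the integral of \<open>\<phi> k\<close> with \<open>k\<close> in L1 (\<open>normal_pairing\<close>), and these functions \<open>k\<close> are, up to a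
  constant, the components of \<open>(-\<Delta>)\<^sup>1\<^sup>/\<^sup>2 u\<close>.

  Most of the work is the comparison of the multiplier with the Gagliardo energy. Fourier inversion
  writes the fractional Laplacian of a test function as a singular integral of second differences
  (\<open>frac_lap_test_singular\<close>), from which the energy identity follows for test functions by Fubini. A bounded
  function \<open>u\<close> of finite energy is then approximated by mollified cutoffs. In one dimension the energy
  of order one half is invariant under dilations, so wide cutoffs are no cheaper than narrow ones;
  but cutoffs at very different scales are almost orthogonal, and averages of them have arbitrarily
  small energy (\<open>small_cutoff\<close>). So the approximations converge strongly and their quarter
  Laplacians converge in L2 (\<open>finite_energy_imp_quarter_laplacian\<close>). Conversely, testing the equation
  for a quarter Laplacian in L2 with a mollified cutoff of \<open>u\<close> itself bounds the energy of \<open>u\<close>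
  (\<open>quarter_laplacian_imp_finite_energy\<close>).\<close>

section \<open>Square integrable functions\<close>

text \<open>Over a general measure, because the same calculus serves functions on the line and difference
  quotients on the plane. The definition makes no quotient by null sets, so \<open>L2nrm\<close> below is only a
  seminorm.\<close>

definition sq_int :: "'x measure \<Rightarrow> ('x \<Rightarrow> 'b::euclidean_space) \<Rightarrow> bool" where
  "sq_int M f \<longleftrightarrow> f \<in> borel_measurable M \<and> integrable M (\<lambda>x. (norm (f x))\<^sup>2)"

definition L2nrm :: "'x measure \<Rightarrow> ('x \<Rightarrow> 'b::euclidean_space) \<Rightarrow> real" where
  "L2nrm M f = sqrt (\<integral>x. (norm (f x))\<^sup>2 \<partial>M)"

lemma sq_int_measurable[measurable_dest]: "sq_int M f \<Longrightarrow> f \<in> borel_measurable M"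
  by (simp add: sq_int_def)

lemma L2nrm_nonneg[simp]: "0 \<le> L2nrm M f"
  by (simp add: L2nrm_def)

lemma L2nrm_sq: "(L2nrm M f)\<^sup>2 = (\<integral>x. (norm (f x))\<^sup>2 \<partial>M)"
  by (simp add: L2nrm_def)

lemma sq_int_dominated:
  fixes f :: "'x \<Rightarrow> 'b::euclidean_space" and g :: "'x \<Rightarrow> 'c::euclidean_space"
  assumes "sq_int M g" "f \<in> borel_measurable M" "AE x in M. norm (f x) \<le> norm (g x)"
  shows "sq_int M f" "L2nrm M f \<le> L2nrm M g"
proof -
  have [measurable]: "f \<in> borel_measurable M" using assms by simp
  have le: "AE x in M. (norm (f x))\<^sup>2 \<le> (norm (g x))\<^sup>2"
    using assms(3) by eventually_elim (auto intro: power_mono)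
  have i: "integrable M (\<lambda>x. (norm (f x))\<^sup>2)"
    by (rule Bochner_Integration.integrable_bound[of M "\<lambda>x. (norm (g x))\<^sup>2"])
       (use assms(1) le in \<open>auto simp: sq_int_def\<close>)
  then show "sq_int M f" using assms by (simp add: sq_int_def)
  show "L2nrm M f \<le> L2nrm M g"
    unfolding L2nrm_def using assms(1) i le by (auto simp: sq_int_def intro!: integral_mono_AE)
qed

lemma sq_int_inner:
  assumes "sq_int M f" "sq_int M g"
  shows "integrable M (\<lambda>x. f x \<bullet> g x)"
proof (rule Bochner_Integration.integrable_bound)
  show "integrable M (\<lambda>x. (norm (f x))\<^sup>2 + (norm (g x))\<^sup>2)"
    using assms by (auto simp: sq_int_def)
  show "(\<lambda>x. f x \<bullet> g x) \<in> borel_measurable M"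
    using assms by (auto simp: sq_int_def)
  have "norm (a \<bullet> b) \<le> norm ((norm a)\<^sup>2 + (norm b)\<^sup>2)" for a b :: 'b
  proof -
    have "\<bar>a \<bullet> b\<bar> \<le> norm a * norm b" by (rule Cauchy_Schwarz_ineq2)
    moreover have "2 * (norm a * norm b) \<le> (norm a)\<^sup>2 + (norm b)\<^sup>2"
      using sum_squares_bound[of "norm a" "norm b"] by simp
    moreover have "0 \<le> norm a * norm b" by simp
    ultimately show ?thesis by simp
  qed
  then show "AE x in M. norm (f x \<bullet> g x) \<le> norm ((norm (f x))\<^sup>2 + (norm (g x))\<^sup>2)" by simp
qed

lemma sq_int_add:
  assumes "sq_int M f" "sq_int M g"
  shows "sq_int M (\<lambda>x. f x + g x)"
proof -
  have "integrable M (\<lambda>x. (norm (f x))\<^sup>2 + 2 * (f x \<bullet> g x) + (norm (g x))\<^sup>2)"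
    using sq_int_inner[OF assms] assms by (auto simp: sq_int_def)
  moreover have "(norm (f x))\<^sup>2 + 2 * (f x \<bullet> g x) + (norm (g x))\<^sup>2 = (norm (f x + g x))\<^sup>2" for x
    by (simp add: power2_norm_eq_inner inner_add inner_commute)
  moreover have "(\<lambda>x. f x + g x) \<in> borel_measurable M" using assms by (intro borel_measurable_add) (auto simp: sq_int_def)
  ultimately show ?thesis by (simp add: sq_int_def)
qed

lemma sq_int_scaleR: "sq_int M f \<Longrightarrow> sq_int M (\<lambda>x. c *\<^sub>R f x)"
  by (auto simp: sq_int_def power_mult_distrib)

lemma sq_int_diff:
  assumes "sq_int M f" "sq_int M g"
  shows "sq_int M (\<lambda>x. f x - g x)"
  using sq_int_add[OF assms(1) sq_int_scaleR[OF assms(2), of "-1"]] by simp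

lemma L2nrm_scaleR: "L2nrm M (\<lambda>x. c *\<^sub>R f x) = \<bar>c\<bar> * L2nrm M f"
  by (simp add: L2nrm_def power_mult_distrib real_sqrt_mult)

lemma L2_Cauchy_Schwarz:
  assumes f: "sq_int M f" and g: "sq_int M g"
  shows "\<bar>\<integral>x. f x \<bullet> g x \<partial>M\<bar> \<le> L2nrm M f * L2nrm M g"
proof -
  have [measurable]: "f \<in> borel_measurable M" "g \<in> borel_measurable M"
    using assms by (auto simp: sq_int_def)
  have fg: "integrable M (\<lambda>x. norm (f x) * norm (g x))"
    using sq_int_inner[of M "\<lambda>x. norm (f x)" "\<lambda>x. norm (g x)"] assms by (simp add: sq_int_def)
  have n: "0 \<le> (\<integral>x. norm (f x) * norm (g x) \<partial>M)" by simp
  have "\<bar>\<integral>x. f x \<bullet> g x \<partial>M\<bar> \<le> (\<integral>x. norm (f x) * norm (g x) \<partial>M)"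
  proof (rule order_trans[OF integral_abs_bound integral_mono])
    show "integrable M (\<lambda>x. \<bar>f x \<bullet> g x\<bar>)" using sq_int_inner[OF f g] by simp
  qed (auto intro: fg Cauchy_Schwarz_ineq2)
  moreover have "(\<integral>x. norm (f x) * norm (g x) \<partial>M)\<^sup>2 \<le> (L2nrm M f * L2nrm M g)\<^sup>2"
  proof -
    have "(\<integral>\<^sup>+x. ennreal (norm (f x)) * ennreal (norm (g x)) \<partial>M)\<^sup>2
        \<le> (\<integral>\<^sup>+x. ennreal (norm (f x)) ^ 2 \<partial>M) * (\<integral>\<^sup>+x. ennreal (norm (g x)) ^ 2 \<partial>M)"
      by (rule Cauchy_Schwarz_nn_integral) auto
    also have "(\<integral>\<^sup>+x. ennreal (norm (f x)) ^ 2 \<partial>M) = ennreal ((L2nrm M f)\<^sup>2)"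
      using f by (simp add: ennreal_power L2nrm_sq nn_integral_eq_integral sq_int_def)
    also have "(\<integral>\<^sup>+x. ennreal (norm (g x)) ^ 2 \<partial>M) = ennreal ((L2nrm M g)\<^sup>2)"
      using g by (simp add: ennreal_power L2nrm_sq nn_integral_eq_integral sq_int_def)
    also have "(\<integral>\<^sup>+x. ennreal (norm (f x)) * ennreal (norm (g x)) \<partial>M)
        = ennreal (\<integral>x. norm (f x) * norm (g x) \<partial>M)"
      using fg by (simp add: ennreal_mult[symmetric] nn_integral_eq_integral)
    finally show ?thesis
      by (simp add: ennreal_power n ennreal_mult[symmetric] power_mult_distrib)
  qed
  ultimately show ?thesis
    using power2_le_imp_le[of "\<integral>x. norm (f x) * norm (g x) \<partial>M" "L2nrm M f * L2nrm M g"] by simp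
qed

lemma L2nrm_triangle:
  assumes f: "sq_int M f" and g: "sq_int M g"
  shows "L2nrm M (\<lambda>x. f x + g x) \<le> L2nrm M f + L2nrm M g"
proof (rule power2_le_imp_le)
  have "(L2nrm M (\<lambda>x. f x + g x))\<^sup>2 = (\<integral>x. (norm (f x))\<^sup>2 + 2 * (f x \<bullet> g x) + (norm (g x))\<^sup>2 \<partial>M)"
    unfolding L2nrm_sq by (rule Bochner_Integration.integral_cong)
      (simp_all add: power2_norm_eq_inner inner_add inner_commute)
  also have "\<dots> = (L2nrm M f)\<^sup>2 + 2 * (\<integral>x. f x \<bullet> g x \<partial>M) + (L2nrm M g)\<^sup>2"
    unfolding L2nrm_sq using assms sq_int_inner[OF assms]
    by (simp add: sq_int_def)
  also have "\<dots> \<le> (L2nrm M f + L2nrm M g)\<^sup>2"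
    using L2_Cauchy_Schwarz[OF assms] by (simp add: power2_sum)
  finally show "(L2nrm M (\<lambda>x. f x + g x))\<^sup>2 \<le> (L2nrm M f + L2nrm M g)\<^sup>2" .
qed simp

lemma L2nrm_triangle_diff:
  assumes "sq_int M f" "sq_int M g"
  shows "L2nrm M (\<lambda>x. f x - g x) \<le> L2nrm M f + L2nrm M g"
  using L2nrm_triangle[OF assms(1) sq_int_scaleR[OF assms(2), of "-1"]] L2nrm_scaleR[of M "-1" g] by simp

lemma L2nrm_add_sq:
  assumes "sq_int M f" "sq_int M g"
  shows "(L2nrm M (\<lambda>x. f x + g x))\<^sup>2 = (L2nrm M f)\<^sup>2 + 2 * (\<integral>x. f x \<bullet> g x \<partial>M) + (L2nrm M g)\<^sup>2"
proof -
  have "(L2nrm M (\<lambda>x. f x + g x))\<^sup>2 = (\<integral>x. (norm (f x))\<^sup>2 + 2 * (f x \<bullet> g x) + (norm (g x))\<^sup>2 \<partial>M)"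
    unfolding L2nrm_sq by (rule Bochner_Integration.integral_cong)
      (simp_all add: power2_norm_eq_inner inner_add inner_commute)
  then show ?thesis 
    unfolding L2nrm_sq using assms sq_int_inner[OF assms] by (simp add: sq_int_def)
qed

text \<open>Solved for the difference: this is how a lower bound for the norm of a sum yields
  smallness of a difference in \<open>L2_strong_convergence\<close>.\<close>

lemma L2nrm_parallelogram:
  assumes "sq_int M f" "sq_int M g"
  shows "(L2nrm M (\<lambda>x. f x - g x))\<^sup>2 = 2 * (L2nrm M f)\<^sup>2 + 2 * (L2nrm M g)\<^sup>2 - (L2nrm M (\<lambda>x. f x + g x))\<^sup>2"
  using L2nrm_add_sq[OF assms] L2nrm_add_sq[OF assms(1) sq_int_scaleR[OF assms(2), of "-1"]]
  by (simp add: L2nrm_scaleR[of M "-1" g, simplified])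

lemma L2nrm_Fatou:
  fixes f :: "'x \<Rightarrow> 'b::euclidean_space"
  assumes F: "\<And>n. sq_int M (F n)" and B: "\<And>n. L2nrm M (F n) \<le> B" "0 \<le> B"
    and f[measurable]: "f \<in> borel_measurable M"
    and lim: "AE x in M. (\<lambda>n. F n x) \<longlonglongrightarrow> f x"
  shows "sq_int M f" "L2nrm M f \<le> B"
proof -
  have [measurable]: "F n \<in> borel_measurable M" for n using F by (simp add: sq_int_def)
  have "(\<integral>\<^sup>+x. ennreal ((norm (f x))\<^sup>2) \<partial>M) = (\<integral>\<^sup>+x. liminf (\<lambda>n. ennreal ((norm (F n x))\<^sup>2)) \<partial>M)"
  proof (rule nn_integral_cong_AE)
    show "AE x in M. ennreal ((norm (f x))\<^sup>2) = liminf (\<lambda>n. ennreal ((norm (F n x))\<^sup>2))"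
      using lim
    proof eventually_elim
      case (elim x)
      have "(\<lambda>n. ennreal ((norm (F n x))\<^sup>2)) \<longlonglongrightarrow> ennreal ((norm (f x))\<^sup>2)"
        by (intro tendsto_intros elim)
      then show ?case by (metis lim_imp_Liminf sequentially_bot)
    qed
  qed
  also have "\<dots> \<le> liminf (\<lambda>n. \<integral>\<^sup>+x. ennreal ((norm (F n x))\<^sup>2) \<partial>M)"
    by (rule nn_integral_liminf) simp
  also have "\<dots> = liminf (\<lambda>n. ennreal ((L2nrm M (F n))\<^sup>2))"
    using F by (simp add: L2nrm_sq nn_integral_eq_integral sq_int_def)
  also have "\<dots> \<le> ennreal (B\<^sup>2)"
    by (rule order_trans[OF Liminf_le_Limsup Limsup_bounded])
       (auto intro!: always_eventually ennreal_leI power_mono B)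
  finally have le: "(\<integral>\<^sup>+x. ennreal ((norm (f x))\<^sup>2) \<partial>M) \<le> ennreal (B\<^sup>2)" .
  then have i: "integrable M (\<lambda>x. (norm (f x))\<^sup>2)"
    by (intro integrableI_bounded) (auto intro: le_less_trans)
  then show "sq_int M f" by (simp add: sq_int_def)
  have "ennreal ((L2nrm M f)\<^sup>2) \<le> ennreal (B\<^sup>2)"
    using le i by (simp add: L2nrm_sq nn_integral_eq_integral)
  then have "(L2nrm M f)\<^sup>2 \<le> B\<^sup>2" by simp
  then show "L2nrm M f \<le> B"
    by (rule power2_le_imp_le[OF _ B(2)])
qed

text \<open>Almost everywhere convergence together with convergence of norms from above gives strong
  convergence. If the distance stayed above \<open>e\<close> along a subsequence, the parallelogram law would keep
  the norm of \<open>F n + f\<close> strictly below twice the norm of \<open>f\<close>, contradicting Fatou's lemma.\<close>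

lemma L2_strong_convergence:
  fixes f :: "'x \<Rightarrow> 'b::euclidean_space"
  assumes F: "\<And>n. sq_int M (F n)" and f: "sq_int M f"
    and lim: "AE x in M. (\<lambda>n. F n x) \<longlonglongrightarrow> f x"
    and le: "\<And>n. L2nrm M (F n) \<le> L2nrm M f + \<delta> n" and \<delta>: "\<delta> \<longlonglongrightarrow> 0"
  shows "(\<lambda>n. L2nrm M (\<lambda>x. F n x - f x)) \<longlonglongrightarrow> 0"
proof (rule ccontr)
  let ?a = "L2nrm M f"
  assume "\<not> (\<lambda>n. L2nrm M (\<lambda>x. F n x - f x)) \<longlonglongrightarrow> 0"
  then have "\<exists>e>0. \<forall>N. \<exists>n\<ge>N. e \<le> L2nrm M (\<lambda>x. F n x - f x)"
    unfolding LIMSEQ_iff by (simp add: not_less)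
  then obtain e where e: "e > 0" "\<And>N. \<exists>n\<ge>N. e \<le> L2nrm M (\<lambda>x. F n x - f x)"
    by blast
  then have "infinite {n. e \<le> L2nrm M (\<lambda>x. F n x - f x)}"
    unfolding infinite_nat_iff_unbounded_le by blast
  from infinite_enumerate[OF this] obtain r where r: "strict_mono (r::nat\<Rightarrow>nat)"
      "\<And>n. e \<le> L2nrm M (\<lambda>x. F (r n) x - f x)" by blast
  have up: "(L2nrm M (\<lambda>x. F (r n) x + f x))\<^sup>2 \<le> 2 * (?a + \<delta> (r n))\<^sup>2 + 2 * ?a\<^sup>2 - e\<^sup>2" for n
  proof -
    have "e\<^sup>2 \<le> (L2nrm M (\<lambda>x. F (r n) x - f x))\<^sup>2" using r(2) e(1) by (intro power_mono) auto
    moreover have "(L2nrm M (F (r n)))\<^sup>2 \<le> (?a + \<delta> (r n))\<^sup>2" using le by (intro power_mono) auto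
    ultimately show ?thesis using L2nrm_parallelogram[OF F f, of "r n"] by simp
  qed
  have "(\<lambda>n. 2 * (?a + \<delta> (r n))\<^sup>2 + 2 * ?a\<^sup>2 - e\<^sup>2) \<longlonglongrightarrow> 2 * (?a + 0)\<^sup>2 + 2 * ?a\<^sup>2 - e\<^sup>2"
    using LIMSEQ_subseq_LIMSEQ[OF \<delta> r(1)] by (intro tendsto_intros) (simp add: o_def)
  then have "eventually (\<lambda>n. 2 * (?a + \<delta> (r n))\<^sup>2 + 2 * ?a\<^sup>2 - e\<^sup>2 < 4 * ?a\<^sup>2 - e\<^sup>2 / 2) sequentially"
    using e(1) by (intro order_tendstoD(2)) auto
  then obtain N where N: "\<And>n. n \<ge> N \<Longrightarrow> 2 * (?a + \<delta> (r n))\<^sup>2 + 2 * ?a\<^sup>2 - e\<^sup>2 < 4 * ?a\<^sup>2 - e\<^sup>2 / 2"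
    by (auto simp: eventually_sequentially)
  have pos: "0 \<le> 4 * ?a\<^sup>2 - e\<^sup>2 / 2"
    using up[of N] N[of N] zero_le_power2[of "L2nrm M (\<lambda>x. F (r N) x + f x)"] by linarith
  have "L2nrm M (\<lambda>x. f x + f x) \<le> sqrt (4 * ?a\<^sup>2 - e\<^sup>2 / 2)"
  proof (rule L2nrm_Fatou(2)[where F="\<lambda>n x. F (r (n + N)) x + f x"])
    show "sq_int M (\<lambda>x. F (r (n + N)) x + f x)" for n by (intro sq_int_add F f)
    show "L2nrm M (\<lambda>x. F (r (n + N)) x + f x) \<le> sqrt (4 * ?a\<^sup>2 - e\<^sup>2 / 2)" for n
      using up[of "n+N"] N[of "n+N"] by (intro real_le_rsqrt) simp
    show "AE x in M. (\<lambda>n. F (r (n + N)) x + f x) \<longlonglongrightarrow> f x + f x"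
      using lim
    proof eventually_elim
      case (elim x)
      have "(\<lambda>n. F (r (n + N)) x) \<longlonglongrightarrow> f x"
        using LIMSEQ_ignore_initial_segment[OF LIMSEQ_subseq_LIMSEQ[OF elim r(1)]] by (simp add: o_def)
      then show ?case by (intro tendsto_intros)
    qed
  qed (use pos f in \<open>auto simp: sq_int_def\<close>)
  moreover have "L2nrm M (\<lambda>x. f x + f x) = 2 * ?a"
    using L2nrm_scaleR[of M 2 f] by (simp add: scaleR_2)
  ultimately have "(2 * ?a)\<^sup>2 \<le> 4 * ?a\<^sup>2 - e\<^sup>2 / 2"
    by (intro sqrt_ge_absD) (simp add: abs_mult)
  then show False using e(1) by (simp add: power_mult_distrib)
qed

text \<open>The Riesz-Fischer argument: a rapidly Cauchy subsequence converges almost everywhere, and Fatou's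
  lemma, applied to its differences, upgrades this to convergence in norm.\<close>

lemma L2_complete:
  fixes F :: "nat \<Rightarrow> real \<Rightarrow> 'b::euclidean_space"
  assumes F: "\<And>n. sq_int lborel (F n)"
    and cauchy: "\<And>e. e > 0 \<Longrightarrow> \<exists>N. \<forall>m\<ge>N. \<forall>n\<ge>N. L2nrm lborel (\<lambda>x. F m x - F n x) \<le> e"
  shows "\<exists>f. sq_int lborel f \<and> (\<lambda>n. L2nrm lborel (\<lambda>x. F n x - f x)) \<longlonglongrightarrow> 0"
proof -
  let ?M = "lborel :: real measure"
  have [measurable]: "F n \<in> borel_measurable ?M" for n using F by (simp add: sq_int_def)
  have "\<forall>k. \<exists>N. \<forall>m\<ge>N. \<forall>n\<ge>N. L2nrm ?M (\<lambda>x. F m x - F n x) \<le> (1/2)^k"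
    by (intro allI cauchy) simp
  from choice[OF this] obtain N where "\<forall>k. \<forall>m\<ge>N k. \<forall>n\<ge>N k. L2nrm ?M (\<lambda>x. F m x - F n x) \<le> (1/2)^k" ..
  then have N: "\<And>k m n. m \<ge> N k \<Longrightarrow> n \<ge> N k \<Longrightarrow> L2nrm ?M (\<lambda>x. F m x - F n x) \<le> (1/2)^k"
    by simp
  define r where "r k = Max (N ` {..k}) + k" for k
  have rN: "r k \<ge> N k" "r (Suc k) \<ge> N k" for k
    unfolding r_def by (rule trans_le_add1, rule Max_ge, simp, simp)+
  have rmono: "r k \<ge> k" for k by (simp add: r_def)
  define d where "d k x = F (r (Suc k)) x - F (r k) x" for k x
  have d: "sq_int ?M (d k)" "L2nrm ?M (d k) \<le> (1/2)^k" for k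
    unfolding d_def[abs_def] using sq_int_diff[OF F F] N[OF rN(2) rN(1)] by auto
  have [measurable]: "d k \<in> borel_measurable ?M" for k using d by (simp add: sq_int_def)
  \<comment> \<open>Paired with the square integrable weight, the increments are summable almost everywhere.\<close>
  define \<rho> :: "real \<Rightarrow> real" where "\<rho> x = inverse (1 + x\<^sup>2)" for x
  have [measurable]: "\<rho> \<in> borel_measurable borel" unfolding \<rho>_def by measurable
  have \<rho>_pos: "\<rho> x > 0" "\<rho> x \<le> 1" for x
    by (simp_all add: \<rho>_def add_pos_nonneg inverse_le_1_iff)
  have \<rho>_int: "integrable ?M \<rho>"
    using integrable_inverse_1_plus_square by (simp add: set_integrable_def \<rho>_def[abs_def])
  have \<rho>_sq: "sq_int ?M \<rho>"
    unfolding sq_int_def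
  proof
    show "integrable ?M (\<lambda>x. (norm (\<rho> x))\<^sup>2)"
    proof (rule Bochner_Integration.integrable_bound[OF \<rho>_int])
      have "norm ((norm (\<rho> x))\<^sup>2) \<le> norm (\<rho> x)" for x
        using \<rho>_pos[of x] by (simp add: power2_eq_square mult_left_le)
      then show "AE x in lborel. norm ((norm (\<rho> x))\<^sup>2) \<le> norm (\<rho> x)" by simp
    qed simp
  qed simp
  have s: "(\<integral>\<^sup>+x. ennreal (norm (d k x) * \<rho> x) \<partial>?M) \<le> ennreal ((1/2)^k * L2nrm ?M \<rho>)" for k
  proof -
    have nd: "sq_int ?M (\<lambda>x. norm (d k x))" using d(1) by (simp add: sq_int_def)
    have "(\<integral>\<^sup>+x. ennreal (norm (d k x) * \<rho> x) \<partial>?M) = ennreal (\<integral>x. norm (d k x) * \<rho> x \<partial>?M)"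
      using sq_int_inner[OF nd \<rho>_sq] \<rho>_pos by (intro nn_integral_eq_integral) (auto simp: less_imp_le)
    also have "\<dots> \<le> ennreal ((1/2)^k * L2nrm ?M \<rho>)"
    proof (rule ennreal_leI)
      have "(\<integral>x. norm (d k x) * \<rho> x \<partial>?M) \<le> L2nrm ?M (\<lambda>x. norm (d k x)) * L2nrm ?M \<rho>"
        using L2_Cauchy_Schwarz[OF nd \<rho>_sq] by simp
      also have "L2nrm ?M (\<lambda>x. norm (d k x)) = L2nrm ?M (d k)" by (simp add: L2nrm_def)
      also have "\<dots> * L2nrm ?M \<rho> \<le> (1/2)^k * L2nrm ?M \<rho>" by (intro mult_right_mono d) simp
      finally show "(\<integral>x. norm (d k x) * \<rho> x \<partial>?M) \<le> (1/2)^k * L2nrm ?M \<rho>" .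
    qed
    finally show ?thesis .
  qed
  have "(\<integral>\<^sup>+x. (\<Sum>k. ennreal (norm (d k x) * \<rho> x)) \<partial>?M) = (\<Sum>k. \<integral>\<^sup>+x. ennreal (norm (d k x) * \<rho> x) \<partial>?M)"
    by (rule nn_integral_suminf) simp
  also have "\<dots> \<le> (\<Sum>k. ennreal ((1/2)^k * L2nrm ?M \<rho>))" by (rule suminf_le) (auto intro: s)
  also have "\<dots> = ennreal (\<Sum>k. (1/2)^k * L2nrm ?M \<rho>)"
    by (rule suminf_ennreal2) (auto intro!: summable_mult2 summable_geometric)
  finally have "(\<integral>\<^sup>+x. (\<Sum>k. ennreal (norm (d k x) * \<rho> x)) \<partial>?M) \<noteq> \<infinity>"
    by (auto simp: top_unique)
  then have "AE x in ?M. (\<Sum>k. ennreal (norm (d k x) * \<rho> x)) \<noteq> \<infinity>"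
    by (intro nn_integral_PInf_AE) auto
  then have conv: "AE x in ?M. (\<lambda>k. F (r k) x) \<longlonglongrightarrow> lim (\<lambda>k. F (r k) x)"
  proof eventually_elim
    case (elim x)
    have "summable (\<lambda>k. norm (d k x) * \<rho> x)"
      using elim \<rho>_pos by (intro summable_suminf_not_top) (auto simp: less_imp_le)
    then have "summable (\<lambda>k. norm (d k x))"
      using \<rho>_pos(1)[of x] summable_mult_D[of "\<rho> x" "\<lambda>k. norm (d k x)"] by (simp add: mult.commute)
    then have "summable (\<lambda>k. d k x)" by (rule summable_norm_cancel)
    then have "convergent (\<lambda>n. F (r 0) x + (\<Sum>k<n. d k x))"
      by (intro convergent_add convergent_const) (simp add: summable_iff_convergent)
    moreover have "F (r 0) x + (\<Sum>k<n. d k x) = F (r n) x" for n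
      unfolding d_def by (subst sum_lessThan_telescope) simp
    ultimately show ?case by (simp add: convergent_LIMSEQ_iff)
  qed
  define f where "f x = lim (\<lambda>k. F (r k) x)" for x
  have [measurable]: "f \<in> borel_measurable ?M"
    unfolding f_def by measurable
  have lim: "AE x in ?M. (\<lambda>k. F (r k) x) \<longlonglongrightarrow> f x" using conv by (simp add: f_def)
  have tail: "sq_int ?M (\<lambda>x. F n x - f x) \<and> L2nrm ?M (\<lambda>x. F n x - f x) \<le> (1/2)^k" if n: "n \<ge> N k" for n k
  proof -
    have a: "sq_int ?M (\<lambda>x. F n x - F (r (j + k + N k)) x)" 
       "L2nrm ?M (\<lambda>x. F n x - F (r (j + k + N k)) x) \<le> (1/2)^k" for j
    proof -
      show "sq_int ?M (\<lambda>x. F n x - F (r (j + k + N k)) x)" by (intro sq_int_diff F)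
      have "r (j + k + N k) \<ge> N k" using rmono[of "j + k + N k"] by simp
      then show "L2nrm ?M (\<lambda>x. F n x - F (r (j + k + N k)) x) \<le> (1/2)^k" using N n by blast
    qed
    have l: "AE x in ?M. (\<lambda>j. F n x - F (r (j + k + N k)) x) \<longlonglongrightarrow> F n x - f x"
      using lim
    proof eventually_elim
      case (elim x)
      have "(\<lambda>j. F (r (j + (k + N k))) x) \<longlonglongrightarrow> f x" by (rule LIMSEQ_ignore_initial_segment[OF elim])
      then show ?case by (intro tendsto_intros) (simp add: add.assoc)
    qed
    show ?thesis
      using L2nrm_Fatou[where F="\<lambda>j x. F n x - F (r (j + k + N k)) x" and B="(1/2)^k" and f="\<lambda>x. F n x - f x", OF a _ _ l]
      by simp
  qed
  have "sq_int ?M (\<lambda>x. F (N 0) x - (F (N 0) x - f x))"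
    by (rule sq_int_diff[OF F]) (use tail[of 0 "N 0"] in simp)
  then have "sq_int ?M f" by simp
  moreover have "(\<lambda>n. L2nrm ?M (\<lambda>x. F n x - f x)) \<longlonglongrightarrow> 0"
  proof (rule LIMSEQ_I)
    fix e :: real assume "e > 0"
    then obtain k where k: "(1/2)^k < e" using real_arch_pow_inv[of e "1/2"] by auto
    have "norm (L2nrm ?M (\<lambda>x. F n x - f x) - 0) < e" if "n \<ge> N k" for n
      using tail[OF that] k by simp
    then show "\<exists>n0. \<forall>n\<ge>n0. norm (L2nrm ?M (\<lambda>x. F n x - f x) - 0) < e" by blast
  qed
  ultimately show ?thesis by blast
qed

section \<open>Test functions\<close>

text \<open>The iterated derivative \<open>deriv ^^ n\<close> is unwieldy; a test function is recognised by a sequence of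
  functions each of which is the derivative of the one before.\<close>

lemma test_functionI:
  assumes F: "\<And>n x. (F n has_real_derivative F (Suc n) x) (at x)"
    and supp: "\<And>x. R < \<bar>x\<bar> \<Longrightarrow> F 0 x = 0"
  shows "test_function (F 0)" "(deriv ^^ n) (F 0) = F n"
proof -
  have eq: "(deriv ^^ n) (F 0) = F n" for n
    by (induction n) (auto intro!: ext DERIV_imp_deriv F)
  then show "(deriv ^^ n) (F 0) = F n" .
  have "{x. F 0 x \<noteq> 0} \<subseteq> cball 0 R" using supp by (force simp: dist_norm)
  then have "compact (closure {x. F 0 x \<noteq> 0})"
    using bounded_subset[OF bounded_cball] by (simp add: compact_closure)
  then show "test_function (F 0)"
    unfolding test_function_def eq using F by (auto simp: real_differentiable_def)
qed

lemma test_function_deriv: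
  assumes "test_function \<phi>"
  shows "((deriv ^^ n) \<phi> has_real_derivative (deriv ^^ Suc n) \<phi> x) (at x)"
  using assms by (auto simp: test_function_def real_differentiable_def dest: DERIV_imp_deriv)

lemma test_function_support:
  assumes "test_function \<phi>"
  shows "\<exists>R\<ge>0. \<forall>n x. R < \<bar>x\<bar> \<longrightarrow> (deriv ^^ n) \<phi> x = 0"
proof -
  have "bounded {x. \<phi> x \<noteq> 0}"
    using assms unfolding test_function_def by (meson bounded_subset closure_subset compact_imp_bounded)
  then obtain R where R: "\<And>x. \<phi> x \<noteq> 0 \<Longrightarrow> \<bar>x\<bar> \<le> R" by (auto simp: bounded_iff)
  have "(deriv ^^ n) \<phi> x = 0" if "max R 0 < \<bar>x\<bar>" for n x
    using that
  proof (induction n arbitrary: x)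
    case 0 then show ?case using R[of x] by auto
  next
    case (Suc n)
    have "open {x. max R 0 < \<bar>x\<bar>}" by (intro open_Collect_less continuous_intros)
    have "((deriv ^^ n) \<phi> has_real_derivative 0) (at x)"
      by (rule has_field_derivative_transform_within_open[OF DERIV_const[of 0] \<open>open {x. max R 0 < \<bar>x\<bar>}\<close>])
         (use Suc in auto)
    then show ?case using test_function_deriv[OF assms, of n x] DERIV_unique by blast
  qed
  then show ?thesis by (intro exI[of _ "max R 0"]) auto
qed

lemma test_function_iterated_deriv:
  assumes "test_function \<phi>" shows "test_function ((deriv ^^ k) \<phi>)"
proof -
  obtain R where R: "\<And>n x. R < \<bar>x\<bar> \<Longrightarrow> (deriv ^^ n) \<phi> x = 0"
    using test_function_support[OF assms] by blast
  show ?thesis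
    using test_functionI(1)[of "\<lambda>n. (deriv ^^ (n + k)) \<phi>" R] test_function_deriv[OF assms] R by auto
qed

lemmas test_function_deriv1 = test_function_iterated_deriv[where k=1, simplified]

lemma test_function_has_deriv:
  assumes "test_function \<phi>" shows "(\<phi> has_real_derivative deriv \<phi> x) (at x)"
  using test_function_deriv[OF assms, of 0] by simp

lemma test_function_affine:
  assumes "test_function \<phi>" "a \<noteq> 0"
  shows "test_function (\<lambda>x. \<phi> (a * x + b))" "deriv (\<lambda>x. \<phi> (a * x + b)) = (\<lambda>x. a * deriv \<phi> (a * x + b))"
proof -
  obtain R where R: "0 \<le> R" "\<And>n x. R < \<bar>x\<bar> \<Longrightarrow> (deriv ^^ n) \<phi> x = 0"
    using test_function_support[OF assms(1)] by blast
  define F where "F = (\<lambda>n x. a ^ n * (deriv ^^ n) \<phi> (a * x + b))"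
  have F: "(F n has_real_derivative F (Suc n) x) (at x)" for n x
  proof -
    have "((\<lambda>x. (deriv ^^ n) \<phi> (a * x + b)) has_real_derivative (deriv ^^ Suc n) \<phi> (a * x + b) * a) (at x)"
      by (rule DERIV_chain2[OF test_function_deriv[OF assms(1)]]) (auto intro!: derivative_eq_intros)
    from DERIV_cmult[OF this, of "a ^ n"] show ?thesis by (simp add: F_def mult_ac)
  qed
  have s: "F 0 x = 0" if "(R + \<bar>b\<bar>) / \<bar>a\<bar> < \<bar>x\<bar>" for x
  proof -
    have "R + \<bar>b\<bar> < \<bar>a * x\<bar>" using that assms(2) by (simp add: field_simps abs_mult)
    then have "R < \<bar>a * x + b\<bar>" by linarith
    then show ?thesis using R(2)[of _ 0] by (simp add: F_def)
  qed
  show "test_function (\<lambda>x. \<phi> (a * x + b))" "deriv (\<lambda>x. \<phi> (a * x + b)) = (\<lambda>x. a * deriv \<phi> (a * x + b))"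
    using test_functionI(1)[of F "(R + \<bar>b\<bar>) / \<bar>a\<bar>", OF F s] test_functionI(2)[of F "(R + \<bar>b\<bar>) / \<bar>a\<bar>" 1, OF F s]
    by (simp_all add: F_def)
qed

lemma test_function_lincomb:
  assumes "test_function \<phi>" "test_function \<psi>"
  shows "test_function (\<lambda>x. a * \<phi> x + b * \<psi> x)"
    "deriv (\<lambda>x. a * \<phi> x + b * \<psi> x) = (\<lambda>x. a * deriv \<phi> x + b * deriv \<psi> x)"
proof -
  obtain R where R: "\<And>n x. R < \<bar>x\<bar> \<Longrightarrow> (deriv ^^ n) \<phi> x = 0"
    using test_function_support[OF assms(1)] by blast
  obtain R' where R': "\<And>n x. R' < \<bar>x\<bar> \<Longrightarrow> (deriv ^^ n) \<psi> x = 0"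
    using test_function_support[OF assms(2)] by blast
  define F where "F = (\<lambda>n x. a * (deriv ^^ n) \<phi> x + b * (deriv ^^ n) \<psi> x)"
  have F: "(F n has_real_derivative F (Suc n) x) (at x)" for n x
    unfolding F_def using test_function_deriv[OF assms(1), of n x] test_function_deriv[OF assms(2), of n x]
    by (intro DERIV_add DERIV_cmult)
  have s: "F 0 x = 0" if "max R R' < \<bar>x\<bar>" for x
    using R[of x 0] R'[of x 0] that by (simp add: F_def)
  show "test_function (\<lambda>x. a * \<phi> x + b * \<psi> x)"
     "deriv (\<lambda>x. a * \<phi> x + b * \<psi> x) = (\<lambda>x. a * deriv \<phi> x + b * deriv \<psi> x)"
    using test_functionI(1)[of F "max R R'", OF F s] test_functionI(2)[of F "max R R'" 1, OF F s]
    by (simp_all add: F_def)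
qed

lemma test_function_continuous: "test_function \<phi> \<Longrightarrow> continuous_on S \<phi>"
  by (meson DERIV_isCont continuous_at_imp_continuous_on test_function_has_deriv)

lemma test_function_measurable[measurable_dest]: "test_function \<phi> \<Longrightarrow> \<phi> \<in> borel_measurable borel"
  using test_function_continuous[of \<phi> UNIV] by (rule borel_measurable_continuous_onI)

lemma test_function_supp:
  assumes "test_function \<phi>" obtains R where "0 \<le> R" "\<And>x. R < \<bar>x\<bar> \<Longrightarrow> \<phi> x = 0"
  using test_function_support[OF assms] by (metis funpow_0)

lemma test_function_integrable: assumes "test_function \<phi>" shows "integrable lborel \<phi>"
proof -
  obtain R where R: "\<And>x. R < \<bar>x\<bar> \<Longrightarrow> \<phi> x = 0" using test_function_supp[OF assms] by blast
  have "integrable lborel (\<lambda>x. indicator {-R..R} x *\<^sub>R \<phi> x)"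
    by (rule borel_integrable_compact) (auto intro: test_function_continuous assms)
  also have "(\<lambda>x. indicator {-R..R} x *\<^sub>R \<phi> x) = \<phi>"
    using R by (force simp: indicator_def)
  finally show ?thesis .
qed

lemma test_function_bounded: assumes "test_function \<phi>" shows "\<exists>B. \<forall>x. \<bar>\<phi> x\<bar> \<le> B"
proof -
  obtain R where R: "\<And>x. R < \<bar>x\<bar> \<Longrightarrow> \<phi> x = 0" using test_function_supp[OF assms] by blast
  have "compact (\<phi> ` {-R..R})"
    by (intro compact_continuous_image test_function_continuous assms) simp
  then obtain B where B: "\<And>x. x \<in> {-R..R} \<Longrightarrow> \<bar>\<phi> x\<bar> \<le> B"
    using compact_imp_bounded by (fastforce simp: bounded_iff)
  have "\<bar>\<phi> x\<bar> \<le> max B 0" for x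
  proof (cases "R < \<bar>x\<bar>")
    case False
    then have "x \<in> {-R..R}" by auto
    from B[OF this] show ?thesis by simp
  qed (simp add: R)
  then show ?thesis by blast
qed

section \<open>The Fourier transform of test functions\<close>

lemma integrable_fourier:
  assumes "integrable lborel \<phi>"
  shows "integrable lborel (\<lambda>x. of_real (\<phi> x) * cis (- (x * \<xi>)))"
proof (rule Bochner_Integration.integrable_bound[OF assms])
  have [measurable]: "\<phi> \<in> borel_measurable lborel" using assms by auto
  show "(\<lambda>x. of_real (\<phi> x) * cis (- (x * \<xi>))) \<in> borel_measurable lborel"
    unfolding cis_conv_exp by measurable
qed (simp add: norm_mult)

lemma cmod_fourier_le:
  assumes "integrable lborel \<phi>" shows "cmod (fourier \<phi> \<xi>) \<le> (\<integral>x. \<bar>\<phi> x\<bar> \<partial>lborel)"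
  unfolding fourier_def
  by (rule order_trans[OF integral_norm_bound]) (simp add: norm_mult)

lemma fourier_measurable[measurable]:
  assumes [measurable]: "\<phi> \<in> borel_measurable borel" shows "fourier \<phi> \<in> borel_measurable borel"
  unfolding fourier_def[abs_def] cis_conv_exp by measurable

lemma fourier_deriv:
  assumes "test_function \<phi>"
  shows "fourier (deriv \<phi>) \<xi> = \<i> * of_real \<xi> * fourier \<phi> \<xi>"
proof -
  have d: "test_function (deriv \<phi>)" by (rule test_function_deriv1[OF assms])
  obtain R where R: "0 \<le> R" "\<And>n x. R < \<bar>x\<bar> \<Longrightarrow> (deriv ^^ n) \<phi> x = 0" using test_function_support[OF assms] by blast
  let ?R = "R + 1"
  let ?F = "\<lambda>x. of_real (\<phi> x) * cis (- (x * \<xi>))"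
  let ?f = "\<lambda>x. of_real (deriv \<phi> x) * cis (- (x * \<xi>)) - \<i> * of_real \<xi> * (of_real (\<phi> x) * cis (- (x * \<xi>)))"
  have "(\<integral>x. indicator {-?R..?R} x *\<^sub>R ?f x \<partial>lborel) = ?F ?R - ?F (-?R)"
  proof (rule integral_FTC_Icc)
    show "(?F has_vector_derivative ?f x) (at x within {- ?R..?R})" for x
    proof -
      have "((\<lambda>x. of_real (\<phi> x) :: complex) has_vector_derivative of_real (deriv \<phi> x)) (at x within {- ?R..?R})"
        using has_vector_derivative_of_real[OF has_field_derivative_at_within[OF test_function_has_deriv[OF assms]]] .
      moreover have "((\<lambda>x. cis (- (x * \<xi>))) has_vector_derivative (- \<xi>) *\<^sub>R (\<i> * cis (- (x * \<xi>)))) (at x within {- ?R..?R})"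
      proof -
        have "((\<lambda>z. exp (- (\<i> * of_real \<xi> * z))) has_field_derivative
            - (\<i> * of_real \<xi>) * exp (- (\<i> * of_real \<xi> * of_real x))) (at (of_real x))"
          by (auto intro!: derivative_eq_intros)
        from has_vector_derivative_real_field[OF this, of "{- ?R..?R}"] show ?thesis
          by (simp add: cis_conv_exp scaleR_conv_of_real mult_ac)
      qed
      ultimately have "(?F has_vector_derivative of_real (\<phi> x) * ((- \<xi>) *\<^sub>R (\<i> * cis (- (x * \<xi>)))) + of_real (deriv \<phi> x) * cis (- (x * \<xi>))) (at x within {- ?R..?R})"
        by (rule has_vector_derivative_mult)
      then show ?thesis by (simp add: scaleR_conv_of_real algebra_simps)
    qed
    show "continuous_on {- ?R..?R} ?f"
      unfolding cis_conv_exp by (intro continuous_intros test_function_continuous assms d)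
  qed (use R in simp)
  also have "?F ?R - ?F (-?R) = 0" using R(2)[of ?R 0] R(2)[of "-?R" 0] R(1) by simp
  also have "(\<lambda>x. indicator {-?R..?R} x *\<^sub>R ?f x) = ?f"
  proof
    fix x show "indicator {-?R..?R} x *\<^sub>R ?f x = ?f x"
      using R(2)[of x 0] R(2)[of x 1] by (cases "R < \<bar>x\<bar>") (auto simp: indicator_def)
  qed
  finally show ?thesis
    using integrable_fourier[OF test_function_integrable[OF assms]] integrable_fourier[OF test_function_integrable[OF d]]
    by (simp add: fourier_def)
qed

text \<open>Since \<open>\<phi> - \<phi>''\<close> has transform \<open>1 + \<xi>\<^sup>2\<close> times that of \<open>\<phi>\<close>, each factor \<open>1 + \<xi>\<^sup>2\<close> costs two
  derivatives, and the transform of an integrable function is bounded.\<close>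

lemma fourier_decay:
  assumes "test_function \<phi>"
  shows "\<exists>C. \<forall>\<xi>. (1 + \<xi>\<^sup>2) ^ k * cmod (fourier \<phi> \<xi>) \<le> C"
  using assms
proof (induction k arbitrary: \<phi>)
  case 0
  then show ?case using cmod_fourier_le[OF test_function_integrable] by auto
next
  case (Suc k)
  let ?\<psi> = "\<lambda>x. 1 * \<phi> x + (-1) * deriv (deriv \<phi>) x"
  have d: "test_function (deriv \<phi>)" "test_function (deriv (deriv \<phi>))"
    using Suc.prems test_function_deriv1 by blast+
  have "test_function ?\<psi>" by (intro test_function_lincomb Suc d)
  with Suc.IH obtain C where C: "\<And>\<xi>. (1 + \<xi>\<^sup>2) ^ k * cmod (fourier ?\<psi> \<xi>) \<le> C" by blast
  have lin: "fourier ?\<psi> \<xi> = of_real (1 + \<xi>\<^sup>2) * fourier \<phi> \<xi>" for \<xi>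
  proof -
    have "fourier ?\<psi> \<xi> = (\<integral>x. of_real (\<phi> x) * cis (- (x * \<xi>)) - of_real (deriv (deriv \<phi>) x) * cis (- (x * \<xi>)) \<partial>lborel)"
      unfolding fourier_def by (rule Bochner_Integration.integral_cong) (auto simp: algebra_simps)
    also have "\<dots> = fourier \<phi> \<xi> - fourier (deriv (deriv \<phi>)) \<xi>"
      unfolding fourier_def
      by (intro Bochner_Integration.integral_diff integrable_fourier test_function_integrable Suc d)
    also have "\<dots> = of_real (1 + \<xi>\<^sup>2) * fourier \<phi> \<xi>"
      by (simp add: fourier_deriv[OF d(1)] fourier_deriv[OF Suc.prems] algebra_simps power2_eq_square)
    finally show ?thesis .
  qed
  have "cmod (fourier ?\<psi> \<xi>) = (1 + \<xi>\<^sup>2) * cmod (fourier \<phi> \<xi>)" for \<xi>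
    unfolding lin norm_mult norm_of_real by simp
  then have "(1 + \<xi>\<^sup>2) ^ Suc k * cmod (fourier \<phi> \<xi>) \<le> C" for \<xi>
    using C[of \<xi>] by (simp add: mult_ac)
  then show ?case by blast
qed

lemma fourier_decay_integrable:
  assumes "test_function \<phi>"
  shows "integrable lborel (\<lambda>\<xi>. (1 + \<xi>\<^sup>2) ^ k * cmod (fourier \<phi> \<xi>))"
proof -
  obtain C where C: "\<And>\<xi>. (1 + \<xi>\<^sup>2) ^ Suc k * cmod (fourier \<phi> \<xi>) \<le> C" using fourier_decay[OF assms] by blast
  have [measurable]: "\<phi> \<in> borel_measurable borel" using assms by measurable
  show ?thesis
  proof (rule Bochner_Integration.integrable_bound)
    show "integrable lborel (\<lambda>\<xi>. C * inverse (1 + \<xi>\<^sup>2))"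
      using integrable_inverse_1_plus_square by (simp add: set_integrable_def)
    have "(1 + \<xi>\<^sup>2) ^ k * cmod (fourier \<phi> \<xi>) \<le> C * inverse (1 + \<xi>\<^sup>2)" for \<xi> :: real
      using C[of \<xi>] by (simp add: field_simps add_pos_nonneg)
    then show "AE \<xi> in lborel. norm ((1 + \<xi>\<^sup>2) ^ k * cmod (fourier \<phi> \<xi>)) \<le> norm (C * inverse (1 + \<xi>\<^sup>2))"
      by (intro always_eventually allI) (smt (verit) abs_of_nonneg mult_nonneg_nonneg norm_ge_zero real_norm_def zero_le_power zero_le_power2)
  qed measurable
qed

section \<open>Fourier inversion\<close>

text \<open>Like \<open>frac_lap_test\<close> this takes the real part at once, as all multipliers in use are transforms of
  real functions times real even symbols.\<close>

definition inv_fourier :: "(real \<Rightarrow> complex) \<Rightarrow> real \<Rightarrow> real" where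
  "inv_fourier m x = Re ((\<integral>\<xi>. m \<xi> * cis (x * \<xi>) \<partial>lborel) / of_real (2 * pi))"

lemma integrable_prod_mult:
  fixes f g :: "real \<Rightarrow> real"
  assumes "integrable lborel f" "integrable lborel g"
  shows "integrable (lborel \<Otimes>\<^sub>M lborel) (\<lambda>(x,y). f x * g y)"
proof (rule lborel_pair.Fubini_integrable)
  have [measurable]: "f \<in> borel_measurable lborel" "g \<in> borel_measurable lborel" using assms by auto
  show "(\<lambda>(x,y). f x * g y) \<in> borel_measurable (lborel \<Otimes>\<^sub>M lborel)" by measurable
  show "integrable lborel (\<lambda>x. \<integral>y. norm (case (x, y) of (x, y) \<Rightarrow> f x * g y) \<partial>lborel)"
    using assms by (simp add: abs_mult)
  show "AE x in lborel. integrable lborel (\<lambda>y. case (x, y) of (x, y) \<Rightarrow> f x * g y)"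
    using assms by simp
qed

text \<open>The characteristic function of the standard normal distribution.\<close>

lemma gaussian_fourier:
  "(\<integral>z. of_real (std_normal_density z) * cis (a * z) \<partial>lborel) = of_real (exp (- a\<^sup>2 / 2))"
proof -
  have "char std_normal_distribution a = (\<integral>x. std_normal_density x *\<^sub>R cis (a * x) \<partial>lborel)"
    unfolding char_def cis_conv_exp by (subst integral_density) (auto simp: cis_conv_exp)
  then show ?thesis by (simp add: char_std_normal_distribution scaleR_conv_of_real)
qed

lemma integrable_std_normal_density: "integrable lborel std_normal_density"
  by simp

text \<open>Insert the Gaussian factor \<open>exp (- (e \<xi>)\<^sup>2 / 2)\<close>. With it the double integral converges absolutely, and
  Fubini's theorem turns it into the average of \<open>\<phi>\<close> at scale \<open>e\<close> around \<open>x\<close> with respect to the normal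
  density. As \<open>e\<close> tends to zero, both sides converge by dominated convergence.\<close>

lemma fourier_inversion:
  assumes \<phi>: "test_function \<phi>"
  shows "inv_fourier (fourier \<phi>) x = \<phi> x"
proof -
  have [measurable]: "\<phi> \<in> borel_measurable borel" using \<phi> by measurable
  obtain B where B: "\<And>x. \<bar>\<phi> x\<bar> \<le> B" using test_function_bounded[OF \<phi>] by blast
  have F1: "integrable lborel (\<lambda>\<xi>. cmod (fourier \<phi> \<xi>))" using fourier_decay_integrable[OF \<phi>, of 0] by simp
  let ?g = "std_normal_density"
  define e where "e n = inverse (real (Suc n))" for n
  have e: "e n > 0" "e \<longlonglongrightarrow> 0" for n
    unfolding e_def[abs_def] by (simp, rule LIMSEQ_inverse_real_of_nat)
  have reg: "(\<integral>\<xi>. fourier \<phi> \<xi> * cis (x * \<xi>) * of_real (exp (- (e n * \<xi>)\<^sup>2 / 2)) \<partial>lborel)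
     = of_real (2 * pi * (\<integral>z. \<phi> (x + e n * z) * ?g z \<partial>lborel))" for n
  proof -
    let ?h = "\<lambda>\<xi>. exp (- (e n * \<xi>)\<^sup>2 / 2)"
    have h_eq: "?h \<xi> = sqrt (2 * pi) * ?g (0 + e n * \<xi>)" for \<xi> by (simp add: normal_density_def)
    have h: "integrable lborel ?h"
      unfolding h_eq using e(1)[of n] lborel_integrable_real_affine[OF integrable_std_normal_density, of "e n" 0]
      by simp
    have [measurable]: "?h \<in> borel_measurable borel" by measurable
    have int: "integrable (lborel \<Otimes>\<^sub>M lborel) (\<lambda>(y, \<xi>). of_real (\<phi> y) * cis (- (y * \<xi>)) * cis (x * \<xi>) * of_real (?h \<xi>))"
      by (rule Bochner_Integration.integrable_bound[OF integrable_prod_mult[OF test_function_integrable[OF \<phi>] h]])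
         (auto simp: cis_conv_exp norm_mult split_beta' simp del: exp_of_real)
    have inner: "(\<integral>\<xi>. cis (- (y * \<xi>)) * cis (x * \<xi>) * of_real (?h \<xi>) \<partial>lborel)
       = of_real (2 * pi / e n * ?g ((x - y) / e n))" for y
    proof -
      let ?k = "\<lambda>z. of_real (?g z) * cis (((x - y) / e n) * z)"
      have "(\<integral>z. ?k z \<partial>lborel) = \<bar>e n\<bar> *\<^sub>R (\<integral>\<xi>. ?k (0 + e n * \<xi>) \<partial>lborel)"
        using e(1)[of n] by (intro lborel_integral_real_affine) simp
      then have "(\<integral>\<xi>. ?k (0 + e n * \<xi>) \<partial>lborel) = of_real (exp (- ((x - y) / e n)\<^sup>2 / 2) / e n)"
        using e(1)[of n] unfolding gaussian_fourier by (simp add: scaleR_conv_of_real field_simps)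
      moreover have "cis (- (y * \<xi>)) * cis (x * \<xi>) * of_real (?h \<xi>) = of_real (sqrt (2 * pi)) * ?k (0 + e n * \<xi>)" for \<xi>
      proof -
        have "((x - y) / e n) * (0 + e n * \<xi>) = (x - y) * \<xi>"
          using e(1)[of n] by simp
        then have "- (y * \<xi>) + x * \<xi> = ((x - y) / e n) * (0 + e n * \<xi>)"
          by (simp add: algebra_simps)
        then show ?thesis unfolding h_eq cis_mult by simp
      qed
      ultimately have "(\<integral>\<xi>. cis (- (y * \<xi>)) * cis (x * \<xi>) * of_real (?h \<xi>) \<partial>lborel) 
         = of_real (sqrt (2 * pi) * (exp (- ((x - y) / e n)\<^sup>2 / 2) / e n))" by simp
      also have "sqrt (2 * pi) * (exp (- ((x - y) / e n)\<^sup>2 / 2) / e n) = 2 * pi / e n * ?g ((x - y) / e n)"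
      proof -
        have "q * (E / t) = q * q / t * (1 / q * E)" if "q \<noteq> 0" for q E t :: real using that by simp
        from this[of "sqrt (2 * pi)"] have "sqrt (2 * pi) * (E / e n) = 2 * pi / e n * (1 / sqrt (2 * pi) * E)" for E
          by simp
        then show ?thesis by (simp only: std_normal_density_def)
      qed
      finally show ?thesis .
    qed
    have "(\<integral>\<xi>. fourier \<phi> \<xi> * cis (x * \<xi>) * of_real (?h \<xi>) \<partial>lborel)
        = (\<integral>\<xi>. (\<integral>y. of_real (\<phi> y) * cis (- (y * \<xi>)) * cis (x * \<xi>) * of_real (?h \<xi>) \<partial>lborel) \<partial>lborel)"
      by (simp add: fourier_def)
    also have "\<dots> = (\<integral>y. (\<integral>\<xi>. of_real (\<phi> y) * cis (- (y * \<xi>)) * cis (x * \<xi>) * of_real (?h \<xi>) \<partial>lborel) \<partial>lborel)"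
      by (rule lborel_pair.Fubini_integral[OF int])
    also have "\<dots> = (\<integral>y. of_real (\<phi> y * (2 * pi / e n * ?g ((x - y) / e n))) \<partial>lborel)"
    proof (rule Bochner_Integration.integral_cong[OF refl])
      fix y
      have "(\<integral>\<xi>. of_real (\<phi> y) * cis (- (y * \<xi>)) * cis (x * \<xi>) * of_real (?h \<xi>) \<partial>lborel)
          = of_real (\<phi> y) * (\<integral>\<xi>. cis (- (y * \<xi>)) * cis (x * \<xi>) * of_real (?h \<xi>) \<partial>lborel)"
        by (simp only: mult.assoc integral_mult_right_zero)
      then show "(\<integral>\<xi>. of_real (\<phi> y) * cis (- (y * \<xi>)) * cis (x * \<xi>) * of_real (?h \<xi>) \<partial>lborel)
          = of_real (\<phi> y * (2 * pi / e n * ?g ((x - y) / e n)))"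
        by (simp only: inner of_real_mult)
    qed
    also have "\<dots> = of_real (\<integral>y. \<phi> y * (2 * pi / e n * ?g ((x - y) / e n)) \<partial>lborel)"
      by (rule integral_complex_of_real)
    also have "(\<integral>y. \<phi> y * (2 * pi / e n * ?g ((x - y) / e n)) \<partial>lborel)
       = \<bar>e n\<bar> *\<^sub>R (\<integral>z. \<phi> (x + e n * z) * (2 * pi / e n * ?g ((x - (x + e n * z)) / e n)) \<partial>lborel)"
      using e(1)[of n] by (intro lborel_integral_real_affine) simp
    also have "\<dots> = (\<integral>z. 2 * pi * (\<phi> (x + e n * z) * ?g z) \<partial>lborel)"
      unfolding real_scaleR_def integral_mult_right_zero[symmetric]
      using e(1)[of n] by (intro Bochner_Integration.integral_cong) (auto simp: normal_density_def)
    finally show ?thesis by simp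
  qed
  have "(\<lambda>n. \<integral>\<xi>. fourier \<phi> \<xi> * cis (x * \<xi>) * of_real (exp (- (e n * \<xi>)\<^sup>2 / 2)) \<partial>lborel)
     \<longlonglongrightarrow> (\<integral>\<xi>. fourier \<phi> \<xi> * cis (x * \<xi>) \<partial>lborel)"
  proof (rule integral_dominated_convergence[OF _ _ F1])
    have "(\<lambda>n. fourier \<phi> \<xi> * cis (x * \<xi>) * of_real (exp (- (e n * \<xi>)\<^sup>2 / 2))) \<longlonglongrightarrow>
        fourier \<phi> \<xi> * cis (x * \<xi>) * of_real (exp (- (0 * \<xi>)\<^sup>2 / 2))" for \<xi>
      by (intro tendsto_intros e) simp
    then show "AE \<xi> in lborel. (\<lambda>n. fourier \<phi> \<xi> * cis (x * \<xi>) * of_real (exp (- (e n * \<xi>)\<^sup>2 / 2))) \<longlonglongrightarrow>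
        fourier \<phi> \<xi> * cis (x * \<xi>)" by simp
    have "cmod (fourier \<phi> \<xi> * cis (x * \<xi>) * of_real (exp (- (e n * \<xi>)\<^sup>2 / 2))) \<le> cmod (fourier \<phi> \<xi>)" for n \<xi>
      unfolding norm_mult by (simp add: mult_left_le del: exp_of_real)
    then show "AE \<xi> in lborel. cmod (fourier \<phi> \<xi> * cis (x * \<xi>) * of_real (exp (- (e n * \<xi>)\<^sup>2 / 2))) \<le> cmod (fourier \<phi> \<xi>)" for n
      by simp
  qed (unfold cis_conv_exp, measurable)
  moreover have "(\<lambda>n. \<integral>z. \<phi> (x + e n * z) * ?g z \<partial>lborel) \<longlonglongrightarrow> (\<integral>z. \<phi> x * ?g z \<partial>lborel)"
  proof (rule integral_dominated_convergence[where w="\<lambda>z. B * ?g z"])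
    have "(\<lambda>n. \<phi> (x + e n * z) * ?g z) \<longlonglongrightarrow> \<phi> (x + 0 * z) * ?g z" for z
      by (intro tendsto_intros e isCont_tendsto_compose[where g=\<phi>] DERIV_isCont[OF test_function_has_deriv[OF \<phi>]])
    then show "AE z in lborel. (\<lambda>n. \<phi> (x + e n * z) * ?g z) \<longlonglongrightarrow> \<phi> x * ?g z" by simp
    show "AE z in lborel. norm (\<phi> (x + e n * z) * ?g z) \<le> B * ?g z" for n
      using B by (simp add: abs_mult mult_right_mono)
  qed auto
  then have "(\<lambda>n. of_real (2 * pi * (\<integral>z. \<phi> (x + e n * z) * ?g z \<partial>lborel)) :: complex) \<longlonglongrightarrow> of_real (2 * pi * (\<integral>z. \<phi> x * ?g z \<partial>lborel))"
    by (intro tendsto_intros)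
  ultimately have "(\<integral>\<xi>. fourier \<phi> \<xi> * cis (x * \<xi>) \<partial>lborel) = of_real (2 * pi * (\<integral>z. \<phi> x * ?g z \<partial>lborel))"
    unfolding reg by (rule LIMSEQ_unique)
  also have "(\<integral>z. \<phi> x * ?g z \<partial>lborel) = \<phi> x" using has_bochner_integral_integral_eq[OF std_normal_moment_even[of 0]] by simp
  finally show ?thesis by (simp add: inv_fourier_def)
qed

lemma frac_lap_test_inv_fourier: "frac_lap_test s \<phi> = inv_fourier (\<lambda>\<xi>. of_real (\<bar>\<xi>\<bar> powr (2 * s)) * fourier \<phi> \<xi>)"
  by (simp add: frac_lap_test_def inv_fourier_def fun_eq_iff)

section \<open>Singular integrals of second differences\<close>

text \<open>The kernel of the fractional Laplacian of order \<open>2 * s\<close>. At \<open>h = 0\<close> it is \<open>0\<close>, not infinite, by the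
  convention for \<open>powr\<close>; this affects only a null set.\<close>

definition kern :: "real \<Rightarrow> real \<Rightarrow> real" where "kern s h = \<bar>h\<bar> powr (- (1 + 2 * s))"

text \<open>The size of a second difference as a function of its step: quadratic for small steps, bounded for
  large ones. Multiplied by \<open>kern s\<close> it is integrable exactly for \<open>0 < s < 1\<close>.\<close>

definition cap_sq :: "real \<Rightarrow> real" where "cap_sq h = min 1 (h\<^sup>2)"

definition second_diff :: "real \<Rightarrow> (real \<Rightarrow> real) \<Rightarrow> real \<Rightarrow> real" where
  "second_diff h g x = 2 * g x - g (x + h) - g (x - h)"

definition kern_const :: "real \<Rightarrow> real" where "kern_const s = (\<integral>h. (1 - cos h) * kern s h \<partial>lborel)"

text \<open>The constant in front of the singular integral that represents \<open>(-\<Delta>)\<^sup>s\<close>; the factor \<open>2\<close> stems from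
  the symbol \<open>2 * (1 - cos (h * \<xi>))\<close> of the second difference.\<close>

definition lap_const :: "real \<Rightarrow> real" where "lap_const s = 1 / (2 * kern_const s)"

definition L1nrm :: "(real \<Rightarrow> real) \<Rightarrow> real" where "L1nrm g = (\<integral>x. \<bar>g x\<bar> \<partial>lborel)"

lemma kern_nonneg[simp]: "0 \<le> kern s h" by (simp add: kern_def)
lemma kern_minus[simp]: "kern s (- h) = kern s h" by (simp add: kern_def)
lemma kern_0[simp]: "kern s 0 = 0" by (simp add: kern_def)
lemma kern_measurable[measurable]: "kern s \<in> borel_measurable borel" unfolding kern_def[abs_def] by measurable
lemma cap_sq_measurable[measurable]: "cap_sq \<in> borel_measurable borel" unfolding cap_sq_def[abs_def] by measurable
lemma cap_sq_nonneg[simp]: "0 \<le> cap_sq h" by (simp add: cap_sq_def)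
lemma L1nrm_nonneg[simp]: "0 \<le> L1nrm g" by (simp add: L1nrm_def)

lemma kern_half: "kern (1/2) h = 1 / h\<^sup>2"
proof (cases "h = 0")
  case False
  then have "\<bar>h\<bar> powr (-2) = 1 / \<bar>h\<bar> ^ 2"
    by (subst powr_minus) (simp add: powr_numeral divide_inverse)
  then show ?thesis by (simp add: kern_def)
qed simp

lemma second_diff_measurable[measurable]:
  assumes [measurable]: "g \<in> borel_measurable borel"
  shows "(\<lambda>(h,x). second_diff h g x) \<in> borel_measurable (lborel \<Otimes>\<^sub>M lborel)"
    "(\<lambda>h. second_diff h g x) \<in> borel_measurable borel"
    "second_diff h g \<in> borel_measurable borel"
  unfolding second_diff_def[abs_def] by measurable

lemma cap_sq_kern_integrable:
  assumes s: "0 < s" "s < 1"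
  shows "integrable lborel (\<lambda>h. cap_sq h * kern s h)"
proof -
  let ?f = "\<lambda>h. cap_sq h * kern s h"
  have "(\<lambda>h. h powr (1 - 2 * s)) integrable_on {0..1}"
    using s by (intro integrable_on_powr_from_0) auto
  moreover have "h powr (1 - 2 * s) = ?f h" if "h \<in> {0..1}" for h
  proof (cases "h = 0")
    case False
    then have "h powr (1 - 2 * s) = h powr 2 * h powr (- (1 + 2 * s))"
      by (subst powr_add[symmetric]) simp
    moreover have "h\<^sup>2 \<le> 1" using that by (simp add: power_le_one_iff)
    ultimately show ?thesis using that False by (simp add: kern_def cap_sq_def powr_numeral min_def)
  qed simp
  ultimately have "?f integrable_on {0..1}"
    by (rule integrable_eq)
  then have 1: "?f absolutely_integrable_on {0..1}"
    by (intro nonnegative_absolutely_integrable_1) auto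
  have "(\<lambda>h. h powr (- (1 + 2 * s))) integrable_on {1..}"
    using has_integral_powr_to_inf[of "- (1 + 2 * s)" 1] s by auto
  moreover have "h powr (- (1 + 2 * s)) = ?f h" if "h \<in> {1..}" for h
    using that one_le_power[of h 2] by (simp add: kern_def cap_sq_def min_def)
  ultimately have "?f integrable_on {1..}"
    by (rule integrable_eq)
  then have 2: "?f absolutely_integrable_on {1..}"
    by (intro nonnegative_absolutely_integrable_1) auto
  have "?f absolutely_integrable_on ({0..1} \<union> {1..})"
    by (rule set_integrable_Un[OF 1 2]) auto
  also have "{0..1} \<union> {1..} = {0::real..}" by auto
  finally have "integrable lebesgue (\<lambda>h. indicator {0..} h *\<^sub>R ?f h)" by (simp add: set_integrable_def)
  then have 3: "integrable lborel (\<lambda>h. indicator {0..} h *\<^sub>R ?f h)"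
    by (subst (asm) integrable_completion) auto
  from lborel_integrable_real_affine[OF this, of "-1" 0]
  have "integrable lborel (\<lambda>h. indicator {0..} (- h) *\<^sub>R ?f h)" by (simp add: cap_sq_def)
  from Bochner_Integration.integrable_add[OF 3 this]
  show ?thesis
    by (rule back_subst[where P="integrable lborel"]) (auto simp: fun_eq_iff indicator_def)
qed

lemma one_minus_cos_le: "1 - cos (h * \<xi>) \<le> 2 * (1 + \<xi>\<^sup>2) * cap_sq h"
proof (cases "h\<^sup>2 \<le> 1")
  case True
  have "cos (h * \<xi>) = 1 - 2 * (sin (h * \<xi> / 2))\<^sup>2"
    using cos_double_sin[of "h * \<xi> / 2"] by simp
  moreover have "(sin (h * \<xi> / 2))\<^sup>2 \<le> (h * \<xi> / 2)\<^sup>2"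
    using abs_sin_x_le_abs_x abs_le_square_iff[of "sin (h * \<xi> / 2)" "h * \<xi> / 2"] by blast
  moreover have "(h * \<xi> / 2)\<^sup>2 = \<xi>\<^sup>2 * h\<^sup>2 / 4" "2 * (1 + \<xi>\<^sup>2) * h\<^sup>2 = 2 * h\<^sup>2 + 2 * (\<xi>\<^sup>2 * h\<^sup>2)"
    by (simp_all add: power_mult_distrib power_divide algebra_simps)
  moreover have "0 \<le> h\<^sup>2" "0 \<le> \<xi>\<^sup>2 * h\<^sup>2" by auto
  moreover have "cap_sq h = h\<^sup>2" using True by (simp add: cap_sq_def min_def)
  ultimately show ?thesis by (simp only:)
next
  case False
  then have "2 * (1 + \<xi>\<^sup>2) * cap_sq h = 2 + 2 * \<xi>\<^sup>2" by (simp add: cap_sq_def min_def)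
  moreover have "-1 \<le> cos (h * \<xi>)" by simp
  moreover have "0 \<le> \<xi>\<^sup>2" by simp
  ultimately show ?thesis by linarith
qed

lemma one_minus_cos_integrable:
  assumes s: "0 < s" "s < 1"
  shows "integrable lborel (\<lambda>h. (1 - cos (h * \<xi>)) * kern s h)"
proof (rule Bochner_Integration.integrable_bound)
  show "integrable lborel (\<lambda>h. 2 * (1 + \<xi>\<^sup>2) * (cap_sq h * kern s h))"
    using cap_sq_kern_integrable[OF s] by simp
  show "AE h in lborel. norm ((1 - cos (h * \<xi>)) * kern s h) \<le> norm (2 * (1 + \<xi>\<^sup>2) * (cap_sq h * kern s h))"
    using mult_right_mono[OF one_minus_cos_le kern_nonneg] by (intro always_eventually) (simp add: abs_mult mult_ac)
qed measurable

lemma kern_const_pos: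
  assumes s: "0 < s" "s < 1"
  shows "0 < kern_const s"
proof -
  define c where "c = (1 - cos 1) * (2 powr (- (1 + 2 * s)))"
  have c: "c > 0" using cos_monotone_0_pi[of 0 1] pi_gt3 by (simp add: c_def)
  have "(\<integral>h. c * indicator {1..2::real} h \<partial>lborel) \<le> kern_const s"
    unfolding kern_const_def
  proof (rule integral_mono)
    show "integrable lborel (\<lambda>h::real. c * indicator {1..2} h)" by simp
    show "integrable lborel (\<lambda>h. (1 - cos h) * kern s h)" using one_minus_cos_integrable[OF s, of 1] by simp
    fix h :: real
    show "c * indicator {1..2} h \<le> (1 - cos h) * kern s h"
    proof (cases "h \<in> {1..2}")
      case True
      then have "cos h \<le> cos 1" using pi_gt3 by (intro cos_monotone_0_pi_le) auto
      moreover have "2 powr (- (1 + 2 * s)) \<le> kern s h"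
        using True s by (simp add: kern_def) (intro powr_mono2', auto)
      ultimately show ?thesis using True by (simp add: c_def) (intro mult_mono, auto)
    qed simp
  qed
  then show ?thesis using c by simp
qed

text \<open>Dilation by \<open>\<xi>\<close> extracts the power \<open>\<bar>\<xi>\<bar> powr (2 * s)\<close>. This identity is the reason why the
  fractional Laplacian is an average of second differences.\<close>

lemma one_minus_cos_integral:
  "(\<integral>h. (1 - cos (h * \<xi>)) * kern s h \<partial>lborel) = \<bar>\<xi>\<bar> powr (2 * s) * kern_const s"
proof (cases "\<xi> = 0")
  case False
  have "kern_const s = \<bar>\<xi>\<bar> *\<^sub>R (\<integral>h. (1 - cos (0 + \<xi> * h)) * kern s (0 + \<xi> * h) \<partial>lborel)"
    unfolding kern_const_def by (rule lborel_integral_real_affine[OF False])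
  also have "\<dots> = \<bar>\<xi>\<bar> * (\<integral>h. \<bar>\<xi>\<bar> powr (- (1 + 2 * s)) * ((1 - cos (h * \<xi>)) * kern s h) \<partial>lborel)"
    by (simp add: kern_def abs_mult powr_mult mult_ac)
  also have "\<dots> = \<bar>\<xi>\<bar> powr (1 + - (1 + 2 * s)) * (\<integral>h. (1 - cos (h * \<xi>)) * kern s h \<partial>lborel)"
    using False unfolding powr_add by simp
  finally have "kern_const s = \<bar>\<xi>\<bar> powr (- (2 * s)) * (\<integral>h. (1 - cos (h * \<xi>)) * kern s h \<partial>lborel)" by simp
  then have "\<bar>\<xi>\<bar> powr (2 * s) * kern_const s = \<bar>\<xi>\<bar> powr (2 * s + - (2 * s)) * (\<integral>h. (1 - cos (h * \<xi>)) * kern s h \<partial>lborel)"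
    unfolding powr_add by simp
  then show ?thesis using False by simp
qed simp

lemma inv_fourier_integrable:
  assumes "integrable lborel m" shows "integrable lborel (\<lambda>\<xi>. m \<xi> * cis (x * \<xi>))"
proof (rule Bochner_Integration.integrable_bound[OF assms])
  have [measurable]: "m \<in> borel_measurable lborel" using assms by auto
  show "(\<lambda>\<xi>. m \<xi> * cis (x * \<xi>)) \<in> borel_measurable lborel" unfolding cis_conv_exp by measurable
qed (simp add: norm_mult)

lemma inv_fourier_measurable[measurable]:
  assumes [measurable]: "m \<in> borel_measurable borel" shows "inv_fourier m \<in> borel_measurable borel"
  unfolding inv_fourier_def[abs_def] cis_conv_exp by measurable

lemma inv_fourier_bounded: "\<bar>inv_fourier m x\<bar> \<le> (\<integral>\<xi>. cmod (m \<xi>) \<partial>lborel)"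
proof -
  have "\<bar>inv_fourier m x\<bar> \<le> cmod ((\<integral>\<xi>. m \<xi> * cis (x * \<xi>) \<partial>lborel) / of_real (2 * pi))"
    unfolding inv_fourier_def by (rule abs_Re_le_cmod)
  also have "\<dots> = cmod (\<integral>\<xi>. m \<xi> * cis (x * \<xi>) \<partial>lborel) / (2 * pi)" by (simp add: norm_divide)
  also have "\<dots> \<le> cmod (\<integral>\<xi>. m \<xi> * cis (x * \<xi>) \<partial>lborel) / 1"
    using pi_gt3 by (intro divide_left_mono) auto
  also have "\<dots> \<le> (\<integral>\<xi>. cmod (m \<xi> * cis (x * \<xi>)) \<partial>lborel)" by simp
  finally show ?thesis by (simp add: norm_mult)
qed

lemma second_diff_inv_fourier:
  assumes "integrable lborel m"
  shows "second_diff h (inv_fourier m) x = inv_fourier (\<lambda>\<xi>. of_real (2 * (1 - cos (h * \<xi>))) * m \<xi>) x"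
proof -
  note i = inv_fourier_integrable[OF assms]
  have c: "2 * of_real (cos t) = cis t + cis (- t)" for t by (simp add: complex_eq_iff)
  have "(\<integral>\<xi>. of_real (2 * (1 - cos (h * \<xi>))) * m \<xi> * cis (x * \<xi>) \<partial>lborel)
     = (\<integral>\<xi>. 2 * (m \<xi> * cis (x * \<xi>)) - m \<xi> * cis ((x + h) * \<xi>) - m \<xi> * cis ((x - h) * \<xi>) \<partial>lborel)"
  proof (rule Bochner_Integration.integral_cong[OF refl])
    fix \<xi> :: real
    have e: "of_real (2 * (1 - cos (h * \<xi>))) = 2 - (cis (h * \<xi>) + cis (- (h * \<xi>)))"
      using c[of "h * \<xi>"] by simp
    have e': "cis ((x + h) * \<xi>) = cis (x * \<xi>) * cis (h * \<xi>)" "cis ((x - h) * \<xi>) = cis (x * \<xi>) * cis (- (h * \<xi>))"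
      by (simp_all add: cis_mult algebra_simps)
    show "of_real (2 * (1 - cos (h * \<xi>))) * m \<xi> * cis (x * \<xi>) = 2 * (m \<xi> * cis (x * \<xi>)) - m \<xi> * cis ((x + h) * \<xi>) - m \<xi> * cis ((x - h) * \<xi>)"
      unfolding e e' by (simp add: algebra_simps)
  qed
  also have "\<dots> = 2 * (\<integral>\<xi>. m \<xi> * cis (x * \<xi>) \<partial>lborel) - (\<integral>\<xi>. m \<xi> * cis ((x + h) * \<xi>) \<partial>lborel) - (\<integral>\<xi>. m \<xi> * cis ((x - h) * \<xi>) \<partial>lborel)"
    using i by simp
  finally show ?thesis
    unfolding second_diff_def inv_fourier_def by (simp add: diff_divide_distrib)
qed

text \<open>Multiply the previous identity by \<open>m \<xi>\<close> and exchange the integrals over \<open>h\<close> and \<open>\<xi>\<close>. The hypothesis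
  on \<open>m\<close> is what makes the double integral absolutely convergent, since a second difference has symbol
  of size at most \<open>4 * (1 + \<xi>\<^sup>2) * cap_sq h\<close>. Stated for a general \<open>m\<close>, because it is applied to
  the transform of a test function and again to that of its quarter Laplacian.\<close>

lemma inv_fourier_singular:
  assumes s: "0 < s" "s < 1"
    and [measurable]: "m \<in> borel_measurable borel"
    and m: "integrable lborel (\<lambda>\<xi>. (1 + \<xi>\<^sup>2) * cmod (m \<xi>))"
  shows "integrable lborel (\<lambda>h. second_diff h (inv_fourier m) x * kern s h)"
    "(\<integral>h. second_diff h (inv_fourier m) x * kern s h \<partial>lborel) = 2 * kern_const s * inv_fourier (\<lambda>\<xi>. of_real (\<bar>\<xi>\<bar> powr (2 * s)) * m \<xi>) x"
    "\<bar>second_diff h (inv_fourier m) x\<bar> \<le> 4 * cap_sq h * (\<integral>\<xi>. (1 + \<xi>\<^sup>2) * cmod (m \<xi>) \<partial>lborel)"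
proof -
  have mi: "integrable lborel m"
    by (rule Bochner_Integration.integrable_bound[OF m]) (auto simp: abs_mult mult_right_mono intro!: always_eventually mult_le_cancel_right1[THEN iffD2])
  define F where "F h \<xi> = of_real (2 * (1 - cos (h * \<xi>)) * kern s h) * m \<xi> * cis (x * \<xi>)" for h \<xi>
  have [measurable]: "case_prod F \<in> borel_measurable (lborel \<Otimes>\<^sub>M lborel)"
    unfolding F_def[abs_def] cis_conv_exp split_beta' by measurable
  have int: "integrable (lborel \<Otimes>\<^sub>M lborel) (case_prod F)"
  proof (rule Bochner_Integration.integrable_bound)
    show "integrable (lborel \<Otimes>\<^sub>M lborel) (\<lambda>(h,\<xi>). (4 * (cap_sq h * kern s h)) * ((1 + \<xi>\<^sup>2) * cmod (m \<xi>)))"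
      by (intro integrable_prod_mult m) (use cap_sq_kern_integrable[OF s] in simp)
    have "cmod (F h \<xi>) \<le> (4 * (cap_sq h * kern s h)) * ((1 + \<xi>\<^sup>2) * cmod (m \<xi>))" for h \<xi>
    proof -
      have "cmod (F h \<xi>) = (1 - cos (h * \<xi>)) * (2 * kern s h * cmod (m \<xi>))"
        by (simp add: F_def norm_mult abs_mult del: of_real_mult of_real_diff)
      also have "\<dots> \<le> (2 * (1 + \<xi>\<^sup>2) * cap_sq h) * (2 * kern s h * cmod (m \<xi>))"
        by (intro mult_right_mono one_minus_cos_le) auto
      finally show ?thesis by (simp add: algebra_simps)
    qed
    then show "AE p in lborel \<Otimes>\<^sub>M lborel. norm (case_prod F p) \<le> norm (case p of (h,\<xi>) \<Rightarrow> (4 * (cap_sq h * kern s h)) * ((1 + \<xi>\<^sup>2) * cmod (m \<xi>)))"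
      by (intro always_eventually) (auto intro: order_trans)
  qed simp
  have eq: "second_diff h (inv_fourier m) x * kern s h = Re ((\<integral>\<xi>. F h \<xi> \<partial>lborel) / of_real (2 * pi))" for h
  proof -
    have "(\<integral>\<xi>. F h \<xi> \<partial>lborel) = of_real (kern s h) * (\<integral>\<xi>. of_real (2 * (1 - cos (h * \<xi>))) * m \<xi> * cis (x * \<xi>) \<partial>lborel)"
      unfolding F_def integral_mult_right_zero[symmetric] by (simp add: mult_ac)
    then show ?thesis unfolding second_diff_inv_fourier[OF mi] inv_fourier_def by simp
  qed
  have "integrable lborel (\<lambda>h. \<integral>\<xi>. F h \<xi> \<partial>lborel)"
    using lborel_pair.integrable_fst[OF int] .
  then have i: "integrable lborel (\<lambda>h. (\<integral>\<xi>. F h \<xi> \<partial>lborel) / of_real (2 * pi))" by simp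
  then show "integrable lborel (\<lambda>h. second_diff h (inv_fourier m) x * kern s h)"
    unfolding eq by (rule integrable_Re)
  have "(\<integral>h. second_diff h (inv_fourier m) x * kern s h \<partial>lborel) = Re ((\<integral>h. (\<integral>\<xi>. F h \<xi> \<partial>lborel) \<partial>lborel) / of_real (2 * pi))"
    unfolding eq using integral_Re[OF i] by simp
  also have "(\<integral>h. (\<integral>\<xi>. F h \<xi> \<partial>lborel) \<partial>lborel) = (\<integral>\<xi>. (\<integral>h. F h \<xi> \<partial>lborel) \<partial>lborel)"
    using lborel_pair.Fubini_integral[OF int] by simp
  also have "\<dots> = (\<integral>\<xi>. of_real (2 * kern_const s) * (of_real (\<bar>\<xi>\<bar> powr (2 * s)) * m \<xi> * cis (x * \<xi>)) \<partial>lborel)"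
  proof (rule Bochner_Integration.integral_cong[OF refl])
    fix \<xi>
    have "(\<integral>h. F h \<xi> \<partial>lborel) = (\<integral>h. of_real (2 * ((1 - cos (h * \<xi>)) * kern s h)) * (m \<xi> * cis (x * \<xi>)) \<partial>lborel)"
      unfolding F_def by (intro Bochner_Integration.integral_cong refl) (simp only: of_real_mult mult_ac)
    also have "\<dots> = of_real (\<integral>h. 2 * ((1 - cos (h * \<xi>)) * kern s h) \<partial>lborel) * (m \<xi> * cis (x * \<xi>))"
      by (simp only: integral_mult_left_zero integral_complex_of_real)
    also have "(\<integral>h. 2 * ((1 - cos (h * \<xi>)) * kern s h) \<partial>lborel) = 2 * (\<bar>\<xi>\<bar> powr (2 * s) * kern_const s)"
      by (simp only: integral_mult_right_zero one_minus_cos_integral)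
    finally show "(\<integral>h. F h \<xi> \<partial>lborel) = of_real (2 * kern_const s) * (of_real (\<bar>\<xi>\<bar> powr (2 * s)) * m \<xi> * cis (x * \<xi>))"
      by (simp add: mult_ac)
  qed
  also have "\<dots> = of_real (2 * kern_const s) * (\<integral>\<xi>. of_real (\<bar>\<xi>\<bar> powr (2 * s)) * m \<xi> * cis (x * \<xi>) \<partial>lborel)"
    by (rule integral_mult_right_zero)
  finally show "(\<integral>h. second_diff h (inv_fourier m) x * kern s h \<partial>lborel) = 2 * kern_const s * inv_fourier (\<lambda>\<xi>. of_real (\<bar>\<xi>\<bar> powr (2 * s)) * m \<xi>) x"
    unfolding inv_fourier_def by (simp add: mult.assoc)
  have "\<bar>second_diff h (inv_fourier m) x\<bar> \<le> (\<integral>\<xi>. cmod (of_real (2 * (1 - cos (h * \<xi>))) * m \<xi>) \<partial>lborel)"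
    unfolding second_diff_inv_fourier[OF mi] by (rule inv_fourier_bounded)
  also have "\<dots> \<le> (\<integral>\<xi>. 4 * cap_sq h * ((1 + \<xi>\<^sup>2) * cmod (m \<xi>)) \<partial>lborel)"
  proof (rule integral_mono)
    have le: "cmod (of_real (2 * (1 - cos (h * \<xi>))) * m \<xi>) \<le> 4 * cap_sq h * ((1 + \<xi>\<^sup>2) * cmod (m \<xi>))" for \<xi>
    proof -
      have "cmod (of_real (2 * (1 - cos (h * \<xi>))) * m \<xi>) = (1 - cos (h * \<xi>)) * (2 * cmod (m \<xi>))"
        by (simp add: norm_mult abs_mult del: of_real_mult of_real_diff)
      also have "\<dots> \<le> (2 * (1 + \<xi>\<^sup>2) * cap_sq h) * (2 * cmod (m \<xi>))"
        by (intro mult_right_mono one_minus_cos_le) auto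
      finally show ?thesis by (simp add: algebra_simps)
    qed
    show i: "integrable lborel (\<lambda>\<xi>. 4 * cap_sq h * ((1 + \<xi>\<^sup>2) * cmod (m \<xi>)))" using m by simp
    show "integrable lborel (\<lambda>\<xi>. cmod (of_real (2 * (1 - cos (h * \<xi>))) * m \<xi>))"
      by (rule Bochner_Integration.integrable_bound[OF i]) (use le in \<open>auto intro: order_trans\<close>)
    show "cmod (of_real (2 * (1 - cos (h * \<xi>))) * m \<xi>) \<le> 4 * cap_sq h * ((1 + \<xi>\<^sup>2) * cmod (m \<xi>))" for \<xi>
      by (rule le)
  qed
  also have "\<dots> = 4 * cap_sq h * (\<integral>\<xi>. (1 + \<xi>\<^sup>2) * cmod (m \<xi>) \<partial>lborel)" by (rule integral_mult_right_zero)
  finally show "\<bar>second_diff h (inv_fourier m) x\<bar> \<le> 4 * cap_sq h * (\<integral>\<xi>. (1 + \<xi>\<^sup>2) * cmod (m \<xi>) \<partial>lborel)" .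
qed

section \<open>The fractional Laplacian of a test function\<close>

lemma L1nrm_cong_affine: "c \<noteq> 0 \<Longrightarrow> L1nrm g = \<bar>c\<bar> * L1nrm (\<lambda>x. g (t + c * x))"
  unfolding L1nrm_def using lborel_integral_real_affine[of c "\<lambda>x. \<bar>g x\<bar>" t] by simp

lemma L1nrm_shift: "L1nrm (\<lambda>x. g (x + t)) = L1nrm g"
  using L1nrm_cong_affine[of 1 g t] by (simp add: add.commute)

lemma L1nrm_add: "integrable lborel f \<Longrightarrow> integrable lborel g \<Longrightarrow> L1nrm (\<lambda>x. f x + g x) \<le> L1nrm f + L1nrm g"
proof -
  assume f: "integrable lborel f" and g: "integrable lborel g"
  have "(\<integral>x. \<bar>f x + g x\<bar> \<partial>lborel) \<le> (\<integral>x. \<bar>f x\<bar> + \<bar>g x\<bar> \<partial>lborel)"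
    using f g by (intro integral_mono) auto
  then show ?thesis using f g by (simp add: L1nrm_def)
qed

lemma L1nrm_scale: "L1nrm (\<lambda>x. c * g x) = \<bar>c\<bar> * L1nrm g"
  by (simp add: L1nrm_def abs_mult)

lemma test_function_shift: "test_function \<phi> \<Longrightarrow> test_function (\<lambda>x. \<phi> (x + h))"
  "test_function \<phi> \<Longrightarrow> deriv (\<lambda>x. \<phi> (x + h)) = (\<lambda>x. deriv \<phi> (x + h))"
  using test_function_affine[of \<phi> 1 h] by auto

lemma test_function_diff_shift:
  assumes "test_function \<phi>"
  shows "test_function (\<lambda>x. \<phi> (x + h) - \<phi> x)" "deriv (\<lambda>x. \<phi> (x + h) - \<phi> x) = (\<lambda>x. deriv \<phi> (x + h) - deriv \<phi> x)"
  using test_function_lincomb[OF test_function_shift(1)[OF assms, of h] assms, of 1 "-1"] test_function_shift(2)[OF assms, of h]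
  by simp_all

lemma test_function_second_diff:
  assumes "test_function \<phi>"
  shows "test_function (second_diff h \<phi>)" "deriv (second_diff h \<phi>) = second_diff h (deriv \<phi>)"
proof -
  note d = test_function_diff_shift[OF assms, of h]
  note d' = test_function_shift[OF d(1), of "- h"]
  have eq: "second_diff h g = (\<lambda>x. 1 * (g (x + (- h) + h) - g (x + - h)) + (-1) * (g (x + h) - g x))" for g
    by (auto simp: second_diff_def fun_eq_iff)
  show "test_function (second_diff h \<phi>)" "deriv (second_diff h \<phi>) = second_diff h (deriv \<phi>)"
    unfolding eq using test_function_lincomb[OF d'(1) d(1), of 1 "-1"] d'(2) d(2) by simp_all
qed

lemma L1nrm_diff_shift_le:
  assumes \<phi>: "test_function \<phi>"
  shows "L1nrm (\<lambda>x. \<phi> (x + h) - \<phi> x) \<le> \<bar>h\<bar> * L1nrm (deriv \<phi>)"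
proof -
  have d: "test_function (deriv \<phi>)" by (rule test_function_deriv1[OF \<phi>])
  have [measurable]: "deriv \<phi> \<in> borel_measurable borel" "\<phi> \<in> borel_measurable borel" using d \<phi> by measurable
  have di: "integrable lborel (\<lambda>x. \<bar>deriv \<phi> x\<bar>)" using test_function_integrable[OF d] by simp
  have pt: "ennreal \<bar>\<phi> (x + h) - \<phi> x\<bar> \<le> (\<integral>\<^sup>+t. ennreal (\<bar>h\<bar> * \<bar>deriv \<phi> (x + t * h)\<bar>) * indicator {0..1} t \<partial>lborel)" for x
  proof -
    have "has_bochner_integral lborel (\<lambda>t. (deriv \<phi> (x + t * h) * h) * indicator {0..1} t) (\<phi> (x + 1 * h) - \<phi> (x + 0 * h))"
    proof (rule has_bochner_integral_FTC_Icc_real)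
      show "DERIV (\<lambda>t. \<phi> (x + t * h)) t :> deriv \<phi> (x + t * h) * h" for t
        by (rule DERIV_chain2[OF test_function_has_deriv[OF \<phi>]]) (auto intro!: derivative_eq_intros)
      show "isCont (\<lambda>t. deriv \<phi> (x + t * h) * h) t" for t
      proof -
        have "isCont (\<lambda>t. deriv \<phi> (x + t * h)) t"
          by (rule isCont_o2[where g="deriv \<phi>"]) (auto intro!: continuous_intros DERIV_isCont[OF test_function_has_deriv[OF d]])
        then show ?thesis by (intro continuous_intros)
      qed
    qed simp
    then have "ennreal \<bar>\<phi> (x + h) - \<phi> x\<bar> \<le> (\<integral>\<^sup>+t. ennreal (norm ((deriv \<phi> (x + t * h) * h) * indicator {0..1} t)) \<partial>lborel)"
      using integral_norm_bound_ennreal[of lborel "\<lambda>t. (deriv \<phi> (x + t * h) * h) * indicator {0..1} t"]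
      by (simp add: has_bochner_integral_iff)
    also have "\<dots> = (\<integral>\<^sup>+t. ennreal (\<bar>h\<bar> * \<bar>deriv \<phi> (x + t * h)\<bar>) * indicator {0..1} t \<partial>lborel)"
      by (intro nn_integral_cong) (auto simp: abs_mult indicator_def mult.commute)
    finally show ?thesis .
  qed
  have "ennreal (L1nrm (\<lambda>x. \<phi> (x + h) - \<phi> x)) = (\<integral>\<^sup>+x. ennreal \<bar>\<phi> (x + h) - \<phi> x\<bar> \<partial>lborel)"
    unfolding L1nrm_def using test_function_integrable[OF test_function_diff_shift(1)[OF \<phi>, of h]]
    by (intro nn_integral_eq_integral[symmetric]) auto
  also have "\<dots> \<le> (\<integral>\<^sup>+x. (\<integral>\<^sup>+t. ennreal (\<bar>h\<bar> * \<bar>deriv \<phi> (x + t * h)\<bar>) * indicator {0..1} t \<partial>lborel) \<partial>lborel)"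
    by (intro nn_integral_mono pt)
  also have "\<dots> = (\<integral>\<^sup>+t. (\<integral>\<^sup>+x. ennreal (\<bar>h\<bar> * \<bar>deriv \<phi> (x + t * h)\<bar>) * indicator {0..1} t \<partial>lborel) \<partial>lborel)"
    by (rule lborel_pair.Fubini') measurable
  also have "\<dots> = (\<integral>\<^sup>+t. ennreal (\<bar>h\<bar> * L1nrm (deriv \<phi>)) * indicator {0..1::real} t \<partial>lborel)"
  proof (rule nn_integral_cong)
    fix t :: real
    have "(\<integral>\<^sup>+x. ennreal (\<bar>h\<bar> * \<bar>deriv \<phi> (x + t * h)\<bar>) \<partial>lborel) = ennreal (\<integral>x. \<bar>h\<bar> * \<bar>deriv \<phi> (x + t * h)\<bar> \<partial>lborel)"
      using lborel_integrable_real_affine[OF di, of 1 "t * h"]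
      by (intro nn_integral_eq_integral) (auto simp: add.commute)
    also have "(\<integral>x. \<bar>h\<bar> * \<bar>deriv \<phi> (x + t * h)\<bar> \<partial>lborel) = \<bar>h\<bar> * L1nrm (deriv \<phi>)"
      using L1nrm_shift[of "deriv \<phi>" "t * h"] by (simp add: L1nrm_def)
    finally show "(\<integral>\<^sup>+x. ennreal (\<bar>h\<bar> * \<bar>deriv \<phi> (x + t * h)\<bar>) * indicator {0..1} t \<partial>lborel)
       = ennreal (\<bar>h\<bar> * L1nrm (deriv \<phi>)) * indicator {0..1::real} t"
      by (simp add: nn_integral_multc)
  qed
  also have "\<dots> = ennreal (\<bar>h\<bar> * L1nrm (deriv \<phi>))"
    by (simp add: nn_integral_cmult_indicator)
  finally show ?thesis by simp
qed

text \<open>A second difference is a first difference of a first difference, so for small steps two derivatives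
  can be used; for large steps the triangle inequality gives the constant \<open>4\<close>.\<close>

lemma L1nrm_second_diff_le:
  assumes \<phi>: "test_function \<phi>"
  shows "L1nrm (second_diff h \<phi>) \<le> 4 * cap_sq h * (L1nrm \<phi> + L1nrm (deriv (deriv \<phi>)))"
proof (cases "h\<^sup>2 \<le> 1")
  case True
  define \<psi> where "\<psi> = (\<lambda>x. \<phi> (x + h) - \<phi> x)"
  have \<psi>: "test_function \<psi>" "deriv \<psi> = (\<lambda>x. deriv \<phi> (x + h) - deriv \<phi> x)"
    using test_function_diff_shift[OF \<phi>, of h] by (simp_all add: \<psi>_def)
  have "second_diff h \<phi> = (\<lambda>x. \<psi> (x + - h) - \<psi> x)" by (auto simp: second_diff_def \<psi>_def fun_eq_iff)
  then have "L1nrm (second_diff h \<phi>) \<le> \<bar>h\<bar> * L1nrm (deriv \<psi>)"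
    using L1nrm_diff_shift_le[OF \<psi>(1), of "- h"] by simp
  also have "\<dots> \<le> \<bar>h\<bar> * (\<bar>h\<bar> * L1nrm (deriv (deriv \<phi>)))"
    unfolding \<psi>(2) by (intro mult_left_mono L1nrm_diff_shift_le test_function_deriv1 \<phi>) simp
  also have "\<dots> = cap_sq h * L1nrm (deriv (deriv \<phi>))"
    using True by (simp add: cap_sq_def min_def power2_eq_square flip: mult.assoc)
  also have "\<dots> \<le> cap_sq h * (4 * (L1nrm \<phi> + L1nrm (deriv (deriv \<phi>))))"
    using L1nrm_nonneg[of \<phi>] L1nrm_nonneg[of "deriv (deriv \<phi>)"] by (intro mult_left_mono) auto
  finally show ?thesis by (simp add: mult_ac)
next
  case False
  note i = test_function_integrable[OF \<phi>]
  have sh: "integrable lborel (\<lambda>x. \<phi> (x + t))" for t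
    by (rule test_function_integrable[OF test_function_shift(1)[OF \<phi>]])
  have eq: "second_diff h \<phi> = (\<lambda>x. 2 * \<phi> x + ((-1) * \<phi> (x + h) + (-1) * \<phi> (x + - h)))" by (auto simp: second_diff_def fun_eq_iff)
  have "L1nrm (second_diff h \<phi>) \<le> L1nrm (\<lambda>x. 2 * \<phi> x) + L1nrm (\<lambda>x. (-1) * \<phi> (x + h) + (-1) * \<phi> (x + - h))"
    unfolding eq using i sh[of h] sh[of "- h"] by (intro L1nrm_add) auto
  also have "\<dots> \<le> L1nrm (\<lambda>x. 2 * \<phi> x) + (L1nrm (\<lambda>x. (-1) * \<phi> (x + h)) + L1nrm (\<lambda>x. (-1) * \<phi> (x + - h)))"
    using i sh[of h] sh[of "- h"] by (intro add_left_mono L1nrm_add) auto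
  also have "\<dots> = 4 * L1nrm \<phi>"
    using L1nrm_scale[of 2 \<phi>] L1nrm_scale[of "-1" "\<lambda>x. \<phi> (x + h)"] L1nrm_scale[of "-1" "\<lambda>x. \<phi> (x + - h)"]
      L1nrm_shift[of \<phi> h] L1nrm_shift[of \<phi> "- h"] by linarith
  also have "\<dots> \<le> 4 * cap_sq h * (L1nrm \<phi> + L1nrm (deriv (deriv \<phi>)))"
    using False by (simp add: cap_sq_def min_def)
  finally show ?thesis .
qed

text \<open>The singular integral representation of the fractional Laplacian. Integrability
  and symmetry of the operator are read off from it rather than from the Fourier transform.\<close>

lemma frac_lap_test_singular:
  assumes s: "0 < s" "s < 1" and \<phi>: "test_function \<phi>"
  shows "integrable lborel (\<lambda>h. second_diff h \<phi> x * kern s h)"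
    "frac_lap_test s \<phi> x = lap_const s * (\<integral>h. second_diff h \<phi> x * kern s h \<partial>lborel)"
proof -
  have [measurable]: "\<phi> \<in> borel_measurable borel" using \<phi> by measurable
  have inv_fourier_eq: "inv_fourier (fourier \<phi>) = \<phi>" using fourier_inversion[OF \<phi>] by auto
  have m: "integrable lborel (\<lambda>\<xi>. (1 + \<xi>\<^sup>2) * cmod (fourier \<phi> \<xi>))" using fourier_decay_integrable[OF \<phi>, of 1] by simp
  show "integrable lborel (\<lambda>h. second_diff h \<phi> x * kern s h)"
    using inv_fourier_singular(1)[OF s _ m, of x] by (simp add: inv_fourier_eq)
  show "frac_lap_test s \<phi> x = lap_const s * (\<integral>h. second_diff h \<phi> x * kern s h \<partial>lborel)"
    using inv_fourier_singular(2)[OF s _ m, of x] kern_const_pos[OF s]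
    by (simp add: inv_fourier_eq frac_lap_test_inv_fourier lap_const_def)
qed

lemma frac_lap_test_measurable[measurable]:
  assumes \<phi>: "test_function \<phi>" shows "frac_lap_test s \<phi> \<in> borel_measurable borel"
proof -
  have [measurable]: "\<phi> \<in> borel_measurable borel" using \<phi> by measurable
  show ?thesis unfolding frac_lap_test_inv_fourier by measurable
qed

lemma quarter_symbol_integrable:
  assumes \<phi>: "test_function \<phi>"
  shows "integrable lborel (\<lambda>\<xi>. (1 + \<xi>\<^sup>2) * cmod (of_real (\<bar>\<xi>\<bar> powr (2 * (1/4))) * fourier \<phi> \<xi>))"
proof (rule Bochner_Integration.integrable_bound[OF fourier_decay_integrable[OF \<phi>, of 2]])
  have [measurable]: "\<phi> \<in> borel_measurable borel" using \<phi> by measurable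
  show "(\<lambda>\<xi>. (1 + \<xi>\<^sup>2) * cmod (of_real (\<bar>\<xi>\<bar> powr (2 * (1/4))) * fourier \<phi> \<xi>)) \<in> borel_measurable lborel"
    by measurable
  have p: "\<bar>\<xi>\<bar> powr (1/2) \<le> 1 + \<xi>\<^sup>2" for \<xi> :: real
  proof (cases "\<bar>\<xi>\<bar> \<le> 1")
    case True
    then have "\<bar>\<xi>\<bar> powr (1/2) \<le> 1" by (simp add: powr_le1)
    then show ?thesis by (simp add: add_increasing2)
  next
    case False
    then have "\<bar>\<xi>\<bar> powr (1/2) \<le> \<bar>\<xi>\<bar> powr 2" by (intro powr_mono) auto
    then show ?thesis using False by (simp add: powr_numeral)
  qed
  have "(1 + \<xi>\<^sup>2) * cmod (of_real (\<bar>\<xi>\<bar> powr (2 * (1/4))) * fourier \<phi> \<xi>) \<le> (1 + \<xi>\<^sup>2)\<^sup>2 * cmod (fourier \<phi> \<xi>)" for \<xi>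
  proof -
    have "(1 + \<xi>\<^sup>2) * cmod (of_real (\<bar>\<xi>\<bar> powr (2 * (1/4))) * fourier \<phi> \<xi>) = (1 + \<xi>\<^sup>2) * (\<bar>\<xi>\<bar> powr (1/2) * cmod (fourier \<phi> \<xi>))"
      by (simp add: norm_mult)
    also have "\<dots> \<le> (1 + \<xi>\<^sup>2) * ((1 + \<xi>\<^sup>2) * cmod (fourier \<phi> \<xi>))"
      using p by (intro mult_left_mono mult_right_mono) auto
    finally show ?thesis by (simp add: power2_eq_square mult.assoc)
  qed
  then show "AE \<xi> in lborel. norm ((1 + \<xi>\<^sup>2) * cmod (of_real (\<bar>\<xi>\<bar> powr (2 * (1/4))) * fourier \<phi> \<xi>)) \<le> norm ((1 + \<xi>\<^sup>2)\<^sup>2 * cmod (fourier \<phi> \<xi>))"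
    by (intro always_eventually allI) (simp add: abs_mult)
qed

text \<open>The half Laplacian is the quarter Laplacian applied twice. The quarter Laplacian of a test function is
  not a test function, so the outer application is expressed by the singular integral.\<close>

lemma quarter_laplacian_twice:
  assumes \<phi>: "test_function \<phi>"
  shows "integrable lborel (\<lambda>h. second_diff h (frac_lap_test (1/4) \<phi>) x * kern (1/4) h)"
    "frac_lap_test (1/2) \<phi> x = lap_const (1/4) * (\<integral>h. second_diff h (frac_lap_test (1/4) \<phi>) x * kern (1/4) h \<partial>lborel)"
proof -
  have [measurable]: "\<phi> \<in> borel_measurable borel" using \<phi> by measurable
  let ?m = "\<lambda>\<xi>. of_real (\<bar>\<xi>\<bar> powr (2 * (1/4))) * fourier \<phi> \<xi>"
  have m: "?m \<in> borel_measurable borel" by measurable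
  note sg = inv_fourier_singular[of "1/4" ?m x, OF _ _ m quarter_symbol_integrable[OF \<phi>]]
  show "integrable lborel (\<lambda>h. second_diff h (frac_lap_test (1/4) \<phi>) x * kern (1/4) h)"
    unfolding frac_lap_test_inv_fourier by (rule sg(1)) auto
  have sq: "of_real (\<bar>\<xi>\<bar> powr (2 * (1/2))) * fourier \<phi> \<xi> = of_real (\<bar>\<xi>\<bar> powr (2 * (1/4))) * ?m \<xi>" for \<xi>
    unfolding mult.assoc[symmetric] of_real_mult[symmetric] powr_add[symmetric] by simp
  have "frac_lap_test (1/2) \<phi> x = inv_fourier (\<lambda>\<xi>. of_real (\<bar>\<xi>\<bar> powr (2 * (1/4))) * ?m \<xi>) x"
    unfolding frac_lap_test_inv_fourier sq ..
  also have "\<dots> = lap_const (1/4) * (2 * kern_const (1/4) * inv_fourier (\<lambda>\<xi>. of_real (\<bar>\<xi>\<bar> powr (2 * (1/4))) * ?m \<xi>) x)"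
    using kern_const_pos[of "1/4"] by (simp add: lap_const_def)
  also have "2 * kern_const (1/4) * inv_fourier (\<lambda>\<xi>. of_real (\<bar>\<xi>\<bar> powr (2 * (1/4))) * ?m \<xi>) x = (\<integral>h. second_diff h (frac_lap_test (1/4) \<phi>) x * kern (1/4) h \<partial>lborel)"
    unfolding frac_lap_test_inv_fourier by (rule sg(2)[symmetric]) auto
  finally show "frac_lap_test (1/2) \<phi> x = lap_const (1/4) * (\<integral>h. second_diff h (frac_lap_test (1/4) \<phi>) x * kern (1/4) h \<partial>lborel)" .
qed

lemma frac_lap_test_bounded:
  assumes \<phi>: "test_function \<phi>"
  shows "\<exists>B. \<forall>x. \<bar>frac_lap_test (1/4) \<phi> x\<bar> \<le> B"
  unfolding frac_lap_test_inv_fourier using inv_fourier_bounded by blast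

lemma second_diff_sup_le:
  assumes \<phi>: "test_function \<phi>"
  shows "\<exists>C\<ge>0. \<forall>h x. \<bar>second_diff h \<phi> x\<bar> \<le> C * cap_sq h"
proof -
  have [measurable]: "\<phi> \<in> borel_measurable borel" using \<phi> by measurable
  have inv_fourier_eq: "inv_fourier (fourier \<phi>) = \<phi>" using fourier_inversion[OF \<phi>] by auto
  have m: "integrable lborel (\<lambda>\<xi>. (1 + \<xi>\<^sup>2) * cmod (fourier \<phi> \<xi>))" using fourier_decay_integrable[OF \<phi>, of 1] by simp
  have "0 \<le> 4 * (\<integral>\<xi>. (1 + \<xi>\<^sup>2) * cmod (fourier \<phi> \<xi>) \<partial>lborel)" by simp
  moreover have "\<bar>second_diff h \<phi> x\<bar> \<le> (4 * (\<integral>\<xi>. (1 + \<xi>\<^sup>2) * cmod (fourier \<phi> \<xi>) \<partial>lborel)) * cap_sq h" for h x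
    using inv_fourier_singular(3)[of "1/2", OF _ _ _ m, of h x] by (simp add: inv_fourier_eq mult_ac)
  ultimately show ?thesis by blast
qed

section \<open>Pairing with bounded functions\<close>

abbreviation "lborel2 \<equiv> (lborel \<Otimes>\<^sub>M lborel :: (real \<times> real) measure)"

lemma integrable_mult_bounded:
  fixes u :: "real \<Rightarrow> real"
  assumes "integrable lborel g" "u \<in> borel_measurable borel" "\<And>x. \<bar>u x\<bar> \<le> M"
  shows "integrable lborel (\<lambda>x. g x * u x)"
proof (rule Bochner_Integration.integrable_bound)
  show "integrable lborel (\<lambda>x. M * g x)" using assms by simp
  have [measurable]: "g \<in> borel_measurable lborel" "u \<in> borel_measurable borel" using assms by auto
  show "(\<lambda>x. g x * u x) \<in> borel_measurable lborel" by measurable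
  have M: "0 \<le> M" using assms(3)[of 0] by linarith
  have "norm (g x * u x) \<le> norm (M * g x)" for x
    using mult_left_mono[OF assms(3), of "\<bar>g x\<bar>" x] M by (simp add: abs_mult mult.commute)
  then show "AE x in lborel. norm (g x * u x) \<le> norm (M * g x)" by simp
qed

lemma L1nrm_mult_bounded:
  fixes u :: "real \<Rightarrow> real"
  assumes "integrable lborel g" "u \<in> borel_measurable borel" "\<And>x. \<bar>u x\<bar> \<le> M"
  shows "L1nrm (\<lambda>x. g x * u x) \<le> M * L1nrm g"
proof -
  have M: "0 \<le> M" using assms(3)[of 0] by linarith
  have "(\<integral>x. \<bar>g x * u x\<bar> \<partial>lborel) \<le> (\<integral>x. M * \<bar>g x\<bar> \<partial>lborel)"
  proof (rule integral_mono)
    show "integrable lborel (\<lambda>x. \<bar>g x * u x\<bar>)" using integrable_mult_bounded[OF assms] by simp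
    show "integrable lborel (\<lambda>x. M * \<bar>g x\<bar>)" using assms(1) by simp
    show "\<bar>g x * u x\<bar> \<le> M * \<bar>g x\<bar>" for x
      using mult_left_mono[OF assms(3), of "\<bar>g x\<bar>" x] by (simp add: abs_mult mult.commute)
  qed
  then show ?thesis by (simp add: L1nrm_def)
qed

text \<open>The integrability criterion behind the exchange of the \<open>h\<close> and \<open>x\<close> integrals in pairings with singular integrals.\<close>

lemma kernel_integrable:
  fixes F :: "real \<Rightarrow> real \<Rightarrow> real"
  assumes s: "0 < s" "s < 1"
    and [measurable]: "case_prod F \<in> borel_measurable lborel2"
    and F: "\<And>h. integrable lborel (F h)" "\<And>h. L1nrm (F h) \<le> C * cap_sq h"
  shows "integrable lborel2 (\<lambda>(h, x). F h x * kern s h)"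
proof (rule lborel_pair.Fubini_integrable)
  show "integrable lborel (\<lambda>h. \<integral>x. norm (case (h, x) of (h, x) \<Rightarrow> F h x * kern s h) \<partial>lborel)"
  proof (rule Bochner_Integration.integrable_bound)
    show "integrable lborel (\<lambda>h. C * (cap_sq h * kern s h))" using cap_sq_kern_integrable[OF s] by simp
    have "norm (\<integral>x. norm (case (h, x) of (h, x) \<Rightarrow> F h x * kern s h) \<partial>lborel) \<le> norm (C * (cap_sq h * kern s h))" for h
    proof -
      have "(\<integral>x. norm (case (h, x) of (h, x) \<Rightarrow> F h x * kern s h) \<partial>lborel) = L1nrm (F h) * kern s h"
        by (simp add: L1nrm_def abs_mult)
      also have "\<dots> \<le> C * cap_sq h * kern s h" by (intro mult_right_mono F) simp
      finally show ?thesis by (simp add: mult.assoc)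
    qed
    then show "AE h in lborel. norm (\<integral>x. norm (case (h, x) of (h, x) \<Rightarrow> F h x * kern s h) \<partial>lborel) \<le> norm (C * (cap_sq h * kern s h))"
      by simp
  qed measurable
  show "AE h in lborel. integrable lborel (\<lambda>x. case (h, x) of (h, x) \<Rightarrow> F h x * kern s h)"
    using F by simp
qed measurable

lemma second_diff_integrable:
  assumes "integrable lborel g" shows "integrable lborel (second_diff h g)"
  using assms lborel_integrable_real_affine[OF assms, of 1 h] lborel_integrable_real_affine[OF assms, of 1 "- h"]
  unfolding second_diff_def[abs_def] by (auto simp: add.commute[of _ h])

lemma second_diff_pair_integrable:
  assumes s: "0 < s" "s < 1" and \<phi>: "test_function \<phi>"
    and u[measurable]: "u \<in> borel_measurable borel" and M: "\<And>x. \<bar>u x\<bar> \<le> M"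
  shows "integrable lborel2 (\<lambda>(h, x). second_diff h \<phi> x * u x * kern s h)"
proof (rule kernel_integrable[OF s])
  have [measurable]: "\<phi> \<in> borel_measurable borel" using \<phi> by measurable
  show "(\<lambda>(h, x). second_diff h \<phi> x * u x) \<in> borel_measurable lborel2"
    unfolding split_beta' second_diff_def by measurable
  note i = test_function_integrable[OF test_function_second_diff(1)[OF \<phi>]]
  show "integrable lborel (\<lambda>x. second_diff h \<phi> x * u x)" for h by (rule integrable_mult_bounded[OF i u M])
  have M0: "0 \<le> M" using M[of 0] by linarith
  show "L1nrm (\<lambda>x. second_diff h \<phi> x * u x) \<le> (M * (4 * (L1nrm \<phi> + L1nrm (deriv (deriv \<phi>))))) * cap_sq h" for h
    using order_trans[OF L1nrm_mult_bounded[OF i u M] mult_left_mono[OF L1nrm_second_diff_le[OF \<phi>] M0]]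
    by (simp add: mult_ac)
qed

text \<open>Absolute convergence of the double integral also yields the integrability of \<open>frac_lap_test s \<phi>\<close>,
  on taking \<open>u = 1\<close>.\<close>

lemma frac_lap_test_pair:
  assumes s: "0 < s" "s < 1" and \<phi>: "test_function \<phi>"
    and u[measurable]: "u \<in> borel_measurable borel" and M: "\<And>x. \<bar>u x\<bar> \<le> M"
  shows "integrable lborel (\<lambda>x. frac_lap_test s \<phi> x * u x)"
    "integrable lborel (\<lambda>h. (\<integral>x. second_diff h \<phi> x * u x \<partial>lborel) * kern s h)"
    "(\<integral>x. frac_lap_test s \<phi> x * u x \<partial>lborel) = lap_const s * (\<integral>h. (\<integral>x. second_diff h \<phi> x * u x \<partial>lborel) * kern s h \<partial>lborel)"
proof -
  note int = second_diff_pair_integrable[OF assms]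
  have eq: "frac_lap_test s \<phi> x * u x = lap_const s * (\<integral>h. second_diff h \<phi> x * u x * kern s h \<partial>lborel)" for x
  proof -
    have "(\<integral>h. second_diff h \<phi> x * u x * kern s h \<partial>lborel) = (\<integral>h. second_diff h \<phi> x * kern s h * u x \<partial>lborel)"
      by (simp add: mult_ac)
    then show ?thesis by (simp add: frac_lap_test_singular(2)[OF s \<phi>])
  qed
  show "integrable lborel (\<lambda>x. frac_lap_test s \<phi> x * u x)"
    unfolding eq using lborel_pair.integrable_snd[OF int] by simp
  show "integrable lborel (\<lambda>h. (\<integral>x. second_diff h \<phi> x * u x \<partial>lborel) * kern s h)"
    using lborel_pair.integrable_fst[OF int] by simp
  have "(\<integral>x. frac_lap_test s \<phi> x * u x \<partial>lborel) = lap_const s * (\<integral>x. (\<integral>h. second_diff h \<phi> x * u x * kern s h \<partial>lborel) \<partial>lborel)"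
    unfolding eq by simp
  also have "(\<integral>x. (\<integral>h. second_diff h \<phi> x * u x * kern s h \<partial>lborel) \<partial>lborel) = (\<integral>h. (\<integral>x. second_diff h \<phi> x * u x * kern s h \<partial>lborel) \<partial>lborel)"
    by (rule lborel_pair.Fubini_integral[OF int])
  finally show "(\<integral>x. frac_lap_test s \<phi> x * u x \<partial>lborel) = lap_const s * (\<integral>h. (\<integral>x. second_diff h \<phi> x * u x \<partial>lborel) * kern s h \<partial>lborel)"
    by simp
qed

lemma frac_lap_test_integrable:
  assumes s: "0 < s" "s < 1" and \<phi>: "test_function \<phi>"
  shows "integrable lborel (frac_lap_test s \<phi>)"
    "L1nrm (frac_lap_test s \<phi>) \<le> 4 * lap_const s * (\<integral>h. cap_sq h * kern s h \<partial>lborel) * (L1nrm \<phi> + L1nrm (deriv (deriv \<phi>)))"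
proof -
  show i: "integrable lborel (frac_lap_test s \<phi>)"
    using frac_lap_test_pair(1)[OF s \<phi>, of "\<lambda>_. 1" 1] by simp
  have [measurable]: "frac_lap_test s \<phi> \<in> borel_measurable borel" by (rule frac_lap_test_measurable[OF \<phi>])
  define S where "S = L1nrm \<phi> + L1nrm (deriv (deriv \<phi>))"
  define u where "u x = sgn (frac_lap_test s \<phi> x)" for x
  have u[measurable]: "u \<in> borel_measurable borel" unfolding u_def[abs_def] by measurable
  have M: "\<bar>u x\<bar> \<le> 1" for x by (simp add: u_def sgn_if)
  have c: "0 \<le> lap_const s" using kern_const_pos[OF s] by (simp add: lap_const_def)
  have "L1nrm (frac_lap_test s \<phi>) = (\<integral>x. frac_lap_test s \<phi> x * u x \<partial>lborel)"
    unfolding L1nrm_def u_def by (simp add: abs_sgn)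
  also have "\<dots> = lap_const s * (\<integral>h. (\<integral>x. second_diff h \<phi> x * u x \<partial>lborel) * kern s h \<partial>lborel)"
    by (rule frac_lap_test_pair(3)[OF s \<phi> u M])
  also have "\<dots> \<le> lap_const s * (\<integral>h. 4 * S * (cap_sq h * kern s h) \<partial>lborel)"
  proof (intro mult_left_mono integral_mono c)
    show "integrable lborel (\<lambda>h. (\<integral>x. second_diff h \<phi> x * u x \<partial>lborel) * kern s h)"
      by (rule frac_lap_test_pair(2)[OF s \<phi> u M])
    show "integrable lborel (\<lambda>h. 4 * S * (cap_sq h * kern s h))" using cap_sq_kern_integrable[OF s] by simp
    fix h
    note ti = test_function_integrable[OF test_function_second_diff(1)[OF \<phi>]]
    have "(\<integral>x. second_diff h \<phi> x * u x \<partial>lborel) \<le> L1nrm (\<lambda>x. second_diff h \<phi> x * u x)"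
      unfolding L1nrm_def by (rule integral_mono) (use integrable_mult_bounded[OF ti u M] in auto)
    also have "\<dots> \<le> 1 * L1nrm (second_diff h \<phi>)" by (rule L1nrm_mult_bounded[OF ti u M])
    also have "\<dots> \<le> 4 * cap_sq h * S" unfolding S_def using L1nrm_second_diff_le[OF \<phi>] by simp
    finally show "(\<integral>x. second_diff h \<phi> x * u x \<partial>lborel) * kern s h \<le> 4 * S * (cap_sq h * kern s h)"
      using mult_right_mono[OF _ kern_nonneg] by (fastforce simp: mult_ac)
  qed
  also have "(\<integral>h. 4 * S * (cap_sq h * kern s h) \<partial>lborel) = 4 * S * (\<integral>h. cap_sq h * kern s h \<partial>lborel)"
    by (rule integral_mult_right_zero)
  finally show "L1nrm (frac_lap_test s \<phi>) \<le> 4 * lap_const s * (\<integral>h. cap_sq h * kern s h \<partial>lborel) * S"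
    by (simp only: mult_ac)
qed

lemma integral_shift: "(\<integral>x. g (x + t) \<partial>lborel) = (\<integral>x. g x \<partial>lborel)" for g :: "real \<Rightarrow> real"
  using lborel_integral_real_affine[of 1 g t] by (simp add: add.commute)

lemma integrable_shift: "integrable lborel g \<Longrightarrow> integrable lborel (\<lambda>x. g (x + t))" for g :: "real \<Rightarrow> real"
  using lborel_integrable_real_affine[of g 1 t] by (simp add: add.commute)

text \<open>Summation by parts: the second difference is minus the composition of a forward and a backward
  difference, and these are adjoint up to sign by translation invariance.\<close>

lemma second_diff_by_parts:
  fixes u :: "real \<Rightarrow> real"
  assumes g: "integrable lborel g" and u[measurable]: "u \<in> borel_measurable borel" and M: "\<And>x. \<bar>u x\<bar> \<le> M"
  shows "(\<integral>x. second_diff h g x * u x \<partial>lborel) = (\<integral>x. g x * second_diff h u x \<partial>lborel)"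
    "integrable lborel (\<lambda>x. (u (x + h) - u x) * (g (x + h) - g x))"
    "(\<integral>x. second_diff h g x * u x \<partial>lborel) = (\<integral>x. (u (x + h) - u x) * (g (x + h) - g x) \<partial>lborel)"
proof -
  have a: "integrable lborel (\<lambda>x. g (x + a) * u (x + b))" for a b
    by (rule integrable_mult_bounded[OF integrable_shift[OF g]]) (use M in auto)
  have a0: "integrable lborel (\<lambda>x. g x * u x)" "integrable lborel (\<lambda>x. g x * u (x + h))" "integrable lborel (\<lambda>x. g (x + h) * u x)"
     "integrable lborel (\<lambda>x. g (x - h) * u x)" "integrable lborel (\<lambda>x. g x * u (x - h))" "integrable lborel (\<lambda>x. g (x + h) * u (x + h))"
    using a[of 0 0] a[of 0 h] a[of h 0] a[of "- h" 0] a[of 0 "- h"] a[of h h] by simp_all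
  have e1: "(\<integral>x. g (x + h) * u x \<partial>lborel) = (\<integral>x. g x * u (x - h) \<partial>lborel)"
    using integral_shift[of "\<lambda>x. g x * u (x - h)" h] by simp
  have e2: "(\<integral>x. g (x - h) * u x \<partial>lborel) = (\<integral>x. g x * u (x + h) \<partial>lborel)"
    using integral_shift[of "\<lambda>x. g (x - h) * u x" h] by simp
  have e3: "(\<integral>x. g (x + h) * u (x + h) \<partial>lborel) = (\<integral>x. g x * u x \<partial>lborel)"
    using integral_shift[of "\<lambda>x. g x * u x" h] by simp
  have l: "(\<integral>x. second_diff h g x * u x \<partial>lborel) = 2 * (\<integral>x. g x * u x \<partial>lborel) - (\<integral>x. g (x + h) * u x \<partial>lborel) - (\<integral>x. g (x - h) * u x \<partial>lborel)"
    unfolding second_diff_def using a0 by (simp add: left_diff_distrib mult.assoc)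
  have "(\<integral>x. g x * second_diff h u x \<partial>lborel) = (\<integral>x. 2 * (g x * u x) - g x * u (x + h) - g x * u (x - h) \<partial>lborel)"
    unfolding second_diff_def by (simp add: algebra_simps)
  also have "\<dots> = 2 * (\<integral>x. g x * u x \<partial>lborel) - (\<integral>x. g x * u (x + h) \<partial>lborel) - (\<integral>x. g x * u (x - h) \<partial>lborel)"
    using a0 by simp
  finally show "(\<integral>x. second_diff h g x * u x \<partial>lborel) = (\<integral>x. g x * second_diff h u x \<partial>lborel)"
    unfolding l e1 e2 by simp
  have eq: "(u (x + h) - u x) * (g (x + h) - g x) = g (x + h) * u (x + h) - g x * u (x + h) - g (x + h) * u x + g x * u x" for x
    by (simp add: algebra_simps)
  show "integrable lborel (\<lambda>x. (u (x + h) - u x) * (g (x + h) - g x))" unfolding eq using a0 by simp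
  show "(\<integral>x. second_diff h g x * u x \<partial>lborel) = (\<integral>x. (u (x + h) - u x) * (g (x + h) - g x) \<partial>lborel)"
    unfolding l eq e2 using a0 e3 by simp
qed

lemma frac_lap_test_symmetric:
  assumes s: "0 < s" "s < 1" and \<phi>: "test_function \<phi>" and \<psi>: "test_function \<psi>"
  shows "(\<integral>x. frac_lap_test s \<phi> x * \<psi> x \<partial>lborel) = (\<integral>x. frac_lap_test s \<psi> x * \<phi> x \<partial>lborel)"
proof -
  have m: "\<phi> \<in> borel_measurable borel" "\<psi> \<in> borel_measurable borel" using \<phi> \<psi> by measurable
  obtain B where B: "\<And>x. \<bar>\<phi> x\<bar> \<le> B" using test_function_bounded[OF \<phi>] by blast
  obtain B' where B': "\<And>x. \<bar>\<psi> x\<bar> \<le> B'" using test_function_bounded[OF \<psi>] by blast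
  have "(\<integral>x. second_diff h \<phi> x * \<psi> x \<partial>lborel) = (\<integral>x. second_diff h \<psi> x * \<phi> x \<partial>lborel)" for h
    using second_diff_by_parts(1)[OF test_function_integrable[OF \<phi>] m(2) B', of h] by (simp add: mult.commute)
  then show ?thesis
    unfolding frac_lap_test_pair(3)[OF s \<phi> m(2) B'] frac_lap_test_pair(3)[OF s \<psi> m(1) B] by simp
qed

lemma frac_lap_test_second_diff:
  assumes s: "0 < s" "s < 1" and \<phi>: "test_function \<phi>"
  shows "frac_lap_test s (second_diff h \<phi>) x = second_diff h (frac_lap_test s \<phi>) x"
proof -
  note i = frac_lap_test_singular(1)[OF s \<phi>]
  have "second_diff k (second_diff h \<phi>) x * kern s k = 2 * (second_diff k \<phi> x * kern s k) - second_diff k \<phi> (x + h) * kern s k - second_diff k \<phi> (x - h) * kern s k" for k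
    by (simp add: second_diff_def algebra_simps)
  then have e: "(\<integral>k. second_diff k (second_diff h \<phi>) x * kern s k \<partial>lborel) = 2 * (\<integral>k. second_diff k \<phi> x * kern s k \<partial>lborel) - (\<integral>k. second_diff k \<phi> (x + h) * kern s k \<partial>lborel) - (\<integral>k. second_diff k \<phi> (x - h) * kern s k \<partial>lborel)"
    using i by simp
  show ?thesis
    unfolding frac_lap_test_singular(2)[OF s test_function_second_diff(1)[OF \<phi>]] e
      second_diff_def[of h "frac_lap_test s \<phi>"] frac_lap_test_singular(2)[OF s \<phi>]
    by (simp add: right_diff_distrib)
qed

lemma sq_int_bounded_L1:
  fixes g :: "real \<Rightarrow> real"
  assumes g: "integrable lborel g" and B: "\<And>x. \<bar>g x\<bar> \<le> B"
  shows "sq_int lborel g" "(L2nrm lborel g)\<^sup>2 \<le> B * L1nrm g"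
proof -
  have gm: "g \<in> borel_measurable borel" using g by auto
  have eq: "(norm (g x))\<^sup>2 = g x * g x" for x by (simp add: power2_eq_square)
  have i: "integrable lborel (\<lambda>x. g x * g x)" by (rule integrable_mult_bounded[OF g gm B])
  then show "sq_int lborel g" using gm by (simp only: sq_int_def eq) simp
  have "(L2nrm lborel g)\<^sup>2 = (\<integral>x. g x * g x \<partial>lborel)" by (simp only: L2nrm_sq eq)
  also have "\<dots> \<le> L1nrm (\<lambda>x. g x * g x)" unfolding L1nrm_def using i by (intro integral_mono) auto
  also have "\<dots> \<le> B * L1nrm g" by (rule L1nrm_mult_bounded[OF g gm B])
  finally show "(L2nrm lborel g)\<^sup>2 \<le> B * L1nrm g" .
qed

lemma test_function_sq_int: assumes "test_function \<phi>" shows "sq_int lborel \<phi>"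
  using test_function_bounded[OF assms] sq_int_bounded_L1(1)[OF test_function_integrable[OF assms]] by blast

lemma frac_lap_test_sq_int: assumes "test_function \<phi>" shows "sq_int lborel (frac_lap_test (1/4) \<phi>)"
  using frac_lap_test_bounded[OF assms] sq_int_bounded_L1(1)[OF frac_lap_test_integrable(1)[OF _ _ assms, of "1/4"]] by auto

text \<open>The scalar and unweighted form of \<open>has_frac_laplacian (1/4)\<close>: for bounded \<open>u\<close> and square integrable
  \<open>f\<close> the integrability conditions there hold automatically, see \<open>has_frac_laplacian_quarter\<close>.\<close>

definition quarter_laplacian :: "(real \<Rightarrow> real) \<Rightarrow> (real \<Rightarrow> real) \<Rightarrow> bool" where
  "quarter_laplacian u f \<longleftrightarrow> sq_int lborel f \<and>
     (\<forall>\<phi>. test_function \<phi> \<longrightarrow> (\<integral>x. frac_lap_test (1/4) \<phi> x * u x \<partial>lborel) = (\<integral>x. \<phi> x * f x \<partial>lborel))"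

text \<open>Formally one moves one of two quarter Laplacians from \<open>\<phi>\<close> to \<open>u\<close>. As the quarter Laplacian of \<open>\<phi>\<close>
  is not a test function, its second differences are used instead: the second difference of step \<open>h\<close>
  commutes with the quarter Laplacian, so each slice is the pairing of \<open>u\<close> with the quarter Laplacian
  of the test function \<open>second_diff h \<phi>\<close>. Two applications of Fubini's theorem then sum over \<open>h\<close>.\<close>

lemma half_laplacian_pair:
  assumes u[measurable]: "u \<in> borel_measurable borel" and M: "\<And>x. \<bar>u x\<bar> \<le> M"
    and f: "quarter_laplacian u f" and \<phi>: "test_function \<phi>"
  shows "(\<integral>x. frac_lap_test (1/2) \<phi> x * u x \<partial>lborel) = (\<integral>x. frac_lap_test (1/4) \<phi> x * f x \<partial>lborel)"
proof -
  let ?g = "frac_lap_test (1/4) \<phi>"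
  have s: "0 < (1/4::real)" "(1/4::real) < 1" by auto
  have f2: "sq_int lborel f" using f by (simp add: quarter_laplacian_def)
  have [measurable]: "\<phi> \<in> borel_measurable borel" "f \<in> borel_measurable borel" "?g \<in> borel_measurable borel"
    using \<phi> f2 frac_lap_test_measurable[OF \<phi>, of "1/4"] by (measurable, auto simp: sq_int_def)
  have t: "test_function (second_diff h \<phi>)" for h by (rule test_function_second_diff(1)[OF \<phi>])
  have M0: "0 \<le> M" using M[of 0] by linarith
  have gi: "integrable lborel ?g" by (rule frac_lap_test_integrable(1)[OF s \<phi>])
  define c where "c = 4 * lap_const (1/4) * (\<integral>h. cap_sq h * kern (1/4) h \<partial>lborel)"
  have c0: "0 \<le> c" using kern_const_pos[OF s] by (simp add: c_def lap_const_def)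
  have sg: "second_diff h ?g = frac_lap_test (1/4) (second_diff h \<phi>)" for h
    using frac_lap_test_second_diff[OF s \<phi>] by auto
  \<comment> \<open>Four derivatives: two for the second difference in \<open>h\<close> and two for the quarter Laplacian.\<close>
  define S where "S = L1nrm \<phi> + 2 * L1nrm (deriv (deriv \<phi>)) + L1nrm (deriv (deriv (deriv (deriv \<phi>))))"
  have sgn: "L1nrm (second_diff h ?g) \<le> (c * (4 * S)) * cap_sq h" for h
  proof -
    have d2: "deriv (deriv (second_diff h \<phi>)) = second_diff h (deriv (deriv \<phi>))"
      using test_function_second_diff(2)[OF \<phi>] test_function_second_diff(2)[OF test_function_deriv1[OF \<phi>]] by simp
    have "L1nrm (second_diff h ?g) \<le> c * (L1nrm (second_diff h \<phi>) + L1nrm (deriv (deriv (second_diff h \<phi>))))"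
      unfolding sg c_def by (rule frac_lap_test_integrable(2)[OF s t])
    also have "\<dots> \<le> c * (4 * cap_sq h * (L1nrm \<phi> + L1nrm (deriv (deriv \<phi>))) 
        + 4 * cap_sq h * (L1nrm (deriv (deriv \<phi>)) + L1nrm (deriv (deriv (deriv (deriv \<phi>))))))"
      unfolding d2 by (intro mult_left_mono add_mono L1nrm_second_diff_le test_function_deriv1 \<phi> c0)
    finally show ?thesis by (simp add: S_def algebra_simps)
  qed
  have int1: "integrable lborel2 (\<lambda>(h, x). second_diff h ?g x * u x * kern (1/4) h)"
  proof (rule kernel_integrable[OF s])
    show "(\<lambda>(h, x). second_diff h ?g x * u x) \<in> borel_measurable lborel2" unfolding split_beta' second_diff_def by measurable
    show "integrable lborel (\<lambda>x. second_diff h ?g x * u x)" for h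
      by (rule integrable_mult_bounded[OF second_diff_integrable[OF gi] u M])
    show "L1nrm (\<lambda>x. second_diff h ?g x * u x) \<le> (M * (c * (4 * S))) * cap_sq h" for h
      using order_trans[OF L1nrm_mult_bounded[OF second_diff_integrable[OF gi] u M] mult_left_mono[OF sgn M0]]
      by (simp add: mult.assoc)
  qed
  obtain C where C: "0 \<le> C" "\<And>h x. \<bar>second_diff h \<phi> x\<bar> \<le> C * cap_sq h" using second_diff_sup_le[OF \<phi>] by blast
  define D where "D = 4 * (L1nrm \<phi> + L1nrm (deriv (deriv \<phi>)))"
  have D0: "0 \<le> D" by (simp add: D_def)
  have int2: "integrable lborel2 (\<lambda>(h, x). second_diff h \<phi> x * f x * kern (1/4) h)"
  proof (rule kernel_integrable[OF s])
    show "(\<lambda>(h, x). second_diff h \<phi> x * f x) \<in> borel_measurable lborel2" unfolding split_beta' second_diff_def by measurable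
    show i: "integrable lborel (\<lambda>x. second_diff h \<phi> x * f x)" for h
      using sq_int_inner[OF test_function_sq_int[OF t] f2] by simp
    show "L1nrm (\<lambda>x. second_diff h \<phi> x * f x) \<le> (sqrt (C * D) * L2nrm lborel f) * cap_sq h" for h
    proof -
      have "sq_int lborel (\<lambda>x. \<bar>second_diff h \<phi> x\<bar>)" "sq_int lborel (\<lambda>x. \<bar>f x\<bar>)"
        using test_function_sq_int[OF t, of h] f2 by (auto simp: sq_int_def)
      from L2_Cauchy_Schwarz[OF this]
      have "L1nrm (\<lambda>x. second_diff h \<phi> x * f x) \<le> L2nrm lborel (second_diff h \<phi>) * L2nrm lborel f"
        by (simp add: L1nrm_def abs_mult L2nrm_def)
      also have "L2nrm lborel (second_diff h \<phi>) \<le> sqrt (C * D) * cap_sq h"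
      proof (rule power2_le_imp_le)
        have "(L2nrm lborel (second_diff h \<phi>))\<^sup>2 \<le> (C * cap_sq h) * L1nrm (second_diff h \<phi>)"
          by (rule sq_int_bounded_L1(2)[OF test_function_integrable[OF t] C(2)])
        also have "\<dots> \<le> (C * cap_sq h) * (4 * cap_sq h * (L1nrm \<phi> + L1nrm (deriv (deriv \<phi>))))"
          using C(1) by (intro mult_left_mono L1nrm_second_diff_le \<phi>) auto
        also have "\<dots> = (sqrt (C * D) * cap_sq h)\<^sup>2"
          using C(1) D0 by (simp add: D_def power2_eq_square algebra_simps)
        finally show "(L2nrm lborel (second_diff h \<phi>))\<^sup>2 \<le> (sqrt (C * D) * cap_sq h)\<^sup>2" .
      qed (use C D0 in auto)
      finally show ?thesis by (simp add: mult_ac mult_right_mono)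
    qed
  qed
  have slice: "(\<integral>x. second_diff h ?g x * u x \<partial>lborel) = (\<integral>x. second_diff h \<phi> x * f x \<partial>lborel)" for h
    unfolding sg using f t by (simp add: quarter_laplacian_def)
  have "(\<integral>x. frac_lap_test (1/2) \<phi> x * u x \<partial>lborel) = (\<integral>x. lap_const (1/4) * (\<integral>h. second_diff h ?g x * u x * kern (1/4) h \<partial>lborel) \<partial>lborel)"
  proof (rule Bochner_Integration.integral_cong[OF refl])
    fix x
    have "(\<integral>h. second_diff h ?g x * u x * kern (1/4) h \<partial>lborel) = (\<integral>h. second_diff h ?g x * kern (1/4) h * u x \<partial>lborel)"
      by (simp add: mult_ac)
    then show "frac_lap_test (1/2) \<phi> x * u x = lap_const (1/4) * (\<integral>h. second_diff h ?g x * u x * kern (1/4) h \<partial>lborel)"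
      by (simp add: quarter_laplacian_twice(2)[OF \<phi>])
  qed
  also have "\<dots> = lap_const (1/4) * (\<integral>h. (\<integral>x. second_diff h ?g x * u x * kern (1/4) h \<partial>lborel) \<partial>lborel)"
    using lborel_pair.Fubini_integral[OF int1] by simp
  also have "\<dots> = lap_const (1/4) * (\<integral>h. (\<integral>x. second_diff h \<phi> x * f x * kern (1/4) h \<partial>lborel) \<partial>lborel)"
    by (simp add: slice)
  also have "\<dots> = lap_const (1/4) * (\<integral>x. (\<integral>h. second_diff h \<phi> x * f x * kern (1/4) h \<partial>lborel) \<partial>lborel)"
    using lborel_pair.Fubini_integral[OF int2] by simp
  also have "\<dots> = (\<integral>x. ?g x * f x \<partial>lborel)"
  proof -
    have "?g x * f x = lap_const (1/4) * (\<integral>h. second_diff h \<phi> x * f x * kern (1/4) h \<partial>lborel)" for x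
    proof -
      have "(\<integral>h. second_diff h \<phi> x * f x * kern (1/4) h \<partial>lborel) = (\<integral>h. second_diff h \<phi> x * kern (1/4) h * f x \<partial>lborel)"
        by (simp add: mult_ac)
      then show ?thesis by (simp add: frac_lap_test_singular(2)[OF s \<phi>])
    qed
    then show ?thesis by simp
  qed
  finally show ?thesis .
qed

section \<open>A smooth bump and mollification of integrable functions\<close>

definition bump_w :: "real \<Rightarrow> real" where "bump_w x = 1 / (1 - x\<^sup>2)"

text \<open>The shape of all derivatives of \<open>exp (- 1 / (1 - x\<^sup>2))\<close>: a polynomial, times a power of
  \<open>w = 1 / (1 - x\<^sup>2)\<close>, times \<open>exp (- w)\<close>, continued by zero.\<close>

definition bump_fam :: "real poly \<Rightarrow> nat \<Rightarrow> real \<Rightarrow> real" where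
  "bump_fam p k x = (if \<bar>x\<bar> < 1 then poly p x * bump_w x ^ k * exp (- bump_w x) else 0)"

text \<open>With \<open>w' = 2 * x * w\<^sup>2\<close>, and all terms brought to the common power \<open>w ^ (k + 2)\<close> by multiplication
  with powers of \<open>1 - x\<^sup>2\<close>.\<close>

definition bump_next :: "real poly \<Rightarrow> nat \<Rightarrow> real poly" where
  "bump_next p k = pderiv p * [:1, 0, -1:]\<^sup>2 + smult (2 * of_nat k) ([:0, 1:] * p * [:1, 0, -1:]) - smult 2 ([:0, 1:] * p)"

lemma abs_less_1_iff_sq: "\<bar>x\<bar> < 1 \<longleftrightarrow> x\<^sup>2 < (1::real)"
  by (simp add: abs_square_less_1)

lemma power_absorb_sq: "(a::real)\<^sup>2 * w ^ (k + 2) = w ^ k * (w * a)\<^sup>2"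
  by (simp add: power2_eq_square algebra_simps)

lemma bump_fam_deriv_inside:
  assumes "\<bar>x\<bar> < 1"
  shows "(bump_fam p k has_real_derivative bump_fam (bump_next p k) (k + 2) x) (at x)"
proof -
  let ?w = "bump_w x"
  have x: "1 - x\<^sup>2 \<noteq> 0" using assms by (simp add: abs_less_1_iff_sq)
  have w: "?w * (1 - x\<^sup>2) = 1" using x by (simp add: bump_w_def)
  have dw: "(bump_w has_real_derivative 2 * x * ?w\<^sup>2) (at x)"
    unfolding bump_w_def[abs_def] using x
    by (auto intro!: derivative_eq_intros simp: power2_eq_square field_simps)
  have "((\<lambda>x. poly p x * bump_w x ^ k * exp (- bump_w x)) has_real_derivative
      (poly (pderiv p) x * ?w ^ k + poly p x * (of_nat k * ?w ^ (k - 1) * (2 * x * ?w\<^sup>2))) * exp (- ?w)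
        + poly p x * ?w ^ k * (exp (- ?w) * - (2 * x * ?w\<^sup>2))) (at x)"
    by (auto intro!: derivative_eq_intros poly_DERIV dw simp: algebra_simps)
  also have "(poly (pderiv p) x * ?w ^ k + poly p x * (of_nat k * ?w ^ (k - 1) * (2 * x * ?w\<^sup>2))) * exp (- ?w)
        + poly p x * ?w ^ k * (exp (- ?w) * - (2 * x * ?w\<^sup>2)) = bump_fam (bump_next p k) (k + 2) x"
  proof -
    have k: "of_nat k * ?w ^ (k - 1) * ?w\<^sup>2 = of_nat k * ?w ^ (k + 1)"
      by (cases k) (auto simp: power2_eq_square)
    have w1: "?w ^ k = (1 - x\<^sup>2)\<^sup>2 * ?w ^ (k + 2)"
    proof -
      have "(1 - x\<^sup>2)\<^sup>2 * ?w ^ (k + 2) = ?w ^ k * (?w * (1 - x\<^sup>2))\<^sup>2" by (rule power_absorb_sq)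
      then show ?thesis unfolding w by simp
    qed
    have w2: "?w ^ (k + 1) = (1 - x\<^sup>2) * ?w ^ (k + 2)"
    proof -
      have "(1 - x\<^sup>2) * ?w ^ (k + 2) = ?w ^ (k + 1) * (?w * (1 - x\<^sup>2))" by (simp add: mult_ac)
      then show ?thesis using w by simp
    qed
    have "poly (bump_next p k) x = poly (pderiv p) x * (1 - x\<^sup>2)\<^sup>2 + 2 * of_nat k * (x * poly p x * (1 - x\<^sup>2)) - 2 * (x * poly p x)"
      by (simp add: bump_next_def power2_eq_square algebra_simps)
    then have "bump_fam (bump_next p k) (k + 2) x = (poly (pderiv p) x * ((1 - x\<^sup>2)\<^sup>2 * ?w ^ (k + 2)) + 
        2 * x * poly p x * of_nat k * ((1 - x\<^sup>2) * ?w ^ (k + 2)) - 2 * x * poly p x * ?w ^ (k + 2)) * exp (- ?w)"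
    proof -
      have "(a * A2 + 2 * m * (y * P * A1) - 2 * (y * P)) * W * E = (a * (A2 * W) + 2 * y * P * m * (A1 * W) - 2 * y * P * W) * E"
        for a A2 m y P A1 W E :: real by (simp add: algebra_simps)
      then show ?thesis using assms \<open>poly (bump_next p k) x = _\<close> by (simp only: bump_fam_def if_True)
    qed
    also have "\<dots> = (poly (pderiv p) x * ?w ^ k + 2 * x * poly p x * (of_nat k * ?w ^ (k + 1)) - 2 * x * poly p x * ?w ^ (k + 2)) * exp (- ?w)"
      unfolding w1[symmetric] w2[symmetric] by (simp add: algebra_simps)
    also have "\<dots> = (poly (pderiv p) x * ?w ^ k + poly p x * (of_nat k * ?w ^ (k - 1) * (2 * x * ?w\<^sup>2))) * exp (- ?w)
        + poly p x * ?w ^ k * (exp (- ?w) * - (2 * x * ?w\<^sup>2))"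
      unfolding k[symmetric] by (simp add: algebra_simps power_add power2_eq_square)
    finally show ?thesis by simp
  qed
  finally have d: "((\<lambda>x. poly p x * bump_w x ^ k * exp (- bump_w x)) has_real_derivative bump_fam (bump_next p k) (k + 2) x) (at x)" .
  have "open {x::real. \<bar>x\<bar> < 1}" by (intro open_Collect_less continuous_intros)
  from has_field_derivative_transform_within_open[OF d this] show ?thesis
    using assms by (auto simp: bump_fam_def)
qed

text \<open>The exponential beats every power of \<open>w\<close>; keeping two extra powers leaves the factor \<open>(1 - y\<^sup>2)\<^sup>2\<close>,
  which vanishes to second order at the boundary. So the derivative at the boundary exists and is zero.\<close>

lemma bump_fam_flat: "\<exists>C. \<forall>x y. \<bar>x\<bar> = 1 \<longrightarrow> \<bar>bump_fam p k y\<bar> \<le> C * (y - x)\<^sup>2"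
proof -
  have "compact (poly p ` {-1..1})" by (intro compact_continuous_image continuous_intros) auto
  then obtain M where M: "\<And>y. y \<in> {-1..1} \<Longrightarrow> \<bar>poly p y\<bar> \<le> M"
    using compact_imp_bounded by (fastforce simp: bounded_iff)
  have M0: "0 \<le> M" using M[of 0] by auto
  have "\<bar>bump_fam p k y\<bar> \<le> (4 * M * fact (k + 2)) * (y - x)\<^sup>2" if x: "\<bar>x\<bar> = 1" for x y
  proof (cases "\<bar>y\<bar> < 1")
    case True
    define w where "w = bump_w y"
    have w0: "w > 0" and w1: "w * (1 - y\<^sup>2) = 1" using True by (auto simp: w_def bump_w_def abs_less_1_iff_sq)
    have "w ^ (k + 2) / fact (k + 2) \<le> exp w"
    proof -
      have "(\<Sum>i\<in>{k + 2}. w ^ i /\<^sub>R fact i) \<le> (\<Sum>i. w ^ i /\<^sub>R fact i)"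
        using w0 sums_summable[OF exp_converges[of w]] by (intro sum_le_suminf) auto
      then show ?thesis by (simp add: exp_def divide_inverse mult.commute)
    qed
    then have "w ^ (k + 2) \<le> fact (k + 2) * exp w"
      by (simp only: pos_divide_le_eq[OF fact_gt_zero] mult.commute)
    then have "w ^ (k + 2) * exp (- w) \<le> fact (k + 2) * exp w * exp (- w)" by (rule mult_right_mono) simp
    then have e: "w ^ (k + 2) * exp (- w) \<le> fact (k + 2)"
      by (simp only: mult.assoc exp_minus_inverse mult_1_right)
    have "w ^ k = w ^ (k + 2) * (1 - y\<^sup>2)\<^sup>2"
    proof -
      have "w ^ (k + 2) * (1 - y\<^sup>2)\<^sup>2 = w ^ k * (w * (1 - y\<^sup>2))\<^sup>2"
        using power_absorb_sq[of "1 - y\<^sup>2" w k] by (simp only: mult.commute)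
      then show ?thesis by (simp add: w1)
    qed
    then have "w ^ k * exp (- w) = (w ^ (k + 2) * exp (- w)) * (1 - y\<^sup>2)\<^sup>2" by simp
    also have "\<dots> \<le> fact (k + 2) * (1 - y\<^sup>2)\<^sup>2" by (rule mult_right_mono[OF e]) simp
    also have "\<dots> \<le> fact (k + 2) * (4 * (y - x)\<^sup>2)"
    proof (rule mult_left_mono)
      have "x = 1 \<or> x = -1" using x by auto
      then have "1 - y\<^sup>2 = (x - y) * (x + y)" by (auto simp: power2_eq_square algebra_simps)
      then have "(1 - y\<^sup>2)\<^sup>2 = (y - x)\<^sup>2 * (x + y)\<^sup>2" by (simp add: power_mult_distrib power2_commute)
      also have "\<dots> \<le> (y - x)\<^sup>2 * 2\<^sup>2"
      proof (rule mult_left_mono)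
        have "\<bar>x + y\<bar> \<le> \<bar>2\<bar>" using x True by linarith
        then show "(x + y)\<^sup>2 \<le> 2\<^sup>2" by (simp only: abs_le_square_iff)
      qed simp
      finally show "(1 - y\<^sup>2)\<^sup>2 \<le> 4 * (y - x)\<^sup>2" by simp
    qed simp
    finally have le: "w ^ k * exp (- w) \<le> fact (k + 2) * (4 * (y - x)\<^sup>2)" .
    have nn: "0 \<le> w ^ k * exp (- w)" using w0 by simp
    have "\<bar>poly p y\<bar> * (w ^ k * exp (- w)) \<le> M * (fact (k + 2) * (4 * (y - x)\<^sup>2))"
      using True by (intro mult_mono[OF M le M0 nn]) auto
    then show ?thesis using True w0 by (simp add: bump_fam_def w_def[symmetric] abs_mult algebra_simps)
  qed (use M0 in \<open>simp add: bump_fam_def\<close>)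
  then show ?thesis by blast
qed

lemma bump_fam_deriv: "(bump_fam p k has_real_derivative bump_fam (bump_next p k) (k + 2) x) (at x)"
proof -
  consider "\<bar>x\<bar> < 1" | "\<bar>x\<bar> = 1" | "\<bar>x\<bar> > 1" by linarith
  then show ?thesis
  proof cases
    case 1 then show ?thesis by (rule bump_fam_deriv_inside)
  next
    case 2
    obtain C where C: "\<And>y. \<bar>bump_fam p k y\<bar> \<le> C * (y - x)\<^sup>2" using bump_fam_flat 2 by blast
    have "((\<lambda>y. (bump_fam p k y - bump_fam p k x) / (y - x)) \<longlongrightarrow> 0) (at x)"
    proof (rule Lim_null_comparison[where g="\<lambda>y. \<bar>C\<bar> * \<bar>y - x\<bar>"])
      have "norm ((bump_fam p k y - bump_fam p k x) / (y - x)) \<le> \<bar>C\<bar> * \<bar>y - x\<bar>" if "y \<noteq> x" for y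
      proof -
        have "\<bar>bump_fam p k y\<bar> \<le> \<bar>C\<bar> * (y - x)\<^sup>2"
          using C[of y] by (smt (verit) mult_right_mono zero_le_power2)
        also have "\<dots> = (\<bar>C\<bar> * \<bar>y - x\<bar>) * \<bar>y - x\<bar>"
          by (simp add: power2_eq_square mult.assoc)
        finally have "\<bar>bump_fam p k y\<bar> / \<bar>y - x\<bar> \<le> \<bar>C\<bar> * \<bar>y - x\<bar>"
          using that by (simp add: pos_divide_le_eq)
        moreover have "bump_fam p k x = 0" using 2 by (simp add: bump_fam_def)
        ultimately show ?thesis by simp
      qed
      then show "\<forall>\<^sub>F y in at x. norm ((bump_fam p k y - bump_fam p k x) / (y - x)) \<le> \<bar>C\<bar> * \<bar>y - x\<bar>"
        by (simp add: eventually_at_filter)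
      have "((\<lambda>y. \<bar>C\<bar> * \<bar>y - x\<bar>) \<longlongrightarrow> \<bar>C\<bar> * \<bar>x - x\<bar>) (at x)" by (intro tendsto_intros)
      then show "((\<lambda>y. \<bar>C\<bar> * \<bar>y - x\<bar>) \<longlongrightarrow> 0) (at x)" by simp
    qed
    then show ?thesis using 2 by (simp add: has_field_derivative_iff bump_fam_def[of "bump_next p k"])
  next
    case 3
    have "open {x::real. 1 < \<bar>x\<bar>}" by (intro open_Collect_less continuous_intros)
    from has_field_derivative_transform_within_open[OF DERIV_const[of 0] this] show ?thesis
      using 3 by (auto simp: bump_fam_def)
  qed
qed

definition bump :: "real \<Rightarrow> real" where "bump = bump_fam 1 0"

lemma bump_test: "test_function bump"
proof -
  \<comment> \<open>The polynomials and exponents of the successive derivatives.\<close>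
  define P where "P = rec_nat (1, 0) (\<lambda>_ (p, k). (bump_next p k, k + 2 :: nat))"
  define F where "F n = bump_fam (fst (P n)) (snd (P n))" for n
  have "(F n has_real_derivative F (Suc n) x) (at x)" for n x
    using bump_fam_deriv[of "fst (P n)" "snd (P n)" x] by (simp add: F_def P_def split_beta)
  moreover have "F 0 x = 0" if "1 < \<bar>x\<bar>" for x using that by (simp add: F_def P_def bump_fam_def)
  ultimately have "test_function (F 0)" by (rule test_functionI(1)[where F=F and R=1])
  then show ?thesis by (simp add: F_def P_def bump_def)
qed

lemma bump_simps: "bump x = (if \<bar>x\<bar> < 1 then exp (- (1 / (1 - x\<^sup>2))) else 0)"
  by (simp add: bump_def bump_fam_def bump_w_def)

lemma bump_integral_pos: "0 < (\<integral>x. bump x \<partial>lborel)"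
proof -
  have "(\<integral>x. exp (-2::real) * indicator {0..1/2::real} x \<partial>lborel) \<le> (\<integral>x. bump x \<partial>lborel)"
  proof (rule integral_mono)
    show "integrable lborel (\<lambda>x. exp (-2::real) * indicator {0..1/2::real} x)"
      by (intro integrable_mult_right integrable_real_indicator emeasure_bounded_finite) auto
    show "integrable lborel bump" by (rule test_function_integrable[OF bump_test])
    fix x :: real
    show "exp (-2::real) * indicator {0..1/2} x \<le> bump x"
    proof (cases "x \<in> {0..1/2}")
      case True
      then have "x * x \<le> (1/2) * (1/2)" by (intro mult_mono) auto
      then have "x\<^sup>2 \<le> 1/4" by (simp add: power2_eq_square)
      then have "1 / (1 - x\<^sup>2) \<le> 2" by (simp add: field_simps)
      then show ?thesis using True by (simp add: bump_simps)
    qed (simp add: bump_simps)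
  qed
  then have "exp (-2::real) \<le> (\<integral>x. bump x \<partial>lborel) * 2" by simp
  with exp_gt_zero[of "-2::real"] show ?thesis by linarith
qed

definition moll :: "real \<Rightarrow> real" where "moll x = bump x / (\<integral>x. bump x \<partial>lborel)"

lemma moll_test: "test_function moll"
  using test_function_lincomb(1)[OF bump_test bump_test, of "1 / (\<integral>x. bump x \<partial>lborel)" 0]
  by (simp add: moll_def[abs_def])

lemma moll_nonneg[simp]: "0 \<le> moll x"
  using bump_integral_pos by (simp add: moll_def bump_simps)

lemma moll_even: "moll (- x) = moll x" by (simp add: moll_def bump_simps)

lemma moll_outside: "1 \<le> \<bar>x\<bar> \<Longrightarrow> moll x = 0" by (simp add: moll_def bump_simps)

lemma moll_le: "moll x \<le> moll 0" "0 < moll 0"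
proof -
  have "bump x \<le> bump 0"
  proof (cases "\<bar>x\<bar> < 1")
    case True
    then have "0 < 1 - x\<^sup>2" "1 - x\<^sup>2 \<le> 1" by (auto simp: abs_less_1_iff_sq)
    then show ?thesis using True by (simp add: bump_simps)
  qed (simp add: bump_simps)
  then show "moll x \<le> moll 0" "0 < moll 0"
    using bump_integral_pos by (auto simp: moll_def bump_simps divide_right_mono)
qed

lemma moll_measurable[measurable]: "moll \<in> borel_measurable borel"
  using moll_test by measurable

lemma moll_integrable: "integrable lborel moll" by (rule test_function_integrable[OF moll_test])

lemma moll_integral: "(\<integral>x. moll x \<partial>lborel) = 1"
  using bump_integral_pos by (simp add: moll_def)

text \<open>Differentiation under the integral sign, with the difference quotient of \<open>\<theta>\<close> dominated by the bound
  of its derivative.\<close>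

lemma convolution_deriv:
  assumes \<theta>: "test_function \<theta>" and v: "integrable lborel v"
  shows "((\<lambda>x. \<integral>y. \<theta> (x - y) * v y \<partial>lborel) has_real_derivative (\<integral>y. deriv \<theta> (x - y) * v y \<partial>lborel)) (at x)"
proof -
  have d: "test_function (deriv \<theta>)" by (rule test_function_deriv1[OF \<theta>])
  have [measurable]: "\<theta> \<in> borel_measurable borel" "deriv \<theta> \<in> borel_measurable borel" "v \<in> borel_measurable borel"
    using test_function_measurable[OF \<theta>] test_function_measurable[OF d] v by auto
  obtain B where B: "\<And>x. \<bar>deriv \<theta> x\<bar> \<le> B" using test_function_bounded[OF d] by blast
  obtain B' where B': "\<And>x. \<bar>\<theta> x\<bar> \<le> B'" using test_function_bounded[OF \<theta>] by blast
  have i: "integrable lborel (\<lambda>y. \<theta> (z - y) * v y)" for z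
    using integrable_mult_bounded[OF v, of "\<lambda>y. \<theta> (z - y)" B'] B' by (simp add: mult.commute)
  show ?thesis
    unfolding has_field_derivative_iff
  proof (rule tendsto_at_iff_sequentially[THEN iffD2], intro allI impI)
    fix X assume X: "\<forall>i. X i \<in> UNIV - {x}" "X \<longlonglongrightarrow> x"
    have "(\<lambda>n. \<integral>y. (\<theta> (X n - y) - \<theta> (x - y)) / (X n - x) * v y \<partial>lborel) \<longlonglongrightarrow> (\<integral>y. deriv \<theta> (x - y) * v y \<partial>lborel)"
    proof (rule integral_dominated_convergence[where w="\<lambda>y. B * \<bar>v y\<bar>"])
      show "integrable lborel (\<lambda>y. B * \<bar>v y\<bar>)" using v by simp
      show "AE y in lborel. (\<lambda>n. (\<theta> (X n - y) - \<theta> (x - y)) / (X n - x) * v y) \<longlonglongrightarrow> deriv \<theta> (x - y) * v y"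
      proof (intro always_eventually allI tendsto_mult tendsto_const)
        fix y
        have "((\<lambda>z. (\<theta> z - \<theta> (x - y)) / (z - (x - y))) \<longlongrightarrow> deriv \<theta> (x - y)) (at (x - y))"
          using test_function_has_deriv[OF \<theta>, of "x - y"] by (simp add: has_field_derivative_iff)
        moreover have "(\<lambda>n. X n - y) \<longlonglongrightarrow> x - y" by (intro tendsto_intros X)
        moreover have "\<forall>i. X i - y \<in> UNIV - {x - y}" using X by auto
        ultimately have "((\<lambda>z. (\<theta> z - \<theta> (x - y)) / (z - (x - y))) \<circ> (\<lambda>n. X n - y)) \<longlonglongrightarrow> deriv \<theta> (x - y)"
          unfolding tendsto_at_iff_sequentially by (metis (no_types, lifting))
        then show "(\<lambda>n. (\<theta> (X n - y) - \<theta> (x - y)) / (X n - x)) \<longlonglongrightarrow> deriv \<theta> (x - y)"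
          by (simp add: o_def)
      qed
      show "AE y in lborel. norm ((\<theta> (X n - y) - \<theta> (x - y)) / (X n - x) * v y) \<le> B * \<bar>v y\<bar>" for n
      proof (intro always_eventually allI)
        fix y
        have "norm (\<theta> (X n - y) - \<theta> (x - y)) \<le> B * norm ((X n - y) - (x - y))"
          by (rule field_differentiable_bound[of UNIV \<theta> "deriv \<theta>"])
             (auto intro: test_function_has_deriv[OF \<theta>] B has_field_derivative_at_within)
        then have q: "\<bar>(\<theta> (X n - y) - \<theta> (x - y)) / (X n - x)\<bar> \<le> B"
          using X(1) by (simp add: divide_le_eq)
        show "norm ((\<theta> (X n - y) - \<theta> (x - y)) / (X n - x) * v y) \<le> B * \<bar>v y\<bar>"
          using mult_right_mono[OF q abs_ge_zero[of "v y"]] by (simp only: real_norm_def abs_mult)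
      qed
    qed measurable
    also have "(\<lambda>n. \<integral>y. (\<theta> (X n - y) - \<theta> (x - y)) / (X n - x) * v y \<partial>lborel) =
      (\<lambda>z. ((\<integral>y. \<theta> (z - y) * v y \<partial>lborel) - (\<integral>y. \<theta> (x - y) * v y \<partial>lborel)) / (z - x)) \<circ> X"
    proof
      fix n
      have "(\<integral>y. (\<theta> (X n - y) - \<theta> (x - y)) / (X n - x) * v y \<partial>lborel) = (\<integral>y. (\<theta> (X n - y) * v y - \<theta> (x - y) * v y) / (X n - x) \<partial>lborel)"
        by (rule Bochner_Integration.integral_cong) (auto simp: algebra_simps)
      then show "(\<integral>y. (\<theta> (X n - y) - \<theta> (x - y)) / (X n - x) * v y \<partial>lborel) =
        ((\<lambda>z. ((\<integral>y. \<theta> (z - y) * v y \<partial>lborel) - (\<integral>y. \<theta> (x - y) * v y \<partial>lborel)) / (z - x)) \<circ> X) n"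
        using i by simp
    qed
    finally show "((\<lambda>z. ((\<integral>y. \<theta> (z - y) * v y \<partial>lborel) - (\<integral>y. \<theta> (x - y) * v y \<partial>lborel)) / (z - x)) \<circ> X) \<longlonglongrightarrow> (\<integral>y. deriv \<theta> (x - y) * v y \<partial>lborel)" .
  qed
qed

text \<open>The averaging form, in which bounds and limits are visible; \<open>mollify_convolution\<close> has the form in
  which smoothness is visible.\<close>

definition mollify :: "real \<Rightarrow> (real \<Rightarrow> real) \<Rightarrow> real \<Rightarrow> real" where
  "mollify e v x = (\<integral>s. moll s * v (x - e * s) \<partial>lborel)"

lemma mollify_convolution:
  assumes "0 < e"
  shows "mollify e v x = (\<integral>y. (moll ((1/e) * (x - y)) / e) * v y \<partial>lborel)"
proof -
  have "(\<integral>y. (moll ((1/e) * (x - y)) / e) * v y \<partial>lborel) = \<bar>- e\<bar> *\<^sub>R (\<integral>s. (moll ((1/e) * (x - (x + (- e) * s))) / e) * v (x + (- e) * s) \<partial>lborel)"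
    using assms by (intro lborel_integral_real_affine) simp
  also have "\<dots> = e * (\<integral>s. (1/e) * (moll s * v (x - e * s)) \<partial>lborel)"
    using assms by (simp add: mult_ac)
  also have "\<dots> = mollify e v x" using assms unfolding mollify_def by (subst integral_mult_right_zero) simp
  finally show ?thesis by simp
qed

lemma mollify_test:
  assumes e: "0 < e" and v: "integrable lborel v" and supp: "\<And>x. R < \<bar>x\<bar> \<Longrightarrow> v x = 0"
  shows "test_function (mollify e v)"
proof -
  define \<theta> where "\<theta> = (\<lambda>z. moll ((1/e) * z) / e)"
  have "test_function (\<lambda>z. moll ((1/e) * z + 0))" by (rule test_function_affine(1)[OF moll_test]) (use e in simp)
  from test_function_lincomb(1)[OF this this, of "1/e" 0] have \<theta>: "test_function \<theta>" by (simp add: \<theta>_def)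
  define F where "F n x = (\<integral>y. (deriv ^^ n) \<theta> (x - y) * v y \<partial>lborel)" for n x
  have "(F n has_real_derivative F (Suc n) x) (at x)" for n x
    using convolution_deriv[OF test_function_iterated_deriv[OF \<theta>] v, of n x] by (simp add: F_def[abs_def])
  moreover have "F 0 x = 0" if "R + e < \<bar>x\<bar>" for x
  proof -
    have "\<theta> (x - y) * v y = 0" for y
    proof (cases "R < \<bar>y\<bar>")
      case False
      then have "e \<le> \<bar>x - y\<bar>" using that by linarith
      then have "1 \<le> \<bar>(1/e) * (x - y)\<bar>" using e by (simp add: abs_mult field_simps)
      then show ?thesis by (simp add: \<theta>_def moll_outside)
    qed (simp add: supp)
    then have "(\<lambda>y. \<theta> (x - y) * v y) = (\<lambda>y. 0)" by blast
    then show ?thesis by (simp add: F_def)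
  qed
  ultimately have "test_function (F 0)" by (rule test_functionI(1)[where F=F and R="R + e"])
  moreover have "F 0 = mollify e v"
    unfolding F_def[abs_def] using mollify_convolution[OF e, of v] by (simp add: \<theta>_def fun_eq_iff)
  ultimately show ?thesis by simp
qed

section \<open>The Gagliardo energy\<close>

text \<open>A point of the plane is a pair \<open>(h, x)\<close> of a step and a base point. The square of this quotient
  integrates to the Gagliardo energy of order one half. The value on the null set \<open>h = 0\<close> is \<open>0\<close>.\<close>

definition diff_quot :: "(real \<Rightarrow> 'a::euclidean_space) \<Rightarrow> real \<times> real \<Rightarrow> 'a" where
  "diff_quot u p = (u (snd p + fst p) - u (snd p)) /\<^sub>R fst p"

lemma diff_quot_measurable[measurable]:
  assumes [measurable]: "u \<in> borel_measurable borel" shows "diff_quot u \<in> borel_measurable lborel2"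
  unfolding diff_quot_def[abs_def] by measurable

abbreviation energy_norm :: "(real \<Rightarrow> 'a::euclidean_space) \<Rightarrow> real" where "energy_norm u \<equiv> L2nrm lborel2 (diff_quot u)"

definition finite_energy :: "(real \<Rightarrow> 'a::euclidean_space) \<Rightarrow> bool" where
  "finite_energy u \<longleftrightarrow> u \<in> borel_measurable borel \<and> sq_int lborel2 (diff_quot u)"

lemma finite_energyD:
  "finite_energy u \<Longrightarrow> u \<in> borel_measurable borel" "finite_energy u \<Longrightarrow> sq_int lborel2 (diff_quot u)"
  by (auto simp: finite_energy_def)

lemma diff_quot_add: "diff_quot (\<lambda>x. u x + v x) = (\<lambda>p. diff_quot u p + diff_quot v p)"
  by (auto simp: diff_quot_def fun_eq_iff algebra_simps)

lemma diff_quot_diff: "diff_quot (\<lambda>x. u x - v x) = (\<lambda>p. diff_quot u p - diff_quot v p)"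
  by (auto simp: diff_quot_def fun_eq_iff algebra_simps)

lemma diff_quot_scaleR: "diff_quot (\<lambda>x. c *\<^sub>R u x) = (\<lambda>p. c *\<^sub>R diff_quot u p)"
  by (auto simp: diff_quot_def fun_eq_iff algebra_simps)

lemma finite_energy_diff: "finite_energy u \<Longrightarrow> finite_energy v \<Longrightarrow> finite_energy (\<lambda>x. u x - v x)"
  by (auto simp: finite_energy_def diff_quot_diff intro: sq_int_diff)

lemma finite_energy_scaleR: "finite_energy u \<Longrightarrow> finite_energy (\<lambda>x. c *\<^sub>R u x)"
  by (auto simp: finite_energy_def diff_quot_scaleR intro: sq_int_scaleR)

lemma test_function_finite_energy:
  assumes \<phi>: "test_function \<phi>" shows "finite_energy \<phi>"
proof -
  have [measurable]: "\<phi> \<in> borel_measurable borel" by (rule test_function_measurable[OF \<phi>])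
  obtain B where B: "\<And>x. \<bar>\<phi> x\<bar> \<le> B" using test_function_bounded[OF \<phi>] by blast
  have B0: "0 \<le> B" using B[of 0] by linarith
  note ti = test_function_integrable[OF \<phi>]
  note sti = test_function_integrable[OF test_function_second_diff(1)[OF \<phi>]]
  note bp = second_diff_by_parts[OF ti test_function_measurable[OF \<phi>] B]
  have "integrable lborel2 (\<lambda>(h, x). ((\<phi> (x + h) - \<phi> x) * (\<phi> (x + h) - \<phi> x)) * kern (1/2) h)"
  proof (rule kernel_integrable)
    show "integrable lborel (\<lambda>x. (\<phi> (x + h) - \<phi> x) * (\<phi> (x + h) - \<phi> x))" for h by (rule bp(2))
    show "L1nrm (\<lambda>x. (\<phi> (x + h) - \<phi> x) * (\<phi> (x + h) - \<phi> x)) \<le> (B * (4 * (L1nrm \<phi> + L1nrm (deriv (deriv \<phi>))))) * cap_sq h" for h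
    proof -
      have "L1nrm (\<lambda>x. (\<phi> (x + h) - \<phi> x) * (\<phi> (x + h) - \<phi> x)) = (\<integral>x. second_diff h \<phi> x * \<phi> x \<partial>lborel)"
        unfolding bp(3) L1nrm_def by simp
      also have "\<dots> \<le> L1nrm (\<lambda>x. second_diff h \<phi> x * \<phi> x)"
        unfolding L1nrm_def by (rule integral_mono) (use integrable_mult_bounded[OF sti _ B] in auto)
      also have "\<dots> \<le> B * L1nrm (second_diff h \<phi>)" by (rule L1nrm_mult_bounded[OF sti _ B]) simp
      also have "\<dots> \<le> B * (4 * cap_sq h * (L1nrm \<phi> + L1nrm (deriv (deriv \<phi>))))"
        by (intro mult_left_mono L1nrm_second_diff_le \<phi> B0)
      finally show ?thesis by (simp add: mult_ac)
    qed
  qed (auto simp: split_beta')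
  also have "(\<lambda>(h, x). ((\<phi> (x + h) - \<phi> x) * (\<phi> (x + h) - \<phi> x)) * kern (1/2) h) = (\<lambda>p. (norm (diff_quot \<phi> p))\<^sup>2)"
    by (auto simp: diff_quot_def kern_half power2_eq_square divide_simps)
  finally show ?thesis by (simp add: finite_energy_def sq_int_def)
qed

text \<open>Polarised energy identity: sum the second differences by parts in each slice, and use that
  \<open>kern (1/2) h\<close> is \<open>1 / h\<^sup>2\<close>.\<close>

lemma half_laplacian_energy:
  fixes u :: "real \<Rightarrow> real"
  assumes u: "finite_energy u" and M: "\<And>x. \<bar>u x\<bar> \<le> M" and \<phi>: "test_function \<phi>"
  shows "(\<integral>x. frac_lap_test (1/2) \<phi> x * u x \<partial>lborel) = lap_const (1/2) * (\<integral>p. diff_quot u p * diff_quot \<phi> p \<partial>lborel2)"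
proof -
  have um: "u \<in> borel_measurable borel" by (rule finite_energyD(1)[OF u])
  have int: "integrable lborel2 (\<lambda>p. diff_quot u p * diff_quot \<phi> p)"
    using sq_int_inner[OF finite_energyD(2)[OF u] finite_energyD(2)[OF test_function_finite_energy[OF \<phi>]]] by simp
  have "(\<integral>p. diff_quot u p * diff_quot \<phi> p \<partial>lborel2) = (\<integral>h. (\<integral>x. diff_quot u (h, x) * diff_quot \<phi> (h, x) \<partial>lborel) \<partial>lborel)"
    using lborel_pair.integral_fst'[OF int] by simp
  also have "\<dots> = (\<integral>h. (\<integral>x. second_diff h \<phi> x * u x \<partial>lborel) * kern (1/2) h \<partial>lborel)"
  proof (rule Bochner_Integration.integral_cong[OF refl])
    fix h
    have "diff_quot u (h, x) * diff_quot \<phi> (h, x) = ((u (x + h) - u x) * (\<phi> (x + h) - \<phi> x)) * kern (1/2) h" for x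
      by (simp add: diff_quot_def kern_half power2_eq_square divide_simps)
    then show "(\<integral>x. diff_quot u (h, x) * diff_quot \<phi> (h, x) \<partial>lborel) = (\<integral>x. second_diff h \<phi> x * u x \<partial>lborel) * kern (1/2) h"
      by (simp add: second_diff_by_parts(3)[OF test_function_integrable[OF \<phi>] um M])
  qed
  finally show ?thesis
    using frac_lap_test_pair(3)[of "1/2", OF _ _ \<phi> um M] by simp
qed

lemma quarter_laplacian_test:
  assumes \<phi>: "test_function \<phi>" shows "quarter_laplacian \<phi> (frac_lap_test (1/4) \<phi>)"
  unfolding quarter_laplacian_def
  using frac_lap_test_sq_int[OF \<phi>] frac_lap_test_symmetric[of "1/4", OF _ _ _ \<phi>] by (auto simp: mult.commute)

lemma test_function_energy:
  assumes \<phi>: "test_function \<phi>"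
  shows "(L2nrm lborel (frac_lap_test (1/4) \<phi>))\<^sup>2 = lap_const (1/2) * (energy_norm \<phi>)\<^sup>2"
proof -
  obtain B where B: "\<And>x. \<bar>\<phi> x\<bar> \<le> B" using test_function_bounded[OF \<phi>] by blast
  have "(L2nrm lborel (frac_lap_test (1/4) \<phi>))\<^sup>2 = (\<integral>x. frac_lap_test (1/4) \<phi> x * frac_lap_test (1/4) \<phi> x \<partial>lborel)"
    unfolding L2nrm_sq by (simp add: power2_eq_square)
  also have "\<dots> = (\<integral>x. frac_lap_test (1/2) \<phi> x * \<phi> x \<partial>lborel)"
    using half_laplacian_pair[OF test_function_measurable[OF \<phi>] B quarter_laplacian_test[OF \<phi>] \<phi>] by simp
  also have "\<dots> = lap_const (1/2) * (\<integral>p. diff_quot \<phi> p * diff_quot \<phi> p \<partial>lborel2)"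
    by (rule half_laplacian_energy[OF test_function_finite_energy[OF \<phi>] B \<phi>])
  also have "(\<integral>p. diff_quot \<phi> p * diff_quot \<phi> p \<partial>lborel2) = (energy_norm \<phi>)\<^sup>2"
    unfolding L2nrm_sq by (simp add: power2_eq_square)
  finally show ?thesis .
qed

lemma lap_const_pos: "0 < s \<Longrightarrow> s < 1 \<Longrightarrow> 0 < lap_const s"
  by (simp add: lap_const_def kern_const_pos)

text \<open>The scaling that makes the order one half critical in dimension one.\<close>

lemma energy_norm_dilate:
  assumes \<phi>: "test_function \<phi>" and R: "0 < R"
  shows "energy_norm (\<lambda>x. \<phi> (x / R)) = energy_norm \<phi>"
proof -
  have t: "test_function (\<lambda>x. \<phi> (x / R))" using test_function_affine(1)[OF \<phi>, of "1/R" 0] R by simp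
  have sl: "(energy_norm \<psi>)\<^sup>2 = (\<integral>h. (\<integral>x. (\<psi> (x + h) - \<psi> x)\<^sup>2 / h\<^sup>2 \<partial>lborel) \<partial>lborel)" if "test_function \<psi>" for \<psi> :: "real \<Rightarrow> real"
  proof -
    have "integrable lborel2 (\<lambda>p. (norm (diff_quot \<psi> p))\<^sup>2)"
      using finite_energyD(2)[OF test_function_finite_energy[OF that]] by (simp add: sq_int_def)
    from lborel_pair.integral_fst'[OF this] show ?thesis
      by (simp add: L2nrm_sq diff_quot_def power_mult_distrib power_divide divide_inverse mult.commute power_inverse)
  qed
  have inner: "(\<integral>x. (\<phi> (x / R + h / R) - \<phi> (x / R))\<^sup>2 / h\<^sup>2 \<partial>lborel) = R * (\<integral>y. (\<phi> (y + h / R) - \<phi> y)\<^sup>2 / h\<^sup>2 \<partial>lborel)" for h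
    using lborel_integral_real_affine[of R "\<lambda>x. (\<phi> (x / R + h / R) - \<phi> (x / R))\<^sup>2 / h\<^sup>2" 0] R by simp
  have "(energy_norm (\<lambda>x. \<phi> (x / R)))\<^sup>2 = (\<integral>h. R * (\<integral>y. (\<phi> (y + h / R) - \<phi> y)\<^sup>2 / h\<^sup>2 \<partial>lborel) \<partial>lborel)"
    unfolding sl[OF t] add_divide_distrib inner ..
  also have "\<dots> = \<bar>R\<bar> *\<^sub>R (\<integral>k. R * (\<integral>y. (\<phi> (y + (0 + R * k) / R) - \<phi> y)\<^sup>2 / (0 + R * k)\<^sup>2 \<partial>lborel) \<partial>lborel)"
    using R by (intro lborel_integral_real_affine) simp
  also have "\<dots> = (\<integral>k. R * (R * (\<integral>y. (\<phi> (y + (0 + R * k) / R) - \<phi> y)\<^sup>2 / (0 + R * k)\<^sup>2 \<partial>lborel)) \<partial>lborel)"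
    using R by (simp only: real_scaleR_def abs_of_pos integral_mult_right_zero)
  also have "\<dots> = (\<integral>k. (\<integral>y. (\<phi> (y + k) - \<phi> y)\<^sup>2 / k\<^sup>2 \<partial>lborel) \<partial>lborel)"
    unfolding integral_mult_right_zero[symmetric] using R
    by (intro Bochner_Integration.integral_cong refl) (simp add: power_mult_distrib power2_eq_square)
  finally have "(energy_norm (\<lambda>x. \<phi> (x / R)))\<^sup>2 = (energy_norm \<phi>)\<^sup>2" by (simp add: sl[OF \<phi>])
  then show ?thesis by simp
qed

section \<open>Mollification and the Gagliardo energy\<close>

lemma mollify_integrand:
  assumes u[measurable]: "u \<in> borel_measurable borel" and M: "\<And>x. \<bar>u x\<bar> \<le> M"
  shows "integrable lborel (\<lambda>s. moll s * u (x - e * s))"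
  by (rule integrable_mult_bounded[OF moll_integrable]) (use M in auto)

lemma mollify_measurable[measurable]:
  assumes [measurable]: "u \<in> borel_measurable borel" shows "mollify e u \<in> borel_measurable borel"
  unfolding mollify_def[abs_def] by measurable

lemma mollify_bounded:
  assumes u: "u \<in> borel_measurable borel" and M: "\<And>x. \<bar>u x\<bar> \<le> M"
  shows "\<bar>mollify e u x\<bar> \<le> M"
proof -
  have "\<bar>mollify e u x\<bar> \<le> (\<integral>s. \<bar>moll s * u (x - e * s)\<bar> \<partial>lborel)"
    unfolding mollify_def by (rule integral_abs_bound)
  also have "\<dots> \<le> (\<integral>s. moll s * M \<partial>lborel)"
  proof (rule integral_mono)
    show "integrable lborel (\<lambda>s. \<bar>moll s * u (x - e * s)\<bar>)" by (rule integrable_abs[OF mollify_integrand[OF u M]])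
  qed (use moll_integrable M in \<open>auto simp: abs_mult mult_left_mono\<close>)
  finally show ?thesis by (simp add: moll_integral)
qed

lemma mollify_diff:
  assumes u: "u \<in> borel_measurable borel" "\<And>x. \<bar>u x\<bar> \<le> M" and v: "v \<in> borel_measurable borel" "\<And>x. \<bar>v x\<bar> \<le> M'"
  shows "mollify e (\<lambda>x. u x - v x) x = mollify e u x - mollify e v x"
  unfolding mollify_def using mollify_integrand[OF u] mollify_integrand[OF v] by (simp add: right_diff_distrib)

lemma mollify_shift: "mollify e u (x + h) = mollify e (\<lambda>x. u (x + h)) x"
  by (simp add: mollify_def algebra_simps)

text \<open>The Cauchy-Schwarz inequality with respect to the probability density \<open>moll\<close>, then translation invariance.\<close>

lemma mollify_L2:
  assumes D[measurable]: "D \<in> borel_measurable borel" and M: "\<And>x. \<bar>D x\<bar> \<le> M"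
  shows "(\<integral>\<^sup>+x. ennreal ((mollify e D x)\<^sup>2) \<partial>lborel) \<le> (\<integral>\<^sup>+x. ennreal ((D x)\<^sup>2) \<partial>lborel)"
proof -
  have pt: "ennreal ((mollify e D x)\<^sup>2) \<le> (\<integral>\<^sup>+s. ennreal (moll s) * ennreal ((D (x - e * s))\<^sup>2) \<partial>lborel)" for x
  proof -
    have "ennreal \<bar>mollify e D x\<bar> \<le> (\<integral>\<^sup>+s. ennreal (norm (moll s * D (x - e * s))) \<partial>lborel)"
      unfolding mollify_def using integral_norm_bound_ennreal[OF mollify_integrand[OF D M, of x e]] by simp
    also have "\<dots> = (\<integral>\<^sup>+s. ennreal (sqrt (moll s)) * ennreal (sqrt (moll s) * \<bar>D (x - e * s)\<bar>) \<partial>lborel)"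
      by (intro nn_integral_cong) (simp add: ennreal_mult[symmetric] abs_mult flip: mult.assoc)
    finally have "(ennreal \<bar>mollify e D x\<bar>)\<^sup>2 \<le> (\<integral>\<^sup>+s. ennreal (sqrt (moll s)) * ennreal (sqrt (moll s) * \<bar>D (x - e * s)\<bar>) \<partial>lborel)\<^sup>2"
      by (intro power_mono) auto
    also have "\<dots> \<le> (\<integral>\<^sup>+s. (ennreal (sqrt (moll s)))\<^sup>2 \<partial>lborel) * (\<integral>\<^sup>+s. (ennreal (sqrt (moll s) * \<bar>D (x - e * s)\<bar>))\<^sup>2 \<partial>lborel)"
      by (rule Cauchy_Schwarz_nn_integral) auto
    also have "(\<integral>\<^sup>+s. (ennreal (sqrt (moll s)))\<^sup>2 \<partial>lborel) = 1"
      using nn_integral_eq_integral[OF moll_integrable] by (simp add: ennreal_power moll_integral)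
    also have "(\<integral>\<^sup>+s. (ennreal (sqrt (moll s) * \<bar>D (x - e * s)\<bar>))\<^sup>2 \<partial>lborel) = (\<integral>\<^sup>+s. ennreal (moll s) * ennreal ((D (x - e * s))\<^sup>2) \<partial>lborel)"
      by (simp add: ennreal_power power_mult_distrib ennreal_mult)
    finally show ?thesis by (simp add: ennreal_power)
  qed
  have "(\<integral>\<^sup>+x. ennreal ((mollify e D x)\<^sup>2) \<partial>lborel) \<le> (\<integral>\<^sup>+x. (\<integral>\<^sup>+s. ennreal (moll s) * ennreal ((D (x - e * s))\<^sup>2) \<partial>lborel) \<partial>lborel)"
    by (intro nn_integral_mono pt)
  also have "\<dots> = (\<integral>\<^sup>+s. (\<integral>\<^sup>+x. ennreal (moll s) * ennreal ((D (x - e * s))\<^sup>2) \<partial>lborel) \<partial>lborel)"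
    by (rule lborel_pair.Fubini') measurable
  also have "\<dots> = (\<integral>\<^sup>+s. ennreal (moll s) * (\<integral>\<^sup>+x. ennreal ((D x)\<^sup>2) \<partial>lborel) \<partial>lborel)"
  proof (rule nn_integral_cong)
    fix s
    have "(\<integral>\<^sup>+x. ennreal ((D x)\<^sup>2) \<partial>lborel) = (\<integral>\<^sup>+x. ennreal ((D (x - e * s))\<^sup>2) \<partial>lborel)"
      using nn_integral_real_affine[of "\<lambda>x. ennreal ((D x)\<^sup>2)" 1 "- (e * s)"] by simp
    then show "(\<integral>\<^sup>+x. ennreal (moll s) * ennreal ((D (x - e * s))\<^sup>2) \<partial>lborel) = ennreal (moll s) * (\<integral>\<^sup>+x. ennreal ((D x)\<^sup>2) \<partial>lborel)"
      by (simp add: nn_integral_cmult)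
  qed
  also have "\<dots> = (\<integral>\<^sup>+s. ennreal (moll s) \<partial>lborel) * (\<integral>\<^sup>+x. ennreal ((D x)\<^sup>2) \<partial>lborel)" by (rule nn_integral_multc) simp
  also have "(\<integral>\<^sup>+s. ennreal (moll s) \<partial>lborel) = 1"
    using nn_integral_eq_integral[OF moll_integrable] by (simp add: moll_integral)
  finally show ?thesis by simp
qed

text \<open>Slicing by the step \<open>h\<close> reduces energy estimates to estimates of L2 norms of increments.\<close>

lemma energy_slices:
  fixes u :: "real \<Rightarrow> real"
  assumes [measurable]: "u \<in> borel_measurable borel"
  shows "(\<integral>\<^sup>+p. ennreal ((norm (diff_quot u p))\<^sup>2) \<partial>lborel2) = (\<integral>\<^sup>+h. (\<integral>\<^sup>+x. ennreal ((u (x + h) - u x)\<^sup>2) \<partial>lborel) * ennreal (1 / h\<^sup>2) \<partial>lborel)"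
proof -
  have "(\<integral>\<^sup>+p. ennreal ((norm (diff_quot u p))\<^sup>2) \<partial>lborel2) = (\<integral>\<^sup>+h. (\<integral>\<^sup>+x. ennreal ((norm (diff_quot u (h, x)))\<^sup>2) \<partial>lborel) \<partial>lborel)"
    by (rule lborel.nn_integral_fst[symmetric]) measurable
  also have "\<dots> = (\<integral>\<^sup>+h. (\<integral>\<^sup>+x. ennreal ((u (x + h) - u x)\<^sup>2) * ennreal (1 / h\<^sup>2) \<partial>lborel) \<partial>lborel)"
    by (intro nn_integral_cong) (simp add: diff_quot_def ennreal_mult[symmetric] power_mult_distrib divide_inverse mult.commute power_inverse)
  finally show ?thesis by (simp add: nn_integral_multc)
qed

lemma finite_energyI_nn:
  fixes u :: "real \<Rightarrow> real"
  assumes [measurable]: "u \<in> borel_measurable borel" 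
    and le: "(\<integral>\<^sup>+p. ennreal ((norm (diff_quot u p))\<^sup>2) \<partial>lborel2) \<le> ennreal (B\<^sup>2)" and B: "0 \<le> B"
  shows "finite_energy u" "energy_norm u \<le> B"
proof -
  have i: "integrable lborel2 (\<lambda>p. (norm (diff_quot u p))\<^sup>2)"
    using le by (intro integrableI_bounded) (auto intro: le_less_trans)
  then show "finite_energy u" by (simp add: finite_energy_def sq_int_def)
  have "ennreal ((energy_norm u)\<^sup>2) \<le> ennreal (B\<^sup>2)" using le i by (simp add: L2nrm_sq nn_integral_eq_integral)
  then have "(energy_norm u)\<^sup>2 \<le> B\<^sup>2" by simp
  then show "energy_norm u \<le> B" by (rule power2_le_imp_le[OF _ B])
qed

lemma nn_energy: "finite_energy u \<Longrightarrow> (\<integral>\<^sup>+p. ennreal ((norm (diff_quot u p))\<^sup>2) \<partial>lborel2) = ennreal ((energy_norm u)\<^sup>2)"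
  by (simp add: L2nrm_sq nn_integral_eq_integral finite_energy_def sq_int_def)

text \<open>Mollification commutes with the formation of increments and does not increase their L2 norms.\<close>

lemma mollify_energy:
  assumes u: "finite_energy u" and M: "\<And>x. \<bar>u x\<bar> \<le> M"
  shows "finite_energy (mollify e u)" "energy_norm (mollify e u) \<le> energy_norm u"
proof -
  have um[measurable]: "u \<in> borel_measurable borel" by (rule finite_energyD(1)[OF u])
  have "(\<integral>\<^sup>+p. ennreal ((norm (diff_quot (mollify e u) p))\<^sup>2) \<partial>lborel2) \<le> (\<integral>\<^sup>+p. ennreal ((norm (diff_quot u p))\<^sup>2) \<partial>lborel2)"
    unfolding energy_slices[OF um] energy_slices[OF mollify_measurable[OF um]]
  proof (rule nn_integral_mono, rule mult_right_mono)
    fix h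
    have "mollify e u (x + h) - mollify e u x = mollify e (\<lambda>x. u (x + h) - u x) x" for x
      unfolding mollify_shift by (rule mollify_diff[symmetric]) (use M in auto)
    moreover have "\<bar>u (x + h) - u x\<bar> \<le> 2 * M" for x using M[of "x + h"] M[of x] by linarith
    ultimately show "(\<integral>\<^sup>+x. ennreal ((mollify e u (x + h) - mollify e u x)\<^sup>2) \<partial>lborel) \<le> (\<integral>\<^sup>+x. ennreal ((u (x + h) - u x)\<^sup>2) \<partial>lborel)"
      using mollify_L2[of "\<lambda>x. u (x + h) - u x" "2 * M" e] by simp
  qed simp
  then have "(\<integral>\<^sup>+p. ennreal ((norm (diff_quot (mollify e u) p))\<^sup>2) \<partial>lborel2) \<le> ennreal ((energy_norm u)\<^sup>2)"
    by (simp only: nn_energy[OF u])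
  from finite_energyI_nn[OF _ this] show "finite_energy (mollify e u)" "energy_norm (mollify e u) \<le> energy_norm u" by auto
qed

lemma mollify_symmetric:
  fixes v u :: "real \<Rightarrow> real"
  assumes v: "integrable lborel v" and u[measurable]: "u \<in> borel_measurable borel" and M: "\<And>x. \<bar>u x\<bar> \<le> M"
  shows "(\<integral>x. mollify e v x * u x \<partial>lborel) = (\<integral>x. v x * mollify e u x \<partial>lborel)"
proof -
  have [measurable]: "v \<in> borel_measurable borel" using v by auto
  have M0: "0 \<le> M" using M[of 0] by linarith
  have int: "integrable lborel2 (\<lambda>(x, s). moll s * v (x - e * s) * u x)"
    if [measurable]: "u \<in> borel_measurable borel" and "\<And>x. \<bar>u x\<bar> \<le> M" for u
  proof -
    have "integrable lborel2 (\<lambda>(s, x). moll s * v (x - e * s) * u x)"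
    proof (rule lborel_pair.Fubini_integrable)
      have i: "integrable lborel (\<lambda>x. v (x - e * s) * u x)" for s
        using integrable_mult_bounded[OF integrable_shift[OF v, of "- (e * s)"] that] by simp
      have le: "L1nrm (\<lambda>x. v (x - e * s) * u x) \<le> M * L1nrm v" for s
        using L1nrm_mult_bounded[OF integrable_shift[OF v, of "- (e * s)"] that] L1nrm_shift[of v "- (e * s)"] by simp
      have eq: "(\<integral>x. norm (case (s, x) of (s, x) \<Rightarrow> moll s * v (x - e * s) * u x) \<partial>lborel) = moll s * L1nrm (\<lambda>x. v (x - e * s) * u x)" for s
        by (simp add: L1nrm_def abs_mult mult.assoc)
      show "integrable lborel (\<lambda>s. \<integral>x. norm (case (s, x) of (s, x) \<Rightarrow> moll s * v (x - e * s) * u x) \<partial>lborel)"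
      proof (rule Bochner_Integration.integrable_bound)
        show "integrable lborel (\<lambda>s. M * L1nrm v * moll s)" using moll_integrable by simp
        show "AE s in lborel. norm (\<integral>x. norm (case (s, x) of (s, x) \<Rightarrow> moll s * v (x - e * s) * u x) \<partial>lborel) \<le> norm (M * L1nrm v * moll s)"
          unfolding eq using mult_left_mono[OF le moll_nonneg] M0 by (simp add: abs_mult mult_ac)
      qed measurable
      show "AE s in lborel. integrable lborel (\<lambda>x. case (s, x) of (s, x) \<Rightarrow> moll s * v (x - e * s) * u x)"
        using i by (simp add: mult.assoc)
    qed measurable
    from lborel_pair.integrable_product_swap[OF this] show ?thesis by (simp add: split_beta')
  qed
  have "(\<integral>x. mollify e v x * u x \<partial>lborel) = (\<integral>x. (\<integral>s. moll s * v (x - e * s) * u x \<partial>lborel) \<partial>lborel)"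
    by (simp add: mollify_def)
  also have "\<dots> = (\<integral>s. (\<integral>x. moll s * v (x - e * s) * u x \<partial>lborel) \<partial>lborel)"
    by (rule lborel_pair.Fubini_integral[OF int[OF u M], symmetric])
  also have "\<dots> = (\<integral>s. (\<integral>x. moll s * v x * u (x + e * s) \<partial>lborel) \<partial>lborel)"
  proof (rule Bochner_Integration.integral_cong[OF refl])
    fix s show "(\<integral>x. moll s * v (x - e * s) * u x \<partial>lborel) = (\<integral>x. moll s * v x * u (x + e * s) \<partial>lborel)"
      using integral_shift[of "\<lambda>x. moll s * v (x - e * s) * u x" "e * s"] by simp
  qed
  also have "\<dots> = (\<integral>s. (\<integral>x. moll s * v x * u (x - e * s) \<partial>lborel) \<partial>lborel)"
    using lborel_integral_real_affine[of "-1" "\<lambda>s. \<integral>x. moll s * v x * u (x + e * s) \<partial>lborel" 0] by (simp add: moll_even)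
  also have "\<dots> = (\<integral>x. (\<integral>s. moll s * v x * u (x - e * s) \<partial>lborel) \<partial>lborel)"
  proof (rule lborel_pair.Fubini_integral)
    have "integrable lborel2 (\<lambda>(x, s). v x * moll s)" by (rule integrable_prod_mult[OF v moll_integrable])
    then have "integrable lborel2 (\<lambda>p. M * (case p of (x, s) \<Rightarrow> v x * moll s))" by simp
    then show "integrable lborel2 (\<lambda>(x, s). moll s * v x * u (x - e * s))"
    proof (rule Bochner_Integration.integrable_bound)
      have "\<bar>moll s * v x * u (x - e * s)\<bar> \<le> \<bar>M * (v x * moll s)\<bar>" for x s
        using mult_left_mono[OF M, of "\<bar>moll s * v x\<bar>" "x - e * s"] M0 by (simp add: abs_mult mult_ac)
      then show "AE p in lborel2. norm (case p of (x, s) \<Rightarrow> moll s * v x * u (x - e * s)) \<le> norm (M * (case p of (x, s) \<Rightarrow> v x * moll s))"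
        by (intro always_eventually) auto
    qed measurable
  qed
  also have "\<dots> = (\<integral>x. v x * mollify e u x \<partial>lborel)"
  proof (rule Bochner_Integration.integral_cong[OF refl])
    fix x
    have "(\<integral>s. moll s * v x * u (x - e * s) \<partial>lborel) = (\<integral>s. v x * (moll s * u (x - e * s)) \<partial>lborel)" by (simp add: mult_ac)
    then show "(\<integral>s. moll s * v x * u (x - e * s) \<partial>lborel) = v x * mollify e u x" by (simp add: mollify_def)
  qed
  finally show ?thesis .
qed

section \<open>Almost everywhere convergence of mollifications\<close>

text \<open>A finite measure on the line with which bounded functions become integrable, and which translations by
  at most \<open>1\<close> change only by a bounded factor.\<close>

definition cauchy_weight :: "real \<Rightarrow> real" where "cauchy_weight x = inverse (1 + x\<^sup>2)"

lemma cauchy_weight_props: "0 < cauchy_weight x" "cauchy_weight \<in> borel_measurable borel" "integrable lborel cauchy_weight"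
  "\<bar>t\<bar> \<le> 1 \<Longrightarrow> cauchy_weight (x + t) \<le> 3 * cauchy_weight x"
proof -
  show "0 < cauchy_weight x" by (simp add: cauchy_weight_def add_pos_nonneg)
  show "cauchy_weight \<in> borel_measurable borel" unfolding cauchy_weight_def[abs_def] by measurable
  show "integrable lborel cauchy_weight" using integrable_inverse_1_plus_square by (simp add: set_integrable_def cauchy_weight_def[abs_def])
  assume t: "\<bar>t\<bar> \<le> 1"
  then have "t\<^sup>2 \<le> 1" by (simp add: abs_square_le_1)
  moreover have "x\<^sup>2 \<le> 2 * (x + t)\<^sup>2 + 2 * t\<^sup>2"
    using zero_le_power2[of "x + 2 * t"] by (simp add: power2_eq_square algebra_simps)
  moreover have "1 + X \<le> 3 * (1 + P)" if "T \<le> 1" "X \<le> 2 * P + 2 * T" "0 \<le> P" for X P T :: real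
  proof -
    have "1 + X \<le> 1 + (2 * P + 2 * T)" using that(2) by simp
    also have "\<dots> \<le> 1 + (3 * P + 2 * 1)" using that by (intro add_mono) auto
    finally show ?thesis by simp
  qed
  ultimately have le: "1 + x\<^sup>2 \<le> 3 * (1 + (x + t)\<^sup>2)" using zero_le_power2[of "x + t"] by blast
  have p: "0 < 1 + x\<^sup>2" "0 < 1 + (x + t)\<^sup>2" by (auto simp: add_pos_nonneg)
  have "inverse (1 + (x + t)\<^sup>2) \<le> 3 * inverse (1 + x\<^sup>2)"
    using le p by (simp add: field_simps)
  then show "cauchy_weight (x + t) \<le> 3 * cauchy_weight x" by (simp add: cauchy_weight_def)
qed

lemmas cauchy_weight_measurable[measurable] = cauchy_weight_props(2)

lemma cauchy_weight_bounded_integrable: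
  fixes g :: "real \<Rightarrow> real"
  assumes "g \<in> borel_measurable borel" "\<And>x. \<bar>g x\<bar> \<le> M"
  shows "integrable lborel (\<lambda>x. g x * cauchy_weight x)"
  using integrable_mult_bounded[OF cauchy_weight_props(3) assms] by (simp add: mult.commute)

text \<open>A Lebesgue measurable function is almost everywhere the limit of continuous functions; truncation at
  the levels \<open>M\<close> and \<open>- M\<close> keeps the bound.\<close>

lemma bounded_measurable_approx:
  fixes u :: "real \<Rightarrow> real"
  assumes u[measurable]: "u \<in> borel_measurable borel" and M: "\<And>x. \<bar>u x\<bar> \<le> M"
  shows "\<exists>g. (\<forall>n. continuous_on UNIV (g n)) \<and> (\<forall>n x. \<bar>g n x\<bar> \<le> M) \<and> (AE x in lborel. (\<lambda>n. g n x) \<longlonglongrightarrow> u x)"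
proof -
  have "u \<in> borel_measurable lebesgue" using u by (simp add: measurable_completion)
  then have "u measurable_on UNIV" by (intro lebesgue_measurable_imp_measurable_on) auto
  then obtain N g where N: "negligible N" and g: "\<And>n. continuous_on UNIV (g n)" "\<And>x. x \<notin> N \<Longrightarrow> (\<lambda>n. g n x) \<longlonglongrightarrow> u x"
    unfolding measurable_on_def by auto
  have "AE x in lebesgue. x \<notin> N" using N by (intro AE_not_in) (simp add: negligible_iff_null_sets)
  then have ae: "AE x in lborel. x \<notin> N" by (simp add: AE_completion_iff)
  have M0: "0 \<le> M" using M[of 0] by linarith
  show ?thesis
  proof (intro exI conjI allI)
    show "continuous_on UNIV (\<lambda>x. max (- M) (min M (g n x)))" for n by (intro continuous_intros g)
    show "\<bar>max (- M) (min M (g n x))\<bar> \<le> M" for n x using M0 by (auto simp: abs_le_iff)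
    show "AE x in lborel. (\<lambda>n. max (- M) (min M (g n x))) \<longlonglongrightarrow> u x"
      using ae
    proof eventually_elim
      case (elim x)
      have "(\<lambda>n. max (- M) (min M (g n x))) \<longlonglongrightarrow> max (- M) (min M (u x))"
        by (intro tendsto_intros g(2) elim)
      moreover have "max (- M) (min M (u x)) = u x" using M[of x] by (auto simp: abs_le_iff)
      ultimately show ?case by simp
    qed
  qed
qed

text \<open>Continuity of translation in weighted L1: clear for continuous functions by dominated convergence,
  and it passes to \<open>u\<close> by approximation, as translations are uniformly bounded on the weighted space.\<close>

lemma weighted_translation_continuous:
  fixes u :: "real \<Rightarrow> real"
  assumes u[measurable]: "u \<in> borel_measurable borel" and M: "\<And>x. \<bar>u x\<bar> \<le> M"
    and t: "t \<longlonglongrightarrow> 0" "\<And>n. \<bar>t n\<bar> \<le> 1"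
  shows "(\<lambda>n. \<integral>x. \<bar>u (x - t n) - u x\<bar> * cauchy_weight x \<partial>lborel) \<longlonglongrightarrow> 0"
proof -
  obtain g where g: "\<And>k. continuous_on UNIV (g k)" "\<And>k x. \<bar>g k x\<bar> \<le> M" and lim: "AE x in lborel. (\<lambda>k. g k x) \<longlonglongrightarrow> u x"
    using bounded_measurable_approx[OF u M] by blast
  have [measurable]: "g k \<in> borel_measurable borel" for k by (rule borel_measurable_continuous_onI[OF g(1)])
  have b: "\<bar>p x - q y\<bar> \<le> 2 * M" if "\<And>w. \<bar>p w\<bar> \<le> M" "\<And>w. \<bar>q w\<bar> \<le> M" for p q :: "real \<Rightarrow> real" and x y
    using that(1)[of x] that(2)[of y] by linarith
  have wi: "integrable lborel (\<lambda>x. 2 * M * cauchy_weight x)" using cauchy_weight_props(3) by simp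
  have dom: "norm (\<bar>p x - q y\<bar> * cauchy_weight z) \<le> 2 * M * cauchy_weight z" if "\<And>w. \<bar>p w\<bar> \<le> M" "\<And>w. \<bar>q w\<bar> \<le> M" for p q :: "real \<Rightarrow> real" and x y z
  proof -
    have "\<bar>p x - q y\<bar> \<le> 2 * M" by (rule b[OF that])
    from mult_right_mono[OF this less_imp_le[OF cauchy_weight_props(1)[of z]]] show ?thesis
      using cauchy_weight_props(1)[of z] by (simp add: abs_mult)
  qed
  define d where "d k = (\<integral>x. \<bar>u x - g k x\<bar> * cauchy_weight x \<partial>lborel)" for k
  have "d \<longlonglongrightarrow> (\<integral>x. \<bar>u x - u x\<bar> * cauchy_weight x \<partial>lborel)"
    unfolding d_def[abs_def]
  proof (rule integral_dominated_convergence[OF _ _ wi])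
    show "AE x in lborel. (\<lambda>k. \<bar>u x - g k x\<bar> * cauchy_weight x) \<longlonglongrightarrow> \<bar>u x - u x\<bar> * cauchy_weight x"
      using lim by eventually_elim (intro tendsto_intros)
    show "AE x in lborel. norm (\<bar>u x - g k x\<bar> * cauchy_weight x) \<le> 2 * M * cauchy_weight x" for k
      by (intro always_eventually allI dom M g)
  qed measurable
  then have d0: "d \<longlonglongrightarrow> 0" by simp
  have mi: "integrable lborel (\<lambda>x. \<bar>p (x - a) - q (x - b)\<bar> * cauchy_weight x)"
    if [measurable]: "p \<in> borel_measurable borel" "q \<in> borel_measurable borel" and pq: "\<And>x. \<bar>p x\<bar> \<le> M" "\<And>x. \<bar>q x\<bar> \<le> M" for p q :: "real \<Rightarrow> real" and a b
    by (rule cauchy_weight_bounded_integrable[where M="2 * M"]) (use b[OF pq] in auto)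
  have split: "(\<integral>x. \<bar>u (x - t n) - u x\<bar> * cauchy_weight x \<partial>lborel) \<le> 4 * d k + (\<integral>x. \<bar>g k (x - t n) - g k x\<bar> * cauchy_weight x \<partial>lborel)" for n k
  proof -
    have i1: "integrable lborel (\<lambda>x. \<bar>u (x - t n) - g k (x - t n)\<bar> * cauchy_weight x)" by (rule mi) (use M g in auto)
    have i2: "integrable lborel (\<lambda>x. \<bar>g k (x - t n) - g k x\<bar> * cauchy_weight x)" using mi[of "g k" "g k" "t n" 0] g by simp
    have i3: "integrable lborel (\<lambda>x. \<bar>u x - g k x\<bar> * cauchy_weight x)" using mi[of u "g k" 0 0] g M by simp
    have i4: "integrable lborel (\<lambda>x. \<bar>u (x - t n) - u x\<bar> * cauchy_weight x)" using mi[of u u "t n" 0] g M by simp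
    have "(\<integral>x. \<bar>u (x - t n) - u x\<bar> * cauchy_weight x \<partial>lborel) \<le> (\<integral>x. \<bar>u (x - t n) - g k (x - t n)\<bar> * cauchy_weight x + (\<bar>g k (x - t n) - g k x\<bar> * cauchy_weight x + \<bar>u x - g k x\<bar> * cauchy_weight x) \<partial>lborel)"
    proof (rule integral_mono[OF i4])
      fix x
      have "\<bar>u (x - t n) - u x\<bar> \<le> \<bar>u (x - t n) - g k (x - t n)\<bar> + (\<bar>g k (x - t n) - g k x\<bar> + \<bar>u x - g k x\<bar>)" by linarith
      from mult_right_mono[OF this less_imp_le[OF cauchy_weight_props(1)[of x]]]
      show "\<bar>u (x - t n) - u x\<bar> * cauchy_weight x \<le> \<bar>u (x - t n) - g k (x - t n)\<bar> * cauchy_weight x + (\<bar>g k (x - t n) - g k x\<bar> * cauchy_weight x + \<bar>u x - g k x\<bar> * cauchy_weight x)"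
        by (simp add: algebra_simps)
    qed (use i1 i2 i3 in auto)
    also have "\<dots> = (\<integral>x. \<bar>u (x - t n) - g k (x - t n)\<bar> * cauchy_weight x \<partial>lborel) + ((\<integral>x. \<bar>g k (x - t n) - g k x\<bar> * cauchy_weight x \<partial>lborel) + d k)"
      using i1 i2 i3 by (simp add: d_def)
    also have "(\<integral>x. \<bar>u (x - t n) - g k (x - t n)\<bar> * cauchy_weight x \<partial>lborel) = (\<integral>x. \<bar>u x - g k x\<bar> * cauchy_weight (x + t n) \<partial>lborel)"
      using integral_shift[of "\<lambda>x. \<bar>u (x - t n) - g k (x - t n)\<bar> * cauchy_weight x" "t n"] by simp
    also have "\<dots> \<le> (\<integral>x. 3 * (\<bar>u x - g k x\<bar> * cauchy_weight x) \<partial>lborel)"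
    proof (rule integral_mono)
      show "integrable lborel (\<lambda>x. \<bar>u x - g k x\<bar> * cauchy_weight (x + t n))"
        using integrable_shift[OF i1, of "t n"] by simp
      show "\<bar>u x - g k x\<bar> * cauchy_weight (x + t n) \<le> 3 * (\<bar>u x - g k x\<bar> * cauchy_weight x)" for x
        using mult_left_mono[OF cauchy_weight_props(4)[OF t(2)[of n], of x], of "\<bar>u x - g k x\<bar>"] by simp
    qed (use i3 in auto)
    also have "\<dots> = 3 * d k" by (simp add: d_def)
    finally show ?thesis by simp
  qed
  show ?thesis
  proof (rule LIMSEQ_I)
    fix r :: real assume r: "0 < r"
    obtain k where k: "\<bar>d k\<bar> < r / 8" using LIMSEQ_D[OF d0, of "r / 8"] r by auto
    have "(\<lambda>n. \<integral>x. \<bar>g k (x - t n) - g k x\<bar> * cauchy_weight x \<partial>lborel) \<longlonglongrightarrow> (\<integral>x. \<bar>g k (x - 0) - g k x\<bar> * cauchy_weight x \<partial>lborel)"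
    proof (rule integral_dominated_convergence[OF _ _ wi])
      show "AE x in lborel. (\<lambda>n. \<bar>g k (x - t n) - g k x\<bar> * cauchy_weight x) \<longlonglongrightarrow> \<bar>g k (x - 0) - g k x\<bar> * cauchy_weight x"
      proof (intro always_eventually allI tendsto_intros)
        fix x
        have "isCont (g k) (x - 0)" using g(1) by (simp add: continuous_on_eq_continuous_at)
        then show "(\<lambda>n. g k (x - t n)) \<longlonglongrightarrow> g k (x - 0)"
          by (rule isCont_tendsto_compose) (intro tendsto_intros t)
      qed
      show "AE x in lborel. norm (\<bar>g k (x - t n) - g k x\<bar> * cauchy_weight x) \<le> 2 * M * cauchy_weight x" for n
        by (intro always_eventually allI dom g)
    qed measurable
    then have "(\<lambda>n. \<integral>x. \<bar>g k (x - t n) - g k x\<bar> * cauchy_weight x \<partial>lborel) \<longlonglongrightarrow> 0" by simp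
    from LIMSEQ_D[OF this, of "r / 2"] r obtain n0 where n0: "\<And>n. n \<ge> n0 \<Longrightarrow> \<bar>\<integral>x. \<bar>g k (x - t n) - g k x\<bar> * cauchy_weight x \<partial>lborel\<bar> < r / 2"
      by auto
    have "norm ((\<integral>x. \<bar>u (x - t n) - u x\<bar> * cauchy_weight x \<partial>lborel) - 0) < r" if "n \<ge> n0" for n
    proof -
      have "0 \<le> (\<integral>x. \<bar>u (x - t n) - u x\<bar> * cauchy_weight x \<partial>lborel)" by (intro Bochner_Integration.integral_nonneg) (simp add: less_imp_le cauchy_weight_props(1))
      then show ?thesis using split[of n k] n0[OF that] k by simp
    qed
    then show "\<exists>n0. \<forall>n\<ge>n0. norm ((\<integral>x. \<bar>u (x - t n) - u x\<bar> * cauchy_weight x \<partial>lborel) - 0) < r" by blast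
  qed
qed

text \<open>Mollifications converge in weighted L1, hence almost everywhere along a sequence of scales. A
  sequence is enough for every later use.\<close>

lemma mollify_AE_tendsto:
  fixes u :: "real \<Rightarrow> real"
  assumes u[measurable]: "u \<in> borel_measurable borel" and M: "\<And>x. \<bar>u x\<bar> \<le> M"
  shows "\<exists>e. (\<forall>n. 0 < e n \<and> e n \<le> 1) \<and> (AE x in lborel. (\<lambda>n. mollify (e n) u x) \<longlonglongrightarrow> u x)"
proof -
  define e where "e n = inverse (real (Suc n))" for n
  have e: "0 < e n" "e n \<le> 1" for n by (auto simp: e_def inverse_le_1_iff)
  have e0: "e \<longlonglongrightarrow> 0" unfolding e_def[abs_def] by (rule LIMSEQ_inverse_real_of_nat)
  have M0: "0 \<le> M" using M[of 0] by linarith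
  define \<omega> where "\<omega> t = (\<integral>x. \<bar>u (x - t) - u x\<bar> * cauchy_weight x \<partial>lborel)" for t
  have [measurable]: "\<omega> \<in> borel_measurable borel" unfolding \<omega>_def[abs_def] by measurable
  have b: "\<bar>u x - u y\<bar> \<le> 2 * M" for x y using M[of x] M[of y] by linarith
  have bw: "\<bar>u x - u y\<bar> * cauchy_weight z \<le> 2 * M * cauchy_weight z" for x y z
    using mult_right_mono[OF b less_imp_le[OF cauchy_weight_props(1)]] .
  have \<omega>0: "0 \<le> \<omega> t" for t unfolding \<omega>_def by (intro Bochner_Integration.integral_nonneg) (simp add: less_imp_le cauchy_weight_props(1))
  have \<omega>1: "\<omega> t \<le> (\<integral>x. 2 * M * cauchy_weight x \<partial>lborel)" for t
    unfolding \<omega>_def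
    by (intro integral_mono cauchy_weight_bounded_integrable[where M="2*M"] bw) (use b cauchy_weight_props(3) M0 in auto)
  define a where "a n = (\<integral>s. moll s * \<omega> (e n * s) \<partial>lborel)" for n
  have "a \<longlonglongrightarrow> (\<integral>s. (0::real) \<partial>(lborel :: real measure))"
    unfolding a_def[abs_def]
  proof (rule integral_dominated_convergence[where w="\<lambda>s. moll s * (\<integral>x. 2 * M * cauchy_weight x \<partial>lborel)"])
    show "AE s in lborel. (\<lambda>n. moll s * \<omega> (e n * s)) \<longlonglongrightarrow> 0"
    proof (intro always_eventually allI)
      fix s
      show "(\<lambda>n. moll s * \<omega> (e n * s)) \<longlonglongrightarrow> 0"
      proof (cases "\<bar>s\<bar> < 1")
        case True
        have "(\<lambda>n. e n * s) \<longlonglongrightarrow> 0 * s" by (intro tendsto_intros e0)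
        moreover have "\<bar>e n * s\<bar> \<le> 1" for n using mult_mono[of "e n" 1 "\<bar>s\<bar>" 1] e[of n] True by (simp add: abs_mult)
        ultimately have "(\<lambda>n. \<omega> (e n * s)) \<longlonglongrightarrow> 0"
          unfolding \<omega>_def by (intro weighted_translation_continuous[OF u M]) auto
        then have "(\<lambda>n. moll s * \<omega> (e n * s)) \<longlonglongrightarrow> moll s * 0" by (intro tendsto_intros)
        then show ?thesis by simp
      qed (simp add: moll_outside)
    qed
    show "AE s in lborel. norm (moll s * \<omega> (e n * s)) \<le> moll s * (\<integral>x. 2 * M * cauchy_weight x \<partial>lborel)" for n
      using mult_left_mono[OF \<omega>1 moll_nonneg] \<omega>0 by (simp add: abs_mult)
  qed (use moll_integrable in auto)
  then have a0: "a \<longlonglongrightarrow> 0" by simp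
  let ?d = "\<lambda>n x. (mollify (e n) u x - u x) * cauchy_weight x"
  have di: "integrable lborel (?d n)" for n
  proof (rule cauchy_weight_bounded_integrable[where M="2 * M"])
    show "\<bar>mollify (e n) u x - u x\<bar> \<le> 2 * M" for x using mollify_bounded[OF u M, of "e n" x] M[of x] by linarith
  qed measurable
  have le: "(\<integral>x. norm (?d n x) \<partial>lborel) \<le> a n" for n
  proof -
    let ?F = "\<lambda>x s. moll s * (\<bar>u (x - e n * s) - u x\<bar> * cauchy_weight x)"
    have int: "integrable lborel2 (case_prod ?F)"
    proof (rule Bochner_Integration.integrable_bound)
      show "integrable lborel2 (\<lambda>(x, s). (2 * M * cauchy_weight x) * moll s)"
        by (rule integrable_prod_mult[OF _ moll_integrable]) (use cauchy_weight_props(3) in simp)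
      have "norm (?F x s) \<le> norm ((2 * M * cauchy_weight x) * moll s)" for x s
        using mult_left_mono[OF bw[of "x - e n * s" x x] moll_nonneg[of s]] M0 cauchy_weight_props(1)[of x] by (simp add: abs_mult mult_ac)
      then show "AE p in lborel2. norm (case_prod ?F p) \<le> norm (case p of (x, s) \<Rightarrow> (2 * M * cauchy_weight x) * moll s)"
        by (intro always_eventually) auto
    qed measurable
    have pt: "norm (?d n x) \<le> (\<integral>s. ?F x s \<partial>lborel)" for x
    proof -
      have i: "integrable lborel (\<lambda>s. moll s * (u (x - e n * s) - u x))"
        by (rule integrable_mult_bounded[OF moll_integrable]) (use b in auto)
      have "mollify (e n) u x - u x = (\<integral>s. moll s * (u (x - e n * s) - u x) \<partial>lborel)"
        using mollify_integrand[OF u M, of x "e n"] moll_integrable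
        by (simp add: mollify_def right_diff_distrib moll_integral)
      then have "\<bar>mollify (e n) u x - u x\<bar> \<le> (\<integral>s. \<bar>moll s * (u (x - e n * s) - u x)\<bar> \<partial>lborel)"
        by (simp only: integral_abs_bound)
      from mult_right_mono[OF this less_imp_le[OF cauchy_weight_props(1)[of x]]]
      have "norm (?d n x) \<le> (\<integral>s. \<bar>moll s * (u (x - e n * s) - u x)\<bar> \<partial>lborel) * cauchy_weight x"
        using cauchy_weight_props(1)[of x] by (simp add: abs_mult)
      also have "\<dots> = (\<integral>s. \<bar>moll s * (u (x - e n * s) - u x)\<bar> * cauchy_weight x \<partial>lborel)" by simp
      also have "\<dots> = (\<integral>s. ?F x s \<partial>lborel)" by (simp only: abs_mult abs_of_nonneg[OF moll_nonneg] mult.assoc)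
      finally show ?thesis .
    qed
    have "(\<integral>x. norm (?d n x) \<partial>lborel) \<le> (\<integral>x. (\<integral>s. ?F x s \<partial>lborel) \<partial>lborel)"
      by (rule integral_mono) (use di lborel_pair.integrable_fst[OF int] pt in auto)
    also have "\<dots> = (\<integral>s. (\<integral>x. ?F x s \<partial>lborel) \<partial>lborel)" using lborel_pair.Fubini_integral[OF int] by simp
    also have "\<dots> = a n" by (simp add: a_def \<omega>_def)
    finally show ?thesis .
  qed
  have "(\<lambda>n. \<integral>x. norm (?d n x) \<partial>lborel) \<longlonglongrightarrow> 0"
    by (rule tendsto_sandwich[OF _ _ tendsto_const a0]) (use le in auto)
  from tendsto_L1_AE_subseq[OF di this] obtain r where r: "strict_mono r" "AE x in lborel. (\<lambda>n. ?d (r n) x) \<longlonglongrightarrow> 0" by blast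
  from r(2) have "AE x in lborel. (\<lambda>n. mollify (e (r n)) u x) \<longlonglongrightarrow> u x"
  proof eventually_elim
    case (elim x)
    have "(\<lambda>n. ?d (r n) x / cauchy_weight x) \<longlonglongrightarrow> 0 / cauchy_weight x" using elim cauchy_weight_props(1)[of x] by (intro tendsto_intros) auto
    then have "(\<lambda>n. mollify (e (r n)) u x - u x) \<longlonglongrightarrow> 0" using cauchy_weight_props(1)[of x] by simp
    then show ?case by (rule LIM_zero_cancel)
  qed
  then show ?thesis using e by (intro exI[of _ "\<lambda>n. e (r n)"]) auto
qed

text \<open>Test with mollifications of the sign of \<open>d\<close> on a bounded interval; the limit is the integral of
  \<open>\<bar>d\<bar>\<close> over that interval.\<close>

lemma test_function_separation:
  fixes d :: "real \<Rightarrow> real"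
  assumes [measurable]: "d \<in> borel_measurable borel"
    and loc: "\<And>r. set_integrable lborel {-r..r} d"
    and zero: "\<And>\<phi>. test_function \<phi> \<Longrightarrow> (\<integral>x. \<phi> x * d x \<partial>lborel) = 0"
  shows "AE x in lborel. d x = 0"
proof -
  have "AE x in lborel. x \<in> {-real r..real r} \<longrightarrow> d x = 0" for r :: nat
  proof -
    let ?I = "indicator {-real r..real r} :: real \<Rightarrow> real"
    define v where "v x = sgn (d x) * ?I x" for x
    have v[measurable]: "v \<in> borel_measurable borel" unfolding v_def[abs_def] by measurable
    have v1: "\<bar>v x\<bar> \<le> 1" for x by (simp add: v_def abs_mult sgn_if indicator_def)
    have "integrable lborel ?I" by (intro integrable_real_indicator emeasure_bounded_finite) auto
    then have vi: "integrable lborel v"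
      by (rule Bochner_Integration.integrable_bound) (auto simp: v_def abs_mult sgn_if indicator_def)
    have v0: "v x = 0" if "real r < \<bar>x\<bar>" for x using that by (auto simp: v_def indicator_def)
    obtain e where e: "\<And>n. 0 < e n" "\<And>n. e n \<le> 1" and lim: "AE x in lborel. (\<lambda>n. mollify (e n) v x) \<longlonglongrightarrow> v x"
      using mollify_AE_tendsto[OF v v1] by blast
    have t: "test_function (mollify (e n) v)" for n by (rule mollify_test[OF e(1) vi v0])
    let ?w = "\<lambda>x. norm (indicator {-(real r + 1)..real r + 1} x *\<^sub>R d x)"
    have "(\<lambda>n. \<integral>x. mollify (e n) v x * d x \<partial>lborel) \<longlonglongrightarrow> (\<integral>x. v x * d x \<partial>lborel)"
    proof (rule integral_dominated_convergence[where w="?w"])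
      show "integrable lborel ?w" using loc[of "real r + 1"] by (simp only: set_integrable_def integrable_norm)
      show "AE x in lborel. (\<lambda>n. mollify (e n) v x * d x) \<longlonglongrightarrow> v x * d x"
        using lim by eventually_elim (intro tendsto_intros)
      show "AE x in lborel. norm (mollify (e n) v x * d x) \<le> ?w x" for n
      proof (intro always_eventually allI)
        fix x
        have "mollify (e n) v x = 0" if "real r + 1 < \<bar>x\<bar>"
        proof -
          have "moll s * v (x - e n * s) = 0" for s
          proof (cases "\<bar>s\<bar> < 1")
            case True
            have "\<bar>e n * s\<bar> \<le> 1" using mult_mono[of "e n" 1 "\<bar>s\<bar>" 1] e[of n] True by (simp add: abs_mult less_imp_le)
            then show ?thesis using v0[of "x - e n * s"] that by simp
          qed (simp add: moll_outside)
          then show ?thesis by (simp only: mollify_def) simp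
        qed
        then show "norm (mollify (e n) v x * d x) \<le> ?w x"
          using mollify_bounded[OF v v1, of "e n" x] mult_right_mono[of "\<bar>mollify (e n) v x\<bar>" 1 "\<bar>d x\<bar>"]
          by (cases "real r + 1 < \<bar>x\<bar>") (auto simp: abs_mult indicator_def)
      qed
    qed measurable
    then have "(\<lambda>n::nat. 0) \<longlonglongrightarrow> (\<integral>x. v x * d x \<partial>lborel)" by (simp only: zero[OF t])
    then have "(\<integral>x. v x * d x \<partial>lborel) = 0" using LIMSEQ_unique[OF _ tendsto_const] by blast
    then have "(\<integral>x. ?I x * \<bar>d x\<bar> \<partial>lborel) = 0" by (simp add: v_def abs_sgn mult_ac)
    moreover have "integrable lborel (\<lambda>x. ?I x * \<bar>d x\<bar>)"
      using integrable_norm[OF loc[of "real r", unfolded set_integrable_def]] by (simp add: abs_mult)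
    ultimately have "AE x in lborel. ?I x * \<bar>d x\<bar> = 0"
      by (subst (asm) integral_nonneg_eq_0_iff_AE) auto
    then show ?thesis by eventually_elim (auto simp: indicator_def)
  qed
  then have "AE x in lborel. \<forall>r::nat. x \<in> {-real r..real r} \<longrightarrow> d x = 0"
    by (intro AE_all_countable[THEN iffD2] allI)
  then show ?thesis
  proof eventually_elim
    case (elim x)
    obtain r :: nat where "\<bar>x\<bar> \<le> real r" using real_arch_simple by blast
    then show ?case using elim by (auto simp: abs_le_iff)
  qed
qed

section \<open>Cutoffs of small energy\<close>

lemma finite_energy_mult:
  fixes u v :: "real \<Rightarrow> real"
  assumes u: "finite_energy u" "\<And>x. \<bar>u x\<bar> \<le> M" and v: "finite_energy v" "\<And>x. \<bar>v x\<bar> \<le> M'"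
  shows "finite_energy (\<lambda>x. u x * v x)" "energy_norm (\<lambda>x. u x * v x) \<le> M' * energy_norm u + M * energy_norm v"
proof -
  have [measurable]: "u \<in> borel_measurable borel" "v \<in> borel_measurable borel" using u v by (auto simp: finite_energy_def)
  have M0: "0 \<le> M" "0 \<le> M'" using u(2)[of 0] v(2)[of 0] by linarith+
  have "sq_int lborel2 (\<lambda>p. \<bar>diff_quot u p\<bar>)" "sq_int lborel2 (\<lambda>p. \<bar>diff_quot v p\<bar>)"
    using finite_energyD(2)[OF u(1)] finite_energyD(2)[OF v(1)] by (auto simp: sq_int_def)
  from this[THEN sq_int_scaleR]
  have su: "sq_int lborel2 (\<lambda>p. M' *\<^sub>R \<bar>diff_quot u p\<bar>)" "sq_int lborel2 (\<lambda>p. M *\<^sub>R \<bar>diff_quot v p\<bar>)" .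
  have n: "L2nrm lborel2 (\<lambda>p. M' *\<^sub>R \<bar>diff_quot u p\<bar>) = M' * energy_norm u" "L2nrm lborel2 (\<lambda>p. M *\<^sub>R \<bar>diff_quot v p\<bar>) = M * energy_norm v"
    unfolding L2nrm_scaleR using M0 by (simp_all add: L2nrm_def)
  have pt: "norm (diff_quot (\<lambda>x. u x * v x) p) \<le> norm (M' *\<^sub>R \<bar>diff_quot u p\<bar> + M *\<^sub>R \<bar>diff_quot v p\<bar>)" for p
  proof -
    obtain h x where p: "p = (h, x)" by (cases p)
    have "diff_quot (\<lambda>x. u x * v x) p = diff_quot u p * v (x + h) + u x * diff_quot v p"
      by (simp add: p diff_quot_def algebra_simps)
    also have "\<bar>\<dots>\<bar> \<le> \<bar>diff_quot u p\<bar> * \<bar>v (x + h)\<bar> + \<bar>u x\<bar> * \<bar>diff_quot v p\<bar>"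
      by (rule order_trans[OF abs_triangle_ineq]) (simp add: abs_mult)
    also have "\<dots> \<le> \<bar>diff_quot u p\<bar> * M' + M * \<bar>diff_quot v p\<bar>"
      by (intro add_mono mult_left_mono mult_right_mono u v) auto
    finally show ?thesis using M0 by (simp add: mult.commute)
  qed
  note d = sq_int_dominated[OF sq_int_add[OF su], of "diff_quot (\<lambda>x. u x * v x)"]
  show "finite_energy (\<lambda>x. u x * v x)"
    unfolding finite_energy_def by (intro conjI d(1)) (use pt in auto)
  have "energy_norm (\<lambda>x. u x * v x) \<le> L2nrm lborel2 (\<lambda>p. M' *\<^sub>R \<bar>diff_quot u p\<bar> + M *\<^sub>R \<bar>diff_quot v p\<bar>)"
    by (rule d(2)) (use pt in auto)
  also have "\<dots> \<le> M' * energy_norm u + M * energy_norm v" using L2nrm_triangle[OF su] by (simp only: n)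
  finally show "energy_norm (\<lambda>x. u x * v x) \<le> M' * energy_norm u + M * energy_norm v" .
qed

text \<open>Pair with the constant function \<open>1\<close>, all of whose differences vanish.\<close>

lemma half_laplacian_mean_zero:
  assumes \<phi>: "test_function \<phi>"
  shows "(\<integral>x. frac_lap_test (1/2) \<phi> x \<partial>lborel) = 0"
proof -
  have "(\<integral>x. second_diff h \<phi> x * 1 \<partial>lborel) = 0" for h
    using second_diff_by_parts(3)[OF test_function_integrable[OF \<phi>], of "\<lambda>_. 1" 1 h] by simp
  then show ?thesis using frac_lap_test_pair(3)[of "1/2" \<phi> "\<lambda>_. 1" 1] \<phi> by simp
qed

text \<open>Very different scales are almost orthogonal. The inner product of the differences of \<open>c\<close> and of its dilation
  \<open>c (x / n)\<close> tends to the pairing of the half Laplacian of \<open>c\<close> with the constant \<open>c 0\<close>, that is, to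
  \<open>0\<close>. Both functions have the same energy, so their average has nearly half of it.\<close>

lemma cutoff_halving:
  assumes c: "test_function c" "\<And>x. 0 \<le> c x" "\<And>x. c x \<le> 1" "c 0 = 1"
  shows "\<exists>c'. test_function c' \<and> (\<forall>x. 0 \<le> c' x \<and> c' x \<le> 1) \<and> c' 0 = 1 \<and> (energy_norm c')\<^sup>2 \<le> 3/4 * (energy_norm c)\<^sup>2"
proof (cases "energy_norm c = 0")
  case True then show ?thesis using c by (intro exI[of _ c]) auto
next
  case False
  \<comment> \<open>Wide dilations of the cutoff, which tend pointwise to \<open>c 0 = 1\<close>.\<close>
  define cR where "cR n = (\<lambda>x. c (x / real (Suc n)))" for n
  have cRt: "test_function (cR n)" for n
    using test_function_affine(1)[OF c(1), of "1 / real (Suc n)" 0] by (simp add: cR_def)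
  have cRb: "\<bar>cR n x\<bar> \<le> 1" "0 \<le> cR n x" for n x using c(2,3) by (auto simp: cR_def)
  have li: "integrable lborel (frac_lap_test (1/2) c)" by (rule frac_lap_test_integrable(1)[OF _ _ c(1)]) auto
  have [measurable]: "frac_lap_test (1/2) c \<in> borel_measurable borel" "cR n \<in> borel_measurable borel" for n
    using li test_function_measurable[OF cRt] by auto
  have "(\<lambda>n. \<integral>x. frac_lap_test (1/2) c x * cR n x \<partial>lborel) \<longlonglongrightarrow> (\<integral>x. frac_lap_test (1/2) c x \<partial>lborel)"
  proof (rule integral_dominated_convergence[where w="\<lambda>x. \<bar>frac_lap_test (1/2) c x\<bar>"])
    show "AE x in lborel. (\<lambda>n. frac_lap_test (1/2) c x * cR n x) \<longlonglongrightarrow> frac_lap_test (1/2) c x"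
    proof (intro always_eventually allI)
      fix x
      have "(\<lambda>n. x * inverse (real (Suc n))) \<longlonglongrightarrow> x * 0" by (intro tendsto_intros LIMSEQ_inverse_real_of_nat)
      then have "(\<lambda>n. c (x * inverse (real (Suc n)))) \<longlonglongrightarrow> c (x * 0)"
        by (rule isCont_tendsto_compose[OF DERIV_isCont[OF test_function_has_deriv[OF c(1)]]])
      then have "(\<lambda>n. frac_lap_test (1/2) c x * cR n x) \<longlonglongrightarrow> frac_lap_test (1/2) c x * 1"
        using c(4) by (intro tendsto_intros) (simp add: cR_def divide_inverse)
      then show "(\<lambda>n. frac_lap_test (1/2) c x * cR n x) \<longlonglongrightarrow> frac_lap_test (1/2) c x" by simp
    qed
    show "AE x in lborel. norm (frac_lap_test (1/2) c x * cR n x) \<le> \<bar>frac_lap_test (1/2) c x\<bar>" for n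
      using cRb(1) by (simp add: abs_mult mult_left_le)
  qed (use li in auto)
  then have lim: "(\<lambda>n. \<integral>x. frac_lap_test (1/2) c x * cR n x \<partial>lborel) \<longlonglongrightarrow> 0"
    by (simp add: half_laplacian_mean_zero[OF c(1)])
  have l0: "0 < lap_const (1/2)" by (rule lap_const_pos) auto
  have pos: "0 < lap_const (1/2) * ((energy_norm c)\<^sup>2 / 2)" using False l0 by simp
  obtain n where n: "(\<integral>x. frac_lap_test (1/2) c x * cR n x \<partial>lborel) < lap_const (1/2) * ((energy_norm c)\<^sup>2 / 2)"
    using order_tendstoD(2)[OF lim pos] by (auto simp: eventually_sequentially)
  have fe: "finite_energy c" "finite_energy (cR n)" using test_function_finite_energy c(1) cRt by blast+
  have "lap_const (1/2) * (\<integral>p. diff_quot (cR n) p * diff_quot c p \<partial>lborel2) < lap_const (1/2) * ((energy_norm c)\<^sup>2 / 2)"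
    using n half_laplacian_energy[OF fe(2) cRb(1) c(1)] by simp
  then have ip: "(\<integral>p. diff_quot (cR n) p * diff_quot c p \<partial>lborel2) < (energy_norm c)\<^sup>2 / 2" using l0 by simp
  \<comment> \<open>The average of two almost orthogonal functions of equal energy.\<close>
  define c' where "c' = (\<lambda>x. (1/2) * cR n x + (1/2) * c x)"
  have "energy_norm (cR n) = energy_norm c" unfolding cR_def by (rule energy_norm_dilate[OF c(1)]) simp
  moreover have "diff_quot c' = (\<lambda>p. (1/2) *\<^sub>R (diff_quot (cR n) p + diff_quot c p))"
    by (auto simp: c'_def diff_quot_def fun_eq_iff algebra_simps)
  ultimately have "(energy_norm c')\<^sup>2 = (1/4) * (2 * (energy_norm c)\<^sup>2 + 2 * (\<integral>p. diff_quot (cR n) p * diff_quot c p \<partial>lborel2))"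
    using L2nrm_add_sq[OF finite_energyD(2)[OF fe(2)] finite_energyD(2)[OF fe(1)]]
    by (simp only: L2nrm_scaleR power_mult_distrib) (simp add: power2_eq_square)
  also have "\<dots> \<le> 3/4 * (energy_norm c)\<^sup>2" using ip by simp
  finally have "(energy_norm c')\<^sup>2 \<le> 3/4 * (energy_norm c)\<^sup>2" .
  moreover have "test_function c'" unfolding c'_def by (intro test_function_lincomb cRt c)
  moreover have "0 \<le> c' x \<and> c' x \<le> 1" for x using c(2,3)[of x] cRb[of n x] by (auto simp: c'_def)
  moreover have "c' 0 = 1" using c(4) by (simp add: c'_def cR_def)
  ultimately show ?thesis by blast
qed

text \<open>Iterating \<open>cutoff_halving\<close> makes the energy small, and dilation, which does not change the
  energy, makes the function close to \<open>1\<close> on as large an interval as desired.\<close>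

lemma small_cutoff:
  assumes d: "0 < d"
  shows "\<exists>c. test_function c \<and> (\<forall>x. 0 \<le> c x \<and> c x \<le> 1) \<and> (\<forall>x. \<bar>x\<bar> \<le> r \<longrightarrow> 1 - d \<le> c x) \<and> energy_norm c \<le> d"
proof -
  define c0 where "c0 = (\<lambda>x. moll x / moll 0)"
  have c0: "test_function c0" "\<And>x. 0 \<le> c0 x" "\<And>x. c0 x \<le> 1" "c0 0 = 1"
    using test_function_lincomb(1)[OF moll_test moll_test, of "1 / moll 0" 0] moll_le
    by (auto simp: c0_def divide_le_eq_1)
  have "\<exists>c. test_function c \<and> (\<forall>x. 0 \<le> c x \<and> c x \<le> 1) \<and> c 0 = 1 \<and> (energy_norm c)\<^sup>2 \<le> (3/4)^n * (energy_norm c0)\<^sup>2" for n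
  proof (induction n)
    case 0 then show ?case using c0 by (intro exI[of _ c0]) auto
  next
    case (Suc n)
    then obtain c where c: "test_function c" "\<And>x. 0 \<le> c x" "\<And>x. c x \<le> 1" "c 0 = 1" "(energy_norm c)\<^sup>2 \<le> (3/4)^n * (energy_norm c0)\<^sup>2" by blast
    obtain c' where c': "test_function c'" "\<forall>x. 0 \<le> c' x \<and> c' x \<le> 1" "c' 0 = 1" "(energy_norm c')\<^sup>2 \<le> 3/4 * (energy_norm c)\<^sup>2"
      using cutoff_halving[OF c(1-4)] by blast
    have "(energy_norm c')\<^sup>2 \<le> (3/4)^Suc n * (energy_norm c0)\<^sup>2" using c'(4) c(5) by simp
    then show ?case using c' by blast
  qed
  moreover obtain n where n: "(3/4::real)^n * (energy_norm c0)\<^sup>2 \<le> d\<^sup>2"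
  proof -
    have "(\<lambda>n. (3/4::real)^n * (energy_norm c0)\<^sup>2) \<longlonglongrightarrow> 0 * (energy_norm c0)\<^sup>2" by (intro tendsto_intros LIMSEQ_power_zero) simp
    then have "\<forall>\<^sub>F n in sequentially. (3/4::real)^n * (energy_norm c0)\<^sup>2 < d\<^sup>2" using d by (intro order_tendstoD(2)) auto
    then show ?thesis using that by (auto simp: eventually_sequentially intro: less_imp_le)
  qed
  ultimately obtain c where c: "test_function c" "\<And>x. 0 \<le> c x" "\<And>x. c x \<le> 1" "c 0 = 1" "(energy_norm c)\<^sup>2 \<le> d\<^sup>2"
    by (meson order_trans)
  have "isCont c 0" by (rule DERIV_isCont[OF test_function_has_deriv[OF c(1)]])
  then obtain \<delta> where \<delta>: "0 < \<delta>" "\<And>x. \<bar>x\<bar> < \<delta> \<Longrightarrow> \<bar>c x - 1\<bar> < d"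
    using d c(4) unfolding isCont_def LIM_eq by (metis abs_zero diff_self diff_zero real_norm_def c(4) zero_less_abs_iff)
  define R where "R = (\<bar>r\<bar> + 1) / \<delta>"
  have R: "0 < R" using \<delta> by (simp add: R_def)
  show ?thesis
  proof (intro exI conjI allI impI)
    show "test_function (\<lambda>x. c (x / R))" using test_function_affine(1)[OF c(1), of "1/R" 0] R by simp
    have "energy_norm (\<lambda>x. c (x / R)) = energy_norm c" by (rule energy_norm_dilate[OF c(1) R])
    also have "\<dots> \<le> d" by (rule power2_le_imp_le[OF c(5)]) (use d in simp)
    finally show "energy_norm (\<lambda>x. c (x / R)) \<le> d" .
    fix x :: real assume "\<bar>x\<bar> \<le> r"
    then have "\<bar>x\<bar> < R * \<delta>" using \<delta>(1) by (simp add: R_def)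
    then have "\<bar>x / R\<bar> < \<delta>" using R by (simp add: divide_less_eq mult.commute)
    from \<delta>(2)[OF this] show "1 - d \<le> c (x / R)" by linarith
  qed (use c in auto)
qed

lemma cutoff_sequence:
  "\<exists>ct. \<forall>n. test_function (ct n) \<and> (\<forall>x. 0 \<le> ct n x \<and> ct n x \<le> 1) \<and>
     (\<forall>x. \<bar>x\<bar> \<le> real n \<longrightarrow> 1 - inverse (real (Suc n)) \<le> ct n x) \<and> energy_norm (ct n) \<le> inverse (real (Suc n))"
proof (rule choice, rule allI)
  fix n show "\<exists>c. test_function c \<and> (\<forall>x. 0 \<le> c x \<and> c x \<le> 1) \<and>
     (\<forall>x. \<bar>x\<bar> \<le> real n \<longrightarrow> 1 - inverse (real (Suc n)) \<le> c x) \<and> energy_norm c \<le> inverse (real (Suc n))"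
    by (rule small_cutoff) simp
qed

text \<open>The two base points \<open>x\<close> and \<open>x + h\<close> avoid a given null set for almost all pairs \<open>(h, x)\<close>.\<close>

lemma AE_diff_quot:
  assumes "AE x in lborel. P (x::real)"
  shows "AE p in lborel2. P (snd p) \<and> P (snd p + fst p)"
proof -
  obtain N where N0: "{x \<in> space lborel. \<not> P x} \<subseteq> N" "emeasure lborel N = 0" "N \<in> sets lborel"
    by (rule AE_E[OF assms])
  then have N: "N \<in> sets lborel" "emeasure lborel N = 0" "\<And>x. \<not> P x \<Longrightarrow> x \<in> N" by auto
  have [measurable]: "N \<in> sets borel" using N(1) by simp
  have ae: "AE x in lborel. x \<notin> N" using N by (intro AE_not_in) auto
  have "AE p in lborel2. snd p \<notin> N \<and> snd p + fst p \<notin> N"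
  proof (rule lborel_pair.AE_pair_measure)
    show "{p \<in> space lborel2. snd p \<notin> N \<and> snd p + fst p \<notin> N} \<in> sets lborel2" by measurable
    have "AE x in lborel. x \<notin> N \<and> x + h \<notin> N" for h
    proof -
      have "AE x in lborel. h + 1 * x \<notin> N" by (rule AE_borel_affine[OF _ _ ae]) auto
      with ae show ?thesis by eventually_elim (simp add: add.commute)
    qed
    then show "AE h in lborel. AE x in lborel. snd (h, x) \<notin> N \<and> snd (h, x) + fst (h, x) \<notin> N" by simp
  qed
  then show ?thesis by eventually_elim (use N(3) in blast)
qed

lemma AE_diff_quot_tendsto:
  fixes u :: "real \<Rightarrow> real"
  assumes "AE x in lborel. (\<lambda>n. F n x) \<longlonglongrightarrow> u x"
  shows "AE p in lborel2. (\<lambda>n. diff_quot (F n) p) \<longlonglongrightarrow> diff_quot u p"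
  using AE_diff_quot[OF assms]
proof eventually_elim
  case (elim p)
  then show ?case unfolding diff_quot_def by (intro tendsto_intros) auto
qed

text \<open>The cutoffs are uniformly close to \<open>1\<close> on the interval of radius \<open>1\<close> around \<open>x\<close> that the
  mollification sees.\<close>

lemma mollified_cutoff_tendsto:
  assumes u[measurable]: "u \<in> borel_measurable borel" and M: "\<And>x. \<bar>u x\<bar> \<le> M"
    and e: "\<And>n. 0 < e n" "\<And>n. e n \<le> 1" and lim: "(\<lambda>n. mollify (e n) u x) \<longlonglongrightarrow> u x"
    and c: "\<And>n. c n \<in> borel_measurable borel" "\<And>n x. \<bar>c n x\<bar> \<le> 1" "\<And>n x. \<bar>x\<bar> \<le> real n \<Longrightarrow> \<bar>c n x - 1\<bar> \<le> inverse (real (Suc n))"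
  shows "(\<lambda>n. mollify (e n) (\<lambda>x. u x * c n x) x) \<longlonglongrightarrow> u x"
proof -
  have M0: "0 \<le> M" using M[of 0] by linarith
  have ucm: "(\<lambda>x. u x * c n x) \<in> borel_measurable borel" for n using u c(1) by measurable
  have ucb: "\<bar>u x * c n x\<bar> \<le> M * 1" for n x unfolding abs_mult by (intro mult_mono M c M0) auto
  have b: "norm (mollify (e n) (\<lambda>x. u x * c n x) x - mollify (e n) u x) \<le> M * inverse (real (Suc n))" if n: "\<bar>x\<bar> + 1 \<le> real n" for n
  proof -
    have i: "integrable lborel (\<lambda>s. moll s * (u (x - e n * s) * c n (x - e n * s)))" "integrable lborel (\<lambda>s. moll s * u (x - e n * s))"
      using mollify_integrand[OF ucm ucb, of x "e n" n] mollify_integrand[OF u M] by auto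
    have eq: "mollify (e n) (\<lambda>x. u x * c n x) x - mollify (e n) u x = (\<integral>s. moll s * (u (x - e n * s) * c n (x - e n * s)) - moll s * u (x - e n * s) \<partial>lborel)"
      unfolding mollify_def using i by simp
    have "norm (mollify (e n) (\<lambda>x. u x * c n x) x - mollify (e n) u x) \<le> (\<integral>s. \<bar>moll s * (u (x - e n * s) * c n (x - e n * s)) - moll s * u (x - e n * s)\<bar> \<partial>lborel)"
      unfolding eq real_norm_def by (rule integral_abs_bound)
    also have "\<dots> \<le> (\<integral>s. moll s * (M * inverse (real (Suc n))) \<partial>lborel)"
    proof (rule integral_mono)
      fix s
      show "\<bar>moll s * (u (x - e n * s) * c n (x - e n * s)) - moll s * u (x - e n * s)\<bar> \<le> moll s * (M * inverse (real (Suc n)))"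
      proof (cases "\<bar>s\<bar> < 1")
        case True
        have "e n * \<bar>s\<bar> \<le> 1 * 1" by (rule mult_mono) (use e[of n] True in auto)
        then have es: "\<bar>e n * s\<bar> \<le> 1" using e(1)[of n] by (simp add: abs_mult)
        have "\<bar>x - e n * s\<bar> \<le> \<bar>x\<bar> + \<bar>e n * s\<bar>" by (rule abs_triangle_ineq4)
        also have "\<dots> \<le> real n" using es n by simp
        finally have xe: "\<bar>x - e n * s\<bar> \<le> real n" .
        have "\<bar>u (x - e n * s)\<bar> * \<bar>c n (x - e n * s) - 1\<bar> \<le> M * inverse (real (Suc n))"
          by (rule mult_mono[OF M c(3)[OF xe] M0 abs_ge_zero])
        from mult_left_mono[OF this moll_nonneg[of s]]
        have "\<bar>moll s * (u (x - e n * s) * (c n (x - e n * s) - 1))\<bar> \<le> moll s * (M * inverse (real (Suc n)))"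
          by (simp only: abs_mult abs_of_nonneg[OF moll_nonneg])
        then show ?thesis by (simp add: algebra_simps)
      qed (simp add: moll_outside)
    qed (use i moll_integrable in auto)
    finally show ?thesis by (simp add: moll_integral)
  qed
  have "(\<lambda>n. mollify (e n) (\<lambda>x. u x * c n x) x - mollify (e n) u x) \<longlonglongrightarrow> 0"
  proof (rule Lim_null_comparison)
    obtain n0 :: nat where n0: "\<bar>x\<bar> + 1 \<le> real n0" using real_arch_simple by blast
    have "norm (mollify (e n) (\<lambda>x. u x * c n x) x - mollify (e n) u x) \<le> M * inverse (real (Suc n))" if "n \<ge> n0" for n
      by (rule b) (use n0 that in linarith)
    then show "\<forall>\<^sub>F n in sequentially. norm (mollify (e n) (\<lambda>x. u x * c n x) x - mollify (e n) u x) \<le> M * inverse (real (Suc n))"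
      unfolding eventually_sequentially by blast
    have "(\<lambda>n. M * inverse (real (Suc n))) \<longlonglongrightarrow> M * 0" by (intro tendsto_intros LIMSEQ_inverse_real_of_nat)
    then show "(\<lambda>n. M * inverse (real (Suc n))) \<longlonglongrightarrow> 0" by simp
  qed
  from tendsto_add[OF this lim] show ?thesis by simp
qed

section \<open>Quarter Laplacian and Gagliardo energy of bounded functions\<close>

lemma frac_lap_test_diff:
  assumes s: "0 < s" "s < 1" and \<phi>: "test_function \<phi>" and \<psi>: "test_function \<psi>"
  shows "frac_lap_test s (\<lambda>x. \<phi> x - \<psi> x) x = frac_lap_test s \<phi> x - frac_lap_test s \<psi> x"
proof -
  have t: "test_function (\<lambda>x. \<phi> x - \<psi> x)" using test_function_lincomb(1)[OF \<phi> \<psi>, of 1 "-1"] by simp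
  have "(\<integral>h. second_diff h (\<lambda>x. \<phi> x - \<psi> x) x * kern s h \<partial>lborel) = (\<integral>h. second_diff h \<phi> x * kern s h - second_diff h \<psi> x * kern s h \<partial>lborel)"
    by (rule Bochner_Integration.integral_cong) (auto simp: second_diff_def algebra_simps)
  also have "\<dots> = (\<integral>h. second_diff h \<phi> x * kern s h \<partial>lborel) - (\<integral>h. second_diff h \<psi> x * kern s h \<partial>lborel)"
    using frac_lap_test_singular(1)[OF s \<phi>] frac_lap_test_singular(1)[OF s \<psi>] by simp
  finally show ?thesis
    by (simp only: frac_lap_test_singular(2)[OF s t] frac_lap_test_singular(2)[OF s \<phi>] frac_lap_test_singular(2)[OF s \<psi>] right_diff_distrib)
qed

lemma L2nrm_diff_bound:
  assumes "sq_int M f" "sq_int M g"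
  shows "\<bar>L2nrm M f - L2nrm M g\<bar> \<le> L2nrm M (\<lambda>x. f x - g x)"
proof -
  have "L2nrm M f \<le> L2nrm M (\<lambda>x. f x - g x) + L2nrm M g"
    using L2nrm_triangle[OF sq_int_diff[OF assms] assms(2)] by simp
  moreover have "L2nrm M g \<le> L2nrm M (\<lambda>x. f x - g x) + L2nrm M f"
    using L2nrm_triangle_diff[OF assms(1) sq_int_diff[OF assms]] by simp
  ultimately show ?thesis by linarith
qed

text \<open>Mollifications of \<open>u\<close> times cutoffs of small energy are test functions whose energies do not exceed
  that of \<open>u\<close> in the limit, so their difference quotients converge strongly. By the energy identity
  for test functions their quarter Laplacians form a Cauchy sequence in L2, and the limit is the
  quarter Laplacian of \<open>u\<close> because the operator is symmetric on test functions.\<close>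

lemma finite_energy_imp_quarter_laplacian:
  fixes u :: "real \<Rightarrow> real"
  assumes u: "finite_energy u" and M: "\<And>x. \<bar>u x\<bar> \<le> M"
  shows "\<exists>f. quarter_laplacian u f \<and> (L2nrm lborel f)\<^sup>2 = lap_const (1/2) * (energy_norm u)\<^sup>2"
proof -
  have um[measurable]: "u \<in> borel_measurable borel" by (rule finite_energyD(1)[OF u])
  have M0: "0 \<le> M" using M[of 0] by linarith
  obtain e where e: "\<And>n. 0 < e n" "\<And>n. e n \<le> 1" and lim: "AE x in lborel. (\<lambda>n. mollify (e n) u x) \<longlonglongrightarrow> u x"
    using mollify_AE_tendsto[OF um M] by blast
  obtain ct where ct: "\<And>n. test_function (ct n)" "\<And>n x. 0 \<le> ct n x" "\<And>n x. ct n x \<le> 1"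
     "\<And>n x. \<bar>x\<bar> \<le> real n \<Longrightarrow> 1 - inverse (real (Suc n)) \<le> ct n x" "\<And>n. energy_norm (ct n) \<le> inverse (real (Suc n))"
    using cutoff_sequence by blast
  have ct1: "\<bar>ct n x\<bar> \<le> 1" for n x using ct(2,3)[of n x] by simp
  have ctm: "ct n \<in> borel_measurable borel" for n by (rule test_function_measurable[OF ct(1)])
  let ?v = "\<lambda>n x. u x * ct n x"
  define \<phi> where "\<phi> n = mollify (e n) (?v n)" for n
  have vb: "\<bar>?v n x\<bar> \<le> M" for n x using mult_mono[OF M[of x] ct1[of n x] M0] by (simp add: abs_mult)
  note fem = finite_energy_mult[OF u M test_function_finite_energy[OF ct(1)] ct1]
  have vi: "integrable lborel (?v n)" for n
    using integrable_mult_bounded[OF test_function_integrable[OF ct(1)] um M] by (simp add: mult.commute)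
  have \<phi>t: "test_function (\<phi> n)" for n
  proof -
    obtain R where "\<And>x. R < \<bar>x\<bar> \<Longrightarrow> ct n x = 0" using test_function_supp[OF ct(1)] by blast
    then show ?thesis unfolding \<phi>_def by (intro mollify_test[OF e(1) vi, of R]) auto
  qed
  have \<phi>b: "\<bar>\<phi> n x\<bar> \<le> M" for n x
    unfolding \<phi>_def by (rule mollify_bounded) (use vb um ctm in auto)
  have \<phi>e: "energy_norm (\<phi> n) \<le> energy_norm u + M * inverse (real (Suc n))" for n
  proof -
    have "energy_norm (\<phi> n) \<le> energy_norm (?v n)" unfolding \<phi>_def by (rule mollify_energy(2)[OF fem(1) vb])
    also have "\<dots> \<le> 1 * energy_norm u + M * energy_norm (ct n)" by (rule fem(2))
    finally show ?thesis using mult_left_mono[OF ct(5)[of n] M0] by simp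
  qed
  have \<phi>lim: "AE x in lborel. (\<lambda>n. \<phi> n x) \<longlonglongrightarrow> u x"
    using lim
  proof eventually_elim
    case (elim x)
    have "\<bar>ct n x - 1\<bar> \<le> inverse (real (Suc n))" if "\<bar>x\<bar> \<le> real n" for n x
      using ct(4)[OF that] ct(3)[of n x] by simp
    then show ?case unfolding \<phi>_def by (intro mollified_cutoff_tendsto[OF um M e elim ctm ct1]) auto
  qed
  note sqd = finite_energyD(2)[OF test_function_finite_energy[OF \<phi>t]]
  have strong: "(\<lambda>n. L2nrm lborel2 (\<lambda>p. diff_quot (\<phi> n) p - diff_quot u p)) \<longlonglongrightarrow> 0"
  proof (rule L2_strong_convergence[OF sqd finite_energyD(2)[OF u] AE_diff_quot_tendsto[OF \<phi>lim] \<phi>e])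
    have "(\<lambda>n. M * inverse (real (Suc n))) \<longlonglongrightarrow> M * 0" by (intro tendsto_intros LIMSEQ_inverse_real_of_nat)
    then show "(\<lambda>n. M * inverse (real (Suc n))) \<longlonglongrightarrow> 0" by simp
  qed
  define F where "F n = frac_lap_test (1/4) (\<phi> n)" for n
  have F: "sq_int lborel (F n)" for n unfolding F_def by (rule frac_lap_test_sq_int[OF \<phi>t])
  define a where "a n = L2nrm lborel2 (\<lambda>p. diff_quot (\<phi> n) p - diff_quot u p)" for n
  let ?k = "lap_const (1/2)"
  have k0: "0 < ?k" by (rule lap_const_pos) auto
  have dist: "L2nrm lborel (\<lambda>x. F m x - F n x) \<le> sqrt ?k * (a m + a n)" for m n
  proof -
    have t: "test_function (\<lambda>x. \<phi> m x - \<phi> n x)" using test_function_lincomb(1)[OF \<phi>t \<phi>t, of 1 m "-1" n] by simp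
    have "(\<lambda>x. F m x - F n x) = frac_lap_test (1/4) (\<lambda>x. \<phi> m x - \<phi> n x)"
      unfolding F_def using frac_lap_test_diff[OF _ _ \<phi>t \<phi>t] by (simp add: fun_eq_iff)
    then have "(L2nrm lborel (\<lambda>x. F m x - F n x))\<^sup>2 = ?k * (energy_norm (\<lambda>x. \<phi> m x - \<phi> n x))\<^sup>2"
      using test_function_energy[OF t] by simp
    from arg_cong[OF this, of sqrt] have "L2nrm lborel (\<lambda>x. F m x - F n x) = sqrt ?k * energy_norm (\<lambda>x. \<phi> m x - \<phi> n x)"
      by (simp add: real_sqrt_mult)
    also have "energy_norm (\<lambda>x. \<phi> m x - \<phi> n x) \<le> a m + a n"
    proof -
      have "diff_quot (\<lambda>x. \<phi> m x - \<phi> n x) = (\<lambda>p. (diff_quot (\<phi> m) p - diff_quot u p) - (diff_quot (\<phi> n) p - diff_quot u p))"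
        by (simp add: diff_quot_diff fun_eq_iff)
      then show ?thesis unfolding a_def
        using L2nrm_triangle_diff[OF sq_int_diff[OF sqd finite_energyD(2)[OF u]] sq_int_diff[OF sqd finite_energyD(2)[OF u]], of m n] by simp
    qed
    finally show ?thesis using k0 by (simp add: mult_left_mono)
  qed
  have "\<exists>f. sq_int lborel f \<and> (\<lambda>n. L2nrm lborel (\<lambda>x. F n x - f x)) \<longlonglongrightarrow> 0"
  proof (rule L2_complete[OF F])
    fix r :: real assume r: "0 < r"
    have "(\<lambda>n. sqrt ?k * (a n + a n)) \<longlonglongrightarrow> sqrt ?k * (0 + 0)"
      using strong unfolding a_def by (intro tendsto_intros)
    then have "(\<lambda>n. sqrt ?k * (a n + a n)) \<longlonglongrightarrow> 0" by simp
    from order_tendstoD(2)[OF this r] obtain N where N: "\<And>n. n \<ge> N \<Longrightarrow> sqrt ?k * (a n + a n) < r"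
      unfolding eventually_sequentially by blast
    have "L2nrm lborel (\<lambda>x. F m x - F n x) \<le> r" if "m \<ge> N" "n \<ge> N" for m n
      using dist[of m n] N[OF that(1)] N[OF that(2)] by (simp add: algebra_simps)
    then show "\<exists>N. \<forall>m\<ge>N. \<forall>n\<ge>N. L2nrm lborel (\<lambda>x. F m x - F n x) \<le> r" by blast
  qed
  then obtain f where f: "sq_int lborel f" and Ff: "(\<lambda>n. L2nrm lborel (\<lambda>x. F n x - f x)) \<longlonglongrightarrow> 0" by blast
  have "(\<integral>x. frac_lap_test (1/4) \<psi> x * u x \<partial>lborel) = (\<integral>x. \<psi> x * f x \<partial>lborel)" if \<psi>: "test_function \<psi>" for \<psi>
  proof -
    note \<psi>2 = test_function_sq_int[OF \<psi>]
    have li: "integrable lborel (frac_lap_test (1/4) \<psi>)" by (rule frac_lap_test_integrable(1)[OF _ _ \<psi>]) auto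
    have [measurable]: "frac_lap_test (1/4) \<psi> \<in> borel_measurable borel" "\<phi> n \<in> borel_measurable borel" for n
      using li test_function_measurable[OF \<phi>t] by auto
    have "(\<lambda>n. \<integral>x. frac_lap_test (1/4) \<psi> x * \<phi> n x \<partial>lborel) \<longlonglongrightarrow> (\<integral>x. frac_lap_test (1/4) \<psi> x * u x \<partial>lborel)"
    proof (rule integral_dominated_convergence[where w="\<lambda>x. M * \<bar>frac_lap_test (1/4) \<psi> x\<bar>"])
      show "AE x in lborel. (\<lambda>n. frac_lap_test (1/4) \<psi> x * \<phi> n x) \<longlonglongrightarrow> frac_lap_test (1/4) \<psi> x * u x"
        using \<phi>lim by eventually_elim (intro tendsto_intros)
      show "AE x in lborel. norm (frac_lap_test (1/4) \<psi> x * \<phi> n x) \<le> M * \<bar>frac_lap_test (1/4) \<psi> x\<bar>" for n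
      proof (intro always_eventually allI)
        fix x show "norm (frac_lap_test (1/4) \<psi> x * \<phi> n x) \<le> M * \<bar>frac_lap_test (1/4) \<psi> x\<bar>"
          using mult_right_mono[OF \<phi>b[of n x] abs_ge_zero[of "frac_lap_test (1/4) \<psi> x"]] by (simp add: abs_mult mult.commute)
      qed
    qed (use li in auto)
    moreover have "(\<lambda>n. \<integral>x. frac_lap_test (1/4) \<psi> x * \<phi> n x \<partial>lborel) \<longlonglongrightarrow> (\<integral>x. \<psi> x * f x \<partial>lborel)"
    proof (rule LIM_zero_cancel, rule Lim_null_comparison)
      have "norm ((\<integral>x. frac_lap_test (1/4) \<psi> x * \<phi> n x \<partial>lborel) - (\<integral>x. \<psi> x * f x \<partial>lborel)) \<le> L2nrm lborel \<psi> * L2nrm lborel (\<lambda>x. F n x - f x)" for n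
      proof -
        have "(\<integral>x. frac_lap_test (1/4) \<psi> x * \<phi> n x \<partial>lborel) = (\<integral>x. \<psi> x * F n x \<partial>lborel)"
          using frac_lap_test_symmetric[OF _ _ \<psi> \<phi>t, of "1/4" n] by (simp add: F_def mult.commute)
        also have "\<dots> - (\<integral>x. \<psi> x * f x \<partial>lborel) = (\<integral>x. \<psi> x \<bullet> (F n x - f x) \<partial>lborel)"
          using sq_int_inner[OF \<psi>2 F[of n]] sq_int_inner[OF \<psi>2 f] by (simp add: right_diff_distrib)
        finally show ?thesis using L2_Cauchy_Schwarz[OF \<psi>2 sq_int_diff[OF F[of n] f]] by simp
      qed
      then show "\<forall>\<^sub>F n in sequentially. norm ((\<integral>x. frac_lap_test (1/4) \<psi> x * \<phi> n x \<partial>lborel) - (\<integral>x. \<psi> x * f x \<partial>lborel)) \<le> L2nrm lborel \<psi> * L2nrm lborel (\<lambda>x. F n x - f x)"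
        by simp
      have "(\<lambda>n. L2nrm lborel \<psi> * L2nrm lborel (\<lambda>x. F n x - f x)) \<longlonglongrightarrow> L2nrm lborel \<psi> * 0" by (intro tendsto_intros Ff)
      then show "(\<lambda>n. L2nrm lborel \<psi> * L2nrm lborel (\<lambda>x. F n x - f x)) \<longlonglongrightarrow> 0" by simp
    qed
    ultimately show ?thesis by (rule LIMSEQ_unique)
  qed
  then have q: "quarter_laplacian u f" using f by (simp add: quarter_laplacian_def)
  have "(\<lambda>n. L2nrm lborel (F n)) \<longlonglongrightarrow> L2nrm lborel f"
    by (rule LIM_zero_cancel, rule Lim_null_comparison[OF _ Ff]) (use L2nrm_diff_bound[OF F f] in simp)
  then have 1: "(\<lambda>n. (L2nrm lborel (F n))\<^sup>2) \<longlonglongrightarrow> (L2nrm lborel f)\<^sup>2" by (intro tendsto_intros)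
  have "(\<lambda>n. energy_norm (\<phi> n)) \<longlonglongrightarrow> energy_norm u"
    by (rule LIM_zero_cancel, rule Lim_null_comparison[OF _ strong]) (use L2nrm_diff_bound[OF sqd finite_energyD(2)[OF u]] in simp)
  then have "(\<lambda>n. ?k * (energy_norm (\<phi> n))\<^sup>2) \<longlonglongrightarrow> ?k * (energy_norm u)\<^sup>2" by (intro tendsto_intros)
  then have 2: "(\<lambda>n. (L2nrm lborel (F n))\<^sup>2) \<longlonglongrightarrow> ?k * (energy_norm u)\<^sup>2" by (simp add: F_def test_function_energy[OF \<phi>t])
  show ?thesis using q LIMSEQ_unique[OF 1 2] by blast
qed

text \<open>Absorbs the linear term in the energy estimate below.\<close>

lemma le_add_of_square_le:
  fixes a b M :: real
  assumes "a\<^sup>2 \<le> b * (a + M) + M\<^sup>2" "0 \<le> b" "0 \<le> M" "0 \<le> a"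
  shows "a \<le> b + M"
proof (rule ccontr)
  assume "\<not> a \<le> b + M"
  then have a: "b + M < a" by simp
  have "a * a \<le> b * a + M * (b + M)" using assms(1) by (simp add: power2_eq_square algebra_simps)
  also have "\<dots> \<le> b * a + M * a" using a assms(3) by (intro add_left_mono mult_left_mono) auto
  also have "\<dots> = (b + M) * a" by (simp add: algebra_simps)
  also have "\<dots> < a * a" using a assms(2,3) by (intro mult_strict_right_mono) auto
  finally show False by simp
qed

text \<open>Let \<open>U\<close> be a mollification of \<open>u\<close> and \<open>c\<close> a cutoff of energy at most \<open>1\<close>. Testing with the
  mollification of \<open>c\<^sup>2 U\<close> moves the mollification onto \<open>u\<close> and produces the energy of \<open>c U\<close>, up to an
  error \<open>M\<^sup>2\<close> from the cutoff. On the other hand the pairing is at most the L2 norm of \<open>f\<close> times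
  the energy norm of the test function. This is a quadratic inequality for the energy norm of \<open>c U\<close>
  with constants that do not depend on the scale or on the cutoff; Fatou's lemma passes to \<open>u\<close>.\<close>

lemma quarter_laplacian_imp_finite_energy:
  fixes u :: "real \<Rightarrow> real"
  assumes um[measurable]: "u \<in> borel_measurable borel" and M: "\<And>x. \<bar>u x\<bar> \<le> M"
    and f: "quarter_laplacian u f"
  shows "finite_energy u"
proof -
  have M0: "0 \<le> M" using M[of 0] by linarith
  have f2: "sq_int lborel f" using f by (simp add: quarter_laplacian_def)
  let ?k = "lap_const (1/2)"
  have k0: "0 < ?k" by (rule lap_const_pos) auto
  have bound: "finite_energy (\<lambda>x. mollify e u x * c x) \<and> energy_norm (\<lambda>x. mollify e u x * c x) \<le> L2nrm lborel f / sqrt ?k + M"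
    if e: "0 < e" and ct: "test_function c" and c01: "\<And>x. 0 \<le> c x" "\<And>x. c x \<le> 1" and ce: "energy_norm c \<le> 1" for e c
  proof -
    define U where "U = mollify e u"
    have Um[measurable]: "U \<in> borel_measurable borel" unfolding U_def by measurable
    have Ub: "\<bar>U x\<bar> \<le> M" for x unfolding U_def by (rule mollify_bounded[OF um M])
    have cm[measurable]: "c \<in> borel_measurable borel" by (rule test_function_measurable[OF ct])
    have cb: "\<bar>c x\<bar> \<le> 1" for x using c01[of x] by simp
    have ci: "integrable lborel c" by (rule test_function_integrable[OF ct])
    note cf = test_function_finite_energy[OF ct]
    have Uci: "integrable lborel (\<lambda>x. c x * U x)" by (rule integrable_mult_bounded[OF ci Um Ub])
    define v where "v = (\<lambda>x. c x * U x * c x)"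
    have vi: "integrable lborel v" unfolding v_def by (rule integrable_mult_bounded[OF Uci cm cb])
    have vm[measurable]: "v \<in> borel_measurable borel" unfolding v_def by measurable
    have Ucb: "\<bar>U x * c x\<bar> \<le> M" for x using mult_mono[OF Ub[of x] cb[of x] M0] by (simp add: abs_mult)
    have v_eq: "v = (\<lambda>x. (U x * c x) * c x)" by (auto simp: v_def)
    have vb: "\<bar>v x\<bar> \<le> M" for x using mult_mono[OF Ucb[of x] cb[of x] M0] by (simp add: v_eq abs_mult)
    define \<phi> where "\<phi> = mollify e v"
    obtain R where R: "\<And>x. R < \<bar>x\<bar> \<Longrightarrow> c x = 0" using test_function_supp[OF ct] by blast
    have \<phi>t: "test_function \<phi>" unfolding \<phi>_def by (rule mollify_test[OF e vi, of R]) (simp add: v_def R)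
    define q where "q h = (\<integral>x. second_diff h \<phi> x * u x \<partial>lborel)" for h
    have qi: "integrable lborel (\<lambda>h. q h * kern (1/2) h)" 
      and qe: "(\<integral>x. frac_lap_test (1/2) \<phi> x * u x \<partial>lborel) = ?k * (\<integral>h. q h * kern (1/2) h \<partial>lborel)"
      unfolding q_def using frac_lap_test_pair(2,3)[OF _ _ \<phi>t um M, of "1/2"] by auto
    have sdv: "second_diff h \<phi> = mollify e (second_diff h v)" for h
    proof
      fix x
      have i: "integrable lborel (\<lambda>s. moll s * v (y - e * s))" for y by (rule mollify_integrand[OF vm vb])
      have "mollify e (second_diff h v) x = (\<integral>s. 2 * (moll s * v (x - e * s)) - moll s * v (x + h - e * s) - moll s * v (x - h - e * s) \<partial>lborel)"
        unfolding mollify_def second_diff_def by (rule Bochner_Integration.integral_cong) (auto simp: algebra_simps)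
      also have "\<dots> = second_diff h \<phi> x" unfolding \<phi>_def second_diff_def mollify_def using i by simp
      finally show "second_diff h \<phi> x = mollify e (second_diff h v) x" by simp
    qed
    \<comment> \<open>The energy of this localised mollification is to be bounded.\<close>
    define w where "w = (\<lambda>x. c x * U x)"
    have wm[measurable]: "w \<in> borel_measurable borel" unfolding w_def by measurable
    have wb: "\<bar>w x\<bar> \<le> M" for x using Ucb[of x] by (simp add: w_def mult.commute)
    define g where "g h = (\<integral>x. (c (x + h) - c x)\<^sup>2 \<partial>lborel)" for h
    have wi: "integrable lborel (\<lambda>x. (w (x + h) - w x) * (w (x + h) - w x))" for h
      by (rule second_diff_by_parts(2)[OF _ wm wb]) (use Uci in \<open>simp add: w_def\<close>)
    have cci: "integrable lborel (\<lambda>x. (c (x + h) - c x) * (c (x + h) - c x))" for h by (rule second_diff_by_parts(2)[OF ci cm cb])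
    have slice: "(\<integral>x. (w (x + h) - w x)\<^sup>2 \<partial>lborel) \<le> q h + M\<^sup>2 * g h" for h
    proof -
      have "q h = (\<integral>x. mollify e (second_diff h v) x * u x \<partial>lborel)" unfolding q_def sdv ..
      also have "\<dots> = (\<integral>x. second_diff h v x * U x \<partial>lborel)"
        unfolding U_def by (rule mollify_symmetric[OF second_diff_integrable[OF vi] um M])
      also have "\<dots> = (\<integral>x. (U (x + h) - U x) * (v (x + h) - v x) \<partial>lborel)" by (rule second_diff_by_parts(3)[OF vi Um Ub])
      finally have qh: "q h = (\<integral>x. (U (x + h) - U x) * (v (x + h) - v x) \<partial>lborel)" .
      have i1: "integrable lborel (\<lambda>x. (U (x + h) - U x) * (v (x + h) - v x))" by (rule second_diff_by_parts(2)[OF vi Um Ub])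
      have "(\<integral>x. (w (x + h) - w x)\<^sup>2 \<partial>lborel) \<le> (\<integral>x. (U (x + h) - U x) * (v (x + h) - v x) + M\<^sup>2 * (c (x + h) - c x)\<^sup>2 \<partial>lborel)"
      proof (rule integral_mono)
        show "integrable lborel (\<lambda>x. (w (x + h) - w x)\<^sup>2)" using wi by (simp add: power2_eq_square)
        show "integrable lborel (\<lambda>x. (U (x + h) - U x) * (v (x + h) - v x) + M\<^sup>2 * (c (x + h) - c x)\<^sup>2)"
          using i1 cci by (simp add: power2_eq_square)
        fix x
        have "(w (x + h) - w x)\<^sup>2 = (U (x + h) - U x) * (v (x + h) - v x) + U (x + h) * U x * (c (x + h) - c x)\<^sup>2"
          by (simp add: w_def v_def power2_eq_square algebra_simps)
        moreover have "U (x + h) * U x \<le> M\<^sup>2"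
        proof -
          have "U (x + h) * U x \<le> \<bar>U (x + h)\<bar> * \<bar>U x\<bar>" by (simp flip: abs_mult)
          also have "\<dots> \<le> M * M" by (intro mult_mono Ub M0) auto
          finally show ?thesis by (simp add: power2_eq_square)
        qed
        ultimately show "(w (x + h) - w x)\<^sup>2 \<le> (U (x + h) - U x) * (v (x + h) - v x) + M\<^sup>2 * (c (x + h) - c x)\<^sup>2"
          by (simp add: mult_right_mono)
      qed
      also have "\<dots> = q h + M\<^sup>2 * g h" using i1 cci by (simp add: qh g_def power2_eq_square)
      finally show ?thesis .
    qed
    have ge: "integrable lborel (\<lambda>h. g h * kern (1/2) h)" "(\<integral>h. g h * kern (1/2) h \<partial>lborel) = (energy_norm c)\<^sup>2"
    proof -
      have i: "integrable lborel2 (\<lambda>p. (norm (diff_quot c p))\<^sup>2)" using finite_energyD(2)[OF cf] by (simp add: sq_int_def)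
      have eq: "(\<integral>x. (norm (diff_quot c (h, x)))\<^sup>2 \<partial>lborel) = g h * kern (1/2) h" for h
      proof -
        have "(norm (diff_quot c (h, x)))\<^sup>2 = (c (x + h) - c x)\<^sup>2 * (1 / h\<^sup>2)" for x
          by (simp add: diff_quot_def power_mult_distrib power_divide inverse_eq_divide)
        then show ?thesis by (simp add: g_def kern_half)
      qed
      show "integrable lborel (\<lambda>h. g h * kern (1/2) h)" using lborel_pair.integrable_fst'[OF i] by (simp only: eq)
      show "(\<integral>h. g h * kern (1/2) h \<partial>lborel) = (energy_norm c)\<^sup>2" using lborel_pair.integral_fst'[OF i] by (simp only: eq L2nrm_sq)
    qed
    define I where "I = (\<integral>h. (q h + M\<^sup>2 * g h) * kern (1/2) h \<partial>lborel)"
    have Ii: "integrable lborel (\<lambda>h. (q h + M\<^sup>2 * g h) * kern (1/2) h)" using qi ge(1) by (simp add: distrib_right mult.assoc)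
    have qg0: "0 \<le> q h + M\<^sup>2 * g h" for h by (rule order_trans[OF _ slice]) simp
    have I0: "0 \<le> I" unfolding I_def using qg0 by (intro Bochner_Integration.integral_nonneg) simp
    have "(\<integral>\<^sup>+p. ennreal ((norm (diff_quot w p))\<^sup>2) \<partial>lborel2) \<le> ennreal ((sqrt I)\<^sup>2)"
    proof -
      have "(\<integral>\<^sup>+p. ennreal ((norm (diff_quot w p))\<^sup>2) \<partial>lborel2) = (\<integral>\<^sup>+h. (\<integral>\<^sup>+x. ennreal ((w (x + h) - w x)\<^sup>2) \<partial>lborel) * ennreal (1 / h\<^sup>2) \<partial>lborel)"
        by (rule energy_slices[OF wm])
      also have "\<dots> \<le> (\<integral>\<^sup>+h. ennreal ((q h + M\<^sup>2 * g h) * kern (1/2) h) \<partial>lborel)"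
      proof (rule nn_integral_mono)
        fix h
        have "(\<integral>\<^sup>+x. ennreal ((w (x + h) - w x)\<^sup>2) \<partial>lborel) = ennreal (\<integral>x. (w (x + h) - w x)\<^sup>2 \<partial>lborel)"
          using wi by (intro nn_integral_eq_integral) (auto simp: power2_eq_square)
        also have "\<dots> \<le> ennreal (q h + M\<^sup>2 * g h)" by (rule ennreal_leI[OF slice])
        finally have "(\<integral>\<^sup>+x. ennreal ((w (x + h) - w x)\<^sup>2) \<partial>lborel) * ennreal (1 / h\<^sup>2) \<le> ennreal (q h + M\<^sup>2 * g h) * ennreal (1 / h\<^sup>2)"
          by (rule mult_right_mono) simp
        also have "\<dots> = ennreal ((q h + M\<^sup>2 * g h) * kern (1/2) h)" unfolding kern_half by (rule ennreal_mult[symmetric]) (use qg0 in auto)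
        finally show "(\<integral>\<^sup>+x. ennreal ((w (x + h) - w x)\<^sup>2) \<partial>lborel) * ennreal (1 / h\<^sup>2) \<le> ennreal ((q h + M\<^sup>2 * g h) * kern (1/2) h)" .
      qed
      also have "\<dots> = ennreal I" unfolding I_def using Ii qg0 by (intro nn_integral_eq_integral) auto
      finally show ?thesis using I0 by simp
    qed
    from finite_energyI_nn[OF wm this] I0 have fw: "finite_energy w" and ew: "energy_norm w \<le> sqrt I" by auto
    let ?N = "L2nrm lborel f"
    have "(energy_norm w)\<^sup>2 \<le> I" using ew I0 by (metis L2nrm_nonneg power_mono real_sqrt_pow2)
    also have "I = (\<integral>h. q h * kern (1/2) h \<partial>lborel) + M\<^sup>2 * (energy_norm c)\<^sup>2"
      unfolding I_def ge(2)[symmetric] using qi ge(1) by (simp add: distrib_right mult.assoc)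
    also have "(\<integral>h. q h * kern (1/2) h \<partial>lborel) = (\<integral>x. frac_lap_test (1/4) \<phi> x * f x \<partial>lborel) / ?k"
      using qe half_laplacian_pair[OF um M f \<phi>t] k0 by (simp add: field_simps)
    also have "\<dots> \<le> (sqrt ?k * energy_norm \<phi> * ?N) / ?k"
    proof (rule divide_right_mono)
      have "(\<integral>x. frac_lap_test (1/4) \<phi> x * f x \<partial>lborel) \<le> L2nrm lborel (frac_lap_test (1/4) \<phi>) * ?N"
        using L2_Cauchy_Schwarz[OF frac_lap_test_sq_int[OF \<phi>t] f2] by simp
      also have "L2nrm lborel (frac_lap_test (1/4) \<phi>) = sqrt ?k * energy_norm \<phi>"
        using arg_cong[OF test_function_energy[OF \<phi>t], of sqrt] by (simp add: real_sqrt_mult)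
      finally show "(\<integral>x. frac_lap_test (1/4) \<phi> x * f x \<partial>lborel) \<le> sqrt ?k * energy_norm \<phi> * ?N" .
    qed (use k0 in simp)
    also have "\<dots> = (?N / sqrt ?k) * energy_norm \<phi>"
    proof -
      have "q / (q * q) = 1 / q" if "q \<noteq> 0" for q :: real using that by simp
      from this[of "sqrt ?k"] have "sqrt ?k / ?k = 1 / sqrt ?k" using k0 by simp
      moreover have "s * E * N / k = (N / q) * E" if "s / k = 1 / q" for s E N k q :: real
      proof -
        have "s * E * N / k = (s / k) * (N * E)" by simp
        also have "\<dots> = (1 / q) * (N * E)" by (simp only: that)
        finally show ?thesis by simp
      qed
      ultimately show ?thesis by blast
    qed
    also have "\<dots> \<le> (?N / sqrt ?k) * (energy_norm w + M)"
    proof (rule mult_left_mono)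
      have wc: "v = (\<lambda>x. w x * c x)" by (auto simp: v_def w_def)
      note fm = finite_energy_mult[OF fw wb cf cb, folded wc]
      have "energy_norm \<phi> \<le> energy_norm v" unfolding \<phi>_def by (rule mollify_energy(2)[OF fm(1) vb])
      also have "\<dots> \<le> 1 * energy_norm w + M * energy_norm c" by (rule fm(2))
      also have "\<dots> \<le> energy_norm w + M" using mult_left_mono[OF ce M0] by simp
      finally show "energy_norm \<phi> \<le> energy_norm w + M" .
    qed (use k0 in simp)
    also have "M\<^sup>2 * (energy_norm c)\<^sup>2 \<le> M\<^sup>2" using power_mono[OF ce, of 2] by (simp add: mult_left_le)
    finally have "(energy_norm w)\<^sup>2 \<le> (?N / sqrt ?k) * (energy_norm w + M) + M\<^sup>2" by simp
    from le_add_of_square_le[OF this] have "energy_norm w \<le> ?N / sqrt ?k + M" using k0 M0 by simp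
    moreover have "w = (\<lambda>x. mollify e u x * c x)" by (auto simp: w_def U_def)
    ultimately show ?thesis using fw by simp
  qed
  obtain e where e: "\<And>n. 0 < e n" "\<And>n. e n \<le> 1" and lim: "AE x in lborel. (\<lambda>n. mollify (e n) u x) \<longlonglongrightarrow> u x"
    using mollify_AE_tendsto[OF um M] by blast
  obtain ct where ct: "\<And>n. test_function (ct n)" "\<And>n x. 0 \<le> ct n x" "\<And>n x. ct n x \<le> 1"
     "\<And>n x. \<bar>x\<bar> \<le> real n \<Longrightarrow> 1 - inverse (real (Suc n)) \<le> ct n x" "\<And>n. energy_norm (ct n) \<le> inverse (real (Suc n))"
    using cutoff_sequence by blast
  have ce: "energy_norm (ct n) \<le> 1" for n by (rule order_trans[OF ct(5)]) (simp add: inverse_le_1_iff)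
  have l: "AE x in lborel. (\<lambda>n. mollify (e n) u x * ct n x) \<longlonglongrightarrow> u x"
    using lim
  proof eventually_elim
    case (elim x)
    have "(\<lambda>n. ct n x) \<longlonglongrightarrow> 1"
    proof (rule tendsto_sandwich)
      obtain n0 :: nat where n0: "\<bar>x\<bar> \<le> real n0" using real_arch_simple by blast
      have "1 - inverse (real (Suc n)) \<le> ct n x" if "n \<ge> n0" for n by (rule ct(4)) (use n0 that in linarith)
      then show "\<forall>\<^sub>F n in sequentially. 1 - inverse (real (Suc n)) \<le> ct n x" unfolding eventually_sequentially by blast
      have "(\<lambda>n. 1 - inverse (real (Suc n))) \<longlonglongrightarrow> 1 - 0" by (intro tendsto_intros LIMSEQ_inverse_real_of_nat)
      then show "(\<lambda>n. 1 - inverse (real (Suc n))) \<longlonglongrightarrow> 1" by simp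
    qed (use ct(3) in auto)
    from tendsto_mult[OF elim this] show ?case by simp
  qed
  have "sq_int lborel2 (diff_quot u)"
  proof (rule L2nrm_Fatou(1)[OF _ _ _ _ AE_diff_quot_tendsto[OF l]])
    show "sq_int lborel2 (diff_quot (\<lambda>x. mollify (e n) u x * ct n x))" for n
      using bound[OF e(1) ct(1) ct(2) ct(3) ce] by (simp add: finite_energy_def)
    show "energy_norm (\<lambda>x. mollify (e n) u x * ct n x) \<le> L2nrm lborel f / sqrt ?k + M" for n
      using bound[OF e(1) ct(1) ct(2) ct(3) ce] by blast
  qed (use k0 M0 in auto)
  then show ?thesis by (simp add: finite_energy_def um)
qed

section \<open>Vector valued functions\<close>

lemma has_frac_laplacian_cong_AE:
  assumes "AE x in lborel. u x = v x" "u \<in> borel_measurable lborel" "v \<in> borel_measurable lborel"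
  shows "has_frac_laplacian s u f \<longleftrightarrow> has_frac_laplacian s v f"
proof -
  have m: "frac_lap_test s \<phi> \<in> borel_measurable borel" if "test_function \<phi>" for \<phi>
    by (rule frac_lap_test_measurable[OF that])
  have "integrable lborel (\<lambda>x. ((1 + \<bar>x\<bar>) powr - (1 + 2 * s)) *\<^sub>R u x) \<longleftrightarrow> integrable lborel (\<lambda>x. ((1 + \<bar>x\<bar>) powr - (1 + 2 * s)) *\<^sub>R v x)"
    using assms by (intro integrable_cong_AE) (auto elim: eventually_mono)
  moreover have "(\<integral>x. frac_lap_test s \<phi> x *\<^sub>R u x \<partial>lborel) = (\<integral>x. frac_lap_test s \<phi> x *\<^sub>R v x \<partial>lborel)" if "test_function \<phi>" for \<phi>
    using assms m[OF that] by (intro integral_cong_AE) (auto elim: eventually_mono)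
  ultimately show ?thesis using assms(2,3) by (auto simp: has_frac_laplacian_def)
qed

lemma Hdot_half_cong_AE:
  assumes "AE x in lborel. u x = v x" "u \<in> borel_measurable lborel" "v \<in> borel_measurable lborel"
  shows "u \<in> Hdot_half \<longleftrightarrow> v \<in> Hdot_half" "half_energy u = half_energy v"
  using has_frac_laplacian_cong_AE[OF assms] by (auto simp: Hdot_half_def half_energy_def frac_laplacian_def)

lemma finite_energy_cong_AE:
  assumes "AE x in lborel. u x = v x" "u \<in> borel_measurable lborel" "v \<in> borel_measurable lborel"
  shows "finite_energy u \<longleftrightarrow> finite_energy v" "energy_norm u = energy_norm v"
proof -
  have [measurable]: "u \<in> borel_measurable borel" "v \<in> borel_measurable borel" using assms by auto
  have ae: "AE p in lborel2. (norm (diff_quot u p))\<^sup>2 = (norm (diff_quot v p))\<^sup>2"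
    using AE_diff_quot[OF assms(1)] by eventually_elim (simp add: diff_quot_def)
  have "integrable lborel2 (\<lambda>p. (norm (diff_quot u p))\<^sup>2) \<longleftrightarrow> integrable lborel2 (\<lambda>p. (norm (diff_quot v p))\<^sup>2)"
    by (rule integrable_cong_AE[OF _ _ ae]) auto
  then show "finite_energy u \<longleftrightarrow> finite_energy v" by (simp add: finite_energy_def sq_int_def)
  show "energy_norm u = energy_norm v" unfolding L2nrm_def
    by (rule arg_cong[where f=sqrt], rule integral_cong_AE[OF _ _ ae]) auto
qed

lemma locally_integrable_measurable:
  fixes f :: "real \<Rightarrow> 'a::euclidean_space"
  assumes "\<And>r. set_integrable lborel {-r..r} f"
  shows "f \<in> borel_measurable borel"
proof (rule borel_measurable_LIMSEQ_metric)
  show "(\<lambda>x. indicator {- real n..real n} x *\<^sub>R f x) \<in> borel_measurable borel" for n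
    using borel_measurable_integrable[OF assms[of "real n", unfolded set_integrable_def]] by simp
  fix x
  obtain n0 :: nat where n0: "\<bar>x\<bar> \<le> real n0" using real_arch_simple by blast
  have "indicator {- real n..real n} x *\<^sub>R f x = f x" if "n \<ge> n0" for n
    using n0 that by (simp add: indicator_def abs_le_iff)
  then have "\<forall>\<^sub>F n in sequentially. indicator {- real n..real n} x *\<^sub>R f x = f x" unfolding eventually_sequentially by blast
  then show "(\<lambda>n. indicator {- real n..real n} x *\<^sub>R f x) \<longlonglongrightarrow> f x" by (rule tendsto_eventually)
qed

lemma test_times_locally_integrable:
  fixes f :: "real \<Rightarrow> 'a::euclidean_space"
  assumes \<phi>: "test_function \<phi>" and f: "\<And>r. set_integrable lborel {-r..r} f"
  shows "integrable lborel (\<lambda>x. \<phi> x *\<^sub>R f x)"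
proof -
  have [measurable]: "\<phi> \<in> borel_measurable borel" "f \<in> borel_measurable borel"
    using test_function_measurable[OF \<phi>] locally_integrable_measurable[OF f] by auto
  obtain R where R: "\<And>x. R < \<bar>x\<bar> \<Longrightarrow> \<phi> x = 0" using test_function_supp[OF \<phi>] by blast
  obtain B where B: "\<And>x. \<bar>\<phi> x\<bar> \<le> B" using test_function_bounded[OF \<phi>] by blast
  have "integrable lborel (\<lambda>x. B * norm (indicator {-R..R} x *\<^sub>R f x))"
    using f[of R] by (simp only: set_integrable_def integrable_norm integrable_mult_right)
  then show ?thesis
  proof (rule Bochner_Integration.integrable_bound)
    have "norm (\<phi> x *\<^sub>R f x) \<le> norm (B * norm (indicator {-R..R} x *\<^sub>R f x))" for x
    proof (cases "R < \<bar>x\<bar>")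
      case False
      then have "indicator {-R..R} x = (1::real)" by (auto simp: indicator_def)
      then show ?thesis using mult_right_mono[OF B[of x] norm_ge_zero[of "f x"]] B[of x] by (simp add: abs_mult)
    qed (simp add: R)
    then show "AE x in lborel. norm (\<phi> x *\<^sub>R f x) \<le> norm (B * norm (indicator {-R..R} x *\<^sub>R f x))" by simp
  qed measurable
qed

lemma sq_int_locally_integrable:
  fixes f :: "real \<Rightarrow> 'a::euclidean_space"
  assumes f: "sq_int lborel f" shows "set_integrable lborel {-r..r} f"
proof -
  have [measurable]: "f \<in> borel_measurable borel" using f by (simp add: sq_int_def)
  have "integrable lborel (\<lambda>x. indicator {-r..r} x + (norm (f x))\<^sup>2)"
    using f by (intro Bochner_Integration.integrable_add integrable_real_indicator emeasure_bounded_finite) (auto simp: sq_int_def)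
  then show ?thesis unfolding set_integrable_def
  proof (rule Bochner_Integration.integrable_bound)
    have "norm (indicator {-r..r} x *\<^sub>R f x) \<le> norm (indicator {-r..r} x + (norm (f x))\<^sup>2)" for x
    proof -
      have "norm (f x) \<le> 1 + (norm (f x))\<^sup>2"
      proof -
        have "norm (f x) \<le> 2 * norm (f x)" by simp
        also have "\<dots> \<le> 1 + (norm (f x))\<^sup>2" using sum_squares_bound[of "norm (f x)" 1] by simp
        finally show ?thesis .
      qed
      then show ?thesis by (auto simp: indicator_def)
    qed
    then show "AE x in lborel. norm (indicator {-r..r} x *\<^sub>R f x) \<le> norm (indicator {-r..r} x + (norm (f x))\<^sup>2)" by simp
  qed measurable
qed

lemma has_frac_laplacian_unique:
  assumes f: "has_frac_laplacian s u f" and g: "has_frac_laplacian s u g"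
  shows "AE x in lborel. f x = g x"
proof -
  have lf: "\<And>r. set_integrable lborel {-r..r} f" and lg: "\<And>r. set_integrable lborel {-r..r} g"
    using f g by (auto simp: has_frac_laplacian_def)
  have [measurable]: "f \<in> borel_measurable borel" "g \<in> borel_measurable borel"
    using locally_integrable_measurable[OF lf] locally_integrable_measurable[OF lg] by auto
  have "AE x in lborel. (f x - g x) \<bullet> b = 0" for b
  proof (rule test_function_separation)
    have li: "set_integrable lborel {-r..r} (\<lambda>x. f x - g x)" for r using lf lg by (rule set_integral_diff(1))
    show "set_integrable lborel {-r..r} (\<lambda>x. (f x - g x) \<bullet> b)" for r
    proof -
      have "integrable lborel (\<lambda>x. (indicator {-r..r} x *\<^sub>R (f x - g x)) \<bullet> b)"
        using li[of r] by (intro integrable_inner_left) (simp add: set_integrable_def)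
      then show ?thesis by (simp add: set_integrable_def)
    qed
    fix \<phi> :: "real \<Rightarrow> real" assume \<phi>: "test_function \<phi>"
    note i = test_times_locally_integrable[OF \<phi> lf] test_times_locally_integrable[OF \<phi> lg]
    have "(\<integral>x. \<phi> x * ((f x - g x) \<bullet> b) \<partial>lborel) = (\<integral>x. (\<phi> x *\<^sub>R f x - \<phi> x *\<^sub>R g x) \<bullet> b \<partial>lborel)"
      by (simp add: inner_diff_left right_diff_distrib)
    also have "\<dots> = (\<integral>x. \<phi> x *\<^sub>R f x - \<phi> x *\<^sub>R g x \<partial>lborel) \<bullet> b" using i by (intro integral_inner_left) auto
    also have "\<dots> = 0" using i f g \<phi> by (simp add: has_frac_laplacian_def)
    finally show "(\<integral>x. \<phi> x * ((f x - g x) \<bullet> b) \<partial>lborel) = 0" .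
  qed measurable
  then have "AE x in lborel. \<forall>b\<in>Basis. (f x - g x) \<bullet> b = 0" by (simp add: AE_finite_all)
  then show ?thesis by eventually_elim (metis eq_iff_diff_eq_0 euclidean_all_zero_iff)
qed

lemma diff_quot_inner: "diff_quot u p \<bullet> b = diff_quot (\<lambda>x. u x \<bullet> b) p"
  by (simp add: diff_quot_def inner_diff_left)

lemma norm_sq_Basis: "(norm (x::'a::euclidean_space))\<^sup>2 = (\<Sum>b\<in>Basis. (x \<bullet> b)\<^sup>2)"
  unfolding power2_norm_eq_inner by (subst euclidean_inner) (simp add: power2_eq_square)

lemma sq_int_components:
  fixes f :: "'x \<Rightarrow> 'a::euclidean_space"
  shows "sq_int M f \<longleftrightarrow> (\<forall>b\<in>Basis. sq_int M (\<lambda>x. f x \<bullet> b))"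
    "sq_int M f \<Longrightarrow> (L2nrm M f)\<^sup>2 = (\<Sum>b\<in>Basis. (L2nrm M (\<lambda>x. f x \<bullet> b))\<^sup>2)"
proof -
  show *: "sq_int M f \<longleftrightarrow> (\<forall>b\<in>Basis. sq_int M (\<lambda>x. f x \<bullet> b))"
  proof
    assume f: "sq_int M f"
    then have [measurable]: "f \<in> borel_measurable M" by (simp add: sq_int_def)
    show "\<forall>b\<in>Basis. sq_int M (\<lambda>x. f x \<bullet> b)"
      by (intro ballI sq_int_dominated(1)[OF f]) (auto simp: Basis_le_norm)
  next
    assume c: "\<forall>b\<in>Basis. sq_int M (\<lambda>x. f x \<bullet> b)"
    then have "f \<in> borel_measurable M" by (subst borel_measurable_euclidean_space) (auto simp: sq_int_def)
    moreover have "integrable M (\<lambda>x. (norm (f x))\<^sup>2)"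
      unfolding norm_sq_Basis using c by (intro Bochner_Integration.integrable_sum) (auto simp: sq_int_def)
    ultimately show "sq_int M f" by (simp add: sq_int_def)
  qed
  assume "sq_int M f"
  with * have c: "\<And>b. b \<in> Basis \<Longrightarrow> integrable M (\<lambda>x. (f x \<bullet> b)\<^sup>2)" by (auto simp: sq_int_def)
  then show "(L2nrm M f)\<^sup>2 = (\<Sum>b\<in>Basis. (L2nrm M (\<lambda>x. f x \<bullet> b))\<^sup>2)"
    by (simp only: L2nrm_sq norm_sq_Basis[where 'a='a] real_norm_def power2_abs) (rule Bochner_Integration.integral_sum)
qed

lemma finite_energy_components:
  fixes u :: "real \<Rightarrow> 'a::euclidean_space"
  shows "finite_energy u \<longleftrightarrow> (\<forall>b\<in>Basis. finite_energy (\<lambda>x. u x \<bullet> b))"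
    "finite_energy u \<Longrightarrow> (energy_norm u)\<^sup>2 = (\<Sum>b\<in>Basis. (energy_norm (\<lambda>x. u x \<bullet> b))\<^sup>2)"
proof -
  have "(\<lambda>p. diff_quot u p \<bullet> b) = diff_quot (\<lambda>x. u x \<bullet> b)" for b by (simp add: diff_quot_inner fun_eq_iff)
  then have *: "sq_int lborel2 (diff_quot u) \<longleftrightarrow> (\<forall>b\<in>Basis. sq_int lborel2 (diff_quot (\<lambda>x. u x \<bullet> b)))"
    "sq_int lborel2 (diff_quot u) \<Longrightarrow> (energy_norm u)\<^sup>2 = (\<Sum>b\<in>Basis. (energy_norm (\<lambda>x. u x \<bullet> b))\<^sup>2)"
    using sq_int_components[of lborel2 "diff_quot u"] by simp_all
  have "u \<in> borel_measurable borel \<longleftrightarrow> (\<forall>b\<in>Basis. (\<lambda>x. u x \<bullet> b) \<in> borel_measurable borel)"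
    by (rule borel_measurable_euclidean_space)
  with * show "finite_energy u \<longleftrightarrow> (\<forall>b\<in>Basis. finite_energy (\<lambda>x. u x \<bullet> b))"
    "finite_energy u \<Longrightarrow> (energy_norm u)\<^sup>2 = (\<Sum>b\<in>Basis. (energy_norm (\<lambda>x. u x \<bullet> b))\<^sup>2)"
    by (auto simp: finite_energy_def)
qed

lemma integrable_scaleR_bounded:
  fixes u :: "real \<Rightarrow> 'a::euclidean_space"
  assumes g: "integrable lborel g" and [measurable]: "u \<in> borel_measurable borel" and B: "\<And>x. norm (u x) \<le> B"
  shows "integrable lborel (\<lambda>x. g x *\<^sub>R u x)"
proof (rule Bochner_Integration.integrable_bound)
  have "g \<in> borel_measurable lborel" using g by auto
  then have [measurable]: "g \<in> borel_measurable borel" by simp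
  show "(\<lambda>x. g x *\<^sub>R u x) \<in> borel_measurable lborel" by measurable
  show "integrable lborel (\<lambda>x. B * g x)" using g by simp
  have "norm (g x *\<^sub>R u x) \<le> norm (B * g x)" for x
    using mult_right_mono[OF B[of x] abs_ge_zero[of "g x"]] order_trans[OF norm_ge_zero B[of x]]
    by (simp add: abs_mult mult.commute)
  then show "AE x in lborel. norm (g x *\<^sub>R u x) \<le> norm (B * g x)" by simp
qed

lemma weight_integrable: "0 < (s::real) \<Longrightarrow> integrable lborel (\<lambda>x. (1 + \<bar>x\<bar>) powr - (1 + 2 * s))"
proof -
  assume s: "0 < s"
  let ?f = "\<lambda>x. (1 + \<bar>x\<bar>) powr - (1 + 2 * s)"
  have "(\<lambda>h. h powr (- (1 + 2 * s))) integrable_on {1..}"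
    using has_integral_powr_to_inf[of "- (1 + 2 * s)" 1] s by auto
  then have "(\<lambda>h. h powr (- (1 + 2 * s))) absolutely_integrable_on {1..}"
    by (intro nonnegative_absolutely_integrable_1) auto
  then have "integrable lborel (\<lambda>h. indicator {1..} h *\<^sub>R h powr (- (1 + 2 * s)))"
    unfolding set_integrable_def by (subst (asm) integrable_completion) auto
  from lborel_integrable_real_affine[OF this, of 1 1]
  have 1: "integrable lborel (\<lambda>h. indicator {1..} (1 + h) *\<^sub>R (1 + h) powr (- (1 + 2 * s)))" by simp
  from lborel_integrable_real_affine[OF this, of "-1" 0]
  have 2: "integrable lborel (\<lambda>h. indicator {1..} (1 - h) *\<^sub>R (1 - h) powr (- (1 + 2 * s)))" by simp
  show ?thesis
    by (rule Bochner_Integration.integrable_bound[OF Bochner_Integration.integrable_add[OF 1 2]])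
       (auto simp: indicator_def)
qed

text \<open>Componentwise, the local conditions in \<open>has_frac_laplacian\<close> follow from boundedness of \<open>u\<close> and
  square integrability of \<open>f\<close>.\<close>

lemma has_frac_laplacian_quarter:
  fixes u f :: "real \<Rightarrow> 'a::euclidean_space"
  assumes um[measurable]: "u \<in> borel_measurable borel" and B: "\<And>x. norm (u x) \<le> B" and f: "sq_int lborel f"
  shows "has_frac_laplacian (1/4) u f \<longleftrightarrow> (\<forall>b\<in>Basis. quarter_laplacian (\<lambda>x. u x \<bullet> b) (\<lambda>x. f x \<bullet> b))"
proof -
  have lf: "\<And>r. set_integrable lborel {-r..r} f" by (rule sq_int_locally_integrable[OF f])
  have w: "integrable lborel (\<lambda>x. ((1 + \<bar>x\<bar>) powr - (1 + 2 * (1/4))) *\<^sub>R u x)"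
    by (intro integrable_scaleR_bounded[OF weight_integrable um B]) simp
  have fc: "sq_int lborel (\<lambda>x. f x \<bullet> b)" if "b \<in> Basis" for b using f sq_int_components(1) that by blast
  have eq: "((\<integral>x. frac_lap_test (1/4) \<phi> x *\<^sub>R u x \<partial>lborel) = (\<integral>x. \<phi> x *\<^sub>R f x \<partial>lborel)) \<longleftrightarrow>
     (\<forall>b\<in>Basis. (\<integral>x. frac_lap_test (1/4) \<phi> x * (u x \<bullet> b) \<partial>lborel) = (\<integral>x. \<phi> x * (f x \<bullet> b) \<partial>lborel))"
    if \<phi>: "test_function \<phi>" for \<phi>
  proof -
    have "integrable lborel (\<lambda>x. frac_lap_test (1/4) \<phi> x *\<^sub>R u x)"
      by (rule integrable_scaleR_bounded[OF frac_lap_test_integrable(1)[OF _ _ \<phi>] um B]) auto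
    then have 1: "(\<integral>x. frac_lap_test (1/4) \<phi> x *\<^sub>R u x \<partial>lborel) \<bullet> b = (\<integral>x. frac_lap_test (1/4) \<phi> x * (u x \<bullet> b) \<partial>lborel)" for b
      by (subst integral_inner_left[symmetric]) auto
    have 2: "(\<integral>x. \<phi> x *\<^sub>R f x \<partial>lborel) \<bullet> b = (\<integral>x. \<phi> x * (f x \<bullet> b) \<partial>lborel)" for b
      using test_times_locally_integrable[OF \<phi> lf] by (subst integral_inner_left[symmetric]) auto
    show ?thesis by (subst euclidean_eq_iff) (simp add: 1 2)
  qed
  show ?thesis
    unfolding has_frac_laplacian_def quarter_laplacian_def using um w lf fc eq by auto
qed

lemma square_integrable_iff: "square_integrable f \<longleftrightarrow> sq_int lborel f"
  by (simp add: square_integrable_def sq_int_def)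

text \<open>The factor between \<open>half_energy\<close> and the Gagliardo energy.\<close>

abbreviation "energy_const \<equiv> lap_const (1/2)"

lemma finite_energy_quarter_exists:
  fixes u :: "real \<Rightarrow> 'a::euclidean_space"
  assumes u: "finite_energy u" and B: "\<And>x. norm (u x) \<le> B"
  shows "\<exists>f. has_frac_laplacian (1/4) u f \<and> sq_int lborel f \<and> (L2nrm lborel f)\<^sup>2 = energy_const * (energy_norm u)\<^sup>2"
proof -
  have um: "u \<in> borel_measurable borel" by (rule finite_energyD(1)[OF u])
  have "\<forall>b\<in>Basis. \<exists>f. quarter_laplacian (\<lambda>x. u x \<bullet> b) f \<and> (L2nrm lborel f)\<^sup>2 = energy_const * (energy_norm (\<lambda>x. u x \<bullet> b))\<^sup>2"
  proof
    fix b :: 'a assume b: "b \<in> Basis"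
    show "\<exists>f. quarter_laplacian (\<lambda>x. u x \<bullet> b) f \<and> (L2nrm lborel f)\<^sup>2 = energy_const * (energy_norm (\<lambda>x. u x \<bullet> b))\<^sup>2"
    proof (rule finite_energy_imp_quarter_laplacian)
      show "finite_energy (\<lambda>x. u x \<bullet> b)" using u b finite_energy_components(1) by blast
      show "\<bar>u x \<bullet> b\<bar> \<le> B" for x using order_trans[OF Basis_le_norm[OF b] B] .
    qed
  qed
  then obtain F where F: "\<And>b. b \<in> Basis \<Longrightarrow> quarter_laplacian (\<lambda>x. u x \<bullet> b) (F b)"
     "\<And>b. b \<in> Basis \<Longrightarrow> (L2nrm lborel (F b))\<^sup>2 = energy_const * (energy_norm (\<lambda>x. u x \<bullet> b))\<^sup>2" by metis
  define f where "f x = (\<Sum>b\<in>Basis. F b x *\<^sub>R b)" for x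
  have fb: "(\<lambda>x. f x \<bullet> b) = F b" if "b \<in> Basis" for b
    using that by (auto simp: f_def inner_sum_left inner_Basis if_distrib cong: if_cong)
  have f2: "sq_int lborel f"
    using F(1) by (subst sq_int_components(1)) (simp add: fb quarter_laplacian_def)
  have "has_frac_laplacian (1/4) u f" using F(1) by (subst has_frac_laplacian_quarter[OF um B f2]) (simp add: fb)
  moreover have "(L2nrm lborel f)\<^sup>2 = energy_const * (energy_norm u)\<^sup>2"
    unfolding sq_int_components(2)[OF f2] finite_energy_components(2)[OF u]
    by (simp add: fb F(2) sum_distrib_left)
  ultimately show ?thesis using f2 by blast
qed

text \<open>The description of \<open>Hdot_half\<close> by differences, to which Lipschitz operations on maps apply directly.
  The choice of representative in \<open>frac_laplacian\<close> is immaterial by uniqueness almost everywhere.\<close>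

lemma bounded_Hdot_half:
  fixes u :: "real \<Rightarrow> 'a::euclidean_space"
  assumes um: "u \<in> borel_measurable borel" and B: "\<And>x. norm (u x) \<le> B"
  shows "u \<in> Hdot_half \<longleftrightarrow> finite_energy u" "finite_energy u \<Longrightarrow> half_energy u = energy_const * (energy_norm u)\<^sup>2"
proof -
  show "u \<in> Hdot_half \<longleftrightarrow> finite_energy u"
  proof
    assume "u \<in> Hdot_half"
    then obtain f where f: "has_frac_laplacian (1/4) u f" "sq_int lborel f" by (auto simp: Hdot_half_def square_integrable_iff)
    show "finite_energy u"
    proof (subst finite_energy_components(1), intro ballI)
      fix b :: 'a assume b: "b \<in> Basis"
      show "finite_energy (\<lambda>x. u x \<bullet> b)"
      proof (rule quarter_laplacian_imp_finite_energy)
        show "quarter_laplacian (\<lambda>x. u x \<bullet> b) (\<lambda>x. f x \<bullet> b)"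
          using f b has_frac_laplacian_quarter[OF um B f(2)] by blast
        show "\<bar>u x \<bullet> b\<bar> \<le> B" for x using order_trans[OF Basis_le_norm[OF b] B] .
      qed (use um in simp)
    qed
  next
    assume "finite_energy u"
    from finite_energy_quarter_exists[OF this B] show "u \<in> Hdot_half"
      unfolding Hdot_half_def square_integrable_iff by blast
  qed
  assume u: "finite_energy u"
  obtain f where f: "has_frac_laplacian (1/4) u f" "sq_int lborel f" "(L2nrm lborel f)\<^sup>2 = energy_const * (energy_norm u)\<^sup>2"
    using finite_energy_quarter_exists[OF u B] by blast
  have l: "has_frac_laplacian (1/4) u (frac_laplacian (1/4) u)"
    unfolding frac_laplacian_def by (rule someI[of "has_frac_laplacian (1/4) u", OF f(1)])
  then have [measurable]: "frac_laplacian (1/4) u \<in> borel_measurable borel" "f \<in> borel_measurable borel"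
    using f(1) locally_integrable_measurable by (auto simp: has_frac_laplacian_def)
  have "AE x in lborel. (norm (frac_laplacian (1/4) u x))\<^sup>2 = (norm (f x))\<^sup>2"
    using has_frac_laplacian_unique[OF l f(1)] by eventually_elim simp
  then have "half_energy u = (\<integral>x. (norm (f x))\<^sup>2 \<partial>lborel)"
    unfolding half_energy_def by (intro integral_cong_AE) auto
  then show "half_energy u = energy_const * (energy_norm u)\<^sup>2" using f(3) by (simp add: L2nrm_sq)
qed

lemma Hdot_half_measurable: "u \<in> Hdot_half \<Longrightarrow> u \<in> borel_measurable borel"
  by (auto simp: Hdot_half_def has_frac_laplacian_def)

lemma half_laplacian_vector_pair:
  fixes u :: "real \<Rightarrow> 'a::euclidean_space"
  assumes u: "finite_energy u" and B: "\<And>x. norm (u x) \<le> B" and \<phi>: "test_function \<phi>" and b: "b \<in> Basis"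
  shows "(\<integral>x. frac_lap_test (1/2) \<phi> x *\<^sub>R u x \<partial>lborel) \<bullet> b = energy_const * (\<integral>p. diff_quot u p \<bullet> diff_quot (\<lambda>x. \<phi> x *\<^sub>R b) p \<partial>lborel2)"
proof -
  have um: "u \<in> borel_measurable borel" by (rule finite_energyD(1)[OF u])
  have "integrable lborel (\<lambda>x. frac_lap_test (1/2) \<phi> x *\<^sub>R u x)"
    by (rule integrable_scaleR_bounded[OF frac_lap_test_integrable(1)[OF _ _ \<phi>] um B]) auto
  then have "(\<integral>x. frac_lap_test (1/2) \<phi> x *\<^sub>R u x \<partial>lborel) \<bullet> b = (\<integral>x. frac_lap_test (1/2) \<phi> x * (u x \<bullet> b) \<partial>lborel)"
    by (subst integral_inner_left[symmetric]) auto
  also have "\<dots> = energy_const * (\<integral>p. diff_quot (\<lambda>x. u x \<bullet> b) p * diff_quot \<phi> p \<partial>lborel2)"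
  proof (rule half_laplacian_energy[OF _ _ \<phi>])
    show "finite_energy (\<lambda>x. u x \<bullet> b)" using u b finite_energy_components(1) by blast
    show "\<bar>u x \<bullet> b\<bar> \<le> B" for x using order_trans[OF Basis_le_norm[OF b] B] .
  qed
  also have "(\<lambda>p. diff_quot (\<lambda>x. u x \<bullet> b) p * diff_quot \<phi> p) = (\<lambda>p. diff_quot u p \<bullet> diff_quot (\<lambda>x. \<phi> x *\<^sub>R b) p)"
  proof
    fix p
    have "diff_quot (\<lambda>x. \<phi> x *\<^sub>R b) p = diff_quot \<phi> p *\<^sub>R b" by (simp add: diff_quot_def algebra_simps)
    then show "diff_quot (\<lambda>x. u x \<bullet> b) p * diff_quot \<phi> p = diff_quot u p \<bullet> diff_quot (\<lambda>x. \<phi> x *\<^sub>R b) p"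
      by (simp add: diff_quot_inner mult.commute)
  qed
  finally show ?thesis .
qed

section \<open>Stationarity in the Gagliardo energy\<close>

text \<open>A curve through \<open>u'\<close> becomes a curve through \<open>u\<close> by changing it at the time \<open>0\<close> only, on a null set.
  This allows \<open>u\<close> to be replaced by a map with all its values in \<open>N\<close>.\<close>

lemma weak_half_harmonic_cong_AE:
  fixes u u' :: "real \<Rightarrow> 'a::euclidean_space"
  assumes harm: "weak_half_harmonic N u" and ae: "AE x in lborel. u x = u' x" and [measurable]: "u' \<in> borel_measurable borel"
  shows "weak_half_harmonic N u'"
proof -
  have uN: "u \<in> Hdot_half_into N" using harm by (simp add: weak_half_harmonic_def)
  then have [measurable]: "u \<in> borel_measurable borel" by (auto simp: Hdot_half_into_def dest: Hdot_half_measurable)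
  have ml: "u \<in> borel_measurable lborel" "u' \<in> borel_measurable lborel" by auto
  note c = Hdot_half_cong_AE[OF ae ml]
  have "AE x in lborel. u' x \<in> N" using uN ae by (auto simp: Hdot_half_into_def elim: eventually_elim2)
  then have u'N: "u' \<in> Hdot_half_into N" using uN c(1) by (auto simp: Hdot_half_into_def)
  have "((\<lambda>t. half_energy (v t)) has_real_derivative 0) (at 0)"
    if v: "\<forall>t. v t \<in> Hdot_half_into N" "v 0 = u'" and w: "has_velocity v w" for v w
  proof -
    \<comment> \<open>All times except \<open>0\<close> are unaffected by the change of representative.\<close>
  define v' where "v' = v(0 := u)"
    have v'N: "\<forall>t. v' t \<in> Hdot_half_into N" using v uN by (simp add: v'_def)
    have vm[measurable]: "v t \<in> borel_measurable borel" for t using v(1) by (auto simp: Hdot_half_into_def dest: Hdot_half_measurable)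
    have [measurable]: "w \<in> borel_measurable borel" using w by (auto simp: has_velocity_def dest: Hdot_half_measurable)
    have aet: "AE x in lborel. (v t x - v 0 x) /\<^sub>R t - w x = (v' t x - v' 0 x) /\<^sub>R t - w x" if "t \<noteq> 0" for t
      using ae by eventually_elim (use that v(2) in \<open>simp add: v'_def\<close>)
    have e: "half_energy (\<lambda>x. (v t x - v 0 x) /\<^sub>R t - w x) = half_energy (\<lambda>x. (v' t x - v' 0 x) /\<^sub>R t - w x)" if t: "t \<noteq> 0" for t
    proof (rule Hdot_half_cong_AE(2)[OF aet[OF t]])
      show "(\<lambda>x. (v' t x - v' 0 x) /\<^sub>R t - w x) \<in> borel_measurable lborel" using t by (simp add: v'_def)
    qed simp
    have "has_velocity v' w"
      unfolding has_velocity_def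
    proof (intro conjI allI impI)
      show "w \<in> Hdot_half" "\<exists>B. AE x in lborel. norm (w x) \<le> B" using w by (auto simp: has_velocity_def)
      have "((\<lambda>t. half_energy (\<lambda>x. (v t x - v 0 x) /\<^sub>R t - w x)) \<longlongrightarrow> 0) (at 0)" using w by (simp add: has_velocity_def)
      then show "((\<lambda>t. half_energy (\<lambda>x. (v' t x - v' 0 x) /\<^sub>R t - w x)) \<longlongrightarrow> 0) (at 0)"
        by (rule Lim_transform_eventually) (simp add: eventually_at_filter e)
      fix \<epsilon> :: real assume "0 < \<epsilon>"
      then have "\<forall>\<^sub>F t in at 0. AE x in lborel. norm ((v t x - v 0 x) /\<^sub>R t - w x) \<le> \<epsilon>" using w by (simp add: has_velocity_def)
      moreover have "\<forall>\<^sub>F t in at (0::real). t \<noteq> 0" by (simp add: eventually_at_filter)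
      ultimately show "\<forall>\<^sub>F t in at 0. AE x in lborel. norm ((v' t x - v' 0 x) /\<^sub>R t - w x) \<le> \<epsilon>"
      proof eventually_elim
        case (elim t)
        from elim(1) aet[OF elim(2)] show ?case by eventually_elim simp
      qed
    qed
    moreover have "v' 0 = u" by (simp add: v'_def)
    ultimately have "((\<lambda>t. half_energy (v' t)) has_real_derivative 0) (at 0)"
      using harm v'N unfolding weak_half_harmonic_def by blast
    moreover have "half_energy (v' t) = half_energy (v t)" for t using c(2) v(2) by (simp add: v'_def)
    ultimately show ?thesis by simp
  qed
  then show ?thesis using u'N unfolding weak_half_harmonic_def by blast
qed

text \<open>Write \<open>v t = u + t * (w + D t)\<close> with a remainder \<open>D t\<close> whose energy tends to \<open>0\<close>, and expand the
  square: the difference quotient of the energy converges to twice the inner product in question, times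
  \<open>energy_const\<close>.\<close>

lemma stationary_imp_orthogonal:
  fixes u w :: "real \<Rightarrow> 'a::euclidean_space"
  assumes harm: "weak_half_harmonic N u" and N: "\<And>z. z \<in> N \<Longrightarrow> norm z \<le> B"
    and v: "\<And>t x. v t x \<in> N" "\<And>t. finite_energy (v t)" "v 0 = u"
    and w: "finite_energy w" "\<And>x. norm (w x) \<le> W"
    and sup: "\<And>\<epsilon>. \<epsilon> > 0 \<Longrightarrow> \<forall>\<^sub>F t in at 0. \<forall>x. norm ((v t x - u x) /\<^sub>R t - w x) \<le> \<epsilon>"
    and en: "((\<lambda>t. energy_norm (\<lambda>x. (v t x - u x) /\<^sub>R t - w x)) \<longlongrightarrow> 0) (at 0)"
  shows "(\<integral>p. diff_quot u p \<bullet> diff_quot w p \<partial>lborel2) = 0"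
proof -
  let ?k = energy_const
  have k0: "0 < ?k" by (rule lap_const_pos) auto
  have vm: "v t \<in> borel_measurable borel" for t by (rule finite_energyD(1)[OF v(2)])
  have vb: "norm (v t x) \<le> B" for t x by (rule N[OF v(1)])
  have wm: "w \<in> borel_measurable borel" by (rule finite_energyD(1)[OF w(1)])
  note hv = bounded_Hdot_half[OF vm vb]
  have vN: "v t \<in> Hdot_half_into N" for t using hv(1) v by (simp add: Hdot_half_into_def)
  define D where "D t x = (v t x - u x) /\<^sub>R t - w x" for t x
  have Df: "finite_energy (D t)" for t
    unfolding D_def[abs_def] using v(2)[of 0] v(3) by (intro finite_energy_diff finite_energy_scaleR v w) simp
  have Db: "norm (D t x) \<le> (B + B) * inverse \<bar>t\<bar> + W" for t x
  proof -
    have "norm (D t x) \<le> norm ((v t x - u x) /\<^sub>R t) + norm (w x)" unfolding D_def by (rule norm_triangle_ineq4)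
    also have "norm ((v t x - u x) /\<^sub>R t) = norm (v t x - u x) * inverse \<bar>t\<bar>" by (simp add: mult.commute)
    also have "norm (v t x - u x) \<le> norm (v t x) + norm (u x)" by (rule norm_triangle_ineq4)
    also have "norm (v t x) + norm (u x) \<le> B + B" using vb[of t x] vb[of 0 x] v(3) by simp
    finally show ?thesis using w(2)[of x] by (simp add: mult_right_mono)
  qed
  have De: "half_energy (D t) = ?k * (energy_norm (D t))\<^sup>2" for t
    by (rule bounded_Hdot_half(2)[OF finite_energyD(1)[OF Df] Db Df])
  have enD: "((\<lambda>t. energy_norm (D t)) \<longlongrightarrow> 0) (at 0)" using en unfolding D_def[abs_def] .
  have "has_velocity v w"
    unfolding has_velocity_def v(3)
  proof (intro conjI allI impI)
    show "w \<in> Hdot_half" using bounded_Hdot_half(1)[OF wm w(2)] w(1) by simp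
    show "\<exists>B. AE x in lborel. norm (w x) \<le> B" using w(2) by (intro exI[of _ W]) simp
    have "((\<lambda>t. ?k * (energy_norm (D t))\<^sup>2) \<longlongrightarrow> ?k * 0\<^sup>2) (at 0)" by (intro tendsto_intros enD)
    then show "((\<lambda>t. half_energy (\<lambda>x. (v t x - u x) /\<^sub>R t - w x)) \<longlongrightarrow> 0) (at 0)"
      using De by (simp add: D_def[abs_def])
    fix \<epsilon> :: real assume "0 < \<epsilon>"
    from sup[OF this] show "\<forall>\<^sub>F t in at 0. AE x in lborel. norm ((v t x - u x) /\<^sub>R t - w x) \<le> \<epsilon>"
      by eventually_elim simp
  qed
  with harm vN v(3) have "((\<lambda>t. half_energy (v t)) has_real_derivative 0) (at 0)"
    unfolding weak_half_harmonic_def by blast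
  then have lim0: "((\<lambda>t. (half_energy (v t) - half_energy (v 0)) / (t - 0)) \<longlongrightarrow> 0) (at 0)"
    by (simp add: has_field_derivative_iff)
  have fu: "sq_int lborel2 (diff_quot u)" using v(2)[of 0] v(3) by (simp add: finite_energy_def)
  have fw: "sq_int lborel2 (diff_quot w)" using w(1) by (simp add: finite_energy_def)
  have fD: "sq_int lborel2 (diff_quot (D t))" for t using Df by (simp add: finite_energy_def)
  define J where "J = (\<integral>p. diff_quot u p \<bullet> diff_quot w p \<partial>lborel2)"
  define R where "R t = 2 * (\<integral>p. diff_quot u p \<bullet> diff_quot (D t) p \<partial>lborel2) + t * (L2nrm lborel2 (\<lambda>p. diff_quot w p + diff_quot (D t) p))\<^sup>2" for t
  have quot: "(half_energy (v t) - half_energy (v 0)) / (t - 0) = ?k * (2 * J + R t)" if t: "t \<noteq> 0" for t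
  proof -
    have "diff_quot (v t) = (\<lambda>p. diff_quot u p + t *\<^sub>R (diff_quot w p + diff_quot (D t) p))"
    proof -
      have "v t = (\<lambda>x. u x + t *\<^sub>R (w x + D t x))" using t by (auto simp: D_def fun_eq_iff)
      then show ?thesis by (simp only: diff_quot_add diff_quot_scaleR)
    qed
    then have "(energy_norm (v t))\<^sup>2 = (energy_norm u)\<^sup>2 + 2 * (\<integral>p. diff_quot u p \<bullet> (t *\<^sub>R (diff_quot w p + diff_quot (D t) p)) \<partial>lborel2) + (L2nrm lborel2 (\<lambda>p. t *\<^sub>R (diff_quot w p + diff_quot (D t) p)))\<^sup>2"
      using L2nrm_add_sq[OF fu sq_int_scaleR[OF sq_int_add[OF fw fD]], of t t] by simp
    also have "(\<integral>p. diff_quot u p \<bullet> (t *\<^sub>R (diff_quot w p + diff_quot (D t) p)) \<partial>lborel2) = t * (J + (\<integral>p. diff_quot u p \<bullet> diff_quot (D t) p \<partial>lborel2))"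
      using sq_int_inner[OF fu fw] sq_int_inner[OF fu fD] by (simp add: J_def inner_add_right)
    also have "(L2nrm lborel2 (\<lambda>p. t *\<^sub>R (diff_quot w p + diff_quot (D t) p)))\<^sup>2 = t * (t * (L2nrm lborel2 (\<lambda>p. diff_quot w p + diff_quot (D t) p))\<^sup>2)"
      unfolding L2nrm_scaleR by (simp add: power_mult_distrib power2_eq_square)
    finally have "(energy_norm (v t))\<^sup>2 - (energy_norm u)\<^sup>2 = t * (2 * J + R t)" by (simp add: R_def algebra_simps)
    then have "half_energy (v t) - half_energy (v 0) = ?k * (t * (2 * J + R t))"
      using hv(2)[OF v(2), of t] hv(2)[OF v(2), of 0] v(3) by (simp add: right_diff_distrib[symmetric])
    then show ?thesis using t by simp
  qed
  have "(R \<longlongrightarrow> 0) (at 0)"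
  proof (rule Lim_null_comparison)
    let ?b = "\<lambda>t. 2 * (energy_norm u * energy_norm (D t)) + \<bar>t\<bar> * (energy_norm w + energy_norm (D t))\<^sup>2"
    have "norm (R t) \<le> ?b t" for t
    proof -
      have "\<bar>R t\<bar> \<le> 2 * \<bar>\<integral>p. diff_quot u p \<bullet> diff_quot (D t) p \<partial>lborel2\<bar> + \<bar>t\<bar> * (L2nrm lborel2 (\<lambda>p. diff_quot w p + diff_quot (D t) p))\<^sup>2"
        unfolding R_def by (rule order_trans[OF abs_triangle_ineq]) (simp add: abs_mult)
      also have "\<dots> \<le> ?b t"
        by (intro add_mono mult_left_mono L2_Cauchy_Schwarz[OF fu fD] power_mono L2nrm_triangle[OF fw fD]) auto
      finally show ?thesis by simp
    qed
    then show "\<forall>\<^sub>F t in at 0. norm (R t) \<le> ?b t" by simp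
    have "(?b \<longlongrightarrow> 2 * (energy_norm u * 0) + \<bar>0\<bar> * (energy_norm w + 0)\<^sup>2) (at 0)" by (intro tendsto_intros enD)
    then show "(?b \<longlongrightarrow> 0) (at 0)" by simp
  qed
  then have "((\<lambda>t. ?k * (2 * J + R t)) \<longlongrightarrow> ?k * (2 * J + 0)) (at 0)" by (intro tendsto_intros)
  moreover have "((\<lambda>t. ?k * (2 * J + R t)) \<longlongrightarrow> 0) (at 0)"
    by (rule Lim_transform_eventually[OF lim0])
       (unfold eventually_at_filter, intro always_eventually allI impI quot)
  ultimately have "?k * (2 * J + 0) = 0" by (intro tendsto_unique[OF _ _ _]) auto
  then show ?thesis using k0 by (simp add: J_def)
qed

text \<open>The chain rule of the Gagliardo energy: whatever has increments controlled by those of \<open>u\<close> and \<open>v\<close>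
  has finite energy. The second and third claims give the dominating function for limits.\<close>

lemma finite_energy_dominated:
  fixes u :: "real \<Rightarrow> 'a::euclidean_space" and v :: "real \<Rightarrow> 'b::euclidean_space" and w :: "real \<Rightarrow> 'c::euclidean_space"
  assumes u: "finite_energy u" and v: "finite_energy v" and [measurable]: "w \<in> borel_measurable borel"
    and le: "\<And>x y. norm (w x - w y) \<le> K * (norm (u x - u y) + norm (v x - v y))"
  shows "finite_energy w"
    "sq_int lborel2 (\<lambda>p. K * (norm (diff_quot u p) + norm (diff_quot v p)))" "\<And>p. norm (diff_quot w p) \<le> K * (norm (diff_quot u p) + norm (diff_quot v p))"
proof -
  have "sq_int lborel2 (\<lambda>p. norm (diff_quot u p))" "sq_int lborel2 (\<lambda>p. norm (diff_quot v p))"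
    using finite_energyD(2)[OF u] finite_energyD(2)[OF v] by (auto simp: sq_int_def)
  from sq_int_scaleR[OF sq_int_add[OF this], of K]
  show s: "sq_int lborel2 (\<lambda>p. K * (norm (diff_quot u p) + norm (diff_quot v p)))" by simp
  show pt: "norm (diff_quot w p) \<le> K * (norm (diff_quot u p) + norm (diff_quot v p))" for p
  proof -
    have dist: "i * (K * (x + y)) = K * (i * x + i * y)" for i x y :: real by (simp add: algebra_simps)
    have "norm (diff_quot w p) = inverse \<bar>fst p\<bar> * norm (w (snd p + fst p) - w (snd p))" by (simp add: diff_quot_def)
    also have "\<dots> \<le> inverse \<bar>fst p\<bar> * (K * (norm (u (snd p + fst p) - u (snd p)) + norm (v (snd p + fst p) - v (snd p))))"
      by (intro mult_left_mono le) auto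
    also have "\<dots> = K * (norm (diff_quot u p) + norm (diff_quot v p))" unfolding dist by (simp add: diff_quot_def)
    finally show ?thesis .
  qed
  show "finite_energy w" unfolding finite_energy_def
  proof (intro conjI sq_int_dominated(1)[OF s])
    show "AE p in lborel2. norm (diff_quot w p) \<le> norm (K * (norm (diff_quot u p) + norm (diff_quot v p)))"
      using pt by (intro always_eventually allI) (metis abs_ge_self order_trans real_norm_def)
  qed measurable
qed

text \<open>A Lipschitz cutoff supported in the ball, so that fields defined only in a chart extend by zero.\<close>

definition tent :: "'a::euclidean_space \<Rightarrow> real \<Rightarrow> 'a \<Rightarrow> real" where "tent p r z = max 0 (r - dist z p)"

lemma tent_props: "0 \<le> tent p r z" "0 < r \<Longrightarrow> tent p r z \<le> r" "z \<notin> ball p r \<Longrightarrow> tent p r z = 0"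
  "z \<in> ball p r \<Longrightarrow> 0 < tent p r z" "\<bar>tent p r z - tent p r z'\<bar> \<le> norm (z - z')"
proof -
  show "\<bar>tent p r z - tent p r z'\<bar> \<le> norm (z - z')"
    using abs_dist_diff_le[of z p z'] dist_triangle3[of z p z'] dist_triangle[of z p z'] dist_triangle[of z' p z]
    unfolding tent_def dist_norm by (auto simp: max_def norm_minus_commute)
qed (auto simp: tent_def dist_commute)

lemma tent_measurable[measurable]: "tent p r \<in> borel_measurable borel"
  unfolding tent_def[abs_def] by measurable

text \<open>The curve is \<open>G (u x) (t * tent * a x)\<close> in the ball and \<open>u x\<close> outside it. The last assumption on \<open>G\<close>
  makes its increments Lipschitz in those of \<open>u\<close> and \<open>a\<close>, with a factor \<open>t\<close>; this provides finite energy, a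
  dominating function for the energy of the velocity error, and, in the limit, finite energy of the
  velocity \<open>w\<close> itself. The case that only one of two points is in the ball is harmless, as the
  tent is then at most the distance of their images.\<close>

lemma tent_variation_orthogonal:
  fixes u a :: "real \<Rightarrow> 'a::euclidean_space" and N :: "'a set"
  assumes harm: "weak_half_harmonic N u" and Nc: "compact N"
    and u: "finite_energy u" "\<And>x. u x \<in> N"
    and a: "finite_energy a" "\<And>x. norm (a x) \<le> M"
    and r: "0 < r" and C: "0 \<le> C" and \<tau>: "0 < \<tau>"
    and P: "\<And>z. z \<in> N \<Longrightarrow> z \<in> ball p r \<Longrightarrow> linear (P z)"
      "\<And>z \<xi>. z \<in> N \<Longrightarrow> z \<in> ball p r \<Longrightarrow> norm (P z \<xi>) \<le> C * norm \<xi>"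
    and G: "\<And>z b. z \<in> N \<Longrightarrow> z \<in> ball p r \<Longrightarrow> norm b \<le> \<tau> \<Longrightarrow> G z b \<in> N"
      "\<And>z b. z \<in> N \<Longrightarrow> z \<in> ball p r \<Longrightarrow> norm b \<le> \<tau> \<Longrightarrow> norm (G z b - z - P z b) \<le> C * (norm b)\<^sup>2"
      "\<And>z b z' b'. z \<in> N \<Longrightarrow> z \<in> ball p r \<Longrightarrow> norm b \<le> \<tau> \<Longrightarrow> z' \<in> N \<Longrightarrow> z' \<in> ball p r \<Longrightarrow> norm b' \<le> \<tau> \<Longrightarrow>
         norm ((G z b - z) - (G z' b' - z')) \<le> C * (norm (b - b') + (norm b + norm b') * norm (z - z'))"
  defines "w \<equiv> \<lambda>x. if u x \<in> ball p r then tent p r (u x) *\<^sub>R P (u x) (a x) else 0"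
  shows "finite_energy w" "\<And>x. norm (w x) \<le> r * (C * M)" "(\<integral>p. diff_quot u p \<bullet> diff_quot w p \<partial>lborel2) = 0"
proof -
  have um[measurable]: "u \<in> borel_measurable borel" by (rule finite_energyD(1)[OF u(1)])
  have am[measurable]: "a \<in> borel_measurable borel" by (rule finite_energyD(1)[OF a(1)])
  have M0: "0 \<le> M" using order_trans[OF norm_ge_zero a(2)] .
  have ub[measurable]: "N \<in> sets borel" using Nc by (simp add: borel_compact)
  define b where "b x = tent p r (u x) *\<^sub>R a x" for x
  have bm[measurable]: "b \<in> borel_measurable borel" unfolding b_def[abs_def] by measurable
  have bb: "norm (b x) \<le> r * M" for x
    unfolding b_def using tent_props(1)[of p r "u x"] tent_props(2)[of r p "u x"] r a(2)[of x] M0 by (simp add: mult_mono)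
  \<comment> \<open>Up to this time the displacements stay in the domain of \<open>G\<close>; later the curve rests at \<open>u\<close>.\<close>
  define t0 where "t0 = \<tau> / (r * M + 1)"
  have rM: "0 \<le> r * M" using r M0 by simp
  have t0: "0 < t0" using \<tau> rM by (simp add: t0_def add_nonneg_pos)
  have tb: "norm (t *\<^sub>R b x) \<le> \<tau>" if "\<bar>t\<bar> \<le> t0" for t x
  proof -
    have "\<bar>t\<bar> * norm (b x) \<le> t0 * (r * M + 1)" using that bb[of x] t0 rM by (intro mult_mono) auto
    also have "\<dots> = \<tau>" using rM by (simp add: t0_def add_nonneg_eq_0_iff)
    finally show ?thesis by simp
  qed
  define v where "v t x = (if \<bar>t\<bar> \<le> t0 \<and> u x \<in> ball p r then G (u x) (t *\<^sub>R b x) else u x)" for t x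
  have G0: "G z 0 = z" if "z \<in> N" "z \<in> ball p r" for z
    using G(2)[OF that, of 0] \<tau> linear_0[OF P(1)[OF that]] by simp
  have w_eq: "w x = (if u x \<in> ball p r then P (u x) (b x) else 0)" for x
    using linear_scale[OF P(1)[OF u(2)]] by (simp add: w_def b_def)
  have wb: "norm (w x) \<le> r * (C * M)" for x
  proof (cases "u x \<in> ball p r")
    case True
    have "norm (w x) \<le> C * norm (b x)" using True P(2)[OF u(2) True] by (simp add: w_eq)
    also have "\<dots> \<le> C * (r * M)" by (rule mult_left_mono[OF bb C])
    finally show ?thesis by (simp add: mult_ac)
  qed (use r C M0 in \<open>simp add: w_def\<close>)
  then show "norm (w x) \<le> r * (C * M)" for x .
  define K where "K = C * (r + M + 2 * (r * M))"
  have K0: "0 \<le> K" using r M0 C by (simp add: K_def)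
  have vm: "v t \<in> borel_measurable borel" for t
  proof (cases "\<bar>t\<bar> \<le> t0")
    case False then show ?thesis by (simp add: v_def[abs_def])
  next
    case True
    \<comment> \<open>The Lipschitz estimate makes \<open>G\<close> continuous on a Borel set, whence measurability of the curve.\<close>
    let ?S = "(N \<inter> ball p r) \<times> cball 0 \<tau> :: ('a \<times> 'a) set"
    have S: "?S \<in> sets borel" by (intro borel_Times) auto
    have "continuous_on ?S (\<lambda>q. G (fst q) (snd q) - fst q)"
      unfolding continuous_on_def
    proof (intro ballI)
      fix q assume q: "q \<in> ?S"
      have "((\<lambda>q'. C * (norm (snd q' - snd q) + (norm (snd q') + norm (snd q)) * norm (fst q' - fst q))) \<longlongrightarrow>
          C * (norm (snd q - snd q) + (norm (snd q) + norm (snd q)) * norm (fst q - fst q))) (at q within ?S)"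
        by (intro tendsto_intros)
      then have l: "((\<lambda>q'. C * (norm (snd q' - snd q) + (norm (snd q') + norm (snd q)) * norm (fst q' - fst q))) \<longlongrightarrow> 0) (at q within ?S)" by simp
      show "((\<lambda>q. G (fst q) (snd q) - fst q) \<longlongrightarrow> G (fst q) (snd q) - fst q) (at q within ?S)"
      proof (rule LIM_zero_cancel, rule Lim_null_comparison[OF _ l])
        show "\<forall>\<^sub>F q' in at q within ?S. norm ((G (fst q') (snd q') - fst q') - (G (fst q) (snd q) - fst q)) \<le> C * (norm (snd q' - snd q) + (norm (snd q') + norm (snd q)) * norm (fst q' - fst q))"
          unfolding eventually_at_filter using q by (intro always_eventually allI impI G(3)) auto
      qed
    qed
    then have "(\<lambda>q. if q \<in> ?S then G (fst q) (snd q) - fst q else 0) \<in> borel_measurable borel"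
      by (intro borel_measurable_continuous_on_if S) auto
    moreover have "(\<lambda>x. (u x, t *\<^sub>R b x)) \<in> borel_measurable borel" by measurable
    ultimately have "(\<lambda>x. u x + (if (u x, t *\<^sub>R b x) \<in> ?S then G (u x) (t *\<^sub>R b x) - u x else 0)) \<in> borel_measurable borel"
      by (intro borel_measurable_add um) (drule (1) measurable_compose_rev, simp cong: if_cong)
    also have "(\<lambda>x. u x + (if (u x, t *\<^sub>R b x) \<in> ?S then G (u x) (t *\<^sub>R b x) - u x else 0)) = v t"
      using True u(2) tb[OF True] by (auto simp: v_def fun_eq_iff)
    finally show ?thesis .
  qed
  have vN: "v t x \<in> N" for t x using G(1)[OF u(2) _ tb] u(2) by (simp add: v_def)
  have v0: "v 0 = u" using t0 G0 u(2) by (auto simp: v_def fun_eq_iff)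
  \<comment> \<open>The difference quotients of the curve are Lipschitz in the data, uniformly in \<open>t\<close>.\<close>
  have diff: "norm ((v t x - u x) - (v t y - u y)) \<le> \<bar>t\<bar> * (K * (norm (u x - u y) + norm (a x - a y)))" if t: "\<bar>t\<bar> \<le> t0" for t x y
  proof -
    have out: "norm (v t x - u x) \<le> \<bar>t\<bar> * (K * norm (u x - u y))" if x: "u x \<in> ball p r" and y: "u y \<notin> ball p r" for x y
    proof -
      have "norm ((G (u x) (t *\<^sub>R b x) - u x) - (G (u x) 0 - u x)) \<le> C * (norm (t *\<^sub>R b x - 0) + (norm (t *\<^sub>R b x) + norm (0::'a)) * norm (u x - u x))"
        by (rule G(3)[OF u(2) x tb[OF t] u(2) x]) (use \<tau> in simp)
      then have "norm (v t x - u x) \<le> C * (\<bar>t\<bar> * norm (b x))" using x t G0[OF u(2) x] by (simp add: v_def)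
      also have "\<dots> \<le> C * (\<bar>t\<bar> * (norm (u x - u y) * M))"
      proof (intro mult_left_mono C)
        show "norm (b x) \<le> norm (u x - u y) * M"
          using tent_props(5)[of p r "u x" "u y"] tent_props(1)[of p r "u x"] tent_props(3)[OF y] a(2)[of x]
          unfolding b_def by (simp add: mult_mono)
      qed simp
      also have "\<dots> = \<bar>t\<bar> * ((C * M) * norm (u x - u y))" by simp
      also have "\<dots> \<le> \<bar>t\<bar> * (K * norm (u x - u y))"
        using C r M0 unfolding K_def by (intro mult_left_mono mult_right_mono) auto
      finally show ?thesis .
    qed
    have weak: "\<bar>t\<bar> * (K * norm (u x - u y)) \<le> \<bar>t\<bar> * (K * (norm (u x - u y) + norm (a x - a y)))"
      using K0 by (intro mult_left_mono) auto
    consider "u x \<in> ball p r" "u y \<in> ball p r" | "u x \<in> ball p r" "u y \<notin> ball p r" | "u x \<notin> ball p r" "u y \<in> ball p r" | "u x \<notin> ball p r" "u y \<notin> ball p r" by blast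
    then show ?thesis
    proof cases
      case 1
      have bd: "norm (b x - b y) \<le> r * norm (a x - a y) + M * norm (u x - u y)"
      proof -
        have "b x - b y = tent p r (u x) *\<^sub>R (a x - a y) + (tent p r (u x) - tent p r (u y)) *\<^sub>R a y"
          by (simp add: b_def algebra_simps)
        also have "norm \<dots> \<le> norm (tent p r (u x) *\<^sub>R (a x - a y)) + norm ((tent p r (u x) - tent p r (u y)) *\<^sub>R a y)" by (rule norm_triangle_ineq)
        also have "\<dots> \<le> r * norm (a x - a y) + norm (u x - u y) * M"
          using tent_props(1)[of p r "u x"] tent_props(2)[of r p "u x"] r tent_props(5)[of p r "u x" "u y"] a(2)[of y]
          by (intro add_mono) (auto intro!: mult_mono mult_right_mono)
        finally show ?thesis by (simp add: mult.commute)
      qed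
      have "norm ((v t x - u x) - (v t y - u y)) \<le> C * (norm (t *\<^sub>R b x - t *\<^sub>R b y) + (norm (t *\<^sub>R b x) + norm (t *\<^sub>R b y)) * norm (u x - u y))"
        using G(3)[OF u(2) 1(1) tb[OF t] u(2) 1(2) tb[OF t]] 1 t by (simp add: v_def)
      also have "\<dots> = \<bar>t\<bar> * (C * (norm (b x - b y) + (norm (b x) + norm (b y)) * norm (u x - u y)))"
        by (simp add: scaleR_diff_right[symmetric] algebra_simps del: scaleR_diff_right)
      also have "\<dots> \<le> \<bar>t\<bar> * (C * ((r * norm (a x - a y) + M * norm (u x - u y)) + (r * M + r * M) * norm (u x - u y)))"
        using C by (intro mult_left_mono add_mono mult_right_mono bd bb) auto
      also have "\<dots> \<le> \<bar>t\<bar> * (C * ((r + M + 2 * (r * M)) * (norm (u x - u y) + norm (a x - a y))))"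
      proof (intro mult_left_mono C)
        have "0 \<le> r * norm (u x - u y)" "0 \<le> M * norm (a x - a y)" "0 \<le> (r * M) * norm (a x - a y)" using r M0 by auto
        then show "(r * norm (a x - a y) + M * norm (u x - u y)) + (r * M + r * M) * norm (u x - u y) \<le> (r + M + 2 * (r * M)) * (norm (u x - u y) + norm (a x - a y))"
          by (simp add: algebra_simps)
      qed simp
      finally show ?thesis by (simp add: K_def mult.assoc)
    next
      case 2
      then have "v t y - u y = 0" by (simp add: v_def)
      then show ?thesis using order_trans[OF out[OF 2] weak] by simp
    next
      case 3
      then have "v t x - u x = 0" by (simp add: v_def)
      then show ?thesis using order_trans[OF out[OF 3(2) 3(1)]] weak by (simp add: norm_minus_commute)
    next
      case 4
      then show ?thesis using K0 by (simp add: v_def)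
    qed
  qed
  have vf: "finite_energy (v t)" for t
  proof (cases "\<bar>t\<bar> \<le> t0")
    case False then show ?thesis using u(1) by (simp add: v_def[abs_def])
  next
    case True
    show ?thesis
    proof (rule finite_energy_dominated(1)[OF u(1) a(1) vm])
      fix x y
      have "norm (v t x - v t y) \<le> norm (u x - u y) + norm ((v t x - u x) - (v t y - u y))"
        using norm_triangle_ineq[of "u x - u y" "(v t x - u x) - (v t y - u y)"] by simp
      also have "\<dots> \<le> (norm (u x - u y) + norm (a x - a y)) + (\<bar>t\<bar> * K) * (norm (u x - u y) + norm (a x - a y))"
        using diff[OF True, of x y] by (intro add_mono) (auto simp: mult.assoc)
      finally show "norm (v t x - v t y) \<le> (1 + \<bar>t\<bar> * K) * (norm (u x - u y) + norm (a x - a y))" by (simp add: algebra_simps)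
    qed
  qed
  have pt: "norm ((v t x - u x) /\<^sub>R t - w x) \<le> \<bar>t\<bar> * (C * (r * M)\<^sup>2)" if t: "t \<noteq> 0" "\<bar>t\<bar> \<le> t0" for t x
  proof (cases "u x \<in> ball p r")
    case True
    have "norm (G (u x) (t *\<^sub>R b x) - u x - t *\<^sub>R P (u x) (b x)) \<le> C * (norm (t *\<^sub>R b x))\<^sup>2"
      using G(2)[OF u(2) True tb[OF t(2)], of x] linear_scale[OF P(1)[OF u(2) True]] by simp
    also have "\<dots> = \<bar>t\<bar> * (\<bar>t\<bar> * (C * (norm (b x))\<^sup>2))" by (simp add: power2_eq_square mult_ac)
    also have "\<dots> \<le> \<bar>t\<bar> * (\<bar>t\<bar> * (C * (r * M)\<^sup>2))" using C by (intro mult_left_mono power_mono bb) auto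
    finally have le: "norm (G (u x) (t *\<^sub>R b x) - u x - t *\<^sub>R P (u x) (b x)) \<le> \<bar>t\<bar> * (\<bar>t\<bar> * (C * (r * M)\<^sup>2))" .
    have "(v t x - u x) /\<^sub>R t - w x = (G (u x) (t *\<^sub>R b x) - u x - t *\<^sub>R P (u x) (b x)) /\<^sub>R t"
      using True t by (simp add: v_def w_eq scaleR_diff_right)
    then have "norm ((v t x - u x) /\<^sub>R t - w x) = norm (G (u x) (t *\<^sub>R b x) - u x - t *\<^sub>R P (u x) (b x)) / \<bar>t\<bar>"
      by (simp add: divide_inverse mult.commute)
    also have "\<dots> \<le> (\<bar>t\<bar> * (\<bar>t\<bar> * (C * (r * M)\<^sup>2))) / \<bar>t\<bar>" by (rule divide_right_mono[OF le]) simp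
    finally show ?thesis using t by simp
  qed (use C in \<open>simp add: v_def w_def\<close>)
  have small: "\<forall>\<^sub>F t in at 0. \<bar>t\<bar> \<le> t0 \<and> t \<noteq> 0"
    using t0 by (auto simp: eventually_at intro!: exI[of _ t0])
  have tend0: "((\<lambda>t. \<bar>t\<bar> * (C * (r * M)\<^sup>2)) \<longlongrightarrow> 0) (at 0)"
  proof -
    have "((\<lambda>t. \<bar>t\<bar> * (C * (r * M)\<^sup>2)) \<longlongrightarrow> \<bar>0\<bar> * (C * (r * M)\<^sup>2)) (at 0)" by (intro tendsto_intros)
    then show ?thesis by simp
  qed
  have ptlim: "((\<lambda>t. (v t x - u x) /\<^sub>R t) \<longlongrightarrow> w x) (at 0)" for x
  proof (rule LIM_zero_cancel, rule Lim_null_comparison[OF _ tend0])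
    show "\<forall>\<^sub>F t in at 0. norm ((v t x - u x) /\<^sub>R t - w x) \<le> \<bar>t\<bar> * (C * (r * M)\<^sup>2)"
      using small by eventually_elim (rule pt, auto)
  qed
  have diff_quot_bound: "norm ((v t x - u x) /\<^sub>R t - (v t y - u y) /\<^sub>R t) \<le> K * (norm (u x - u y) + norm (a x - a y))" if t: "t \<noteq> 0" "\<bar>t\<bar> \<le> t0" for t x y
  proof -
    have "norm ((v t x - u x) /\<^sub>R t - (v t y - u y) /\<^sub>R t) = norm ((v t x - u x) - (v t y - u y)) / \<bar>t\<bar>"
      unfolding scaleR_diff_right[symmetric] by (simp add: divide_inverse mult.commute)
    also have "\<dots> \<le> (\<bar>t\<bar> * (K * (norm (u x - u y) + norm (a x - a y)))) / \<bar>t\<bar>" by (rule divide_right_mono[OF diff[OF t(2)]]) simp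
    finally show ?thesis using t by simp
  qed
  have wlip: "norm (w x - w y) \<le> K * (norm (u x - u y) + norm (a x - a y))" for x y
  proof (rule tendsto_upperbound)
    show "((\<lambda>t. norm ((v t x - u x) /\<^sub>R t - (v t y - u y) /\<^sub>R t)) \<longlongrightarrow> norm (w x - w y)) (at 0)"
      by (intro tendsto_intros ptlim)
    show "\<forall>\<^sub>F t in at 0. norm ((v t x - u x) /\<^sub>R t - (v t y - u y) /\<^sub>R t) \<le> K * (norm (u x - u y) + norm (a x - a y))"
      using small by eventually_elim (rule diff_quot_bound, auto)
  qed simp
  define ts where "ts n = t0 * inverse (real (Suc n))" for n
  have wm[measurable]: "w \<in> borel_measurable borel"
  proof (rule borel_measurable_LIMSEQ_metric)
    show "(\<lambda>x. (v (ts n) x - u x) /\<^sub>R ts n) \<in> borel_measurable borel" for n using vm[of "ts n"] by measurable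
    have "ts \<longlonglongrightarrow> t0 * 0" unfolding ts_def[abs_def] by (intro tendsto_intros LIMSEQ_inverse_real_of_nat)
    moreover have "\<forall>i. ts i \<in> UNIV - {0}" using t0 by (simp add: ts_def)
    ultimately show "(\<lambda>n. (v (ts n) x - u x) /\<^sub>R ts n) \<longlonglongrightarrow> w x" for x
      using ptlim[of x] unfolding tendsto_at_iff_sequentially o_def by simp
  qed
  note fw = finite_energy_dominated[OF u(1) a(1) wm wlip]
  show wf: "finite_energy w" by (rule fw(1))
  have en: "((\<lambda>t. energy_norm (\<lambda>x. (v t x - u x) /\<^sub>R t - w x)) \<longlongrightarrow> 0) (at 0)"
    unfolding tendsto_at_iff_sequentially
  proof (intro allI impI)
    fix X :: "nat \<Rightarrow> real" assume X: "\<forall>i. X i \<in> UNIV - {0}" "X \<longlonglongrightarrow> 0"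
    define Z where "Z n x = (v (X n) x - u x) /\<^sub>R X n - w x" for n x
    have [measurable]: "Z n \<in> borel_measurable borel" for n unfolding Z_def[abs_def] using vm[of "X n"] by measurable
    have ev: "\<forall>\<^sub>F n in sequentially. \<bar>X n\<bar> \<le> t0"
      using order_tendstoD(2)[OF tendsto_rabs[OF X(2)], of t0] t0 by (auto elim: eventually_mono)
    then obtain n0 where n0: "\<And>n. n \<ge> n0 \<Longrightarrow> \<bar>X n\<bar> \<le> t0" by (auto simp: eventually_sequentially)
    let ?W = "\<lambda>p. (2 * (K * (norm (diff_quot u p) + norm (diff_quot a p))))\<^sup>2"
    have Wi: "integrable lborel2 ?W" using fw(2) by (simp add: sq_int_def power_mult_distrib)
    have "(\<lambda>n. \<integral>p. (norm (diff_quot (Z (n + n0)) p))\<^sup>2 \<partial>lborel2) \<longlonglongrightarrow> (\<integral>p. 0 \<partial>lborel2)"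
    proof (rule integral_dominated_convergence[OF _ _ Wi])
      show "AE p in lborel2. (\<lambda>n. (norm (diff_quot (Z (n + n0)) p))\<^sup>2) \<longlonglongrightarrow> 0"
      proof (intro always_eventually allI)
        fix p
        have z: "(\<lambda>n. Z (n + n0) x) \<longlonglongrightarrow> 0" for x
        proof -
          have "(\<lambda>n. (v (X n) x - u x) /\<^sub>R X n) \<longlonglongrightarrow> w x"
            using ptlim[of x] X unfolding tendsto_at_iff_sequentially o_def by blast
          from LIM_zero[OF this] have "Z' \<longlonglongrightarrow> 0" if "Z' = (\<lambda>n. Z n x)" for Z' using that by (simp add: Z_def)
          then show ?thesis using LIMSEQ_ignore_initial_segment[of "\<lambda>n. Z n x" 0 n0] by simp
        qed
        have "(\<lambda>n. (norm (diff_quot (Z (n + n0)) p))\<^sup>2) \<longlonglongrightarrow> (norm ((0 - (0::'a)) /\<^sub>R fst p))\<^sup>2"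
          unfolding diff_quot_def by (intro tendsto_intros z)
        then show "(\<lambda>n. (norm (diff_quot (Z (n + n0)) p))\<^sup>2) \<longlonglongrightarrow> 0" by simp
      qed
      have nb: "norm (diff_quot (Z (n + n0)) p) \<le> 2 * (K * (norm (diff_quot u p) + norm (diff_quot a p)))" for n p
      proof -
        have "norm (Z (n + n0) x - Z (n + n0) y) \<le> (2 * K) * (norm (u x - u y) + norm (a x - a y))" for x y
        proof -
          have "X (n + n0) \<noteq> 0" "\<bar>X (n + n0)\<bar> \<le> t0" using X(1) n0 by auto
          from diff_quot_bound[OF this, of x y] wlip[of x y]
          show ?thesis unfolding Z_def
            using norm_triangle_ineq4[of "(v (X (n + n0)) x - u x) /\<^sub>R X (n + n0) - (v (X (n + n0)) y - u y) /\<^sub>R X (n + n0)" "w x - w y"]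
            by (simp add: algebra_simps)
        qed
        from finite_energy_dominated(3)[OF u(1) a(1) _ this] show ?thesis by (simp add: mult.assoc)
      qed
      show "AE p in lborel2. norm ((norm (diff_quot (Z (n + n0)) p))\<^sup>2) \<le> ?W p" for n
      proof (intro always_eventually allI)
        fix p
        have "(norm (diff_quot (Z (n + n0)) p))\<^sup>2 \<le> ?W p" by (intro power_mono nb norm_ge_zero)
        then show "norm ((norm (diff_quot (Z (n + n0)) p))\<^sup>2) \<le> ?W p" by (simp only: real_norm_def abs_power2)
      qed
    qed measurable
    then have "(\<lambda>n. sqrt (\<integral>p. (norm (diff_quot (Z (n + n0)) p))\<^sup>2 \<partial>lborel2)) \<longlonglongrightarrow> sqrt 0"
      by (intro tendsto_real_sqrt) simp
    then have "(\<lambda>n. energy_norm (Z (n + n0))) \<longlonglongrightarrow> 0" by (simp add: L2nrm_def)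
    then have "(\<lambda>n. energy_norm (Z n)) \<longlonglongrightarrow> 0" by (rule LIMSEQ_offset)
    then show "((\<lambda>t. energy_norm (\<lambda>x. (v t x - u x) /\<^sub>R t - w x)) \<circ> X) \<longlonglongrightarrow> 0" by (simp add: Z_def[abs_def] o_def)
  qed
  obtain B where B: "\<And>z. z \<in> N \<Longrightarrow> norm z \<le> B" using compact_imp_bounded[OF Nc] by (auto simp: bounded_iff)
  show "(\<integral>p. diff_quot u p \<bullet> diff_quot w p \<partial>lborel2) = 0"
  proof (rule stationary_imp_orthogonal[OF harm, where v=v and B=B and W="r * (C * M)"])
    show "\<forall>\<^sub>F t in at 0. \<forall>x. norm ((v t x - u x) /\<^sub>R t - w x) \<le> \<epsilon>" if "\<epsilon> > 0" for \<epsilon>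
      using order_tendstoD(2)[OF tend0 that] small
    proof eventually_elim
      case (elim t)
      have "norm ((v t x - u x) /\<^sub>R t - w x) \<le> \<epsilon>" for x
        using pt[of t x] elim by linarith
      then show ?case by blast
    qed
  qed (fact B vN vf v0 wf wb en)+
qed

section \<open>Orthogonal projection onto the range of an oblique one\<close>

text \<open>For idempotent \<open>q\<close>, the first summand ranges in the range of \<open>q\<close> and the second in its orthogonal
  complement. So inverting this operator splits a vector orthogonally.\<close>

definition split_op :: "('a::euclidean_space \<Rightarrow> 'a) \<Rightarrow> 'a \<Rightarrow> 'a" where
  "split_op q v = q (adjoint q v) + ((v - q v) - adjoint q (v - q v))"

text \<open>The orthogonal projection onto the range of an oblique projection \<open>q\<close>, by a formula that depends on
  \<open>q\<close> in a Lipschitz way without reference to a basis.\<close>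

definition orth_proj :: "('a::euclidean_space \<Rightarrow> 'a) \<Rightarrow> 'a \<Rightarrow> 'a" where
  "orth_proj q \<xi> = q (adjoint q (inv (split_op q) \<xi>))"

lemma adjoint_bound:
  fixes q :: "'a::euclidean_space \<Rightarrow> 'a"
  assumes q: "linear q" and K: "\<And>v. norm (q v) \<le> K * norm v"
  shows "norm (adjoint q v) \<le> K * norm v"
proof (cases "adjoint q v = 0")
  case True
  have "0 \<le> K * norm v" using order_trans[OF norm_ge_zero K[of v]] .
  then show ?thesis using True by simp
next
  case False
  have "norm (adjoint q v) * norm (adjoint q v) = q (adjoint q v) \<bullet> v"
    using adjoint_works[OF q, of "adjoint q v" v] by (simp add: power2_norm_eq_inner[symmetric] power2_eq_square)
  also have "\<dots> \<le> norm (q (adjoint q v)) * norm v" by (rule norm_cauchy_schwarz)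
  also have "\<dots> \<le> (K * norm (adjoint q v)) * norm v" by (intro mult_right_mono K) simp
  finally have "norm (adjoint q v) * norm (adjoint q v) \<le> norm (adjoint q v) * (K * norm v)" by (simp add: mult_ac)
  then show ?thesis using False by (simp add: mult_le_cancel_left)
qed

lemma split_op_linear: "linear q \<Longrightarrow> linear (split_op q)"
proof -
  assume q: "linear q"
  note a = adjoint_linear[OF q]
  show ?thesis unfolding split_op_def[abs_def]
    by (intro linearI) (simp_all add: linear_add[OF q] linear_diff[OF q] linear_add[OF a] linear_diff[OF a] linear_scale[OF q] linear_scale[OF a] algebra_simps)
qed

text \<open>The quadratic form of this operator is \<open>\<bar>q\<^sup>* v\<bar>\<^sup>2 + \<bar>v - q v\<bar>\<^sup>2\<close>, and
  \<open>v \<bullet> v = q\<^sup>* v \<bullet> v + (v - q v) \<bullet> v\<close> bounds \<open>v\<close> by the two parts. The bound \<open>2\<close> holds for every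
  linear \<open>q\<close>, so no constant enters that depends on the angle of the oblique projection.\<close>

lemma split_op_coercive:
  fixes q :: "'a::euclidean_space \<Rightarrow> 'a"
  assumes q: "linear q"
  shows "norm v \<le> 2 * norm (split_op q v)"
proof -
  let ?a = "adjoint q v" and ?r = "v - q v"
  have e: "split_op q v \<bullet> v = ?a \<bullet> ?a + ?r \<bullet> ?r"
  proof -
    have "q ?a \<bullet> v = ?a \<bullet> ?a" using adjoint_works[OF q, of ?a v] by simp
    moreover have "adjoint q ?r \<bullet> v = ?r \<bullet> q v" using adjoint_works[OF q, of v ?r] by (simp add: inner_commute)
    ultimately show ?thesis unfolding split_op_def by (simp add: inner_add_left inner_diff_left inner_diff_right)
  qed
  have "norm v * norm v = ?a \<bullet> v + ?r \<bullet> v"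
  proof -
    have "?a \<bullet> v = q v \<bullet> v" using adjoint_works[OF q, of v v] by (simp add: inner_commute)
    then show ?thesis by (simp add: inner_diff_left power2_norm_eq_inner[symmetric] power2_eq_square)
  qed
  also have "\<dots> \<le> norm ?a * norm v + norm ?r * norm v" by (intro add_mono norm_cauchy_schwarz)
  finally have "norm v * norm v \<le> (norm ?a + norm ?r) * norm v" by (simp add: algebra_simps)
  then have le: "norm v \<le> norm ?a + norm ?r" by (cases "v = 0") (auto simp: mult_le_cancel_right)
  have "norm v * norm v \<le> (norm ?a + norm ?r) * (norm ?a + norm ?r)" using le by (intro mult_mono) auto
  also have "\<dots> \<le> 2 * ((norm ?a)\<^sup>2 + (norm ?r)\<^sup>2)"
    using zero_le_power2[of "norm ?a - norm ?r"] by (simp add: power2_eq_square algebra_simps)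
  also have "\<dots> = 2 * (split_op q v \<bullet> v)" by (simp add: e power2_norm_eq_inner)
  also have "\<dots> \<le> 2 * (norm (split_op q v) * norm v)" by (intro mult_left_mono norm_cauchy_schwarz) simp
  finally have "norm v * norm v \<le> (2 * norm (split_op q v)) * norm v" by simp
  then show ?thesis by (cases "v = 0") (auto simp: mult_le_cancel_right)
qed

lemma split_op_inv:
  fixes q :: "'a::euclidean_space \<Rightarrow> 'a"
  assumes q: "linear q"
  shows "split_op q (inv (split_op q) \<xi>) = \<xi>" "linear (inv (split_op q))" "norm (inv (split_op q) \<xi>) \<le> 2 * norm \<xi>"
proof -
  note l = split_op_linear[OF q]
  have "v = 0" if "split_op q v = 0" for v using split_op_coercive[OF q, of v] that by simp
  then have inj: "inj (split_op q)" using l by (simp add: linear_injective_0)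
  then have surj: "surj (split_op q)" using l by (simp add: linear_injective_imp_surjective)
  show s: "split_op q (inv (split_op q) \<xi>) = \<xi>" for \<xi> by (rule surj_f_inv_f[OF surj])
  show "linear (inv (split_op q))" by (rule inj_linear_imp_inv_linear[OF l inj])
  show "norm (inv (split_op q) \<xi>) \<le> 2 * norm \<xi>" using split_op_coercive[OF q, of "inv (split_op q) \<xi>"] by (simp add: s)
qed

text \<open>In the last claim \<open>y - q y\<close> measures how far \<open>y\<close> is from the range of \<open>q\<close>, to which
  \<open>\<xi> - orth_proj q \<xi>\<close> is orthogonal.\<close>

lemma orth_proj_props:
  fixes q :: "'a::euclidean_space \<Rightarrow> 'a"
  assumes q: "linear q" and K: "\<And>v. norm (q v) \<le> K * norm v" "0 \<le> K" and idem: "\<And>v. q (q v) = q v"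
  shows "linear (orth_proj q)" "norm (orth_proj q \<xi>) \<le> 2 * K\<^sup>2 * norm \<xi>" "q (orth_proj q \<xi>) = orth_proj q \<xi>"
    "\<bar>(\<xi> - orth_proj q \<xi>) \<bullet> y\<bar> \<le> 2 * (1 + K) * norm \<xi> * norm (y - q y)"
proof -
  note a = adjoint_linear[OF q] and i = split_op_inv[OF q] and ab = adjoint_bound[OF q K(1)]
  let ?v = "inv (split_op q) \<xi>"
  show "linear (orth_proj q)" unfolding orth_proj_def[abs_def]
    using linear_compose[OF linear_compose[OF i(2) a] q] by (simp add: o_def)
  have "norm (orth_proj q \<xi>) \<le> K * (K * (2 * norm \<xi>))"
    unfolding orth_proj_def using K(2) by (intro order_trans[OF K(1)] mult_left_mono order_trans[OF ab] i(3)) auto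
  then show "norm (orth_proj q \<xi>) \<le> 2 * K\<^sup>2 * norm \<xi>" by (simp add: power2_eq_square mult_ac)
  show "q (orth_proj q \<xi>) = orth_proj q \<xi>" by (simp add: orth_proj_def idem)
  have "\<xi> - orth_proj q \<xi> = (?v - q ?v) - adjoint q (?v - q ?v)"
    using i(1)[of \<xi>] by (simp add: orth_proj_def split_op_def algebra_simps)
  then have "(\<xi> - orth_proj q \<xi>) \<bullet> y = (?v - q ?v) \<bullet> (y - q y)"
    using adjoint_works[OF q, of y "?v - q ?v"] by (simp add: inner_diff_left inner_diff_right inner_commute)
  then have "\<bar>(\<xi> - orth_proj q \<xi>) \<bullet> y\<bar> \<le> norm (?v - q ?v) * norm (y - q y)" using Cauchy_Schwarz_ineq2 by simp
  also have "\<dots> \<le> (2 * (1 + K) * norm \<xi>) * norm (y - q y)"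
  proof (rule mult_right_mono)
    have "norm (?v - q ?v) \<le> norm ?v + norm (q ?v)" by (rule norm_triangle_ineq4)
    also have "\<dots> \<le> (1 + K) * norm ?v" using K(1)[of ?v] by (simp add: distrib_right)
    also have "\<dots> \<le> (1 + K) * (2 * norm \<xi>)" using K(2) by (intro mult_left_mono i(3)) auto
    finally show "norm (?v - q ?v) \<le> 2 * (1 + K) * norm \<xi>" by (simp only: mult_ac)
  qed simp
  finally show "\<bar>(\<xi> - orth_proj q \<xi>) \<bullet> y\<bar> \<le> 2 * (1 + K) * norm \<xi> * norm (y - q y)" .
qed

text \<open>The resolvent identity for the inverse of \<open>split_op\<close>.\<close>

lemma orth_proj_lipschitz:
  fixes q q' :: "'a::euclidean_space \<Rightarrow> 'a"
  assumes q: "linear q" "linear q'" and K: "\<And>v. norm (q v) \<le> K * norm v" "\<And>v. norm (q' v) \<le> K * norm v" "0 \<le> K"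
    and d: "\<And>v. norm (q v - q' v) \<le> d * norm v" "0 \<le> d"
  shows "norm (orth_proj q \<xi> - orth_proj q' \<xi>) \<le> (4 * K + K\<^sup>2 * (8 * (2 * K + 1))) * d * norm \<xi>"
proof -
  note a = adjoint_linear[OF q(1)] adjoint_linear[OF q(2)]
  note ab = adjoint_bound[OF q(1) K(1)] adjoint_bound[OF q(2) K(2)]
  have ql: "linear (\<lambda>v. q v - q' v)" by (rule linear_compose_sub[OF q])
  have adj: "adjoint (\<lambda>v. q v - q' v) = (\<lambda>v. adjoint q v - adjoint q' v)"
  proof (rule adjoint_unique, intro allI)
    fix x y show "(q x - q' x) \<bullet> y = x \<bullet> (adjoint q y - adjoint q' y)"
      using adjoint_works[OF q(1), of x y] adjoint_works[OF q(2), of x y] by (simp add: inner_diff_left inner_diff_right)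
  qed
  have da: "norm (adjoint q v - adjoint q' v) \<le> d * norm v" for v
    using adjoint_bound[OF ql d(1), of v] by (simp add: adj)
  have qa: "norm (q (adjoint q v) - q' (adjoint q' v)) \<le> (2 * K * d) * norm v" for v
  proof -
    have "q (adjoint q v) - q' (adjoint q' v) = (q (adjoint q v) - q' (adjoint q v)) + q' (adjoint q v - adjoint q' v)"
      by (simp add: linear_diff[OF q(2)])
    also have "norm \<dots> \<le> norm (q (adjoint q v) - q' (adjoint q v)) + norm (q' (adjoint q v - adjoint q' v))" by (rule norm_triangle_ineq)
    also have "\<dots> \<le> d * (K * norm v) + K * (d * norm v)"
      using K(3) d(2) by (intro add_mono order_trans[OF d(1)] order_trans[OF K(2)] mult_left_mono ab da) auto
    finally show ?thesis by (simp add: algebra_simps)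
  qed
  have ra: "norm (((v - q v) - adjoint q (v - q v)) - ((v - q' v) - adjoint q' (v - q' v))) \<le> (2 * (1 + K) * d) * norm v" for v
  proof -
    have "((v - q v) - adjoint q (v - q v)) - ((v - q' v) - adjoint q' (v - q' v))
       = (adjoint q (q v - q' v) - (q v - q' v)) - (adjoint q (v - q' v) - adjoint q' (v - q' v))"
      by (simp add: linear_diff[OF a(1)] algebra_simps)
    also have "norm \<dots> \<le> (norm (adjoint q (q v - q' v)) + norm (q v - q' v)) + norm (adjoint q (v - q' v) - adjoint q' (v - q' v))"
      by (rule order_trans[OF norm_triangle_ineq4 add_right_mono[OF norm_triangle_ineq4]])
    also have "\<dots> \<le> (K * (d * norm v) + d * norm v) + d * ((1 + K) * norm v)"
    proof (intro add_mono)
      show "norm (adjoint q (q v - q' v)) \<le> K * (d * norm v)" using K(3) by (intro order_trans[OF ab(1)] mult_left_mono d(1)) auto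
      show "norm (q v - q' v) \<le> d * norm v" by (rule d(1))
      have "norm (v - q' v) \<le> (1 + K) * norm v" using norm_triangle_ineq4[of v "q' v"] K(2)[of v] by (simp add: distrib_right)
      then show "norm (adjoint q (v - q' v) - adjoint q' (v - q' v)) \<le> d * ((1 + K) * norm v)"
        using d(2) by (intro order_trans[OF da] mult_left_mono) auto
    qed
    finally show ?thesis by (simp add: algebra_simps)
  qed
  have sp: "norm (split_op q v - split_op q' v) \<le> ((4 * K + 2) * d) * norm v" for v
  proof -
    have "split_op q v - split_op q' v = (q (adjoint q v) - q' (adjoint q' v)) + (((v - q v) - adjoint q (v - q v)) - ((v - q' v) - adjoint q' (v - q' v)))"
      by (simp add: split_op_def)
    also have "norm \<dots> \<le> (2 * K * d) * norm v + (2 * (1 + K) * d) * norm v" by (intro order_trans[OF norm_triangle_ineq] add_mono qa ra)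
    finally show ?thesis by (simp add: algebra_simps)
  qed
  let ?v = "inv (split_op q) \<xi>" and ?v' = "inv (split_op q') \<xi>"
  have "norm (?v - ?v') \<le> 2 * norm (split_op q (?v - ?v'))" by (rule split_op_coercive[OF q(1)])
  also have "split_op q (?v - ?v') = - (split_op q ?v' - split_op q' ?v')"
    using split_op_inv(1)[OF q(1), of \<xi>] split_op_inv(1)[OF q(2), of \<xi>] linear_diff[OF split_op_linear[OF q(1)], of ?v ?v'] by simp
  also have "2 * norm (- (split_op q ?v' - split_op q' ?v')) \<le> 2 * (((4 * K + 2) * d) * (2 * norm \<xi>))"
    using K(3) d(2) unfolding norm_minus_cancel
    by (intro mult_left_mono order_trans[OF sp] split_op_inv(3)[OF q(2)]) auto
  finally have vv: "norm (?v - ?v') \<le> 8 * (2 * K + 1) * d * norm \<xi>" by (simp add: algebra_simps)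
  have "orth_proj q \<xi> - orth_proj q' \<xi> = (q (adjoint q ?v) - q' (adjoint q' ?v)) + q' (adjoint q' (?v - ?v'))"
    by (simp add: orth_proj_def linear_diff[OF a(2)] linear_diff[OF q(2)])
  also have "norm \<dots> \<le> (2 * K * d) * (2 * norm \<xi>) + K * (K * (8 * (2 * K + 1) * d * norm \<xi>))"
  proof (intro order_trans[OF norm_triangle_ineq] add_mono)
    show "norm (q (adjoint q ?v) - q' (adjoint q' ?v)) \<le> (2 * K * d) * (2 * norm \<xi>)"
      using K(3) d(2) by (intro order_trans[OF qa] mult_left_mono split_op_inv(3)[OF q(1)]) auto
    show "norm (q' (adjoint q' (?v - ?v'))) \<le> K * (K * (8 * (2 * K + 1) * d * norm \<xi>))"
      using K(3) by (intro order_trans[OF K(2)] mult_left_mono order_trans[OF ab(2)] vv) auto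
  qed
  finally show ?thesis by (simp add: power2_eq_square algebra_simps)
qed

section \<open>Quantitative Taylor estimates for C2 maps\<close>

lemma C2_local_bounds:
  fixes f :: "'a::euclidean_space \<Rightarrow> 'b::euclidean_space"
  assumes f: "C2_on U f" and U: "open U" "p \<in> U"
  shows "\<exists>r>0. \<exists>L\<ge>0. \<exists>f'. cball p r \<subseteq> U \<and> (\<forall>x\<in>U. (f has_derivative blinfun_apply (f' x)) (at x)) \<and>
     (\<forall>x\<in>cball p r. norm (f' x) \<le> L) \<and> (\<forall>x\<in>cball p r. \<forall>y\<in>cball p r. norm (f' x - f' y) \<le> L * norm (x - y))
     \<and> (\<forall>x\<in>cball p r. \<forall>y\<in>cball p r. norm (f x - f y) \<le> L * norm (x - y))"
proof -
  obtain f' :: "'a \<Rightarrow> 'a \<Rightarrow>\<^sub>L 'b" and f'' where d: "\<And>x. x \<in> U \<Longrightarrow> (f has_derivative blinfun_apply (f' x)) (at x)"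
    and d': "\<And>x. x \<in> U \<Longrightarrow> (f' has_derivative blinfun_apply (f'' x)) (at x)" and c: "continuous_on U f''"
    using f unfolding C2_on_def by blast
  obtain r where r: "0 < r" "cball p r \<subseteq> U" using U open_contains_cball by blast
  have "compact (f'' ` cball p r)" by (intro compact_continuous_image continuous_on_subset[OF c r(2)]) auto
  then obtain L2 where L2: "\<And>x. x \<in> cball p r \<Longrightarrow> norm (f'' x) \<le> L2"
    using compact_imp_bounded by (fastforce simp: bounded_iff)
  have lip: "norm (f' x - f' y) \<le> L2 * norm (x - y)" if "x \<in> cball p r" "y \<in> cball p r" for x y
  proof (rule differentiable_bound[of "cball p r" f' "\<lambda>x. blinfun_apply (f'' x)"])
    show "(f' has_derivative blinfun_apply (f'' x)) (at x within cball p r)" if "x \<in> cball p r" for x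
      using d' r(2) that by (meson has_derivative_at_withinI subsetD)
    show "onorm (blinfun_apply (f'' x)) \<le> L2" if "x \<in> cball p r" for x
      using L2[OF that] by (simp add: norm_blinfun.rep_eq)
  qed (use that in auto)
  have pc: "p \<in> cball p r" using r by simp
  have L20: "0 \<le> L2" using order_trans[OF norm_ge_zero L2[OF pc]] .
  define L1 where "L1 = norm (f' p) + L2 * r"
  have b: "norm (f' x) \<le> L1" if "x \<in> cball p r" for x
  proof -
    have "norm (f' x) \<le> norm (f' p) + norm (f' x - f' p)" using norm_triangle_ineq[of "f' p" "f' x - f' p"] by simp
    also have "norm (f' x - f' p) \<le> L2 * norm (x - p)" by (rule lip[OF that pc])
    also have "\<dots> \<le> L2 * r" using that L20 by (intro mult_left_mono) (auto simp: dist_norm norm_minus_commute)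
    finally show ?thesis by (simp add: L1_def)
  qed
  have lip0: "norm (f x - f y) \<le> L1 * norm (x - y)" if "x \<in> cball p r" "y \<in> cball p r" for x y
  proof (rule differentiable_bound[of "cball p r" f "\<lambda>x. blinfun_apply (f' x)"])
    show "(f has_derivative blinfun_apply (f' x)) (at x within cball p r)" if "x \<in> cball p r" for x
      using d r(2) that by (meson has_derivative_at_withinI subsetD)
    show "onorm (blinfun_apply (f' x)) \<le> L1" if "x \<in> cball p r" for x
      using b[OF that] by (simp add: norm_blinfun.rep_eq)
  qed (use that in auto)
  have L10: "0 \<le> L1" using L20 r by (simp add: L1_def)
  show ?thesis
  proof (intro exI conjI ballI)
    show "0 < r" "cball p r \<subseteq> U" by fact+
    show "0 \<le> L1 + L2" using L10 L20 by simp
    fix x y assume x: "x \<in> cball p r" and y: "y \<in> cball p r"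
    show "norm (f' x - f' y) \<le> (L1 + L2) * norm (x - y)"
      using lip[OF x y] mult_nonneg_nonneg[OF L10 norm_ge_zero[of "x - y"]] by (simp add: distrib_right)
    show "norm (f x - f y) \<le> (L1 + L2) * norm (x - y)"
      using lip0[OF x y] mult_nonneg_nonneg[OF L20 norm_ge_zero[of "x - y"]] by (simp add: distrib_right)
  next
    fix x assume "x \<in> cball p r" then show "norm (f' x) \<le> L1 + L2" using b L20 by fastforce
  qed (use d in auto)
qed

lemma quadratic_remainder:
  fixes f :: "'a::euclidean_space \<Rightarrow> 'b::euclidean_space"
  assumes S: "convex S" "x \<in> S" "y \<in> S" and d: "\<And>x. x \<in> S \<Longrightarrow> (f has_derivative blinfun_apply (f' x)) (at x)"
    and L: "\<And>x y. x \<in> S \<Longrightarrow> y \<in> S \<Longrightarrow> norm (f' x - f' y) \<le> L * norm (x - y)" "0 \<le> L"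
  shows "norm (f y - f x - f' x (y - x)) \<le> L * (norm (y - x))\<^sup>2"
proof -
  have seg: "closed_segment x y \<subseteq> S" using S by (simp add: closed_segment_subset)
  have "norm ((f y - f' x y) - (f x - f' x x)) \<le> (L * norm (y - x)) * norm (y - x)"
  proof (rule differentiable_bound[of "closed_segment x y" "\<lambda>w. f w - f' x w" "\<lambda>w. blinfun_apply (f' w - f' x)"])
    fix w assume w: "w \<in> closed_segment x y"
    have "((\<lambda>w. f w - f' x w) has_derivative (\<lambda>v. f' w v - f' x v)) (at w within closed_segment x y)"
      using w seg by (intro has_derivative_diff has_derivative_at_withinI[OF d] bounded_linear_imp_has_derivative blinfun.bounded_linear_right) auto
    then show "((\<lambda>w. f w - f' x w) has_derivative blinfun_apply (f' w - f' x)) (at w within closed_segment x y)"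
      by (simp add: blinfun.diff_left fun_eq_iff[symmetric] minus_blinfun.rep_eq)
    have "norm (f' w - f' x) \<le> L * norm (w - x)" using w seg S by (intro L) auto
    also have "\<dots> \<le> L * norm (y - x)" using segment_bound1[OF w] L(2) by (intro mult_left_mono) auto
    finally show "onorm (blinfun_apply (f' w - f' x)) \<le> L * norm (y - x)" by (simp add: norm_blinfun.rep_eq)
  qed auto
  then show ?thesis by (simp add: blinfun.diff_right power2_eq_square algebra_simps)
qed

text \<open>The increment map \<open>w \<mapsto> f (w + l) - f w\<close> has derivative at most \<open>L * norm l\<close>.\<close>

lemma second_difference_bound:
  fixes f :: "'a::euclidean_space \<Rightarrow> 'b::euclidean_space"
  assumes S: "convex S" "x \<in> S" "y \<in> S" and sh: "\<And>w. w \<in> S \<Longrightarrow> w + l \<in> T" "S \<subseteq> T"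
    and d: "\<And>x. x \<in> T \<Longrightarrow> (f has_derivative blinfun_apply (f' x)) (at x)"
    and L: "\<And>x y. x \<in> T \<Longrightarrow> y \<in> T \<Longrightarrow> norm (f' x - f' y) \<le> L * norm (x - y)"
  shows "norm ((f (x + l) - f x) - (f (y + l) - f y)) \<le> (L * norm l) * norm (x - y)"
proof (rule differentiable_bound[of S "\<lambda>w. f (w + l) - f w" "\<lambda>w. blinfun_apply (f' (w + l) - f' w)"])
  fix w assume w: "w \<in> S"
  have "((\<lambda>w. f (w + l)) has_derivative (\<lambda>v. f' (w + l) v)) (at w)"
  proof -
    have "((\<lambda>w. w + l) has_derivative (\<lambda>v. v)) (at w)" by (auto intro!: derivative_eq_intros)
    from has_derivative_compose[OF this d[OF sh(1)[OF w]]] show ?thesis .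
  qed
  then have "((\<lambda>w. f (w + l) - f w) has_derivative (\<lambda>v. f' (w + l) v - f' w v)) (at w)"
    using sh(2) w by (intro has_derivative_diff d) auto
  note dd = this
  show "((\<lambda>w. f (w + l) - f w) has_derivative blinfun_apply (f' (w + l) - f' w)) (at w within S)"
  proof -
    have "blinfun_apply (f' (w + l) - f' w) = (\<lambda>v. f' (w + l) v - f' w v)" by (intro ext) (rule blinfun.diff_left)
    with has_derivative_at_withinI[OF dd, of S] show ?thesis by simp
  qed
  show "onorm (blinfun_apply (f' (w + l) - f' w)) \<le> L * norm l"
    using L[OF sh(1)[OF w], of w] sh(2) w by (auto simp: norm_blinfun.rep_eq)
qed (use S in auto)

section \<open>Tangential displacements of a submanifold\<close>

text \<open>Data near \<open>p\<close> for moving points of \<open>N\<close> inside \<open>N\<close>: \<open>P z\<close> is a tangent projection, and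
  \<open>G z b\<close> is the point reached from \<open>z\<close> with displacement \<open>b\<close>. In order, the clauses say that \<open>P z\<close>
  is bounded, that chords of \<open>N\<close> are tangent to second order, even for far endpoints \<open>z'\<close>, that \<open>G\<close>
  stays in \<open>N\<close> with velocity \<open>P z\<close>, and that its increments are Lipschitz in a form that is
  homogeneous of degree one in the displacements.\<close>

definition tangent_flow :: "'a::euclidean_space set \<Rightarrow> 'a \<Rightarrow> real \<Rightarrow> real \<Rightarrow> real \<Rightarrow> ('a \<Rightarrow> 'a \<Rightarrow> 'a) \<Rightarrow> ('a \<Rightarrow> 'a \<Rightarrow> 'a) \<Rightarrow> bool" where
  "tangent_flow N p r C \<tau> P G \<longleftrightarrow> 0 < r \<and> 0 \<le> C \<and> 0 < \<tau> \<and>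
    (\<forall>z\<in>N \<inter> ball p r. linear (P z) \<and> (\<forall>\<xi>. norm (P z \<xi>) \<le> C * norm \<xi>) \<and>
       (\<forall>\<xi>. \<forall>z'\<in>N. \<bar>(\<xi> - P z \<xi>) \<bullet> (z - z')\<bar> \<le> C * norm \<xi> * (norm (z - z'))\<^sup>2) \<and>
       (\<forall>b. norm b \<le> \<tau> \<longrightarrow> G z b \<in> N \<and> norm (G z b - z - P z b) \<le> C * (norm b)\<^sup>2 \<and>
         (\<forall>z'\<in>N \<inter> ball p r. \<forall>b'. norm b' \<le> \<tau> \<longrightarrow>
            norm ((G z b - z) - (G z' b' - z')) \<le> C * (norm (b - b') + (norm b + norm b') * norm (z - z')))))"

text \<open>Conjugating a linear projection \<open>\<pi>\<close> onto the model subspace by the derivatives of the chart gives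
  an oblique projection \<open>q z\<close> onto the tangent space, and \<open>orth_proj\<close> makes it orthogonal. The
  displacement moves by \<open>l z b\<close>, the image of \<open>P z b\<close> under the derivative of the chart, along the model
  subspace and maps back. The second order statements are Taylor's formula for the inverse chart, whose
  derivative is Lipschitz. No more than two derivatives are available, so the Lipschitz estimate of \<open>G\<close>
  uses a second difference instead of a derivative in \<open>z\<close>.\<close>

lemma submanifold_tangent_flow:
  fixes N :: "'a::euclidean_space set"
  assumes N: "C2_submanifold k N" and p: "p \<in> N"
  shows "\<exists>r C \<tau> P G. tangent_flow N p r C \<tau> P G"
proof -
  from N[unfolded C2_submanifold_def, rule_format, OF p]
  obtain U V :: "'a set" and L :: "'a set" and \<Psi> \<Phi> where UV: "open U" "open V" "p \<in> U" and L: "subspace L"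
    and hom: "homeomorphism U V \<Psi> \<Phi>" and C2: "C2_on U \<Psi>" "C2_on V \<Phi>" and im: "\<Psi> ` (N \<inter> U) = L \<inter> V"
    by (elim exE conjE) (rule that; assumption)
  have inv: "\<And>x. x \<in> U \<Longrightarrow> \<Phi> (\<Psi> x) = x" "\<And>y. y \<in> V \<Longrightarrow> \<Psi> (\<Phi> y) = y" "\<And>x. x \<in> U \<Longrightarrow> \<Psi> x \<in> V" "\<And>y. y \<in> V \<Longrightarrow> \<Phi> y \<in> U"
    using hom by (auto simp: homeomorphism_def)
  have onN: "\<Phi> y \<in> N" if "y \<in> L" "y \<in> V" for y
  proof -
    have "y \<in> \<Psi> ` (N \<inter> U)" using that by (simp add: im)
    then show ?thesis by (auto simp: inv(1))
  qed
  define q0 where "q0 = \<Psi> p"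
  have q0: "q0 \<in> V" using inv(3) UV(3) by (simp add: q0_def)
  obtain r1 L1 \<Psi>' where r1: "0 < r1" "0 \<le> L1" "cball p r1 \<subseteq> U" and d1: "\<And>x. x \<in> U \<Longrightarrow> (\<Psi> has_derivative blinfun_apply (\<Psi>' x)) (at x)"
    and n1: "\<And>x. x \<in> cball p r1 \<Longrightarrow> norm (\<Psi>' x) \<le> L1"
    and l1: "\<And>x y. x \<in> cball p r1 \<Longrightarrow> y \<in> cball p r1 \<Longrightarrow> norm (\<Psi>' x - \<Psi>' y) \<le> L1 * norm (x - y)"
    and m1: "\<And>x y. x \<in> cball p r1 \<Longrightarrow> y \<in> cball p r1 \<Longrightarrow> norm (\<Psi> x - \<Psi> y) \<le> L1 * norm (x - y)"
    using C2_local_bounds[OF C2(1) UV(1) UV(3)] by (elim exE conjE, intro that) blast+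
  obtain r2 L2 \<Phi>' where r2: "0 < r2" "0 \<le> L2" "cball q0 r2 \<subseteq> V" and d2: "\<And>x. x \<in> V \<Longrightarrow> (\<Phi> has_derivative blinfun_apply (\<Phi>' x)) (at x)"
    and n2: "\<And>x. x \<in> cball q0 r2 \<Longrightarrow> norm (\<Phi>' x) \<le> L2"
    and l2: "\<And>x y. x \<in> cball q0 r2 \<Longrightarrow> y \<in> cball q0 r2 \<Longrightarrow> norm (\<Phi>' x - \<Phi>' y) \<le> L2 * norm (x - y)"
    and m2: "\<And>x y. x \<in> cball q0 r2 \<Longrightarrow> y \<in> cball q0 r2 \<Longrightarrow> norm (\<Phi> x - \<Phi> y) \<le> L2 * norm (x - y)"
    using C2_local_bounds[OF C2(2) UV(2) q0] by (elim exE conjE, intro that) blast+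
  obtain \<pi> where \<pi>: "range \<pi> \<subseteq> L" "linear \<pi>" "\<And>v. v \<in> L \<Longrightarrow> \<pi> v = v"
    using linear_exists_left_inverse_on[of "\<lambda>x::'a. x" L] L by (auto simp: linear_id[unfolded id_def])
  have "bounded_linear \<pi>" using \<pi>(2) by (simp add: linear_conv_bounded_linear)
  from bounded_linear.nonneg_bounded[OF this] obtain L3 where L3: "0 \<le> L3" "\<And>v. norm (\<pi> v) \<le> norm v * L3" by blast
  \<comment> \<open>On the ball of radius \<open>r0\<close> the chart takes values in half of the ball on which its inverse
    is controlled, which leaves room for displacements.\<close>
  define r0 where "r0 = min r1 (r2 / (2 * (L1 + 1)))"
  have r0: "0 < r0" "r0 \<le> r1" using r1 r2 by (auto simp: r0_def)
  have \<Psi>b: "\<Psi> z \<in> cball q0 (r2 / 2)" if "z \<in> cball p r0" for z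
  proof -
    have "norm (\<Psi> z - \<Psi> p) \<le> L1 * norm (z - p)" using that r0 r1 by (intro m1) auto
    also have "\<dots> \<le> (L1 + 1) * r0" using that r1 by (intro mult_mono) (auto simp: dist_norm norm_minus_commute)
    also have "\<dots> \<le> (L1 + 1) * (r2 / (2 * (L1 + 1)))" using r1 by (intro mult_left_mono) (auto simp: r0_def)
    also have "\<dots> = r2 / 2" using r1(2) by (simp add: field_simps)
    finally show ?thesis by (simp add: q0_def dist_norm norm_minus_commute)
  qed
  have half: "w \<in> cball q0 r2" "w \<in> V" if "w \<in> cball q0 (r2 / 2)" for w
    using that r2 by (auto simp: subset_iff)
  have add_half: "w + l \<in> cball q0 r2" if "w \<in> cball q0 (r2 / 2)" "norm l \<le> r2 / 2" for w l
  proof -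
    have "norm (q0 - (w + l)) \<le> norm (q0 - w) + norm l" using norm_triangle_ineq4[of "q0 - w" l] by (simp add: algebra_simps)
    then show ?thesis using that by (simp add: dist_norm)
  qed
  have zU: "z \<in> U" if "z \<in> cball p r0" for z using that r0 r1 by auto
  have z1: "z \<in> cball p r1" if "z \<in> cball p r0" for z using that r0 by auto
  let ?A = "\<lambda>z. blinfun_apply (\<Psi>' z)" and ?B = "\<lambda>z. blinfun_apply (\<Phi>' (\<Psi> z))"
  have AB: "?A z (?B z l) = l" if z: "z \<in> cball p r0" for z l
  proof -
    have b: "\<Psi> z \<in> V" by (rule inv(3)[OF zU[OF z]])
    have "((\<lambda>y. \<Psi> (\<Phi> y)) has_derivative (\<lambda>l. ?A z (?B z l))) (at (\<Psi> z))"
      using has_derivative_compose[OF d2[OF b], of \<Psi> "?A z"] d1[OF zU[OF z]] inv(1)[OF zU[OF z]] by simp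
    moreover have "((\<lambda>y. \<Psi> (\<Phi> y)) has_derivative (\<lambda>l. l)) (at (\<Psi> z))"
      by (rule has_derivative_transform_within_open[OF has_derivative_ident UV(2) b]) (simp add: inv(2))
    ultimately have "(\<lambda>l. ?A z (?B z l)) = (\<lambda>l. l)" by (rule has_derivative_unique)
    then show ?thesis by meson
  qed
  have Ab: "norm (?A z v) \<le> L1 * norm v" if "z \<in> cball p r0" for z v
    using norm_blinfun[of "\<Psi>' z" v] mult_right_mono[OF n1[OF z1[OF that]] norm_ge_zero[of v]] by linarith
  have Bb: "norm (?B z v) \<le> L2 * norm v" if "z \<in> cball p r0" for z v
    using norm_blinfun[of "\<Phi>' (\<Psi> z)" v] mult_right_mono[OF n2[OF half(1)[OF \<Psi>b[OF that]]] norm_ge_zero[of v]] by linarith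
  have Ad: "norm (?A z v - ?A z' v) \<le> L1 * norm (z - z') * norm v" if "z \<in> cball p r0" "z' \<in> cball p r0" for z z' v
    using norm_blinfun[of "\<Psi>' z - \<Psi>' z'" v] mult_right_mono[OF l1[OF z1[OF that(1)] z1[OF that(2)]] norm_ge_zero[of v]]
    by (simp add: blinfun.diff_left)
  have \<Psi>d: "norm (\<Psi> z - \<Psi> z') \<le> L1 * norm (z - z')" if "z \<in> cball p r0" "z' \<in> cball p r0" for z z'
    by (rule m1[OF z1[OF that(1)] z1[OF that(2)]])
  have Bd: "norm (?B z v - ?B z' v) \<le> L2 * L1 * norm (z - z') * norm v" if "z \<in> cball p r0" "z' \<in> cball p r0" for z z' v
  proof -
    have "norm (?B z v - ?B z' v) \<le> norm (\<Phi>' (\<Psi> z) - \<Phi>' (\<Psi> z')) * norm v"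
      using norm_blinfun[of "\<Phi>' (\<Psi> z) - \<Phi>' (\<Psi> z')" v] by (simp add: blinfun.diff_left)
    also have "\<dots> \<le> (L2 * (L1 * norm (z - z'))) * norm v"
      using r2(2) by (intro mult_right_mono order_trans[OF l2[OF half(1)[OF \<Psi>b[OF that(1)]] half(1)[OF \<Psi>b[OF that(2)]]]] mult_left_mono \<Psi>d that) auto
    finally show ?thesis by (simp add: mult.assoc)
  qed
  define q where "q z v = ?B z (\<pi> (?A z v))" for z v
  have qlin: "linear (q z)" for z
  proof -
    have "linear (?A z)" "linear (?B z)" by (auto intro: bounded_linear.linear blinfun.bounded_linear_right)
    then show ?thesis unfolding q_def[abs_def] using linear_compose[OF linear_compose[OF _ \<pi>(2)], of "?A z" "?B z"] by (simp add: o_def)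
  qed
  define K where "K = L2 * (L3 * L1)"
  have K0: "0 \<le> K" using r1 r2 L3 by (simp add: K_def)
  have piA: "norm (\<pi> (?A z v)) \<le> L3 * L1 * norm v" if "z \<in> cball p r0" for z v
    using order_trans[OF L3(2)[of "?A z v"] mult_right_mono[OF Ab[OF that, of v] L3(1)]] by (simp add: mult_ac)
  have qK: "norm (q z v) \<le> K * norm v" if z: "z \<in> cball p r0" for z v
    using order_trans[OF Bb[OF z, of "\<pi> (?A z v)"] mult_left_mono[OF piA[OF z, of v] r2(2)]] by (simp add: q_def K_def mult_ac)
  have fix\<pi>: "\<pi> (\<pi> v) = \<pi> v" for v using \<pi>(1,3) by blast
  have idem: "q z (q z v) = q z v" if "z \<in> cball p r0" for z v by (simp add: q_def AB[OF that] fix\<pi>)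
  define Q where "Q = L2 * L1 * (L3 * L1) + L2 * (L3 * L1)"
  have Q0: "0 \<le> Q" using r1 r2 L3 by (simp add: Q_def)
  have qd: "norm (q z v - q z' v) \<le> (Q * norm (z - z')) * norm v" if z: "z \<in> cball p r0" "z' \<in> cball p r0" for z z' v
  proof -
    have "q z v - q z' v = (?B z (\<pi> (?A z v)) - ?B z' (\<pi> (?A z v))) + ?B z' (\<pi> (?A z v - ?A z' v))"
      by (simp add: q_def linear_diff[OF \<pi>(2)] blinfun.diff_right)
    also have "norm \<dots> \<le> L2 * L1 * norm (z - z') * (L3 * L1 * norm v) + L2 * ((L1 * norm (z - z') * norm v) * L3)"
    proof (intro order_trans[OF norm_triangle_ineq] add_mono)
      show "norm (?B z (\<pi> (?A z v)) - ?B z' (\<pi> (?A z v))) \<le> L2 * L1 * norm (z - z') * (L3 * L1 * norm v)"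
        using r1 r2 by (intro order_trans[OF Bd[OF z]] mult_left_mono piA z) auto
      show "norm (?B z' (\<pi> (?A z v - ?A z' v))) \<le> L2 * ((L1 * norm (z - z') * norm v) * L3)"
        using r2 L3 by (intro order_trans[OF Bb[OF z(2)]] mult_left_mono order_trans[OF L3(2)] mult_right_mono Ad z) auto
    qed
    finally show ?thesis by (simp add: Q_def algebra_simps)
  qed
  define P where "P z = orth_proj (q z)" for z
  have Plin: "linear (P z)" and Pb: "norm (P z \<xi>) \<le> 2 * K\<^sup>2 * norm \<xi>" and qP: "q z (P z \<xi>) = P z \<xi>"
    and Pn: "\<bar>(\<xi> - P z \<xi>) \<bullet> y\<bar> \<le> 2 * (1 + K) * norm \<xi> * norm (y - q z y)" if z: "z \<in> cball p r0" for z \<xi> y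
    unfolding P_def using orth_proj_props[OF qlin qK[OF z] K0 idem[OF z]] by blast+
  define D where "D = (4 * K + K\<^sup>2 * (8 * (2 * K + 1))) * Q"
  have D0: "0 \<le> D" using K0 Q0 by (simp add: D_def)
  have Pd: "norm (P z \<xi> - P z' \<xi>) \<le> D * norm (z - z') * norm \<xi>" if z: "z \<in> cball p r0" "z' \<in> cball p r0" for z z' \<xi>
    using orth_proj_lipschitz[OF qlin qlin qK[OF z(1)] qK[OF z(2)] K0 qd[OF z], of \<xi>] Q0 by (simp add: P_def D_def mult_ac)
  define l where "l z b = ?A z (P z b)" for z b
  have lL: "l z b \<in> L" and Bl: "?B z (l z b) = P z b" if z: "z \<in> cball p r0" for z b
  proof -
    have "?B z (\<pi> (?A z (P z b))) = P z b" using qP[OF z] by (simp add: q_def)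
    then have "?A z (P z b) = \<pi> (?A z (P z b))" using AB[OF z, of "\<pi> (?A z (P z b))"] by simp
    moreover have "\<pi> (?A z (P z b)) \<in> L" using \<pi>(1) by blast
    ultimately show "l z b \<in> L" unfolding l_def by (rule ssubst)
    show "?B z (l z b) = P z b" unfolding l_def using \<open>?B z (\<pi> _) = _\<close> \<open>?A z (P z b) = \<pi> _\<close> by simp
  qed
  define c where "c = L1 * (2 * K\<^sup>2)"
  have c0: "0 \<le> c" using r1 by (simp add: c_def)
  have lb: "norm (l z b) \<le> c * norm b" if z: "z \<in> cball p r0" for z b
    using order_trans[OF Ab[OF z] mult_left_mono[OF Pb[OF z, of b] r1(2)]] by (simp add: l_def c_def mult_ac)
  define c1 where "c1 = L1 * D + c"
  have c10: "0 \<le> c1" using c0 r1 D0 by (simp add: c1_def)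
  have ld: "norm (l z b - l z' b') \<le> c * norm (b - b') + c1 * norm b' * norm (z - z')" if z: "z \<in> cball p r0" "z' \<in> cball p r0" for z z' b b'
  proof -
    have "l z b - l z' b' = l z (b - b') + (?A z (P z b' - P z' b') + (?A z (P z' b') - ?A z' (P z' b')))"
      by (simp add: l_def linear_diff[OF Plin[OF z(1)]] blinfun.diff_right)
    also have "norm \<dots> \<le> c * norm (b - b') + (L1 * (D * norm (z - z') * norm b') + L1 * norm (z - z') * (2 * K\<^sup>2 * norm b'))"
      using r1 by (intro order_trans[OF norm_triangle_ineq] add_mono lb z order_trans[OF Ab[OF z(1)]] order_trans[OF Ad[OF z]] mult_left_mono Pd Pb) auto
    finally show ?thesis by (simp add: c1_def c_def algebra_simps)
  qed
  \<comment> \<open>Displacements of this size move the chart value by at most \<open>r2 / 2\<close>.\<close>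
  define \<tau> where "\<tau> = r2 / (2 * (c + 1))"
  have \<tau>: "0 < \<tau>" using r2 c0 by (simp add: \<tau>_def)
  have lt: "norm (l z b) \<le> r2 / 2" if z: "z \<in> cball p r0" and b: "norm b \<le> \<tau>" for z b
  proof -
    have "norm (l z b) \<le> (c + 1) * norm b" using order_trans[OF lb[OF z, of b] mult_right_mono[of c "c + 1" "norm b"]] by simp
    also have "\<dots> \<le> (c + 1) * \<tau>" using c0 b by (intro mult_left_mono) auto
    also have "\<dots> = r2 / 2" using c0 by (simp add: \<tau>_def field_simps)
    finally show ?thesis .
  qed
  define G where "G z b = \<Phi> (\<Psi> z + l z b)" for z b
  have GN: "G z b \<in> N" if z: "z \<in> cball p r0" "z \<in> N" and b: "norm b \<le> \<tau>" for z b
  proof -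
    have "\<Psi> z \<in> L" using im z zU[OF z(1)] by blast
    then have "\<Psi> z + l z b \<in> L" by (rule subspace_add[OF L _ lL[OF z(1)]])
    then show ?thesis unfolding G_def using add_half[OF \<Psi>b[OF z(1)] lt[OF z(1) b]] r2(3) by (intro onN) auto
  qed
  have \<Phi>r: "norm (\<Phi> y - \<Phi> x - \<Phi>' x (y - x)) \<le> L2 * (norm (y - x))\<^sup>2" if "x \<in> cball q0 r2" "y \<in> cball q0 r2" for x y
    by (rule quadratic_remainder[OF convex_cball that]) (use d2 r2 l2 in auto)
  have G2: "norm (G z b - z - P z b) \<le> L2 * c\<^sup>2 * (norm b)\<^sup>2" if z: "z \<in> cball p r0" and b: "norm b \<le> \<tau>" for z b
  proof -
    have "norm (\<Phi> (\<Psi> z + l z b) - \<Phi> (\<Psi> z) - \<Phi>' (\<Psi> z) (l z b)) \<le> L2 * (norm (l z b))\<^sup>2"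
      using \<Phi>r[OF half(1)[OF \<Psi>b[OF z]] add_half[OF \<Psi>b[OF z] lt[OF z b]]] by simp
    also have "\<dots> \<le> L2 * (c * norm b)\<^sup>2" using r2 by (intro mult_left_mono power_mono lb z) auto
    finally show ?thesis by (simp add: G_def inv(1)[OF zU[OF z]] Bl[OF z] power_mult_distrib mult.assoc)
  qed
  have GL: "norm ((G z b - z) - (G z' b' - z')) \<le> (L2 * c * L1 + L2 * (c + c1)) * (norm (b - b') + (norm b + norm b') * norm (z - z'))"
    if z: "z \<in> cball p r0" "z' \<in> cball p r0" and b: "norm b \<le> \<tau>" "norm b' \<le> \<tau>" for z z' b b'
  proof -
    let ?s = "\<Psi> z" and ?s' = "\<Psi> z'" and ?l = "l z b" and ?l' = "l z' b'"
    have 1: "norm ((\<Phi> (?s + ?l) - \<Phi> ?s) - (\<Phi> (?s' + ?l) - \<Phi> ?s')) \<le> (L2 * norm ?l) * norm (?s - ?s')"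
    proof (rule second_difference_bound[OF convex_cball \<Psi>b[OF z(1)] \<Psi>b[OF z(2)]])
      show "w + ?l \<in> cball q0 r2" if "w \<in> cball q0 (r2 / 2)" for w by (rule add_half[OF that lt[OF z(1) b(1)]])
      show "(\<Phi> has_derivative blinfun_apply (\<Phi>' x)) (at x)" if "x \<in> cball q0 r2" for x by (rule d2[OF subsetD[OF r2(3) that]])
      show "cball q0 (r2 / 2) \<subseteq> cball q0 r2" using r2 by (intro subset_cball) simp
    qed (rule l2)
    have 2: "norm (\<Phi> (?s' + ?l) - \<Phi> (?s' + ?l')) \<le> L2 * norm (?l - ?l')"
      using m2[OF add_half[OF \<Psi>b[OF z(2)] lt[OF z(1) b(1)]] add_half[OF \<Psi>b[OF z(2)] lt[OF z(2) b(2)]]] by simp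
    have "(G z b - z) - (G z' b' - z') = ((\<Phi> (?s + ?l) - \<Phi> ?s) - (\<Phi> (?s' + ?l) - \<Phi> ?s')) + (\<Phi> (?s' + ?l) - \<Phi> (?s' + ?l'))"
      by (simp add: G_def inv(1)[OF zU[OF z(1)]] inv(1)[OF zU[OF z(2)]])
    also have "norm \<dots> \<le> (L2 * (c * norm b)) * (L1 * norm (z - z')) + L2 * (c * norm (b - b') + c1 * norm b' * norm (z - z'))"
    proof (intro order_trans[OF norm_triangle_ineq] add_mono order_trans[OF 1] order_trans[OF 2])
      show "L2 * norm ?l * norm (?s - ?s') \<le> (L2 * (c * norm b)) * (L1 * norm (z - z'))"
        using r1 r2 c0 by (intro mult_mono mult_left_mono lb \<Psi>d z) auto
      show "L2 * norm (?l - ?l') \<le> L2 * (c * norm (b - b') + c1 * norm b' * norm (z - z'))"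
        using r2 by (intro mult_left_mono ld z) auto
    qed
    also have "\<dots> = (L2 * c * L1) * (norm b * norm (z - z')) + (L2 * c) * norm (b - b') + (L2 * c1) * (norm b' * norm (z - z'))"
      by (simp add: algebra_simps)
    also have "\<dots> \<le> (L2 * c * L1) * (norm (b - b') + (norm b + norm b') * norm (z - z'))
        + (L2 * c) * (norm (b - b') + (norm b + norm b') * norm (z - z')) + (L2 * c1) * (norm (b - b') + (norm b + norm b') * norm (z - z'))"
      using r1 r2 c0 c10 by (intro add_mono mult_left_mono) (auto simp: distrib_right)
    finally show ?thesis by (simp add: algebra_simps)
  qed
  have normal_near: "\<bar>(\<xi> - P z \<xi>) \<bullet> (z - z')\<bar> \<le> (2 * (1 + K) * ((1 + K) * (L2 * L1\<^sup>2))) * norm \<xi> * (norm (z - z'))\<^sup>2"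
    if z: "z \<in> cball p r0" "z \<in> N" and z': "z' \<in> cball p r0" "z' \<in> N" for z z' \<xi>
  proof -
    define e where "e = \<Phi> (\<Psi> z') - \<Phi> (\<Psi> z) - \<Phi>' (\<Psi> z) (\<Psi> z' - \<Psi> z)"
    have eb: "norm e \<le> L2 * (L1\<^sup>2 * (norm (z - z'))\<^sup>2)"
    proof -
      have "norm e \<le> L2 * (norm (\<Psi> z' - \<Psi> z))\<^sup>2" unfolding e_def by (rule \<Phi>r[OF half(1)[OF \<Psi>b[OF z(1)]] half(1)[OF \<Psi>b[OF z'(1)]]])
      also have "\<dots> \<le> L2 * (L1 * norm (z' - z))\<^sup>2" using r2 by (intro mult_left_mono power_mono \<Psi>d z z') auto
      finally show ?thesis by (simp add: power_mult_distrib norm_minus_commute)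
    qed
    have bL: "\<Psi> z' - \<Psi> z \<in> L"
    proof -
      have "\<Psi> z \<in> L" "\<Psi> z' \<in> L" using im z z' zU by blast+
      then show ?thesis using subspace_diff[OF L] by blast
    qed
    have t: "q z (?B z (\<Psi> z' - \<Psi> z)) = ?B z (\<Psi> z' - \<Psi> z)" by (simp add: q_def AB[OF z(1)] \<pi>(3)[OF bL])
    have y: "z - z' = - ?B z (\<Psi> z' - \<Psi> z) - e"
      by (simp add: e_def inv(1)[OF zU[OF z(1)]] inv(1)[OF zU[OF z'(1)]])
    have "(z - z') - q z (z - z') = q z e - e"
      unfolding y using linear_diff[OF qlin[of z], of "- ?B z (\<Psi> z' - \<Psi> z)" e] linear_neg[OF qlin[of z], of "?B z (\<Psi> z' - \<Psi> z)"] t by simp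
    then have "norm ((z - z') - q z (z - z')) \<le> norm (q z e) + norm e" by (simp add: norm_triangle_ineq4)
    also have "\<dots> \<le> (1 + K) * norm e" using qK[OF z(1), of e] by (simp add: distrib_right)
    also have "\<dots> \<le> (1 + K) * (L2 * (L1\<^sup>2 * (norm (z - z'))\<^sup>2))" using K0 by (intro mult_left_mono eb) auto
    finally have n: "norm ((z - z') - q z (z - z')) \<le> (1 + K) * (L2 * (L1\<^sup>2 * (norm (z - z'))\<^sup>2))" .
    have "\<bar>(\<xi> - P z \<xi>) \<bullet> (z - z')\<bar> \<le> 2 * (1 + K) * norm \<xi> * norm ((z - z') - q z (z - z'))" by (rule Pn[OF z(1)])
    also have "\<dots> \<le> 2 * (1 + K) * norm \<xi> * ((1 + K) * (L2 * (L1\<^sup>2 * (norm (z - z'))\<^sup>2)))"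
      using K0 by (intro mult_left_mono n) auto
    finally show ?thesis by (simp add: mult_ac)
  qed
  \<comment> \<open>Far from \<open>z\<close> the quadratic bound is trivial, since \<open>norm (z - z')\<close> is bounded below.\<close>
  have normal_far: "\<bar>(\<xi> - P z \<xi>) \<bullet> (z - z')\<bar> \<le> ((1 + 2 * K\<^sup>2) * (2 / r0)) * norm \<xi> * (norm (z - z'))\<^sup>2"
    if z: "z \<in> ball p (r0 / 2)" and z': "z' \<notin> cball p r0" for z z' \<xi>
  proof -
    have zc: "z \<in> cball p r0" using z r0 by auto
    have "r0 < norm (p - z) + norm (z - z')" using z' norm_triangle_ineq[of "p - z" "z - z'"] by (simp add: dist_norm)
    then have far: "1 \<le> (2 / r0) * norm (z - z')" using z r0(1) by (simp add: dist_norm field_simps)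
    have "norm (\<xi> - P z \<xi>) \<le> (1 + 2 * K\<^sup>2) * norm \<xi>"
      using norm_triangle_ineq4[of \<xi> "P z \<xi>"] Pb[OF zc, of \<xi>] by (simp add: distrib_right)
    then have "\<bar>(\<xi> - P z \<xi>) \<bullet> (z - z')\<bar> \<le> ((1 + 2 * K\<^sup>2) * norm \<xi>) * norm (z - z')"
      by (intro order_trans[OF Cauchy_Schwarz_ineq2] mult_right_mono) auto
    also have "\<dots> \<le> (((1 + 2 * K\<^sup>2) * norm \<xi>) * norm (z - z')) * ((2 / r0) * norm (z - z'))"
      using mult_left_mono[OF far, of "((1 + 2 * K\<^sup>2) * norm \<xi>) * norm (z - z')"] by simp
    also have "\<dots> = ((1 + 2 * K\<^sup>2) * (2 / r0)) * norm \<xi> * (norm (z - z'))\<^sup>2" by (simp only: power2_eq_square[of "norm (z - z')"] mult_ac)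
    finally show ?thesis .
  qed
  \<comment> \<open>One constant for all clauses.\<close>
  define Cs where "Cs = [2 * K\<^sup>2, L2 * c\<^sup>2, L2 * c * L1 + L2 * (c + c1), 2 * (1 + K) * ((1 + K) * (L2 * L1\<^sup>2)), (1 + 2 * K\<^sup>2) * (2 / r0)]"
  define C where "C = sum_list Cs"
  have Cs0: "\<forall>x\<in>set Cs. 0 \<le> x" using r0 r1 r2 c0 c10 K0 by (simp add: Cs_def)
  then have C0: "0 \<le> C" unfolding C_def by (intro sum_list_nonneg) auto
  have Cle: "x \<le> C" if "x \<in> set Cs" for x using Cs0 that unfolding C_def by (intro member_le_sum_list) auto
  have up: "X \<le> C * Y" if "X \<le> x * Y" "x \<in> set Cs" "0 \<le> Y" for X x Y
    using order_trans[OF that(1) mult_right_mono[OF Cle[OF that(2)] that(3)]] .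
  have in_c: "z \<in> cball p r0" if "z \<in> ball p (r0 / 2)" for z using that r0 by auto
  show ?thesis
    unfolding tangent_flow_def
  proof (intro exI conjI ballI allI impI)
    show "0 < r0 / 2" "0 \<le> C" "0 < \<tau>" using r0 C0 \<tau> by auto
    fix z assume z: "z \<in> N \<inter> ball p (r0 / 2)"
    then have zc: "z \<in> cball p r0" using in_c by blast
    show "linear (P z)" by (rule Plin[OF zc])
    show "norm (P z \<xi>) \<le> C * norm \<xi>" for \<xi> by (rule up[OF Pb[OF zc]]) (auto simp: Cs_def)
    show "\<bar>(\<xi> - P z \<xi>) \<bullet> (z - z')\<bar> \<le> C * norm \<xi> * (norm (z - z'))\<^sup>2" if z': "z' \<in> N" for \<xi> z'
    proof (cases "z' \<in> cball p r0")
      case True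
      have "\<bar>(\<xi> - P z \<xi>) \<bullet> (z - z')\<bar> \<le> C * (norm \<xi> * (norm (z - z'))\<^sup>2)"
        by (rule up[OF normal_near[OF zc _ True z', where \<xi>=\<xi>, unfolded mult.assoc[of _ "norm \<xi>"]]]) (use z in \<open>auto simp: Cs_def\<close>)
      then show ?thesis by (simp add: mult.assoc)
    next
      case False
      have "\<bar>(\<xi> - P z \<xi>) \<bullet> (z - z')\<bar> \<le> C * (norm \<xi> * (norm (z - z'))\<^sup>2)"
        by (rule up[OF normal_far[OF _ False, where \<xi>=\<xi>, unfolded mult.assoc[of _ "norm \<xi>"]]]) (use z in \<open>auto simp: Cs_def\<close>)
      then show ?thesis by (simp add: mult.assoc)
    qed
    fix b :: 'a assume b: "norm b \<le> \<tau>"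
    show "G z b \<in> N" using GN[OF zc _ b] z by blast
    show "norm (G z b - z - P z b) \<le> C * (norm b)\<^sup>2" by (rule up[OF G2[OF zc b]]) (auto simp: Cs_def)
    fix z' b' :: 'a assume z': "z' \<in> N \<inter> ball p (r0 / 2)" and b': "norm b' \<le> \<tau>"
    show "norm ((G z b - z) - (G z' b' - z')) \<le> C * (norm (b - b') + (norm b + norm b') * norm (z - z'))"
      by (rule up[OF GL[OF zc in_c b b']]) (use z' in \<open>auto simp: Cs_def\<close>)
  qed
qed

section \<open>The normal component of the Euler-Lagrange equation\<close>

text \<open>The product of the increments is \<open>\<phi> (x + h)\<close> times a kernel plus \<open>\<phi> x\<close> times a kernel, and the
  symmetry \<open>(h, x) \<mapsto> (- h, x + h)\<close> of the plane exchanges the two terms, which explains the factor \<open>2\<close>.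
  Both kernels are dominated by the energy density of \<open>u\<close> because \<open>s\<close> is normal to second order.\<close>

lemma normal_pairing:
  fixes u s :: "real \<Rightarrow> 'a::euclidean_space"
  assumes u: "finite_energy u" and [measurable]: "s \<in> borel_measurable borel" "\<phi> \<in> borel_measurable borel"
    and C: "\<And>x y. \<bar>s x \<bullet> (u x - u y)\<bar> \<le> C * (norm (u x - u y))\<^sup>2" and B: "\<And>x. \<bar>\<phi> x\<bar> \<le> B"
  defines "k \<equiv> \<lambda>x. \<integral>h. (s x \<bullet> (u x - u (x + h))) / h\<^sup>2 \<partial>lborel"
  shows "integrable lborel k" "(\<integral>p. diff_quot u p \<bullet> diff_quot (\<lambda>x. \<phi> x *\<^sub>R s x) p \<partial>lborel2) = 2 * (\<integral>x. \<phi> x * k x \<partial>lborel)"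
proof -
  have [measurable]: "u \<in> borel_measurable borel" by (rule finite_energyD(1)[OF u])
  define F where "F p = (s (snd p) \<bullet> (u (snd p) - u (snd p + fst p))) / (fst p)\<^sup>2" for p
  define H where "H p = \<phi> (snd p + fst p) * F (- fst p, snd p + fst p)" for p
  have Fm[measurable]: "F \<in> borel_measurable lborel2" unfolding F_def[abs_def] by measurable
  have Hm[measurable]: "H \<in> borel_measurable lborel2" unfolding H_def[abs_def] F_def[abs_def] by measurable
  have nd: "(norm (diff_quot u p))\<^sup>2 = (norm (u (snd p) - u (snd p + fst p)))\<^sup>2 / (fst p)\<^sup>2" for p
    by (simp add: diff_quot_def power_mult_distrib norm_minus_commute divide_inverse power_inverse)
  have Fb: "\<bar>F p\<bar> \<le> C * (norm (diff_quot u p))\<^sup>2" for p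
    unfolding nd F_def using divide_right_mono[OF C[of "snd p" "snd p + fst p"], of "(fst p)\<^sup>2"] by simp
  have B0: "0 \<le> B" using order_trans[OF abs_ge_zero B] .
  have Fbm: "\<bar>\<phi> y * F p\<bar> \<le> B * (C * (norm (diff_quot u p))\<^sup>2)" for y p
    unfolding abs_mult using B0 by (intro mult_mono B Fb) auto
  have Hb: "\<bar>H p\<bar> \<le> B * (C * (norm (diff_quot u p))\<^sup>2)" for p
  proof -
    have "(norm (diff_quot u (- fst p, snd p + fst p)))\<^sup>2 = (norm (diff_quot u p))\<^sup>2" by (simp add: nd norm_minus_commute)
    then show ?thesis unfolding H_def using Fbm[of "snd p + fst p" "(- fst p, snd p + fst p)"] by simp
  qed
  have sq: "integrable lborel2 (\<lambda>p. (norm (diff_quot u p))\<^sup>2)" using finite_energyD(2)[OF u] by (simp add: sq_int_def)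
  have dom: "integrable lborel2 f" if [measurable]: "f \<in> borel_measurable lborel2" and b: "\<And>p. \<bar>f p\<bar> \<le> K * (norm (diff_quot u p))\<^sup>2" for f :: "real \<times> real \<Rightarrow> real" and K
  proof (rule Bochner_Integration.integrable_bound)
    show "integrable lborel2 (\<lambda>p. K * (norm (diff_quot u p))\<^sup>2)" using sq by simp
    show "AE p in lborel2. norm (f p) \<le> norm (K * (norm (diff_quot u p))\<^sup>2)"
      using order_trans[OF b abs_ge_self] by (intro AE_I2) simp
  qed measurable
  have Fi: "integrable lborel2 F" by (rule dom[OF Fm Fb])
  have \<phi>Fi: "integrable lborel2 (\<lambda>p. \<phi> (snd p) * F p)"
    by (rule dom[of _ "B * C"]) (use Fbm in \<open>auto simp: mult.assoc\<close>)
  have Hi: "integrable lborel2 H" by (rule dom[of _ "B * C"]) (use Hb in \<open>auto simp: mult.assoc\<close>)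
  have k_eq: "k = (\<lambda>x. \<integral>h. F (h, x) \<partial>lborel)" by (simp add: k_def F_def)
  show "integrable lborel k"
    unfolding k_eq by (rule lborel_pair.integrable_snd[of "\<lambda>h x. F (h, x)"]) (use Fi in simp)
  have "diff_quot u p \<bullet> diff_quot (\<lambda>x. \<phi> x *\<^sub>R s x) p = H p + \<phi> (snd p) * F p" for p
  proof (cases "fst p = 0")
    case False
    then show ?thesis
      by (simp add: diff_quot_def H_def F_def inner_diff_left inner_diff_right inner_commute field_simps power2_eq_square)
  qed (simp add: diff_quot_def H_def F_def)
  then have "(\<integral>p. diff_quot u p \<bullet> diff_quot (\<lambda>x. \<phi> x *\<^sub>R s x) p \<partial>lborel2) = (\<integral>p. H p \<partial>lborel2) + (\<integral>p. \<phi> (snd p) * F p \<partial>lborel2)"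
    using Hi \<phi>Fi by simp
  moreover have "(\<integral>p. H p \<partial>lborel2) = (\<integral>p. \<phi> (snd p) * F p \<partial>lborel2)"
  proof -
    have "(\<integral>p. H p \<partial>lborel2) = (\<integral>h. (\<integral>x. H (h, x) \<partial>lborel) \<partial>lborel)"
      by (rule lborel_pair.integral_fst'[OF Hi, symmetric])
    also have "\<dots> = (\<integral>h. (\<integral>x. \<phi> x * F (- h, x) \<partial>lborel) \<partial>lborel)"
      using integral_shift[of "\<lambda>x. \<phi> x * F (- _, x)"] by (simp add: H_def)
    also have "\<dots> = (\<integral>h. (\<integral>x. \<phi> x * F (h, x) \<partial>lborel) \<partial>lborel)"
      using lborel_integral_real_affine[of "-1" "\<lambda>h. \<integral>x. \<phi> x * F (h, x) \<partial>lborel" 0] by simp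
    also have "\<dots> = (\<integral>p. \<phi> (snd p) * F p \<partial>lborel2)"
      using lborel_pair.integral_fst'[OF \<phi>Fi] by simp
    finally show ?thesis .
  qed
  moreover have "(\<integral>p. \<phi> (snd p) * F p \<partial>lborel2) = (\<integral>x. \<phi> x * k x \<partial>lborel)"
    using lborel_pair.integral_snd[of "\<lambda>h x. \<phi> x * F (h, x)"] \<phi>Fi by (simp add: k_eq split_beta')
  ultimately show "(\<integral>p. diff_quot u p \<bullet> diff_quot (\<lambda>x. \<phi> x *\<^sub>R s x) p \<partial>lborel2) = 2 * (\<integral>x. \<phi> x * k x \<partial>lborel)" by simp
qed

lemma tangent_flow_family:
  assumes "C2_submanifold k N"
  shows "\<exists>r C \<tau> P G. \<forall>p\<in>N. tangent_flow N p (r p) (C p) (\<tau> p) (P p) (G p)"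
proof -
  have "\<forall>p\<in>N. \<exists>r C \<tau> P G. tangent_flow N p r C \<tau> P G" using submanifold_tangent_flow[OF assms] by simp
  from bchoice[OF this] obtain r where "\<forall>p\<in>N. \<exists>C \<tau> P G. tangent_flow N p (r p) C \<tau> P G" by (rule exE)
  from bchoice[OF this] obtain C where "\<forall>p\<in>N. \<exists>\<tau> P G. tangent_flow N p (r p) (C p) \<tau> P G" by (rule exE)
  from bchoice[OF this] obtain \<tau> where "\<forall>p\<in>N. \<exists>P G. tangent_flow N p (r p) (C p) (\<tau> p) P G" by (rule exE)
  from bchoice[OF this] obtain P where "\<forall>p\<in>N. \<exists>G. tangent_flow N p (r p) (C p) (\<tau> p) (P p) G" by (rule exE)
  from bchoice[OF this] obtain G where "\<forall>p\<in>N. tangent_flow N p (r p) (C p) (\<tau> p) (P p) (G p)" by (rule exE)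
  then show ?thesis by (intro exI)
qed

lemma finite_energy_scaleR_vector:
  assumes f: "finite_energy (f :: real \<Rightarrow> real)" shows "finite_energy (\<lambda>x. f x *\<^sub>R e)"
proof (rule finite_energy_dominated(1)[OF f f, of _ "norm e"])
  have [measurable]: "f \<in> borel_measurable borel" by (rule finite_energyD(1)[OF f])
  show "(\<lambda>x. f x *\<^sub>R e) \<in> borel_measurable borel" by measurable
  show "norm (f x *\<^sub>R e - f y *\<^sub>R e) \<le> norm e * (norm (f x - f y) + norm (f x - f y))" for x y
    unfolding scaleR_diff_left[symmetric] norm_scaleR
    using mult_nonneg_nonneg[OF norm_ge_zero[of e] norm_ge_zero[of "f x - f y"]] by (simp add: distrib_left mult.commute)
qed

text \<open>With a partition of unity \<open>tent / \<Theta>\<close> subordinate to a finite cover of \<open>N\<close>, the field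
  \<open>s = e - (\<Sum>p. tent * P e / \<Theta>)\<close> is the weighted mean of the normal parts \<open>e - P e\<close>. For a test function
  \<open>\<phi>\<close> the difference \<open>\<phi> e - \<phi> s\<close> is a sum of velocities of admissible variations, with
  \<open>a = \<phi> e / \<Theta>\<close>, to which the difference quotient of \<open>u\<close> is orthogonal.\<close>

lemma half_harmonic_normal_field:
  fixes u :: "real \<Rightarrow> 'a::euclidean_space" and e :: 'a
  assumes harm: "weak_half_harmonic N u" and Nc: "compact N" and sub: "C2_submanifold k N"
    and u: "finite_energy u" "\<And>x. u x \<in> N"
  shows "\<exists>s C. s \<in> borel_measurable borel \<and> (\<forall>x y. \<bar>s x \<bullet> (u x - u y)\<bar> \<le> C * (norm (u x - u y))\<^sup>2) \<and>
     (\<forall>\<phi>. test_function \<phi> \<longrightarrow> (\<integral>p. diff_quot u p \<bullet> diff_quot (\<lambda>x. \<phi> x *\<^sub>R e) p \<partial>lborel2) = (\<integral>p. diff_quot u p \<bullet> diff_quot (\<lambda>x. \<phi> x *\<^sub>R s x) p \<partial>lborel2))"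
proof -
  obtain r C \<tau> P G where "\<forall>p\<in>N. tangent_flow N p (r p) (C p) (\<tau> p) (P p) (G p)"
    using tangent_flow_family[OF sub] by (elim exE)
  then have tf: "\<And>p. p \<in> N \<Longrightarrow> tangent_flow N p (r p) (C p) (\<tau> p) (P p) (G p)" by (rule bspec)
  have r0: "0 < r p" and C0: "0 \<le> C p" and \<tau>0: "0 < \<tau> p" if "p \<in> N" for p
    using tf[OF that] by (simp_all add: tangent_flow_def)
  have lin: "linear (P p z)" and Pb: "norm (P p z \<xi>) \<le> C p * norm \<xi>"
    and nor: "z' \<in> N \<Longrightarrow> \<bar>(\<xi> - P p z \<xi>) \<bullet> (z - z')\<bar> \<le> C p * norm \<xi> * (norm (z - z'))\<^sup>2"
    and GN: "norm b \<le> \<tau> p \<Longrightarrow> G p z b \<in> N"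
    and GP: "norm b \<le> \<tau> p \<Longrightarrow> norm (G p z b - z - P p z b) \<le> C p * (norm b)\<^sup>2"
    and GL: "norm b \<le> \<tau> p \<Longrightarrow> z' \<in> N \<Longrightarrow> z' \<in> ball p (r p) \<Longrightarrow> norm b' \<le> \<tau> p \<Longrightarrow>
         norm ((G p z b - z) - (G p z' b' - z')) \<le> C p * (norm (b - b') + (norm b + norm b') * norm (z - z'))"
    if p: "p \<in> N" and z: "z \<in> N" "z \<in> ball p (r p)" for p z z' b b' \<xi>
    using tf[OF p] z unfolding tangent_flow_def by (metis IntI)+
  obtain J where J: "J \<subseteq> N" "finite J" "N \<subseteq> (\<Union>p\<in>J. ball p (r p))"
  proof (rule compactE_image[OF Nc, of N "\<lambda>p. ball p (r p)"])
    show "N \<subseteq> (\<Union>p\<in>N. ball p (r p))" using r0 by force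
  qed auto
  have JN: "p \<in> N" if "p \<in> J" for p using J(1) that by blast
  define \<Theta> where "\<Theta> z = (\<Sum>p\<in>J. tent p (r p) z)" for z
  have [measurable]: "\<Theta> \<in> borel_measurable borel" unfolding \<Theta>_def[abs_def] by measurable
  have \<Theta>pos: "0 < \<Theta> z" if z: "z \<in> N" for z
  proof -
    obtain p where p: "p \<in> J" "z \<in> ball p (r p)" using subsetD[OF J(3) z] by blast
    show ?thesis unfolding \<Theta>_def by (rule sum_pos2[OF J(2) p(1)]) (rule tent_props(4)[OF p(2)], rule tent_props(1))
  qed
  have \<Theta>lip: "\<bar>\<Theta> z - \<Theta> z'\<bar> \<le> card J * norm (z - z')" for z z'
  proof -
    have "\<bar>\<Theta> z - \<Theta> z'\<bar> \<le> (\<Sum>p\<in>J. \<bar>tent p (r p) z - tent p (r p) z'\<bar>)"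
      unfolding \<Theta>_def sum_subtractf[symmetric] by (rule sum_abs)
    also have "\<dots> \<le> card J * norm (z - z')" by (rule sum_bounded_above) (rule tent_props(5))
    finally show ?thesis .
  qed
  have "continuous_on N \<Theta>" unfolding \<Theta>_def[abs_def] tent_def by (intro continuous_intros)
  from continuous_attains_inf[OF Nc _ this] u(2) obtain z0 where z0: "z0 \<in> N" "\<And>z. z \<in> N \<Longrightarrow> \<Theta> z0 \<le> \<Theta> z" by blast
  define \<delta> where "\<delta> = \<Theta> z0"
  have \<delta>: "0 < \<delta>" "\<And>x. \<delta> \<le> \<Theta> (u x)" using \<Theta>pos z0 u(2) by (auto simp: \<delta>_def)
  have um[measurable]: "u \<in> borel_measurable borel" by (rule finite_energyD(1)[OF u(1)])
  \<comment> \<open>The normalisation of the partition of unity along \<open>u\<close>; it has finite energy since \<open>\<Theta> \<ge> \<delta>\<close> on \<open>N\<close>.\<close>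
  define \<rho> where "\<rho> x = 1 / \<Theta> (u x)" for x
  have \<rho>m[measurable]: "\<rho> \<in> borel_measurable borel" unfolding \<rho>_def[abs_def] by measurable
  have \<rho>0: "0 \<le> \<rho> x" and \<rho>b: "\<rho> x \<le> 1 / \<delta>" and \<rho>\<Theta>: "\<rho> x * \<Theta> (u x) = 1" for x
    using \<delta>(1) \<delta>(2)[of x] by (auto simp: \<rho>_def frac_le)
  have \<rho>d: "\<bar>\<rho> x - \<rho> y\<bar> \<le> card J / \<delta>\<^sup>2 * (norm (u x - u y) + norm (u x - u y))" for x y
  proof -
    have "\<rho> x - \<rho> y = \<rho> x * \<rho> y * (\<Theta> (u y) - \<Theta> (u x))"
      using \<rho>\<Theta>[of x] \<rho>\<Theta>[of y] by (simp add: right_diff_distrib mult.assoc mult.left_commute[of "\<rho> x" "\<rho> y"])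
    then have "\<bar>\<rho> x - \<rho> y\<bar> = \<rho> x * \<rho> y * \<bar>\<Theta> (u y) - \<Theta> (u x)\<bar>" using \<rho>0 by (simp add: abs_mult)
    also have "\<dots> \<le> (1 / \<delta>) * (1 / \<delta>) * (card J * norm (u y - u x))"
      using \<delta>(1) by (intro mult_mono \<rho>b \<rho>0 \<Theta>lip mult_nonneg_nonneg) auto
    also have "\<dots> = card J / \<delta>\<^sup>2 * norm (u x - u y)" by (simp add: power2_eq_square norm_minus_commute)
    also have "\<dots> \<le> card J / \<delta>\<^sup>2 * (norm (u x - u y) + norm (u x - u y))" by (intro mult_left_mono) auto
    finally show ?thesis .
  qed
  have \<rho>e: "finite_energy \<rho>"
    by (rule finite_energy_dominated(1)[OF u(1) u(1) \<rho>m]) (unfold real_norm_def, rule \<rho>d)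
  define W where "W a p x = (if u x \<in> ball p (r p) then tent p (r p) (u x) *\<^sub>R P p (u x) (a x) else 0)" for a p x
  have Wprops: "finite_energy (W a p)" "(\<integral>q. diff_quot u q \<bullet> diff_quot (W a p) q \<partial>lborel2) = 0"
    if a: "finite_energy a" "\<And>x. norm (a x) \<le> M" and p: "p \<in> J" for a M p
  proof -
    note pN = JN[OF p]
    note t = tent_variation_orthogonal[where p=p and r="r p" and C="C p" and \<tau>="\<tau> p" and P="P p" and G="G p",
        OF harm Nc u a r0[OF pN] C0[OF pN] \<tau>0[OF pN] lin[OF pN] Pb[OF pN] GN[OF pN] GP[OF pN] GL[OF pN]]
    show "finite_energy (W a p)" unfolding W_def[abs_def] by (rule t(1))
    show "(\<integral>q. diff_quot u q \<bullet> diff_quot (W a p) q \<partial>lborel2) = 0" unfolding W_def[abs_def] by (rule t(3))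
  qed
  define s where "s x = e - (\<Sum>p\<in>J. W (\<lambda>x. \<rho> x *\<^sub>R e) p x)" for x
  have \<rho>n: "norm (\<rho> x *\<^sub>R e) \<le> 1 / \<delta> * norm e" for x using mult_right_mono[OF \<rho>b[of x] norm_ge_zero[of e]] \<rho>0[of x] by simp
  have Wm: "W (\<lambda>x. \<rho> x *\<^sub>R e) p \<in> borel_measurable borel" if "p \<in> J" for p
    by (rule finite_energyD(1)[OF Wprops(1)[OF finite_energy_scaleR_vector[OF \<rho>e] \<rho>n that]])
  have sm: "s \<in> borel_measurable borel" unfolding s_def[abs_def] by (intro borel_measurable_diff borel_measurable_sum Wm) auto
  have W\<rho>: "W (\<lambda>x. (f x * \<rho> x) *\<^sub>R e) p x = (f x * \<rho> x) *\<^sub>R (if u x \<in> ball p (r p) then tent p (r p) (u x) *\<^sub>R P p (u x) e else 0)"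
    if "p \<in> J" for f p x
    using linear_scale[OF lin[OF JN[OF that] u(2)[of x]]] by (simp add: W_def)
  \<comment> \<open>Since the weights sum to one, \<open>s\<close> is the mean of the normal parts of \<open>e\<close>.\<close>
  have s_eq: "s x = (\<Sum>p\<in>J. (\<rho> x * tent p (r p) (u x)) *\<^sub>R (if u x \<in> ball p (r p) then e - P p (u x) e else 0))" for x
  proof -
    have "e = (\<Sum>p\<in>J. (\<rho> x * tent p (r p) (u x)) *\<^sub>R e)"
      using \<rho>\<Theta>[of x] by (simp add: scaleR_sum_left[symmetric] sum_distrib_left[symmetric] \<Theta>_def)
    then have "s x = (\<Sum>p\<in>J. (\<rho> x * tent p (r p) (u x)) *\<^sub>R e - W (\<lambda>x. \<rho> x *\<^sub>R e) p x)"
      by (simp add: s_def sum_subtractf)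
    also have "\<dots> = (\<Sum>p\<in>J. (\<rho> x * tent p (r p) (u x)) *\<^sub>R (if u x \<in> ball p (r p) then e - P p (u x) e else 0))"
      using W\<rho>[of _ "\<lambda>_. 1"] tent_props(3)[of "u x"] by (intro sum.cong) (auto simp: scaleR_diff_right)
    finally show ?thesis .
  qed
  define K where "K = (\<Sum>p\<in>J. 1 / \<delta> * r p * (C p * norm e))"
  have sK: "\<bar>s x \<bullet> (u x - u y)\<bar> \<le> K * (norm (u x - u y))\<^sup>2" for x y
  proof -
    have "\<bar>s x \<bullet> (u x - u y)\<bar> \<le> (\<Sum>p\<in>J. 1 / \<delta> * r p * (C p * norm e * (norm (u x - u y))\<^sup>2))"
      unfolding s_eq inner_sum_left
    proof (rule sum_abs[THEN order_trans], rule sum_mono)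
      fix p assume p: "p \<in> J"
      note pN = JN[OF p]
      let ?n = "(if u x \<in> ball p (r p) then e - P p (u x) e else 0) \<bullet> (u x - u y)" and ?c = "\<rho> x * tent p (r p) (u x)"
      have 1: "\<bar>?n\<bar> \<le> C p * norm e * (norm (u x - u y))\<^sup>2"
        using nor[OF pN u(2) _ u(2)] C0[OF pN] by simp
      have 2: "?c \<le> 1 / \<delta> * r p"
        using \<delta>(1) by (intro mult_mono \<rho>b tent_props(1,2) r0[OF pN]) auto
      have "\<bar>?c * ?n\<bar> = ?c * \<bar>?n\<bar>" using \<rho>0[of x] tent_props(1)[of p "r p" "u x"] by (simp add: abs_mult)
      also have "\<dots> \<le> 1 / \<delta> * r p * (C p * norm e * (norm (u x - u y))\<^sup>2)"
        by (rule mult_mono[OF 2 1]) (use \<delta>(1) r0[OF pN] in auto)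
      finally show "\<bar>(?c *\<^sub>R (if u x \<in> ball p (r p) then e - P p (u x) e else 0)) \<bullet> (u x - u y)\<bar> \<le> \<dots>"
        unfolding inner_scaleR_left .
    qed
    then show ?thesis by (simp add: K_def sum_distrib_right mult.assoc)
  qed
  have orth: "(\<integral>p. diff_quot u p \<bullet> diff_quot (\<lambda>x. \<phi> x *\<^sub>R e) p \<partial>lborel2) = (\<integral>p. diff_quot u p \<bullet> diff_quot (\<lambda>x. \<phi> x *\<^sub>R s x) p \<partial>lborel2)"
    if \<phi>: "test_function \<phi>" for \<phi>
  proof -
    obtain B where B: "\<And>x. \<bar>\<phi> x\<bar> \<le> B" using test_function_bounded[OF \<phi>] by blast
    note fe = test_function_finite_energy[OF \<phi>]
    let ?a = "\<lambda>x. (\<phi> x * \<rho> x) *\<^sub>R e"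
    have ae: "finite_energy ?a"
      by (rule finite_energy_scaleR_vector[OF finite_energy_mult(1)[OF fe B \<rho>e, of "1 / \<delta>"]]) (use \<rho>0 \<rho>b in simp)
    have ab: "norm (?a x) \<le> B * (1 / \<delta> * norm e)" for x
    proof -
      have "norm (?a x) = \<bar>\<phi> x\<bar> * norm (\<rho> x *\<^sub>R e)" by (simp add: abs_mult)
      also have "\<dots> \<le> B * (1 / \<delta> * norm e)" using B[of x] by (intro mult_mono \<rho>n) auto
      finally show ?thesis .
    qed
    have W1: "W ?a p x = \<phi> x *\<^sub>R W (\<lambda>x. \<rho> x *\<^sub>R e) p x" if "p \<in> J" for p x
      using W\<rho>[OF that, of \<phi> x] W\<rho>[OF that, of "\<lambda>_. 1" x] by simp
    have "\<phi> x *\<^sub>R s x = \<phi> x *\<^sub>R e - (\<Sum>p\<in>J. W ?a p x)" for x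
      by (simp add: s_def scaleR_diff_right scaleR_sum_right W1)
    then have "diff_quot (\<lambda>x. \<phi> x *\<^sub>R s x) q = diff_quot (\<lambda>x. \<phi> x *\<^sub>R e) q - (\<Sum>p\<in>J. diff_quot (W ?a p) q)" for q
      by (simp add: diff_quot_def sum_subtractf[symmetric] scaleR_sum_right[symmetric] scaleR_diff_right[symmetric])
         (simp add: sum_subtractf algebra_simps)
    then have eq: "diff_quot u q \<bullet> diff_quot (\<lambda>x. \<phi> x *\<^sub>R s x) q = diff_quot u q \<bullet> diff_quot (\<lambda>x. \<phi> x *\<^sub>R e) q - (\<Sum>p\<in>J. diff_quot u q \<bullet> diff_quot (W ?a p) q)" for q
      by (simp add: inner_diff_right inner_sum_right)
    have i1: "integrable lborel2 (\<lambda>q. diff_quot u q \<bullet> diff_quot (\<lambda>x. \<phi> x *\<^sub>R e) q)"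
      by (rule sq_int_inner[OF finite_energyD(2)[OF u(1)] finite_energyD(2)[OF finite_energy_scaleR_vector[OF fe]]])
    have i2: "integrable lborel2 (\<lambda>q. diff_quot u q \<bullet> diff_quot (W ?a p) q)" if "p \<in> J" for p
      by (rule sq_int_inner[OF finite_energyD(2)[OF u(1)] finite_energyD(2)[OF Wprops(1)[OF ae ab that]]])
    have "(\<integral>q. (\<Sum>p\<in>J. diff_quot u q \<bullet> diff_quot (W ?a p) q) \<partial>lborel2) = 0"
      using i2 Wprops(2)[OF ae ab] by simp
    then show ?thesis unfolding eq using i1 i2 by simp
  qed
  show ?thesis by (intro exI conjI allI impI) (rule sm, rule sK, erule orth)
qed

text \<open>For each basis vector \<open>e\<close> the normal field of \<open>e\<close> and \<open>normal_pairing\<close> give an integrable function,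
  which up to a constant is the component of the half Laplacian along \<open>e\<close>. All values of \<open>u\<close>, not only
  almost all, are taken in \<open>N\<close>, because \<open>P\<close> and \<open>G\<close> are controlled on \<open>N\<close> only.\<close>

lemma half_harmonic_half_laplacian:
  fixes u :: "real \<Rightarrow> 'a::euclidean_space"
  assumes harm: "weak_half_harmonic N u" and Nc: "compact N" and sub: "C2_submanifold k N"
    and u: "finite_energy u" "\<And>x. u x \<in> N"
  shows "\<exists>g. has_frac_laplacian (1/2) u g \<and> integrable lborel g"
proof -
  have um[measurable]: "u \<in> borel_measurable borel" by (rule finite_energyD(1)[OF u(1)])
  obtain B where "\<forall>z\<in>N. norm z \<le> B" using compact_imp_bounded[OF Nc] by (auto simp: bounded_iff)
  then have B: "norm (u x) \<le> B" for x using u(2) by blast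
  have "\<forall>e::'a. \<exists>s. s \<in> borel_measurable borel \<and> (\<exists>C. \<forall>x y. \<bar>s x \<bullet> (u x - u y)\<bar> \<le> C * (norm (u x - u y))\<^sup>2) \<and>
     (\<forall>\<phi>. test_function \<phi> \<longrightarrow> (\<integral>p. diff_quot u p \<bullet> diff_quot (\<lambda>x. \<phi> x *\<^sub>R e) p \<partial>lborel2) = (\<integral>p. diff_quot u p \<bullet> diff_quot (\<lambda>x. \<phi> x *\<^sub>R s x) p \<partial>lborel2))"
  proof
    fix e :: 'a
    from half_harmonic_normal_field[OF harm Nc sub u, of e]
    show "\<exists>s. s \<in> borel_measurable borel \<and> (\<exists>C. \<forall>x y. \<bar>s x \<bullet> (u x - u y)\<bar> \<le> C * (norm (u x - u y))\<^sup>2) \<and>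
     (\<forall>\<phi>. test_function \<phi> \<longrightarrow> (\<integral>p. diff_quot u p \<bullet> diff_quot (\<lambda>x. \<phi> x *\<^sub>R e) p \<partial>lborel2) = (\<integral>p. diff_quot u p \<bullet> diff_quot (\<lambda>x. \<phi> x *\<^sub>R s x) p \<partial>lborel2))"
      by (elim exE conjE) (intro exI conjI; assumption)
  qed
  from choice[OF this] obtain s where s: "\<And>e::'a. s e \<in> borel_measurable borel"
      "\<And>e. \<exists>C. \<forall>x y. \<bar>s e x \<bullet> (u x - u y)\<bar> \<le> C * (norm (u x - u y))\<^sup>2"
      "\<And>e \<phi>. test_function \<phi> \<Longrightarrow> (\<integral>p. diff_quot u p \<bullet> diff_quot (\<lambda>x. \<phi> x *\<^sub>R e) p \<partial>lborel2) = (\<integral>p. diff_quot u p \<bullet> diff_quot (\<lambda>x. \<phi> x *\<^sub>R s e x) p \<partial>lborel2)"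
    by (elim exE, intro that) blast+
  define k where "k e x = (\<integral>h. (s e x \<bullet> (u x - u (x + h))) / h\<^sup>2 \<partial>lborel)" for e x
  have ki: "integrable lborel (k e)" for e
  proof -
    obtain C where C: "\<And>x y. \<bar>s e x \<bullet> (u x - u y)\<bar> \<le> C * (norm (u x - u y))\<^sup>2" using s(2) by blast
    show ?thesis unfolding k_def[abs_def] by (rule normal_pairing(1)[OF u(1) s(1) _ C, of "\<lambda>_. 0" 0]) auto
  qed
  have kp: "(\<integral>p. diff_quot u p \<bullet> diff_quot (\<lambda>x. \<phi> x *\<^sub>R e) p \<partial>lborel2) = 2 * (\<integral>x. \<phi> x * k e x \<partial>lborel)" if \<phi>: "test_function \<phi>" for \<phi> e
  proof -
    obtain C where C: "\<And>x y. \<bar>s e x \<bullet> (u x - u y)\<bar> \<le> C * (norm (u x - u y))\<^sup>2" using s(2) by blast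
    obtain M where M: "\<And>x. \<bar>\<phi> x\<bar> \<le> M" using test_function_bounded[OF \<phi>] by blast
    show ?thesis unfolding s(3)[OF \<phi>] k_def by (rule normal_pairing(2)[OF u(1) s(1) test_function_measurable[OF \<phi>] C M])
  qed
  define g where "g x = (\<Sum>e\<in>Basis. (2 * energy_const * k e x) *\<^sub>R e)" for x
  have gi: "integrable lborel g" unfolding g_def[abs_def] using ki by (intro Bochner_Integration.integrable_sum Bochner_Integration.integrable_scaleR_left Bochner_Integration.integrable_mult_right)
  have gb: "g x \<bullet> e = 2 * energy_const * k e x" if "e \<in> Basis" for e x
    using that by (simp add: g_def)
  have gl: "set_integrable lborel {-R..R} g" for R
    unfolding set_integrable_def by (rule integrable_mult_indicator[OF _ gi]) simp
  have "has_frac_laplacian (1/2) u g"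
    unfolding has_frac_laplacian_def
  proof (intro conjI allI impI)
    show "u \<in> borel_measurable lborel" by simp
    show "integrable lborel (\<lambda>x. ((1 + \<bar>x\<bar>) powr - (1 + 2 * (1/2))) *\<^sub>R u x)"
      by (rule integrable_scaleR_bounded[OF weight_integrable um B]) simp
    show "set_integrable lborel {-R..R} g" for R by (rule gl)
    fix \<phi> assume \<phi>: "test_function \<phi>"
    note \<phi>g = test_times_locally_integrable[OF \<phi> gl]
    show "(\<integral>x. frac_lap_test (1/2) \<phi> x *\<^sub>R u x \<partial>lborel) = (\<integral>x. \<phi> x *\<^sub>R g x \<partial>lborel)"
    proof (rule euclidean_eqI)
      fix e :: 'a assume e: "e \<in> Basis"
      have "(\<integral>x. frac_lap_test (1/2) \<phi> x *\<^sub>R u x \<partial>lborel) \<bullet> e = energy_const * (2 * (\<integral>x. \<phi> x * k e x \<partial>lborel))"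
        by (simp only: half_laplacian_vector_pair[OF u(1) B \<phi> e] kp[OF \<phi>])
      also have "\<dots> = (\<integral>x. (\<phi> x *\<^sub>R g x) \<bullet> e \<partial>lborel)"
        by (simp add: gb[OF e] mult.left_commute[of "\<phi> _"] mult.assoc)
      also have "\<dots> = (\<integral>x. \<phi> x *\<^sub>R g x \<partial>lborel) \<bullet> e" by (rule integral_inner_left) (rule \<phi>g)
      finally show "(\<integral>x. frac_lap_test (1/2) \<phi> x *\<^sub>R u x \<partial>lborel) \<bullet> e = (\<integral>x. \<phi> x *\<^sub>R g x \<partial>lborel) \<bullet> e" .
    qed
  qed
  with gi show ?thesis by blast
qed

theorem proposition4p1:
  fixes N :: "(real ^ 'm) set" and u :: "real \<Rightarrow> real ^ 'm"
  assumes "closed_C2_submanifold N"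
    and "u \<in> Hdot_half_into N"
    and "weak_half_harmonic N u"
  shows "\<exists>g. has_frac_laplacian (1/2) u g \<and> integrable lborel g"
proof -
  obtain k where Nc: "compact N" and sub: "C2_submanifold k N" using assms(1) by (auto simp: closed_C2_submanifold_def)
  have uH: "u \<in> Hdot_half" and uN: "AE x in lborel. u x \<in> N" using assms(2) by (auto simp: Hdot_half_into_def)
  have um[measurable]: "u \<in> borel_measurable borel" by (rule Hdot_half_measurable[OF uH])
  have "N \<noteq> {}"
  proof
    assume "N = {}"
    with uN have "ae_filter (lborel :: real measure) = bot" by (simp add: trivial_limit_def)
    then show False by (simp add: ae_filter_eq_bot_iff)
  qed
  then obtain p0 where p0: "p0 \<in> N" by blast
  have [measurable]: "N \<in> sets borel" using Nc by (rule borel_compact)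
  define v where "v x = (if u x \<in> N then u x else p0)" for x
  have vm[measurable]: "v \<in> borel_measurable borel" unfolding v_def[abs_def] by measurable
  have vN: "v x \<in> N" for x using p0 by (simp add: v_def)
  have ae: "AE x in lborel. u x = v x" using uN by eventually_elim (simp add: v_def)
  have ml: "u \<in> borel_measurable lborel" "v \<in> borel_measurable lborel" by simp_all
  obtain B where "\<forall>z\<in>N. norm z \<le> B" using compact_imp_bounded[OF Nc] by (auto simp: bounded_iff)
  then have "norm (v x) \<le> B" for x using vN by blast
  then have "finite_energy v" using bounded_Hdot_half(1)[OF vm] Hdot_half_cong_AE[OF ae ml] uH by blast
  from half_harmonic_half_laplacian[OF weak_half_harmonic_cong_AE[OF assms(3) ae vm] Nc sub this vN]
  show ?thesis using has_frac_laplacian_cong_AE[OF ae ml] by blast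
qed

end
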